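(* Assume $V=L$. Then the class $\mathbf K$ of all (regular) Kurepa trees on $\omega_1$ is a $\Pi^1_2$-complete subset of $\omega_1^{\omega_1}$.
   Context: Topology: $\omega_1^{\omega_1}$ has as basic open sets $\{f: s\subseteq f\}$ for $s$ a function from a countable ordinal into $\omega_1$; Borel sets form the smallest family containing the open sets and closed under complements and unions/intersections of size $\aleph_1$. A binary relation on $\omega_1$ is identified with a point of $2^{\omega_1}\subseteq\omega_1^{\omega_1}$ via its characteristic function and a fixed bijection $\omega_1\times\omega_1\to\omega_1$. A set $A\subseteq\omega_1^{\omega_1}$ is $\Pi^1_2$ if there is a Borel set $B\subseteq(\omega_1^{\omega_1})^3$ with $X\in A\iff\forall Y\,\exists Z\,(X,Y,Z)\in B$. $A$ is $\Pi^1_2$-complete if it is $\Pi^1_2$ and every $\Pi^1_2$ set $\mathcal S$ admits a continuous $\pi:\omega_1^{\omega_1}\to\omega_1^{\omega_1}$ with $T\in\mathcal S\iff\pi(T)\in A$. An $\aleph_1$-tree is a partial order $(\omega_1,<_T)$ with well-ordered sets of predecessors whose levels are countable nonempty below $\omega_1$ and empty from $\omega_1$ on. Regular: rooted, every node has at least two immediate successors, pruned. A Kurepa tree is an $\aleph_1$-tree with at least $\aleph_2$ uncountable branches; $\mathbf K$ consists only of regular trees. *)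

theory Defs
  imports Main
begin

text \<open>
  Isabelle/HOL is not itself a theory of the universe \<open>V\<close>, so an axiom such as \<open>V = L\<close> has to be
  stated about a universe given explicitly.  The universe is a type of class \<open>zfc\<close>: an arbitrary
  model of first-order ZFC, with \<open>elts a\<close> the class of members of \<open>a\<close>.  Separation and replacement
  are the first-order schemas, over formulas with parameters.  All set-theoretic notions below are
  internal to the model: their quantifiers range over elements of the universe only, and HOL sets
  are used merely as notation for classes given by first-order formulas.  A statement
  about all types of class \<open>zfc\<close> is thus a statement about all models of ZFC.
\<close>

datatype fm = Mem nat nat | Eq nat nat | Neg fm | And fm fm | Ex nat fm

primrec sat :: "('v \<Rightarrow> 'v set) \<Rightarrow> fm \<Rightarrow> (nat \<Rightarrow> 'v) \<Rightarrow> bool" where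
  "sat el (Mem i j) e \<longleftrightarrow> e i \<in> el (e j)"
| "sat el (Eq i j) e \<longleftrightarrow> e i = e j"
| "sat el (Neg \<phi>) e \<longleftrightarrow> \<not> sat el \<phi> e"
| "sat el (And \<phi> \<psi>) e \<longleftrightarrow> sat el \<phi> e \<and> sat el \<psi> e"
| "sat el (Ex i \<phi>) e \<longleftrightarrow> (\<exists>x. sat el \<phi> (e(i := x)))"

class zfc =
  fixes elts :: "'a \<Rightarrow> 'a set"
  assumes extensionality: "elts x = elts y \<Longrightarrow> x = y"
    and foundation: "elts x \<noteq> {} \<Longrightarrow> \<exists>y\<in>elts x. elts y \<inter> elts x = {}"
    and pairing: "\<exists>z. elts z = {x, y}"
    and union: "\<exists>z. elts z = (\<Union>y\<in>elts x. elts y)"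
    and powerset: "\<exists>z. elts z = {y. elts y \<subseteq> elts x}"
    and infinity: "\<exists>z. (\<exists>x\<in>elts z. elts x = {}) \<and>
                        (\<forall>x\<in>elts z. \<exists>y\<in>elts z. elts y = insert x (elts x))"
    and separation: "\<exists>z. elts z = {x \<in> elts a. sat elts \<phi> (e(0 := x))}"
    and replacement: "\<forall>x\<in>elts a. \<exists>!y. sat elts \<phi> (e(0 := x, 1 := y)) \<Longrightarrow>
                      \<exists>z. elts z = {y. \<exists>x\<in>elts a. sat elts \<phi> (e(0 := x, 1 := y))}"
    and choice: "\<forall>x\<in>elts a. elts x \<noteq> {} \<Longrightarrow>
                 \<forall>x\<in>elts a. \<forall>y\<in>elts a. x \<noteq> y \<longrightarrow> elts x \<inter> elts y = {} \<Longrightarrow>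
                 \<exists>c. \<forall>x\<in>elts a. \<exists>!y. y \<in> elts x \<inter> elts c"

section \<open>Basic set theory\<close>

text \<open>\<open>set_of X\<close> is meaningful when the class \<open>X\<close> is a set of the universe, and it is applied
  below only to classes that ZFC proves to be sets.\<close>

definition set_of :: "'v::zfc set \<Rightarrow> 'v" where
  "set_of X = (THE a. elts a = X)"

lemma set_of_elts [simp]: "set_of (elts a) = a"
  unfolding set_of_def by (rule the_equality) (auto intro: extensionality)

lemma elts_set_of: "elts a = X \<Longrightarrow> elts (set_of X) = X"
  by auto

definition vempty :: "'v::zfc" where
  "vempty = set_of {}"

definition vsucc :: "'v::zfc \<Rightarrow> 'v" where
  "vsucc x = set_of (insert x (elts x))"

definition vUnion :: "'v::zfc \<Rightarrow> 'v" where
  "vUnion C = set_of (\<Union>a\<in>elts C. elts a)"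

definition vInter :: "'v::zfc \<Rightarrow> 'v" where
  "vInter C = set_of (\<Inter>a\<in>elts C. elts a)"

definition vpair :: "'v::zfc \<Rightarrow> 'v \<Rightarrow> 'v" where
  "vpair x y = set_of {set_of {x}, set_of {x, y}}"

definition vtimes :: "'v::zfc \<Rightarrow> 'v \<Rightarrow> 'v" where
  "vtimes A B = set_of {vpair x y | x y. x \<in> elts A \<and> y \<in> elts B}"

definition is_fun :: "'v::zfc \<Rightarrow> 'v \<Rightarrow> 'v \<Rightarrow> bool" where
  "is_fun f A B \<longleftrightarrow>
     elts f \<subseteq> elts (vtimes A B) \<and> (\<forall>x\<in>elts A. \<exists>!y. vpair x y \<in> elts f)"

definition app :: "'v::zfc \<Rightarrow> 'v \<Rightarrow> 'v" where
  "app f x = (THE y. vpair x y \<in> elts f)"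

definition funs :: "'v::zfc \<Rightarrow> 'v \<Rightarrow> 'v" where
  "funs A B = set_of {f. is_fun f A B}"

definition is_injection :: "'v::zfc \<Rightarrow> 'v \<Rightarrow> 'v \<Rightarrow> bool" where
  "is_injection f A B \<longleftrightarrow> is_fun f A B \<and> inj_on (app f) (elts A)"

definition is_bijection :: "'v::zfc \<Rightarrow> 'v \<Rightarrow> 'v \<Rightarrow> bool" where
  "is_bijection f A B \<longleftrightarrow> is_fun f A B \<and> bij_betw (app f) (elts A) (elts B)"

definition card_le :: "'v::zfc \<Rightarrow> 'v \<Rightarrow> bool" where
  "card_le A B \<longleftrightarrow> (\<exists>f. is_injection f A B)"

definition transitive_set :: "'v::zfc \<Rightarrow> bool" where
  "transitive_set x \<longleftrightarrow> (\<forall>y\<in>elts x. elts y \<subseteq> elts x)"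

definition Ord :: "'v::zfc \<Rightarrow> bool" where
  "Ord \<alpha> \<longleftrightarrow> transitive_set \<alpha> \<and> (\<forall>\<beta>\<in>elts \<alpha>. transitive_set \<beta>)"

definition is_succ :: "'v::zfc \<Rightarrow> bool" where
  "is_succ \<alpha> \<longleftrightarrow> (\<exists>\<beta>. Ord \<beta> \<and> \<alpha> = vsucc \<beta>)"

definition is_limit :: "'v::zfc \<Rightarrow> bool" where
  "is_limit \<alpha> \<longleftrightarrow> Ord \<alpha> \<and> \<alpha> \<noteq> vempty \<and> \<not> is_succ \<alpha>"

definition omega :: "'v::zfc" where
  "omega = set_of {n. Ord n \<and> (\<forall>m\<in>elts (vsucc n). m = vempty \<or> is_succ m)}"

definition vcountable :: "'v::zfc \<Rightarrow> bool" where
  "vcountable A \<longleftrightarrow> card_le A omega"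

definition omega1 :: "'v::zfc" where
  "omega1 = set_of {\<alpha>. Ord \<alpha> \<and> card_le \<alpha> omega}"

definition omega2 :: "'v::zfc" where
  "omega2 = set_of {\<alpha>. Ord \<alpha> \<and> card_le \<alpha> omega1}"

section \<open>The constructible hierarchy\<close>

definition snoc :: "'v::zfc \<Rightarrow> 'v \<Rightarrow> 'v \<Rightarrow> 'v" where
  "snoc n s x = set_of (insert (vpair n x) (elts s))"

text \<open>\<open>A\<^sup>n\<close> is \<open>funs n A\<close> for \<open>n \<in> \<omega>\<close>.  As in Kunen's textbook, the definable relations on the structure
  \<open>(A, \<in>)\<close> form the least family of relations containing the membership and equality diagonals and
  closed under complement, intersection and projection (negation, conjunction and existential
  quantification).  The arity is that of the model, so internal \<open>\<omega>\<close> need not be standard.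
  A member \<open>vpair n R\<close> of \<open>D\<close> stands for the \<open>n\<close>-ary relation \<open>R\<close>.\<close>

definition definability_closed :: "'v::zfc \<Rightarrow> 'v \<Rightarrow> bool" where
  "definability_closed A D \<longleftrightarrow>
     (\<forall>n\<in>elts omega. \<forall>i\<in>elts n. \<forall>j\<in>elts n.
        vpair n (set_of {s \<in> elts (funs n A). app s i \<in> elts (app s j)}) \<in> elts D \<and>
        vpair n (set_of {s \<in> elts (funs n A). app s i = app s j}) \<in> elts D) \<and>
     (\<forall>n\<in>elts omega. \<forall>R. vpair n R \<in> elts D \<longrightarrow>
        vpair n (set_of (elts (funs n A) - elts R)) \<in> elts D) \<and>
     (\<forall>n\<in>elts omega. \<forall>R S. vpair n R \<in> elts D \<and> vpair n S \<in> elts D \<longrightarrow>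
        vpair n (set_of (elts R \<inter> elts S)) \<in> elts D) \<and>
     (\<forall>n\<in>elts omega. \<forall>R. vpair (vsucc n) R \<in> elts D \<longrightarrow>
        vpair n (set_of {s \<in> elts (funs n A). \<exists>x\<in>elts A. snoc n s x \<in> elts R}) \<in> elts D)"

definition definable_rel :: "'v::zfc \<Rightarrow> 'v \<Rightarrow> 'v \<Rightarrow> bool" where
  "definable_rel A n R \<longleftrightarrow> (\<forall>D. definability_closed A D \<longrightarrow> vpair n R \<in> elts D)"

definition Def :: "'v::zfc \<Rightarrow> 'v" where
  "Def A = set_of {X. \<exists>n\<in>elts omega. \<exists>s\<in>elts (funs n A). \<exists>R.
             definable_rel A (vsucc n) R \<and> elts X = {x \<in> elts A. snoc n s x \<in> elts R}}"

definition L_sequence :: "'v::zfc \<Rightarrow> 'v \<Rightarrow> bool" where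
  "L_sequence \<alpha> f \<longleftrightarrow>
     (\<exists>B. is_fun f (vsucc \<alpha>) B) \<and>
     app f vempty = vempty \<and>
     (\<forall>\<beta>\<in>elts \<alpha>. app f (vsucc \<beta>) = Def (app f \<beta>)) \<and>
     (\<forall>\<gamma>\<in>elts (vsucc \<alpha>). is_limit \<gamma> \<longrightarrow>
        app f \<gamma> = set_of (\<Union>\<beta>\<in>elts \<gamma>. elts (app f \<beta>)))"

definition constructible :: "'v::zfc \<Rightarrow> bool" where
  "constructible x \<longleftrightarrow> (\<exists>\<alpha> f. Ord \<alpha> \<and> L_sequence \<alpha> f \<and> x \<in> elts (app f \<alpha>))"

section \<open>The generalized Baire space\<close>

definition is_open :: "'v::zfc \<Rightarrow> 'v \<Rightarrow> bool" where
  "is_open \<B> U \<longleftrightarrow> (\<exists>C. elts C \<subseteq> elts \<B> \<and> U = vUnion C)"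

definition borel_closed :: "'v::zfc \<Rightarrow> 'v \<Rightarrow> 'v \<Rightarrow> bool" where
  "borel_closed S \<B> F \<longleftrightarrow>
     (\<forall>a\<in>elts F. elts a \<subseteq> elts S) \<and>
     (\<forall>U. is_open \<B> U \<longrightarrow> U \<in> elts F) \<and>
     (\<forall>a\<in>elts F. set_of (elts S - elts a) \<in> elts F) \<and>
     (\<forall>C. elts C \<subseteq> elts F \<and> C \<noteq> vempty \<and> card_le C omega1 \<longrightarrow>
        vUnion C \<in> elts F \<and> vInter C \<in> elts F)"

definition is_borel :: "'v::zfc \<Rightarrow> 'v \<Rightarrow> 'v \<Rightarrow> bool" where
  "is_borel S \<B> b \<longleftrightarrow> (\<forall>F. borel_closed S \<B> F \<longrightarrow> b \<in> elts F)"

definition baire :: "'v::zfc" where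
  "baire = funs omega1 omega1"

definition is_node :: "'v::zfc \<Rightarrow> bool" where
  "is_node s \<longleftrightarrow> (\<exists>\<alpha>\<in>elts omega1. is_fun s \<alpha> omega1)"

definition cone :: "'v::zfc \<Rightarrow> 'v" where
  "cone s = set_of {f \<in> elts baire. elts s \<subseteq> elts f}"

definition baire_base :: "'v::zfc" where
  "baire_base = set_of {cone s | s. is_node s}"

definition vtimes3 :: "'v::zfc \<Rightarrow> 'v \<Rightarrow> 'v \<Rightarrow> 'v" where
  "vtimes3 A B C = vtimes A (vtimes B C)"

definition baire3_base :: "'v::zfc" where
  "baire3_base =
     set_of {vtimes3 (cone s) (cone t) (cone u) | s t u. is_node s \<and> is_node t \<and> is_node u}"

definition is_continuous :: "'v::zfc \<Rightarrow> bool" where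
  "is_continuous \<pi> \<longleftrightarrow> is_fun \<pi> baire baire \<and>
     (\<forall>U. is_open baire_base U \<longrightarrow>
        is_open baire_base (set_of {f \<in> elts baire. app \<pi> f \<in> elts U}))"

definition Pi12 :: "'v::zfc \<Rightarrow> bool" where
  "Pi12 A \<longleftrightarrow> elts A \<subseteq> elts baire \<and>
     (\<exists>B. is_borel (vtimes3 baire baire baire) baire3_base B \<and>
        (\<forall>X\<in>elts baire. X \<in> elts A \<longleftrightarrow>
           (\<forall>Y\<in>elts baire. \<exists>Z\<in>elts baire. vpair X (vpair Y Z) \<in> elts B)))"

definition Pi12_complete :: "'v::zfc \<Rightarrow> bool" where
  "Pi12_complete A \<longleftrightarrow> Pi12 A \<and>
     (\<forall>S. Pi12 S \<longrightarrow>
        (\<exists>\<pi>. is_continuous \<pi> \<and>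
           (\<forall>T\<in>elts baire. T \<in> elts S \<longleftrightarrow> app \<pi> T \<in> elts A)))"

section \<open>Kurepa trees\<close>

text \<open>\<open>T\<close> is a strict order on \<open>\<omega>\<^sub>1\<close>, given as a set of pairs.\<close>

definition below :: "'v::zfc \<Rightarrow> 'v \<Rightarrow> 'v \<Rightarrow> bool" where
  "below T x y \<longleftrightarrow> vpair x y \<in> elts T"

definition preds :: "'v::zfc \<Rightarrow> 'v \<Rightarrow> 'v" where
  "preds T x = set_of {y \<in> elts omega1. below T y x}"

definition strict_order :: "'v::zfc \<Rightarrow> bool" where
  "strict_order T \<longleftrightarrow>
     elts T \<subseteq> elts (vtimes omega1 omega1) \<and>
     (\<forall>x\<in>elts omega1. \<not> below T x x) \<and>
     (\<forall>x\<in>elts omega1. \<forall>y\<in>elts omega1. \<forall>z\<in>elts omega1.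
        below T x y \<and> below T y z \<longrightarrow> below T x z)"

definition well_ordered_by :: "'v::zfc \<Rightarrow> 'v \<Rightarrow> bool" where
  "well_ordered_by T A \<longleftrightarrow>
     (\<forall>M. elts M \<subseteq> elts A \<and> M \<noteq> vempty \<longrightarrow>
        (\<exists>m\<in>elts M. \<forall>x\<in>elts M. x \<noteq> m \<longrightarrow> below T m x))"

definition has_height :: "'v::zfc \<Rightarrow> 'v \<Rightarrow> 'v \<Rightarrow> bool" where
  "has_height T x \<alpha> \<longleftrightarrow> Ord \<alpha> \<and>
     (\<exists>h. is_bijection h (preds T x) \<alpha> \<and>
        (\<forall>y\<in>elts (preds T x). \<forall>z\<in>elts (preds T x).
           below T y z \<longleftrightarrow> app h y \<in> elts (app h z)))"

definition level :: "'v::zfc \<Rightarrow> 'v \<Rightarrow> 'v" where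
  "level T \<alpha> = set_of {x \<in> elts omega1. has_height T x \<alpha>}"

definition aleph1_tree :: "'v::zfc \<Rightarrow> bool" where
  "aleph1_tree T \<longleftrightarrow>
     strict_order T \<and>
     (\<forall>x\<in>elts omega1. well_ordered_by T (preds T x)) \<and>
     (\<forall>\<alpha>\<in>elts omega1. vcountable (level T \<alpha>) \<and> level T \<alpha> \<noteq> vempty) \<and>
     (\<forall>\<alpha>. Ord \<alpha> \<and> \<alpha> \<notin> elts omega1 \<longrightarrow> level T \<alpha> = vempty)"

definition rooted :: "'v::zfc \<Rightarrow> bool" where
  "rooted T \<longleftrightarrow> (\<exists>r\<in>elts omega1. \<forall>x\<in>elts omega1. x \<noteq> r \<longrightarrow> below T r x)"

definition immediate_succ :: "'v::zfc \<Rightarrow> 'v \<Rightarrow> 'v \<Rightarrow> bool" where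
  "immediate_succ T x y \<longleftrightarrow> y \<in> elts omega1 \<and> below T x y \<and>
     \<not> (\<exists>z\<in>elts omega1. below T x z \<and> below T z y)"

definition pruned :: "'v::zfc \<Rightarrow> bool" where
  "pruned T \<longleftrightarrow>
     (\<forall>\<alpha>\<in>elts omega1. \<forall>\<beta>\<in>elts omega1. \<alpha> \<in> elts \<beta> \<longrightarrow>
        (\<forall>x\<in>elts (level T \<alpha>). \<exists>y\<in>elts (level T \<beta>). below T x y))"

definition regular_tree :: "'v::zfc \<Rightarrow> bool" where
  "regular_tree T \<longleftrightarrow> rooted T \<and>
     (\<forall>x\<in>elts omega1. \<exists>y z. y \<noteq> z \<and> immediate_succ T x y \<and> immediate_succ T x z) \<and>
     pruned T"

definition is_chain :: "'v::zfc \<Rightarrow> 'v \<Rightarrow> bool" where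
  "is_chain T b \<longleftrightarrow> elts b \<subseteq> elts omega1 \<and>
     (\<forall>x\<in>elts b. \<forall>y\<in>elts b. x = y \<or> below T x y \<or> below T y x)"

definition is_branch :: "'v::zfc \<Rightarrow> 'v \<Rightarrow> bool" where
  "is_branch T b \<longleftrightarrow> is_chain T b \<and> (\<forall>c. is_chain T c \<and> elts b \<subseteq> elts c \<longrightarrow> c = b)"

definition uncountable_branches :: "'v::zfc \<Rightarrow> 'v" where
  "uncountable_branches T = set_of {b. is_branch T b \<and> \<not> vcountable b}"

definition kurepa_tree :: "'v::zfc \<Rightarrow> bool" where
  "kurepa_tree T \<longleftrightarrow> aleph1_tree T \<and> card_le omega2 (uncountable_branches T)"

text \<open>The point of \<open>2\<^bsup>\<omega>\<^sub>1\<^esup>\<close> corresponding to a relation on \<open>\<omega>\<^sub>1\<close>, with \<open>p\<close> the chosen bijection from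
  \<open>\<omega>\<^sub>1 \<times> \<omega>\<^sub>1\<close> to \<open>\<omega>\<^sub>1\<close>.\<close>

definition char_fun :: "'v::zfc \<Rightarrow> 'v \<Rightarrow> 'v" where
  "char_fun p T = set_of {vpair (app p (vpair x y)) (if below T x y then vsucc vempty else vempty)
                          | x y. x \<in> elts omega1 \<and> y \<in> elts omega1}"

definition Kurepa_class :: "'v::zfc \<Rightarrow> 'v" where
  "Kurepa_class p = set_of {char_fun p T | T. kurepa_tree T \<and> regular_tree T}"

end

theory Submission
 imports Defs
begin

text \<open>
  Under \<open>V = L\<close> every function \<open>f : \<omega>\<^sub>1 \<rightarrow> \<omega>\<^sub>1\<close> has an ordinal code \<open>i\<close>, with \<open>f \<eta> = v i \<eta>\<close>, and the
  coding commutes with the collapses of sets of ordinals closed under finitely many Skolem functions.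

  A \<open>\<Pi>\<^sup>1\<^sub>2\<close> set \<open>S\<close> can be written as \<open>X \<in> S \<longleftrightarrow> \<forall>Y. \<exists>Z. \<forall>\<eta> < \<omega>\<^sub>1. (X|\<eta>, Y|\<eta>, Z|\<eta>) \<in> Rs\<close>, because sets which, together
  with their complements, are projections of closed sets form a Borel-closed family. Call an ordinal \<open>l\<close>
  good if below \<open>l\<close> every code of some \<open>Y\<close> is matched by the code of a witness \<open>Z\<close>. Given \<open>i < l\<close>, the
  collapses of \<open>(i, l)\<close> under the hulls of \<open>\<xi> \<union> {i, l}\<close>, listed along the closed set of \<open>\<xi>\<close> at which the hull
  meets \<open>\<omega>\<^sub>1\<close> in \<open>\<xi>\<close>, form a function \<open>bb\<close> on \<open>\<omega>\<^sub>1\<close>. Its initial segments only depend on countable collapses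
  in which goodness still holds, and an ordinal \<open>ff \<xi>\<close> bounds these collapses, so that they form a tree
  with countable levels that depends continuously on \<open>X\<close>; adding finitely many arbitrary natural numbers
  as values makes it regular.

  If \<open>X \<in> S\<close>, then good ordinals exist above each \<open>i\<close>, and different functions yield different branches. If
  \<open>Y\<close> witnesses \<open>X \<notin> S\<close> and has the code \<open>i0\<close>, then consider the pair \<open>(j, k)\<close> read off a branch at \<open>\<xi>\<close>. If \<open>k\<close>
  exceeds the collapse of \<open>i0\<close> stationarily often, then Fodor's lemma glues the witnesses below \<open>k\<close> to a
  \<open>Z\<close> for \<open>Y\<close>, which is impossible; otherwise Fodor's lemma shows that the branch is given by a pair of ordinals
  at most \<open>i0\<close>, so that there are at most \<open>\<aleph>\<^sub>1\<close> branches.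

  The class of Kurepa trees is itself \<open>\<Pi>\<^sup>1\<^sub>2\<close>: by CH the heights of nodes are Borel, and a tree has more than
  \<open>\<aleph>\<^sub>1\<close> uncountable branches iff no \<open>Y\<close> enumerates them all.
\<close>

section \<open>Definable classes\<close>

text \<open>The universe is an arbitrary model, which may look ill-founded from outside and may have
  nonstandard natural numbers. Every separation, replacement, recursion and induction therefore
  happens inside it, for classes given by formulas with parameters, and formulas over stages of the
  hierarchy are internal codes.

  To have exact equations in place of absoluteness arguments, condensation is stated for codes:
  \<open>F\<close> enumerates the universe by ordinals, and the collapse of a set of ordinals closed
  under the Skolem functions \<open>HH\<close> and under pairing commutes with \<open>F\<close> and
  with the Skolem functions themselves.

  Two demands shape the tree. Levels must be countable: \<open>ff xi\<close> is the least code of an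
  \<omega>-sequence with supremum \<open>xi\<close>, and a hull with trace \<open>xi\<close> has no
  element that collapses to \<open>ff xi\<close>, since it would then contain \<open>xi\<close>; so
  all its collapses lie below the countable ordinal \<open>ff xi\<close>. And level
  \<open>xi\<close> may depend only on \<open>X\<close> below \<open>xi\<close>: hence the
  parameters \<open>al\<close> and \<open>x\<close> in the definitions, which are evaluated both at
  \<open>omega1\<close> with \<open>X\<close> and at \<open>xi\<close> with
  \<open>rs X xi\<close>.\<close>

abbreviation vmem :: "'v::zfc => 'v => bool" (infix "IN" 50) where "x IN y == x : elts y"

abbreviation E :: "'v::zfc => 'v set" where "E == elts"

abbreviation bfun :: "'v::zfc => bool" where "bfun f == is_fun f omega1 omega1"

abbreviation biimp (infixr "<->" 25) where "A <-> B == (A::bool) = B"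

abbreviation O1 :: "'v::zfc set" where "O1 == elts omega1"

primrec fm_vars :: "fm => nat set" where
 "fm_vars (Mem i j) = {i, j}"
| "fm_vars (Eq i j) = {i, j}"
| "fm_vars (Neg ph) = fm_vars ph"
| "fm_vars (And ph ps) = fm_vars ph Un fm_vars ps"
| "fm_vars (Ex i ph) = insert i (fm_vars ph)"

lemma finite_fm_vars: "finite (fm_vars ph)"
 by (induction ph) auto

lemma sat_cong: "(!!n. n : fm_vars ph ==> e n = e' n) ==> sat el ph e = sat el ph e'"
proof (induction ph arbitrary: e e')
 case (Ex i ph)
 have "sat el ph (e(i := x)) = sat el ph (e'(i := x))" for x
  by (rule Ex.IH) (use Ex.prems in auto)
 then show ?case by simp
next
 case (And ph1 ph2)
 have "sat el ph1 e = sat el ph1 e'" "sat el ph2 e = sat el ph2 e'"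
  using And.IH[of e e'] And.prems by auto
 then show ?case by simp
next
 case (Neg ph)
 have "sat el ph e = sat el ph e'" by (rule Neg.IH) (use Neg.prems in simp)
 then show ?case by simp
qed simp_all

text \<open>In the quantifier case the bound variable is renamed to some \<open>k\<close> outside
  the image of the variables of the subformula, so \<open>r\<close> need not be injective.\<close>

lemma sat_reindex: "EX ps. ALL e. sat el ps e <-> sat el ph (%n. e (r n))"
proof (induction ph arbitrary: r)
 case (Mem i j)
 show ?case by (rule exI[of _ "Mem (r i) (r j)"]) simp
next
 case (Eq i j)
 show ?case by (rule exI[of _ "Eq (r i) (r j)"]) simp
next
 case (Neg ph)
 from Neg.IH[of r] obtain ps where "ALL e. sat el ps e <-> sat el ph (%n. e (r n))" by blast
 then show ?case by (intro exI[of _ "Neg ps"]) simp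
next
 case (And ph1 ph2)
 from And.IH[of r] obtain ps1 ps2 where "ALL e. sat el ps1 e <-> sat el ph1 (%n. e (r n))"
  "ALL e. sat el ps2 e <-> sat el ph2 (%n. e (r n))" by blast
 then show ?case by (intro exI[of _ "And ps1 ps2"]) simp
next
 case (Ex i ph)
 obtain k where k: "k ~: r ` fm_vars ph"
  using ex_new_if_finite[OF infinite_UNIV_nat, of "r ` fm_vars ph"] finite_fm_vars[of ph] by auto
 obtain ps where ps: "ALL e. sat el ps e <-> sat el ph (%n. e ((r(i := k)) n))"
  using Ex.IH[of "r(i := k)"] by blast
 have "sat el ph (%n. (e(k := x)) ((r(i := k)) n)) <-> sat el ph ((%n. e (r n))(i := x))" for e x
  by (rule sat_cong) (use k in auto)
 then show ?case by (intro exI[of _ "Ex k ps"]) (simp add: ps)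
qed

definition mrg :: "(nat => 'v) => (nat => 'v) => nat => 'v" where
 "mrg e c n = (if even n then e (n div 2) else c (n div 2))"

text \<open>A relation on environments is definable (with parameters) if some formula defines it; the even
  variables hold the environment and the odd ones the parameters.\<close>

definition dpred :: "((nat => 'v::zfc) => bool) => bool" where
 "dpred P <-> (EX ph c. ALL e. P e <-> sat E ph (mrg e c))"

text \<open>Binders follow the de Bruijn convention: the bound variable is \<open>e 0\<close> and
  the outer environment is shifted by one. With it, the rules \<open>dint\<close> prove definability
  by recursion on the syntax of a notion, which is how separation, replacement and induction get
  their premises below.\<close>

definition dfun :: "((nat => 'v::zfc) => 'v) => bool" where
 "dfun f <-> dpred (%e. e 0 = f (%n. e (Suc n)))"

named_theorems dint

section \<open>Closure of definability under connectives and quantifiers\<close>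

lemma dpred_reindex: fixes P :: "(nat => 'v::zfc) => bool" assumes "dpred P" shows "dpred (%e. P (%n. e (r n)))"
proof -
 obtain ph c where ph: "!!e. P e <-> sat E ph (mrg e c)" using assms unfolding dpred_def by blast
 define r' where "r' n = (if even n then 2 * r (n div 2) else n)" for n
 obtain ps where ps[rule_format]: "ALL e::nat=>'v. sat E ps e <-> sat E ph (%n. e (r' n))"
  using sat_reindex[of E "ph" "%n. r' n"] by blast
 have "P (%n. e (r n)) <-> sat E ps (mrg e c)" for e
 proof -
  have m: "mrg (%n. e (r n)) c = (%n. mrg e c (r' n))" by (auto simp: mrg_def r'_def fun_eq_iff)
  show ?thesis unfolding ph ps m ..
 qed
 then show ?thesis unfolding dpred_def by blast
qed

lemma [dint]: assumes "dpred P" shows "dpred (%e. ~P e)"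
proof -
 obtain ph c where "ALL e. P e <-> sat E ph (mrg e c)" using assms unfolding dpred_def by blast
 then have "ALL e. ~P e <-> sat E (Neg ph) (mrg e c)" by simp
 then show ?thesis unfolding dpred_def by blast
qed

lemma [dint]: fixes P :: "(nat => 'v::zfc) => bool" assumes "dpred P" "dpred Q" shows "dpred (%e. P e & Q e)"
proof -
 obtain ph c where ph: "!!e. P e <-> sat E ph (mrg e c)" using assms unfolding dpred_def by blast
 obtain ps d where ps: "!!e. Q e <-> sat E ps (mrg e d)" using assms unfolding dpred_def by blast
 \<comment> \<open>The parameter lists \<open>c\<close> and \<open>d\<close> are interleaved to
   \<open>mrg c d\<close>, so the parameter slots of the two formulas move to the variables 4m + 1
   and 4m + 3.\<close>
 define r where "r n = (if even n then n else 4 * (n div 2) + 1)" for n :: nat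
 define s where "s n = (if even n then n else 4 * (n div 2) + 3)" for n :: nat
 obtain ph' where ph'[rule_format]: "ALL e::nat=>'v. sat E ph' e <-> sat E ph (%n. e (r n))"
  using sat_reindex[of E "ph" "%n. r n"] by blast
 obtain ps' where ps'[rule_format]: "ALL e::nat=>'v. sat E ps' e <-> sat E ps (%n. e (s n))"
  using sat_reindex[of E "ps" "%n. s n"] by blast
 define b where "b = mrg c d"
 have "mrg e c n = mrg e b (r n) & mrg e d n = mrg e b (s n)" for e n
 proof (cases "even n")
  case False
  then obtain m where m: "n = 2 * m + 1" using oddE by blast
  have "r n = 2 * (2 * m) + 1" "s n = 2 * (Suc (2 * m)) + 1" unfolding r_def s_def m by simp_all
  then show ?thesis unfolding mrg_def b_def m by simp
 qed (simp add: mrg_def r_def s_def)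
 then have m: "mrg e c = (%n. mrg e b (r n))" "mrg e d = (%n. mrg e b (s n))" for e
  by (auto simp: fun_eq_iff)
 have "(P e & Q e) <-> sat E (And ph' ps') (mrg e b)" for e
  using ph[of e] ps[of e] ph'[of "mrg e b"] ps'[of "mrg e b"] m[of e] by simp
 then show ?thesis unfolding dpred_def by blast
qed

lemma [dint]:
 fixes P :: "'v::zfc => (nat => 'v) => bool"
 assumes "dpred (%e. P (e 0) (%n. e (Suc n)))" shows "dpred (%e. EX x. P x e)"
proof -
 obtain ph c where ph: "!!e. P (e 0) (%n. e (Suc n)) <-> sat E ph (mrg e c)"
  using assms unfolding dpred_def by blast
 \<comment> \<open>The bound variable takes the parameter slot 1, which the shifted list
   \<open>d\<close> leaves free; the environment variables move down by 2 and the parameters up by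
   2.\<close>
 define r where "r n = (if n = 0 then 1 else if even n then n - 2 else n + 2)" for n :: nat
 obtain ps where ps[rule_format]: "ALL e::nat=>'v. sat E ps e <-> sat E ph (%n. e (r n))"
  using sat_reindex[of E "ph" "%n. r n"] by blast
 define d where "d n = c (n - 1)" for n
 have "mrg (case_nat x e) c n = ((mrg e d)(1 := x)) (r n)" for x e n
 proof (cases "n = 0")
  case False
  show ?thesis
  proof (cases "even n")
   case True
   then obtain m where "n = 2 * Suc m" using False by (metis evenE mult_0_right not0_implies_Suc)
   then show ?thesis by (simp add: mrg_def r_def d_def)
  next
   case odd: False
   then obtain m where m: "n = 2 * m + 1" using oddE by blast
   have "(n + 2) div 2 = Suc m" using m by presburger
   then show ?thesis using m by (simp add: mrg_def r_def d_def)
  qed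
 qed (simp add: mrg_def r_def)
 then have "mrg (case_nat x e) c = (%n. ((mrg e d)(1 := x)) (r n))" for x e by (simp add: fun_eq_iff)
 then have "P x e <-> sat E ps ((mrg e d)(1 := x))" for x e
  using ph[of "case_nat x e"] ps[of "(mrg e d)(1 := x)"] by simp
 then have "ALL e. (EX x. P x e) <-> sat E (Ex 1 ps) (mrg e d)" by simp
 then show ?thesis unfolding dpred_def by blast
qed

lemma dpred_var_mem: "dpred (%e. e i IN (e j))"
 unfolding dpred_def by (rule exI[of _ "Mem (2*i) (2*j)"]) (simp add: mrg_def)

lemma dpred_var_eq: "dpred (%e. e i = e j)"
 unfolding dpred_def by (rule exI[of _ "Eq (2*i) (2*j)"]) (simp add: mrg_def)

lemma dpred_const [dint]: "dpred (%e. Q)"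
proof (cases Q)
 case True
 then show ?thesis unfolding dpred_def by (intro exI[of _ "Eq 0 0"]) simp
next
 case False
 then show ?thesis unfolding dpred_def by (intro exI[of _ "Neg (Eq 0 0)"]) simp
qed

lemma dfun_var [dint]: "dfun (%e. e n)"
 unfolding dfun_def by (rule dpred_var_eq)

lemma [dint]: "dfun (%e. c)"
 unfolding dfun_def dpred_def
 by (rule exI[of _ "Eq 0 1"], rule exI[of _ "%_. c"]) (simp add: mrg_def)

section \<open>Substitution of definable functions into definable relations\<close>

lemma dpred_cong: "dpred P ==> (!!e. P e = Q e) ==> dpred Q"
 by (simp add: dpred_def)

lemma dfun_reindex: "dfun f ==> dfun (%e. f (%n. e (r n)))"
 unfolding dfun_def using dpred_reindex[of "%e. e 0 = f (%n. e (Suc n))" "case_nat 0 (%n. Suc (r n))"] by simp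

lemma dpred_subst:
 assumes "dpred (%e. P (e 0) (%n. e (Suc n)))" "dfun f" shows "dpred (%e. P (f e) e)"
proof -
 have "dpred (%e. EX y. y = f e & P y e)"
  using assms by (intro dint) (simp_all add: dfun_def)
 then show ?thesis by (rule dpred_cong) auto
qed

lemma dpred_subst_upto:
 assumes "dpred P" "!!i. dfun (f i)" shows "dpred (%e. P (%n. if n < k then f n e else e (n - k)))"
 using assms(2)
proof (induction k arbitrary: f)
 case 0
 then show ?case using assms(1) by simp
next
 case (Suc k)
 have "dpred (%e. P (%n. if n < k then f n (%n. e (Suc n)) else e (n - k)))"
  by (rule Suc.IH) (rule dfun_reindex[OF Suc.prems])
 then have "dpred (%e. (%x e. P (%n. if n < k then f n e else if n = k then x else e (n - Suc k))) (e 0) (%n. e (Suc n)))"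
  by (rule dpred_cong) (rule arg_cong[of _ _ P], auto simp: fun_eq_iff not_less Suc_diff_Suc le_neq_implies_less)
 from dpred_subst[where P = "%x e. P (%n. if n < k then f n e else if n = k then x else e (n - Suc k))", OF this[unfolded case_prod_beta] Suc.prems[of k]]
 show ?case by (rule dpred_cong) (rule arg_cong[of _ _ P], auto simp: fun_eq_iff less_Suc_eq)
qed

text \<open>A formula mentions only finitely many variables, so substituting below some bound
  \<open>k\<close> already has the full effect.\<close>

lemma dpred_subst_all:
 assumes "dpred P" "!!i. dfun (f i)" shows "dpred (%e. P (%n. f n e))"
proof -
 obtain ph c where ph: "!!e. P e <-> sat E ph (mrg e c)" using assms unfolding dpred_def by blast
 obtain k where k: "!!n. n : fm_vars ph ==> n < k"
  using finite_fm_vars[of ph] unfolding finite_nat_set_iff_bounded by auto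
 have "P (%n. f n e) = P (%n. if n < k then f n e else e (n - k))" for e
  unfolding ph by (rule sat_cong) (auto simp: mrg_def dest: k)
 then show ?thesis using dpred_subst_upto[OF assms, of k] by simp
qed

lemma dfun_subst_all:
 assumes "dfun h" "!!i. dfun (f i)" shows "dfun (%e. h (%n. f n e))"
proof -
 have "dfun (%e. case n of 0 => e 0 | Suc m => f m (%n. e (Suc n)))" for n
  by (cases n) (simp_all add: dfun_var dfun_reindex assms)
 from dpred_subst_all[OF assms(1)[unfolded dfun_def], of "%n e. case n of 0 => e 0 | Suc m => f m (%n. e (Suc n))", OF this]
 show ?thesis unfolding dfun_def by simp
qed

text \<open>Once a notion is definable as a relation between variables, rules of this shape carry it
  to arbitrary definable arguments; most later notions enter \<open>dint\<close> in this
  way.\<close>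

lemma dpred_comp1: assumes "dpred (%e. P (e 0))" "dfun f" shows "dpred (%e. P (f e))"
proof -
 have "dfun ((%_. f) i)" for i using assms by simp
 from dpred_subst_all[OF assms(1), of "%_. f", OF this] show ?thesis by simp
qed

lemma dpred_comp2: 
 assumes "dpred (%e. P (e 0) (e (Suc 0)))" "dfun f" "dfun g" shows "dpred (%e. P (f e) (g e))"
proof -
 have "dfun ((%n. if n = 0 then f else g) i)" for i using assms by simp
 from dpred_subst_all[OF assms(1), of "%n. if n = 0 then f else g", OF this] show ?thesis by simp
qed

lemma dpred_comp3: 
 assumes "dpred (%e. P (e 0) (e (Suc 0)) (e (Suc (Suc 0))))" "dfun f" "dfun g" "dfun h"
 shows "dpred (%e. P (f e) (g e) (h e))"
proof -
 have "dfun ((%n. if n = 0 then f else if n = 1 then g else h) i)" for i using assms by simp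
 from dpred_subst_all[OF assms(1), of "%n. if n = 0 then f else if n = 1 then g else h", OF this] show ?thesis by simp
qed

lemma dpred_comp4: 
 assumes "dpred (%e. P (e 0) (e (Suc 0)) (e (Suc (Suc 0))) (e (Suc (Suc (Suc 0)))))"
  "dfun f" "dfun g" "dfun h" "dfun k"
 shows "dpred (%e. P (f e) (g e) (h e) (k e))"
proof -
 have "dfun ((%n. if n = 0 then f else if n = 1 then g else if n = 2 then h else k) i)" for i using assms by simp
 from dpred_subst_all[OF assms(1), of "%n. if n = 0 then f else if n = 1 then g else if n = 2 then h else k", OF this] show ?thesis by simp
qed

lemma dpred_comp5: 
 assumes "dpred (%e. P (e 0) (e (Suc 0)) (e (Suc (Suc 0))) (e (Suc (Suc (Suc 0)))) (e (Suc (Suc (Suc (Suc 0))))))"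
  "dfun f" "dfun g" "dfun h" "dfun k" "dfun l"
 shows "dpred (%e. P (f e) (g e) (h e) (k e) (l e))"
proof -
 have "dfun ((%n. if n = 0 then f else if n = 1 then g else if n = 2 then h else if n = 3 then k else l) i)" for i using assms by simp
 from dpred_subst_all[OF assms(1), of "%n. if n = 0 then f else if n = 1 then g else if n = 2 then h else if n = 3 then k else l", OF this] show ?thesis by simp
qed

lemma dfun_comp1: assumes "dfun (%e. K (e 0))" "dfun f" shows "dfun (%e. K (f e))"
proof -
 have "dfun ((%_. f) i)" for i using assms by simp
 from dfun_subst_all[OF assms(1), of "%_. f", OF this] show ?thesis by simp
qed

lemma dfun_comp2: assumes "dfun (%e. K (e 0) (e (Suc 0)))" "dfun f" "dfun g" shows "dfun (%e. K (f e) (g e))"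
proof -
 have "dfun ((%n. if n = 0 then f else g) i)" for i using assms by simp
 from dfun_subst_all[OF assms(1), of "%n. if n = 0 then f else g", OF this] show ?thesis by simp
qed

lemma dfun_comp3:
 assumes "dfun (%e. K (e 0) (e (Suc 0)) (e (Suc (Suc 0))))" "dfun f" "dfun g" "dfun h"
 shows "dfun (%e. K (f e) (g e) (h e))"
proof -
 have "dfun ((%n. if n = 0 then f else if n = 1 then g else h) i)" for i using assms by simp
 from dfun_subst_all[OF assms(1), of "%n. if n = 0 then f else if n = 1 then g else h", OF this] show ?thesis by simp
qed

lemma dfun_comp4:
 assumes "dfun (%e. K (e 0) (e (Suc 0)) (e (Suc (Suc 0))) (e (Suc (Suc (Suc 0)))))" 
  "dfun f" "dfun g" "dfun h" "dfun k"
 shows "dfun (%e. K (f e) (g e) (h e) (k e))"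
proof -
 have "dfun ((%n. if n = 0 then f else if n = 1 then g else if n = 2 then h else k) i)" for i using assms by simp
 from dfun_subst_all[OF assms(1), of "%n. if n = 0 then f else if n = 1 then g else if n = 2 then h else k", OF this] show ?thesis by simp
qed

lemma [dint]: "dfun f ==> dfun g ==> dpred (%e. f e = g e)"
 by (rule dpred_comp2[where P = "(=)"]) (rule dpred_var_eq)

lemma [dint]: "dfun f ==> dfun g ==> dpred (%e. f e IN (g e))"
 by (rule dpred_comp2[where P = "%x y. x IN y"]) (rule dpred_var_mem)

lemma [dint]: assumes "dpred P" "dpred Q" shows "dpred (%e. P e | Q e)"
 by (rule dpred_cong[of "%e. ~(~P e & ~Q e)"]) (intro dint assms, auto)

lemma [dint]: assumes "dpred P" "dpred Q" shows "dpred (%e. P e --> Q e)"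
 by (rule dpred_cong[of "%e. ~P e | Q e"]) (intro dint assms, auto)

lemma [dint]: assumes "dpred P" "dpred Q" shows "dpred (%e. P e <-> Q e)"
 by (rule dpred_cong[of "%e. (P e --> Q e) & (Q e --> P e)"]) (intro dint assms, auto)

lemma [dint]:
 assumes "dpred (%e. P (e 0) (%n. e (Suc n)))" shows "dpred (%e. ALL x. P x e)"
 by (rule dpred_cong[of "%e. ~(EX x. ~P x e)"]) (intro dint assms, auto)

lemma [dint]:
 assumes "dfun A" "dpred (%e. P (e 0) (%n. e (Suc n)))" shows "dpred (%e. EX x:E (A e). P x e)"
 by (rule dpred_cong[of "%e. EX x. x IN (A e) & P x e"]) (intro dint assms dfun_reindex[where r = Suc, OF assms(1)], auto)

lemma [dint]:
 assumes "dfun A" "dpred (%e. P (e 0) (%n. e (Suc n)))" shows "dpred (%e. ALL x:E (A e). P x e)"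
 by (rule dpred_cong[of "%e. ALL x. x IN (A e) --> P x e"]) (intro dint assms dfun_reindex[where r = Suc, OF assms(1)], auto)

lemma [dint]:
 assumes "dpred (%e. P (e 0) (%n. e (Suc n)))" shows "dpred (%e. EX! x. P x e)"
proof -
 have "dpred (%e. P (e 0) (%n. e (Suc (Suc n))))"
  using dpred_reindex[OF assms, of "%n. if n = 0 then 0 else Suc n"] by simp
 then have "dpred (%e. EX x. P x e & (ALL y. P y e --> y = x))" by (intro dint assms)
 then show ?thesis by (rule dpred_cong) auto
qed

lemma [dint]: assumes "dfun f" "dfun g" shows "dpred (%e. E (f e) <= E (g e))"
 by (rule dpred_cong[of "%e. ALL x:E (f e). x IN (g e)"]) (intro dint assms dfun_reindex[where r = Suc, OF assms(2)], auto)

lemma [dint]: assumes "dpred P" "dfun f" "dfun g" shows "dfun (%e. if P e then f e else g e)"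
 unfolding dfun_def
 by (rule dpred_cong[of "%e. P (%n. e (Suc n)) & e 0 = f (%n. e (Suc n)) | ~P (%n. e (Suc n)) & e 0 = g (%n. e (Suc n))"])
  (intro dint dfun_reindex[where r = Suc, OF assms(2)] dfun_reindex[where r = Suc, OF assms(3)] dpred_reindex[where r = Suc, OF assms(1)], auto)

text \<open>Descriptions that take the value \<open>\<emptyset>\<close> when undefined are definable unconditionally.\<close>

definition vthe :: "('v::zfc => bool) => 'v" where
 "vthe P = (if EX! x. P x then THE x. P x else vempty)"

definition vcol :: "('v::zfc => bool) => 'v" where
 "vcol P = vthe (%y. ALL x. x IN y <-> P x)"

lemma vthe_eq: assumes "P a" "!!x. P x ==> x = a" shows "vthe P = a"
proof -
 have "(THE x. P x) = a" by (rule the_equality) (fact assms)+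
 moreover have "EX! x. P x" by (rule ex1I) (fact assms)+
 ultimately show ?thesis by (simp add: vthe_def)
qed

lemma vtheI: "EX! x. P x ==> P (vthe P)"
 unfolding vthe_def using theI'[of P] by presburger

lemma [dint]:
 fixes P :: "'v::zfc => (nat => 'v) => bool"
 assumes "dpred (%e. P (e 0) (%n. e (Suc n)))" shows "dfun (%e. vthe (%x. P x e))"
proof -
 have "dpred (%e. P (e 0) (%n. e (Suc (Suc n))))"
  using dpred_reindex[OF assms, of "%n. if n = 0 then 0 else Suc n"] by simp
 then have "dpred (%e. (EX! x. P x (%n. e (Suc n))) & P (e 0) (%n. e (Suc n)) | ~(EX! x. P x (%n. e (Suc n))) & e 0 = vempty)"
  by (intro dint assms)
 then show ?thesis unfolding dfun_def
 proof (rule dpred_cong)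
  fix e :: "nat => 'v"
  show "((EX! x. P x (%n. e (Suc n))) & P (e 0) (%n. e (Suc n)) | ~(EX! x. P x (%n. e (Suc n))) & e 0 = vempty) =
     (e 0 = vthe (%x. P x (%n. e (Suc n))))"
  proof (cases "EX! x. P x (%n. e (Suc n))")
   case True
   then show ?thesis using vtheI[OF True] by metis
  next
   case False
   then show ?thesis by (simp add: vthe_def)
  qed
 qed
qed

lemma [dint]:
 assumes "dpred (%e. P (e 0) (%n. e (Suc n)))" shows "dfun (%e. vcol (%x. P x e))"
proof -
 have "dpred (%e. P (e 0) (%n. e (Suc (Suc n))))"
  using dpred_reindex[OF assms, of "%n. if n = 0 then 0 else Suc n"] by simp
 then show ?thesis unfolding vcol_def by (intro dint)
qed

lemma ext: "(!!x. x IN a <-> x IN b) ==> a = (b::'v::zfc)"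
 by (rule extensionality) auto

lemma vcol_eq: "E a = {x. P x} ==> vcol P = a"
 unfolding vcol_def by (rule vthe_eq) (auto intro: ext)

lemma mem_vcol0: "E a = {x. P x} ==> x IN (vcol P) <-> P x"
 using vcol_eq by blast

section \<open>Separation and replacement for definable classes\<close>

lemma sep_ex:
 fixes P :: "'v::zfc => bool"
 assumes "dpred (%e. P (e 0))" shows "EX z. E z = {x : E a. P x}"
proof -
 obtain ph c where ph: "!!e. P (e 0) <-> sat E ph (mrg e c)" using assms unfolding dpred_def by blast
 have "mrg (%n. x) c = (mrg (%n. x) c)(0 := x)" for x by (auto simp: fun_eq_iff mrg_def)
 \<comment> \<open>The separation schema changes only variable 0, so all even variables, which hold
   the environment, are identified with it.\<close>
 obtain ps where ps[rule_format]: "ALL e::nat=>'v. sat E ps e <-> sat E ph (%n. e (if even n then 0 else n))"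
  using sat_reindex[of E "ph" "%n. if even n then 0 else n"] by blast
 have "P x <-> sat E ps ((mrg (%n. x) c)(0 := x))" for x
  unfolding ph[of "%n. x", simplified] ps by (rule sat_cong) (auto simp: mrg_def)
 moreover have "sat E ps ((mrg (%n. x) c)(0 := x)) = sat E ps ((mrg (%n. vempty) c)(0 := x))" for x
  unfolding ps by (rule sat_cong) (auto simp: mrg_def)
 ultimately show ?thesis using separation[of a ps "mrg (%n. vempty) c"] by auto
qed

lemma repl_ex:
 fixes f :: "'v::zfc => 'v"
 assumes "dfun (%e. f (e 0))" shows "EX z. E z = f ` E a"
proof -
 obtain ph c where ph: "!!e. e 0 = f (e (Suc 0)) <-> sat E ph (mrg e c)"
  using assms unfolding dfun_def dpred_def by blast
 \<comment> \<open>The replacement schema has the argument at variable 0 and the value at variable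
   1, while the graph formula has the value first; the parameters move up by 2 to make room.\<close>
 define r where "r n = (if odd n then n + 2 else if n = 0 then 1 else 0)" for n :: nat
 obtain ps where ps[rule_format]: "ALL e::nat=>'v. sat E ps e <-> sat E ph (%n. e (r n))"
  using sat_reindex[of E "ph" "%n. r n"] by blast
 define d where "d n = c (n div 2 - 1)" for n
 have *: "(d(0 := x, 1 := y)) (r n) = mrg (%n. if n = 0 then y else x) c n" for x y n
 proof (cases "odd n")
  case True
  then obtain m where "n = 2 * m + 1" using oddE by blast
  moreover have "(2 * m + 3) div 2 = Suc m" by presburger
  ultimately show ?thesis by (simp add: d_def r_def mrg_def)
 qed (auto simp: r_def mrg_def)
 have sat: "sat E ps (d(0 := x, 1 := y)) <-> y = f x" for x y
  using ph[of "%n. if n = 0 then y else x"] unfolding ps * by simp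
 show ?thesis using replacement[of a ps d] unfolding sat by (auto simp: image_def)
qed

lemma mem_vcol:
 assumes "dpred (%e. P (e 0))" "!!x. P x ==> x IN a" shows "x IN (vcol P) <-> P x"
proof -
 obtain z where "E z = {x : E a. P x}" using sep_ex[OF assms(1)] by blast
 then have "E z = {x. P x}" using assms(2) by auto
 then show ?thesis by (rule mem_vcol0)
qed

lemma mem_vcol_image:
 assumes "dfun (%e. f (e 0))" shows "y IN (vcol (%y. EX x:E a. y = f x)) <-> (EX x:E a. y = f x)"
proof -
 obtain z where "E z = f ` E a" using repl_ex[OF assms] by blast
 then have "E z = {y. EX x:E a. y = f x}" by auto
 then show ?thesis by (rule mem_vcol0)
qed

lemma mem_vcol_subset:
 assumes "dfun (%e. f (e 0))" "dpred (%e. P (e 0))" "!!y. P y ==> EX x:E a. y = f x"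
 shows "y IN (vcol P) <-> P y"
 by (rule mem_vcol[OF assms(2), of "vcol (%y. EX x:E a. y = f x)"]) (use assms(3) mem_vcol_image[OF assms(1)] in blast)

section \<open>Sets, functions and ordinals\<close>

lemma elts_vempty [simp]: "E (vempty :: 'v::zfc) = {}"
proof -
 obtain a :: 'v where "E a = {x : E undefined. False}" using sep_ex[OF dpred_const] by blast
 then show ?thesis unfolding vempty_def by (intro elts_set_of[of a]) simp
qed

lemma vempty_iff: "a = vempty <-> E (a::'v::zfc) = {}"
 using extensionality[of a vempty] by auto

definition upair :: "'v::zfc => 'v => 'v" where "upair x y = set_of {x, y}"

lemma elts_upair [simp]: "E (upair x y) = {x, y}"
 unfolding upair_def using pairing[of x y] elts_set_of by blast

lemma vUnion_elts [simp]: "E (vUnion C) = (UN a:E C. E a)"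
 unfolding vUnion_def using union[of C] elts_set_of by blast

lemma elts_vsucc [simp]: "E (vsucc x) = insert x (E x)"
proof -
 have "E (vUnion (upair x (upair x x))) = insert x (E x)" by auto
 then show ?thesis unfolding vsucc_def by (rule elts_set_of)
qed

definition vun :: "'v::zfc => 'v => 'v" where "vun x y = vUnion (upair x y)"

lemma elts_vun [simp]: "E (vun x y) = E x Un E y"
 by (simp add: vun_def)

definition vpow :: "'v::zfc => 'v" where "vpow x = set_of {y. E y <= E x}"

lemma elts_vpow [simp]: "E (vpow x) = {y. E y <= E x}"
 unfolding vpow_def using powerset[of x] elts_set_of by blast

lemma vpair_upair: "vpair x y = upair (upair x x) (upair x y)"
 by (simp add: vpair_def upair_def)

lemma upair_eq_iff: "upair x y = upair a b <-> x = a & y = b | x = b & y = a"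
proof
 assume "upair x y = upair a b"
 then have "{x, y} = {a, b}" by (metis elts_upair)
 then show "x = a & y = b | x = b & y = a" by (simp add: doubleton_eq_iff)
next
 have "upair x y = upair y x" for x y :: 'a by (rule ext) auto
 then show "x = a & y = b | x = b & y = a ==> upair x y = upair a b" by auto
qed

lemma vpair_inject [simp]: "vpair x y = vpair a b <-> x = a & y = b"
 by (auto simp: vpair_upair upair_eq_iff)

lemma upair_vcol: "upair x y = vcol (%z. z = x | z = y)"
 by (rule vcol_eq[symmetric]) auto

lemma [dint]: "dfun f ==> dfun g ==> dfun (%e. upair (f e) (g e))"
 by (rule dfun_comp2[where K = upair]) (unfold upair_vcol, intro dint)

lemma [dint]: "dfun f ==> dfun g ==> dfun (%e. vpair (f e) (g e))"
 unfolding vpair_upair by (intro dint)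

lemma vUnion_vcol: "vUnion x = vcol (%z. EX y:E x. z IN y)"
 by (rule vcol_eq[symmetric]) auto

lemma [dint]: "dfun f ==> dfun (%e. vUnion (f e))"
 by (rule dfun_comp1[where K = vUnion]) (unfold vUnion_vcol, intro dint)

lemma [dint]: "dfun f ==> dfun g ==> dfun (%e. vun (f e) (g e))"
 unfolding vun_def by (intro dint)

lemma vsucc_vun: "vsucc x = vun x (upair x x)"
 by (rule ext) auto

lemma [dint]: "dfun f ==> dfun (%e. vsucc (f e))"
 unfolding vsucc_vun by (intro dint)

lemma vpow_vcol: "vpow x = vcol (%z. E z <= E x)"
 by (rule vcol_eq[symmetric]) auto

lemma [dint]: "dfun f ==> dfun (%e. vpow (f e))"
 by (rule dfun_comp1[where K = vpow]) (unfold vpow_vcol, intro dint)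

definition vimg :: "('v::zfc => 'v) => 'v => 'v" where
 "vimg f a = vcol (%y. EX x:E a. y = f x)"

lemma elts_vimg: "dfun (%e. f (e 0)) ==> E (vimg f a) = f ` E a"
 unfolding vimg_def using mem_vcol_image[of f _ a] by blast

lemma [dint]:
 assumes "dfun (%e. f (e 0) (%n. e (Suc n)))" "dfun a" shows "dfun (%e. vimg (%x. f x e) (a e))"
proof -
 have "dfun (%e. f (e 0) (%n. e (Suc (Suc n))))"
  using dfun_reindex[OF assms(1), of "%n. if n = 0 then 0 else Suc n"] by simp
 then show ?thesis unfolding vimg_def by (intro dint dfun_reindex[where r = Suc, OF assms(2)])
qed

definition vUN :: "'v::zfc => ('v => 'v) => 'v" where
 "vUN a f = vUnion (vimg f a)"

lemma elts_vUN: "dfun (%e. f (e 0)) ==> E (vUN a f) = (UN x:E a. E (f x))"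
 unfolding vUN_def by (simp add: elts_vimg)

lemma [dint]:
 assumes "dfun a" "dfun (%e. f (e 0) (%n. e (Suc n)))" shows "dfun (%e. vUN (a e) (%x. f x e))"
 unfolding vUN_def by (intro dint assms)

lemma vtimes_vUN: "vtimes A B = vUN A (%x. vimg (%y. vpair x y) B)"
 and elts_vtimes [simp]: "E (vtimes A B) = {vpair x y | x y. x IN A & y IN B}"
proof -
 have d: "dfun (%e. vimg (%y. vpair (e 0) y) B)" "dfun (%e. vpair x (e 0))" for x by (intro dint)+
 have e: "E (vUN A (%x. vimg (%y. vpair x y) B)) = {vpair x y | x y. x IN A & y IN B}"
  unfolding elts_vUN[OF d(1)] elts_vimg[OF d(2)] by blast
 then show "vtimes A B = vUN A (%x. vimg (%y. vpair x y) B)"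
  unfolding vtimes_def by (metis set_of_elts)
 then show "E (vtimes A B) = {vpair x y | x y. x IN A & y IN B}" using e by simp
qed

lemma [dint]: "dfun f ==> dfun g ==> dfun (%e. vtimes (f e) (g e))"
 by (rule dfun_comp2[where K = vtimes]) (unfold vtimes_vUN, intro dint)

definition vsep :: "'v::zfc => ('v => bool) => 'v" where
 "vsep a P = vcol (%x. x IN a & P x)"

lemma elts_vsep: "dpred (%e. P (e 0)) ==> E (vsep a P) = {x : E a. P x}"
proof -
 assume "dpred (%e. P (e 0))"
 then have "dpred (%e. e 0 IN a & P (e 0))" by (intro dint)
 then have "x IN (vcol (%x. x IN a & P x)) <-> x IN a & P x" for x
  by (rule mem_vcol[where a = a]) simp
 then show ?thesis unfolding vsep_def by blast
qed

lemma [dint]: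
 assumes "dfun a" "dpred (%e. P (e 0) (%n. e (Suc n)))" shows "dfun (%e. vsep (a e) (%x. P x e))"
 unfolding vsep_def by (intro dint assms dfun_reindex[where r = Suc, OF assms(1)])

lemma set_of_eq: "E a = X ==> set_of X = a"
 by auto

lemma set_of_vsep: "dpred (%e. P (e 0)) ==> set_of {x : E a. P x} = vsep a P"
 by (rule set_of_eq) (rule elts_vsep)

text \<open>A total variant of \<open>app\<close>: the default \<open>vempty\<close> makes
  application definable in every case, whereas nothing is known of \<open>THE\<close> when there is
  no unique value. The two agree on genuine functions.\<close>

definition ap :: "'v::zfc => 'v => 'v" where
 "ap f x = vthe (%y. vpair x y IN f)"

lemma [dint]: "dfun f ==> dfun g ==> dfun (%e. ap (f e) (g e))"
 by (rule dfun_comp2[where K = ap]) (unfold ap_def, intro dint)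

lemma [dint]: "dfun f ==> dfun A ==> dfun B ==> dpred (%e. is_fun (f e) (A e) (B e))"
 by (rule dpred_comp3[where P = is_fun]) (unfold is_fun_def, intro dint)

lemma app_ap: "is_fun f A B ==> x IN A ==> app f x = ap f x"
 unfolding is_fun_def app_def ap_def vthe_def by simp

lemma vpair_ap: "is_fun f A B ==> x IN A ==> vpair x (ap f x) IN f"
 unfolding ap_def is_fun_def using vtheI[of "%y. vpair x y IN f"] by blast

lemma ap_eq: "is_fun f A B ==> vpair x y IN f ==> ap f x = y"
proof -
 assume f: "is_fun f A B" and y: "vpair x y IN f"
 then have "x IN A" unfolding is_fun_def by auto
 then have "EX! y. vpair x y IN f" using f unfolding is_fun_def by blast
 then show ?thesis unfolding ap_def using y by (intro vthe_eq) blast+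
qed

lemma ap_type: "is_fun f A B ==> x IN A ==> ap f x IN B"
 using vpair_ap[of f A B x] unfolding is_fun_def by auto

lemma mem_is_fun: "is_fun f A B ==> z IN f <-> (EX x:E A. z = vpair x (ap f x))"
proof
 assume f: "is_fun f A B" and z: "z IN f"
 then obtain x y where "z = vpair x y" "x IN A" unfolding is_fun_def by auto
 then show "EX x:E A. z = vpair x (ap f x)" using ap_eq[OF f, of x y] z by auto
qed (auto intro: vpair_ap)

lemma fun_ext: "is_fun f A B ==> is_fun g A C ==> (!!x. x IN A ==> ap f x = ap g x) ==> f = g"
 by (rule ext) (simp add: mem_is_fun)

definition vlam :: "'v::zfc => ('v => 'v) => 'v" where
 "vlam A f = vimg (%x. vpair x (f x)) A"

lemma [dint]:
 assumes "dfun A" "dfun (%e. f (e 0) (%n. e (Suc n)))" shows "dfun (%e. vlam (A e) (%x. f x e))"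
 unfolding vlam_def by (intro dint assms)

lemma elts_vlam: "dfun (%e. f (e 0)) ==> E (vlam A f) = {vpair x (f x) | x. x IN A}"
 unfolding vlam_def by (subst elts_vimg) (auto intro: dint)

lemma is_fun_vlam: "dfun (%e. f (e 0)) ==> (!!x. x IN A ==> f x IN B) ==> is_fun (vlam A f) A B"
 unfolding is_fun_def by (auto simp: elts_vlam)

lemma ap_vlam: "dfun (%e. f (e 0)) ==> x IN A ==> ap (vlam A f) x = f x"
 unfolding ap_def by (rule vthe_eq) (auto simp: elts_vlam)

lemma is_fun_vlam_img: "dfun (%e. f (e 0)) ==> is_fun (vlam A f) A (vimg f A)"
 by (rule is_fun_vlam) (auto simp: elts_vimg)

lemma vlam_eta: "is_fun f A B ==> vlam A (ap f) = f"
proof (rule ext)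
 have "dfun (%e. ap f (e 0))" by (intro dint)
 then show "is_fun f A B ==> x IN (vlam A (ap f)) <-> x IN f" for x by (auto simp: elts_vlam mem_is_fun)
qed

lemma vlam_cong: "(!!x. x IN A ==> f x = g x) ==> vlam A f = vlam A g"
 unfolding vlam_def vimg_def by (rule arg_cong[of _ _ vcol]) auto

lemma vimg_cong: "(!!x. x IN A ==> f x = g x) ==> vimg f A = vimg g A"
 unfolding vimg_def by (rule arg_cong[of _ _ vcol]) auto

lemma funs_eq: "funs A B = vsep (vpow (vtimes A B)) (%f. is_fun f A B)"
 and mem_funs [simp]: "f IN (funs A B) <-> is_fun f A B"
proof -
 have d: "dpred (%e. is_fun (e 0) A B)" by (intro dint)
 have e: "E (vsep (vpow (vtimes A B)) (%f. is_fun f A B)) = {f. is_fun f A B}"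
  unfolding elts_vsep[OF d] by (auto simp: is_fun_def)
 then show "funs A B = vsep (vpow (vtimes A B)) (%f. is_fun f A B)"
  unfolding funs_def by (rule set_of_eq)
 then show "f IN (funs A B) <-> is_fun f A B" using e by simp
qed

lemma [dint]: "dfun f ==> dfun g ==> dfun (%e. funs (f e) (g e))"
 by (rule dfun_comp2[where K = funs]) (unfold funs_eq, intro dint)

lemma is_injection_iff: "is_injection f A B <-> is_fun f A B & (ALL x:E A. ALL y:E A. ap f x = ap f y --> x = y)"
 unfolding is_injection_def inj_on_def using app_ap[of f A B] by auto

lemma [dint]: "dfun f ==> dfun A ==> dfun B ==> dpred (%e. is_injection (f e) (A e) (B e))"
 by (rule dpred_comp3[where P = is_injection]) (unfold is_injection_iff, intro dint)

lemma is_bijection_iff: "is_bijection f A B <-> is_fun f A B & (ALL x:E A. ALL y:E A. ap f x = ap f y --> x = y)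
  & (ALL z:E B. EX x:E A. ap f x = z)"
proof (cases "is_fun f A B")
 case True
 have "app f ` E A = ap f ` E A" using app_ap[OF True] by simp
 moreover have "inj_on (app f) (E A) = inj_on (ap f) (E A)" using app_ap[OF True] by (simp add: inj_on_def)
 moreover have sub: "ap f ` E A <= E B" using ap_type[OF True] by blast
 have "(ap f ` E A = E B) <-> (ALL z:E B. EX x:E A. ap f x = z)"
 proof
  assume "ap f ` E A = E B"
  then show "ALL z:E B. EX x:E A. ap f x = z" by (metis imageE)
 next
  assume "ALL z:E B. EX x:E A. ap f x = z"
  then have "E B <= ap f ` E A" by (metis imageI subsetI)
  then show "ap f ` E A = E B" using sub by (rule subset_antisym[rotated])
 qed
 ultimately show ?thesis using True unfolding is_bijection_def bij_betw_def inj_on_def by simp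
qed (simp add: is_bijection_def)

lemma [dint]: "dfun f ==> dfun A ==> dfun B ==> dpred (%e. is_bijection (f e) (A e) (B e))"
 by (rule dpred_comp3[where P = is_bijection]) (unfold is_bijection_iff, intro dint)

section \<open>Comparison of cardinalities\<close>

lemma [dint]: "dfun A ==> dfun B ==> dpred (%e. card_le (A e) (B e))"
 by (rule dpred_comp2[where P = card_le]) (unfold card_le_def, intro dint)

lemma card_leI:
 assumes "dfun (%e. f (e 0))" "!!x. x IN A ==> f x IN B"
  "!!x y. x IN A ==> y IN A ==> f x = f y ==> x = y"
 shows "card_le A B"
 unfolding card_le_def is_injection_iff
 by (rule exI[of _ "vlam A f"]) (auto simp: is_fun_vlam ap_vlam assms)

lemma card_leE:
 assumes "card_le A B"
 obtains f where "ALL x:E A. ap f x IN B" "ALL x:E A. ALL y:E A. ap f x = ap f y --> x = y"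
 using assms ap_type unfolding card_le_def is_injection_iff by metis

lemma card_le_subset: "E A <= E B ==> card_le A B"
 by (rule card_leI[of "%x. x"]) (auto intro: dint)

lemma card_le_trans: assumes "card_le A B" "card_le B C" shows "card_le A C"
proof -
 obtain f where f: "ALL x:E A. ap f x IN B" "ALL x:E A. ALL y:E A. ap f x = ap f y --> x = y"
  using assms(1) by (rule card_leE)
 obtain g where g: "ALL x:E B. ap g x IN C" "ALL x:E B. ALL y:E B. ap g x = ap g y --> x = y"
  using assms(2) by (rule card_leE)
 have "dfun (%e. ap g (ap f (e 0)))" by (intro dint)
 then show ?thesis by (rule card_leI) (use f g in blast)+
qed

subsection \<open>Ordinals\<close>

lemma [dint]: "dfun f ==> dpred (%e. transitive_set (f e))"
 by (rule dpred_comp1[where P = transitive_set]) (unfold transitive_set_def, intro dint)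

lemma [dint]: "dfun f ==> dpred (%e. Ord (f e))"
 by (rule dpred_comp1[where P = Ord]) (unfold Ord_def, intro dint)

lemma mem_not_refl: "x ~: E (x::'v::zfc)"
 using foundation[of "upair x x"] by auto

lemma mem_not_sym: "x IN (y::'v::zfc) ==> y ~: E x"
 using foundation[of "upair x y"] by auto

lemma Ord_in_Ord: "Ord al ==> bt IN al ==> Ord bt"
 unfolding Ord_def transitive_set_def by blast

lemma Ord_trans: "Ord al ==> bt IN al ==> ga IN bt ==> ga IN al"
 unfolding Ord_def transitive_set_def by blast

lemma Ord_sub: "Ord al ==> bt IN al ==> E bt <= E al"
 unfolding Ord_def transitive_set_def by blast

lemma OrdI: "(!!x. x IN a ==> Ord x) ==> (!!x. x IN a ==> E x <= E a) ==> Ord a"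
 unfolding Ord_def transitive_set_def by blast

lemma Ord_vempty [simp]: "Ord vempty" by (rule OrdI) auto

lemma Ord_vsucc: "Ord al ==> Ord (vsucc al)"
 by (rule OrdI) (auto intro: Ord_in_Ord dest: Ord_sub)

lemma set_minimal:
 assumes "dpred (%e. P (e 0))" "x IN a" "P x"
 shows "EX y:E a. P y & (ALL z:E a. z IN y --> ~P z)"
proof -
 have e: "E (vsep a P) = {x : E a. P x}" using assms by (simp add: elts_vsep)
 then have "E (vsep a P) ~= {}" using assms by blast
 then obtain y where "y IN (vsep a P)" "E y Int E (vsep a P) = {}" using foundation[of "vsep a P"] by blast
 then show ?thesis unfolding e by blast
qed

text \<open>The ordinals of the model need not be well-ordered from outside, so \<open>P\<close> has
  to be definable: only then does a failure at \<open>al\<close> yield a least failure in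
  \<open>vsucc al\<close>.\<close>

lemma Ord_induct:
 assumes "dpred (%e. P (e 0))" "Ord al" "!!al. Ord al ==> (!!bt. bt IN al ==> P bt) ==> P al"
 shows "P al"
proof (rule ccontr)
 assume "~P al"
 moreover have "dpred (%e. ~P (e 0))" by (intro dint assms)
 ultimately obtain y where y: "y IN (vsucc al)" "~P y" "ALL z:E (vsucc al). z IN y --> ~~P z"
  using set_minimal[of "%x. ~P x" al "vsucc al"] by auto
 have o: "Ord (vsucc al)" using assms Ord_vsucc by blast
 have "P y" using assms(3)[of y] y Ord_in_Ord[OF o] Ord_trans[OF o] by blast
 then show False using y by blast
qed

lemma Ord_linear:
 assumes "Ord al" "Ord bt" shows "al IN bt | al = bt | bt IN al"
proof -
 have "dpred (%e. ALL bt. Ord bt --> e 0 IN bt | e 0 = bt | bt IN (e 0))" by (intro dint)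
 then have "ALL bt. Ord bt --> al IN bt | al = bt | bt IN al"
 proof (rule Ord_induct)
  show "Ord al" by fact
 next
  fix al :: 'a assume al: "Ord al" and IH: "!!bt. bt IN al ==> ALL ga. Ord ga --> bt IN ga | bt = ga | ga IN bt"
  have "dpred (%e. al IN (e 0) | al = e 0 | e 0 IN al)" by (intro dint)
  then have "Ord bt ==> al IN bt | al = bt | bt IN al" for bt
  proof (rule Ord_induct)
   fix bt assume bt: "Ord bt" and IH2: "!!ga. ga IN bt ==> al IN ga | al = ga | ga IN al"
   show "al IN bt | al = bt | bt IN al"
   proof (rule ccontr)
    assume n: "~?thesis"
    have "E al <= E bt" using IH bt n Ord_trans[OF al] by blast
    moreover have "E bt <= E al" using IH2 n Ord_trans[OF bt] by blast
    ultimately show False using n extensionality[of al bt] by blast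
   qed
  qed
  then show "ALL bt. Ord bt --> al IN bt | al = bt | bt IN al" by blast
 qed
 then show ?thesis using assms by blast
qed

lemma Ord_subset_iff: "Ord al ==> Ord bt ==> E al <= E bt <-> al IN bt | al = bt"
 using Ord_linear[of al bt] Ord_sub mem_not_refl by blast

lemma Ord_not_mem: "Ord al ==> Ord bt ==> al ~: E bt <-> E bt <= E al"
 using Ord_linear[of al bt] Ord_sub mem_not_refl by blast

text \<open>Without any witness the value is \<open>vempty\<close>, which every collapse fixes; thus
  a Skolem function commutes with collapses even where it has no witness.\<close>

definition vleast :: "('v::zfc => bool) => 'v" where
 "vleast P = vthe (%al. Ord al & P al & (ALL bt:E al. ~P bt))"

lemma [dint]:
 assumes "dpred (%e. P (e 0) (%n. e (Suc n)))" shows "dfun (%e. vleast (%x. P x e))"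
proof -
 have "dpred (%e. P (e 0) (%n. e (Suc (Suc n))))"
  using dpred_reindex[OF assms, of "%n. if n = 0 then 0 else Suc n"] by simp
 then show ?thesis unfolding vleast_def by (intro dint assms)
qed

lemma vleast_eq: "Ord al ==> P al ==> (!!bt. bt IN al ==> ~P bt) ==> vleast P = al"
 unfolding vleast_def by (rule vthe_eq) (use Ord_linear in blast)+

lemma vleast:
 assumes "dpred (%e. P (e 0))" "Ord al" "P al"
 shows "Ord (vleast P)" "P (vleast P)" "!!bt. Ord bt ==> P bt ==> E (vleast P) <= E bt"
  "!!bt. bt IN (vleast P) ==> ~P bt"
proof -
 obtain y where y: "y IN (vsucc al)" "P y" "ALL z:E (vsucc al). z IN y --> ~P z"
  using set_minimal[OF assms(1), of al "vsucc al"] assms by auto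
 have o: "Ord (vsucc al)" using assms Ord_vsucc by blast
 have y': "Ord y" "ALL z:E y. ~P z" using y Ord_in_Ord[OF o] Ord_trans[OF o] by blast+
 then have e: "vleast P = y" using y by (intro vleast_eq) auto
 show "Ord (vleast P)" "P (vleast P)" "!!bt. bt IN (vleast P) ==> ~P bt" using e y y' by auto
 show "!!bt. Ord bt ==> P bt ==> E (vleast P) <= E bt" using e y' Ord_not_mem by blast
qed

subsection \<open>The natural numbers\<close>

lemma [dint]: "dfun f ==> dpred (%e. is_succ (f e))"
 by (rule dpred_comp1[where P = is_succ]) (unfold is_succ_def, intro dint)

lemma [dint]: "dfun f ==> dpred (%e. is_limit (f e))"
 by (rule dpred_comp1[where P = is_limit]) (unfold is_limit_def, intro dint)

lemma elts_omega: "E (omega::'v::zfc) = {n. Ord n & (ALL m:E (vsucc n). m = vempty | is_succ m)}"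
proof -
 obtain z :: 'v where z: "EX x:E z. E x = {}" "ALL x:E z. EX y:E z. E y = insert x (E x)"
  using infinity by blast
 have z0: "vempty IN z" using z(1) vempty_iff by metis
 have zs: "vsucc x IN z" if "x IN z" for x using z(2) that extensionality[of _ "vsucc x"] by (metis elts_vsucc)
 let ?P = "%n. Ord n & (ALL m:E (vsucc n). m = vempty | is_succ m)"
 have d: "dpred (%e. ?P (e 0))" by (intro dint)
 have "dpred (%e. ?P (e 0) --> e 0 IN z)" by (intro dint)
 then have "Ord n ==> ?P n --> n IN z" for n
 proof (rule Ord_induct)
  fix n assume n: "Ord n" "!!m. m IN n ==> ?P m --> m IN z"
  show "?P n --> n IN z"
  proof
   assume p: "?P n"
   then consider "n = vempty" | m where "Ord m" "n = vsucc m" unfolding is_succ_def by auto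
   then show "n IN z"
   proof cases
    case 2
    then have "?P m" using p by auto
    then show ?thesis using n(2)[of m] 2 zs by auto
   qed (use z0 in simp)
  qed
 qed
 then have "E (vsep z ?P) = {n. ?P n}" using elts_vsep[OF d] by blast
 then show ?thesis unfolding omega_def by (rule elts_set_of)
qed

lemma Ord_omega [simp]: "Ord omega"
proof (rule OrdI)
 fix x :: 'a assume x: "x IN omega"
 then show "Ord x" by (simp add: elts_omega)
 show "E x <= E omega"
 proof
  fix y assume y: "y IN x"
  have "Ord y" "E y <= E x" using x y Ord_in_Ord[of x] Ord_sub[of x] by (auto simp: elts_omega)
  then show "y IN omega" using x y by (auto simp: elts_omega)
 qed
qed

lemma zero_in_omega [simp]: "vempty IN omega"
 by (simp add: elts_omega)

lemma succ_in_omega [simp]: "n IN omega ==> vsucc n IN omega"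
 by (auto simp: elts_omega Ord_vsucc is_succ_def)

lemma omega_cases: "n IN omega ==> n = vempty | (EX m:E omega. n = vsucc m)"
proof -
 assume n: "n IN omega"
 then have "n = vempty | is_succ n" by (simp add: elts_omega)
 then consider "n = vempty" | m where "n = vsucc m" unfolding is_succ_def by blast
 then show ?thesis
 proof cases
  case 2
  then have "m IN omega" using Ord_trans[OF Ord_omega n, of m] by simp
  then show ?thesis using 2 by blast
 qed simp
qed

lemma Ord_nat: "n IN omega ==> Ord n"
 using Ord_in_Ord[OF Ord_omega] .

lemma omega_induct:
 assumes "dpred (%e. P (e 0))" "n IN omega" "P vempty" "!!n. n IN omega ==> P n ==> P (vsucc n)"
 shows "P n"
proof -
 have "dpred (%e. e 0 IN omega --> P (e 0))" by (intro dint assms)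
 then have "n IN omega --> P n"
 proof (rule Ord_induct)
  show "Ord n" using assms Ord_nat by blast
  fix n :: 'a assume "Ord n" "!!m. m IN n ==> m IN omega --> P m"
  then show "n IN omega --> P n" using omega_cases[of n] assms(3,4) by auto
 qed
 then show ?thesis using assms by blast
qed

section \<open>Recursion\<close>

definition rclosed :: "('v::zfc => 'v => bool) => 'v => bool" where
 "rclosed R t <-> (ALL x:E t. ALL y. R y x --> y IN t)"

definition is_apx :: "('v::zfc => 'v => bool) => ('v => 'v => 'v) => 'v => 'v => bool" where
 "is_apx R G t f <-> rclosed R t & (ALL x:E t. ap f x = G x (vlam (vsep t (%y. R y x)) (ap f)))"

text \<open>Recursion by approximations on sets closed under \<open>R\<close>-predecessors. It
  serves three relations: membership, the order of pairs behind \<open>J\<close>, and the tree order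
  when heights are constructed.\<close>

definition rrec :: "('v::zfc => 'v => bool) => ('v => 'v => 'v) => 'v => 'v" where
 "rrec R G x = vthe (%v. EX t f. x IN t & is_apx R G t f & v = ap f x)"

lemma dfun_rrec [dint]:
 fixes R :: "(nat => 'v::zfc) => 'v => 'v => bool"
 assumes R: "dpred (%e. R (%n. e (Suc (Suc n))) (e 0) (e (Suc 0)))"
  and G: "dfun (%e. G (%n. e (Suc (Suc n))) (e 0) (e (Suc 0)))" and h: "dfun h"
 shows "dfun (%e. rrec (R e) (G e) (h e))"
proof -
 have R': "dpred (%e. R (%n. p n e) (q e) (a e))" if "!!n. dfun (p n)" "dfun q" "dfun a" for p q a
 proof -
  have "dfun (case n of 0 => q | Suc m => (case m of 0 => a | Suc k => p k))" for n
   using that by (auto split: nat.split)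
  from dpred_subst_all[OF R, of "%n. case n of 0 => q | Suc m => (case m of 0 => a | Suc k => p k)", OF this]
  show ?thesis by simp
 qed
 have G': "dfun (%e. G (%n. p n e) (q e) (a e))" if "!!n. dfun (p n)" "dfun q" "dfun a" for p q a
 proof -
  have "dfun (case n of 0 => q | Suc m => (case m of 0 => a | Suc k => p k))" for n
   using that by (auto split: nat.split)
  from dfun_subst_all[OF G, of "%n. case n of 0 => q | Suc m => (case m of 0 => a | Suc k => p k)", OF this]
  show ?thesis by simp
 qed
 have h': "dfun (%e. h (%n. p n e))" if "!!n. dfun (p n)" for p
  using dfun_subst_all[OF h that] by simp
 show ?thesis unfolding rrec_def is_apx_def rclosed_def
  by (intro dint R' G' h')
qed

lemma dfun_ap1: "dfun (%e. ap f (e 0))" by (intro dint)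

context
 fixes R :: "'v::zfc => 'v => bool" and G :: "'v => 'v => 'v"
 assumes dR: "dpred (%e. R (e 0) (e (Suc 0)))" and dG: "dfun (%e. G (e 0) (e (Suc 0)))"
  and wf: "!!a. E a ~= {} ==> EX y:E a. ALL z:E a. ~R z y"
begin

lemma dR': "dfun f ==> dfun g ==> dpred (%e. R (f e) (g e))"
 by (rule dpred_comp2[where P = R, OF dR])

lemma dG': "dfun f ==> dfun g ==> dfun (%e. G (f e) (g e))"
 by (rule dfun_comp2[where K = G, OF dG])

lemma rmin:
 assumes "dpred (%e. P (e 0))" "x IN t" "P x"
 obtains y where "y IN t" "P y" "!!z. z IN t ==> R z y ==> ~P z"
proof -
 have e: "E (vsep t P) = {x : E t. P x}" using assms by (simp add: elts_vsep)
 then have "E (vsep t P) ~= {}" using assms by blast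
 from wf[OF this] show ?thesis unfolding e using that by blast
qed

lemma elts_rpred: "E (vsep t (%y. R y x)) = {y : E t. R y x}"
 by (rule elts_vsep) (intro dint dR')

lemma apx_unique:
 assumes "is_apx R G t f" "is_apx R G t' f'" "x IN t" "x IN t'" shows "ap f x = ap f' x"
proof (rule ccontr)
 assume n: "ap f x ~= ap f' x"
 have "dpred (%e. e 0 IN t' & ap f (e 0) ~= ap f' (e 0))" by (intro dint)
 from rmin[where P = "%x. x IN t' & ap f x ~= ap f' x" and t = t and x = x, OF this] n assms
 obtain y where y: "y IN t" "y IN t'" "ap f y ~= ap f' y"
  and m: "!!z. z IN t ==> R z y ==> ~(z IN t' & ap f z ~= ap f' z)" by metis
 have c: "!!z. R z y ==> z IN t & z IN t'" using assms y unfolding is_apx_def rclosed_def by blast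
 have "vsep t (%z. R z y) = vsep t' (%z. R z y)" by (rule ext) (use c in \<open>auto simp: elts_rpred\<close>)
 moreover have "vlam (vsep t (%z. R z y)) (ap f) = vlam (vsep t (%z. R z y)) (ap f')"
  by (rule vlam_cong) (use c m in \<open>auto simp: elts_rpred\<close>)
 ultimately show False using assms y unfolding is_apx_def by metis
qed

lemma rrec_apx: assumes "is_apx R G t f" "x IN t" shows "rrec R G x = ap f x"
 unfolding rrec_def by (rule vthe_eq) (use assms apx_unique in blast)+

lemma dfun_rrec0: "dfun h ==> dfun (%e. rrec R G (h e))"
 by (intro dint dR' dG')

text \<open>Let \<open>gd\<close> be the set of points that belong to some approximation. A minimal
  \<open>y\<close> in \<open>t\<close> outside \<open>gd\<close> has all its predecessors in
  \<open>gd\<close>, so \<open>rrec\<close> on \<open>gd\<close>, extended by the one value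
  prescribed at \<open>y\<close>, is again an approximation; this is a contradiction.\<close>

lemma rrec_eq0:
 assumes "rclosed R t"
 shows "is_apx R G t (vlam t (rrec R G))"
proof -
 let ?good = "%x. EX t' f. x IN t' & is_apx R G t' f"
 have dgood: "dpred (%e. ?good (e 0))" unfolding is_apx_def rclosed_def by (intro dint dR' dG')
 define gd where "gd = vsep t ?good"
 have gd: "E gd = {x : E t. ?good x}" unfolding gd_def by (rule elts_vsep[OF dgood])
 have drec: "dfun (%e. rrec R G (e 0))" by (intro dfun_rrec0 dint)
 have cl: "rclosed R gd" unfolding rclosed_def gd using assms unfolding rclosed_def is_apx_def by blast
 have step: "rrec R G x = G x (vlam (vsep s (%y. R y x)) (rrec R G))"
  if s: "?good x" "rclosed R s" "x IN s" for x s
 proof -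
  obtain t' f where f: "x IN t'" "is_apx R G t' f" using s by blast
  have c: "!!z. R z x ==> z IN s & z IN t'" using s f unfolding rclosed_def is_apx_def by blast
  have 1: "vsep t' (%z. R z x) = vsep s (%z. R z x)" by (rule ext) (use c in \<open>auto simp: elts_rpred\<close>)
  have 2: "vlam (vsep t' (%z. R z x)) (ap f) = vlam (vsep t' (%z. R z x)) (rrec R G)"
   by (rule vlam_cong) (use c rrec_apx[OF f(2)] in \<open>auto simp: elts_rpred\<close>)
  show ?thesis using rrec_apx[OF f(2,1)] f 1 2 unfolding is_apx_def by metis
 qed
 have all: "?good x" if x: "x IN t" for x
 proof (rule ccontr)
  assume "~?good x"
  moreover have "dpred (%e. ~?good (e 0))" by (intro dint dgood)
  ultimately obtain y where y: "y IN t" "~?good y" and m: "!!z. z IN t ==> R z y ==> ~~?good z"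
   using rmin[where P = "%x. ~?good x" and t = t and x = x] x by blast
  define t2 where "t2 = vun gd (upair y y)"
  let ?v = "G y (vlam (vsep gd (%z. R z y)) (rrec R G))"
  let ?h = "%z. if z = y then ?v else rrec R G z"
  have dh: "dfun (%e. ?h (e 0))" by (intro dint drec)
  have et: "E t2 = insert y (E gd)" unfolding t2_def by auto
  have py: "R z y ==> z IN gd" for z using m y assms unfolding gd rclosed_def by blast
  have ynr: "~R y z" if "z IN gd" for z using that cl y unfolding rclosed_def gd by blast
  have nyy: "~R y y" using py y gd by blast
  have cl2: "rclosed R t2" using cl py unfolding rclosed_def et by blast
  have "ap (vlam t2 ?h) z = G z (vlam (vsep t2 (%w. R w z)) (ap (vlam t2 ?h)))" if z: "z IN t2" for z
  proof -
   have v1: "vlam (vsep t2 (%w. R w z)) (ap (vlam t2 ?h)) = vlam (vsep t2 (%w. R w z)) (rrec R G)"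
   proof (rule vlam_cong)
    fix w assume "w IN (vsep t2 (%w. R w z))"
    then have w: "w IN t2" "R w z" by (simp_all add: elts_rpred)
    have "w ~= y" using w z ynr nyy unfolding et by blast
    then show "ap (vlam t2 ?h) w = rrec R G w" using ap_vlam[OF dh, of w t2] w by simp
   qed
   have v2: "vsep t2 (%w. R w z) = vsep gd (%w. R w z)"
    by (rule ext) (use z ynr nyy in \<open>auto simp: elts_rpred et\<close>)
   show ?thesis
   proof (cases "z = y")
    case True
    then show ?thesis using ap_vlam[OF dh z] v1 v2 by simp
   next
    case False
    then have zg: "z IN gd" using z et by blast
    then have "?good z" using gd by blast
    then show ?thesis using ap_vlam[OF dh z] v1 v2 False step[OF _ cl zg] by simp
   qed
  qed
  then have "is_apx R G t2 (vlam t2 ?h)" using cl2 unfolding is_apx_def by blast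
  then show False using y et by blast
 qed
 have v: "vlam (vsep t (%w. R w z)) (ap (vlam t (rrec R G))) = vlam (vsep t (%w. R w z)) (rrec R G)" for z
  by (rule vlam_cong) (simp add: elts_rpred ap_vlam[OF drec])
 show ?thesis unfolding is_apx_def v using assms step[OF all assms] ap_vlam[OF drec] by simp
qed

lemma rrec_eq:
 assumes "rclosed R t" "x IN t"
 shows "rrec R G x = G x (vlam (vsep t (%y. R y x)) (rrec R G))"
proof -
 have drec: "dfun (%e. rrec R G (e 0))" by (intro dfun_rrec0 dint)
 have v: "vlam (vsep t (%w. R w x)) (ap (vlam t (rrec R G))) = vlam (vsep t (%w. R w x)) (rrec R G)"
  by (rule vlam_cong) (simp add: elts_rpred ap_vlam[OF drec])
 show ?thesis using rrec_eq0[OF assms(1)] assms(2) v ap_vlam[OF drec assms(2)] unfolding is_apx_def by simp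
qed

end

definition erec :: "('v::zfc => 'v => 'v) => 'v => 'v" where
 "erec G x = rrec (%y x. y IN x) G x"

lemma [dint]:
 "dfun (%e. G (%n. e (Suc (Suc n))) (e 0) (e (Suc 0))) ==> dfun h ==> dfun (%e. erec (G e) (h e))"
 unfolding erec_def by (intro dfun_rrec[where R = "%_ y x. y IN x"] dint)

lemma erec_eq0:
 assumes "dfun (%e. G (e 0) (e (Suc 0)))" "transitive_set t" "x IN t"
 shows "erec G x = G x (vlam x (erec G))"
proof -
 have d: "dpred (%e. e 0 IN (e (Suc 0)))" by (intro dint)
 have wf: "EX y:E a. ALL z:E a. z ~: E y" if "E a ~= {}" for a :: 'a using foundation[OF that] by blast
 have c: "rclosed (%y x. y IN x) t" using assms unfolding rclosed_def transitive_set_def by blast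
 have "vsep t (%y. y IN x) = x"
 proof (rule ext)
  have "dpred (%e. e 0 IN x)" by (intro dint)
  then show "z IN (vsep t (%y. y IN x)) <-> z IN x" for z
   using assms unfolding transitive_set_def by (auto simp: elts_vsep)
 qed
 then show ?thesis using rrec_eq[OF d assms(1) wf c assms(3)] unfolding erec_def by simp
qed

lemma erec_Ord: "dfun (%e. G (e 0) (e (Suc 0))) ==> Ord al ==> erec G al = G al (vlam al (erec G))"
proof -
 assume d: "dfun (%e. G (e 0) (e (Suc 0)))" and "Ord al"
 then have "transitive_set (vsucc al)" using Ord_vsucc unfolding Ord_def by blast
 then show ?thesis by (rule erec_eq0[OF d]) simp
qed

text \<open>Recursion along an ordinal can use the transitive set \<open>vsucc al\<close>. Stage
  \<open>omega\<close> of this recursion is a transitive set that contains \<open>x\<close>, and so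
  opens the way to recursion on arbitrary sets.\<close>

definition tcl_step :: "'v::zfc => 'v => 'v" where
 "tcl_step x al = erec (%al f. vun (upair x x) (vUN al (%bt. vUnion (ap f bt)))) al"

lemma ex_transitive: "EX t. transitive_set t & x IN (t::'v::zfc)"
proof -
 let ?G = "%al f. vun (upair x x) (vUN al (%bt. vUnion (ap f bt)))"
 have dG: "dfun (%e. ?G (e 0) (e (Suc 0)))" by (intro dint)
 have ds: "dfun (%e. tcl_step x (e 0))" unfolding tcl_step_def by (intro dint)
 have eq: "E (tcl_step x al) = insert x (UN bt:E al. UN y:E (tcl_step x bt). E y)" if "Ord al" for al
 proof -
  have "tcl_step x al = ?G al (vlam al (tcl_step x))" using erec_Ord[OF dG that] unfolding tcl_step_def .
  moreover have "dfun (%e. vUnion (ap (vlam al (tcl_step x)) (e 0)))" by (intro dint)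
  ultimately show ?thesis by (simp add: elts_vUN ap_vlam[OF ds])
 qed
 let ?t = "tcl_step x omega"
 have "transitive_set ?t" unfolding transitive_set_def
 proof
  fix y assume "y IN ?t"
  then consider "y = x" | n where "n IN omega" "y : (UN y:E (tcl_step x n). E y)" unfolding eq[OF Ord_omega] by blast
  then obtain n where n: "n IN omega" "y IN (tcl_step x n)"
  proof cases
   case 1
   then show ?thesis using that[of vempty] eq[OF Ord_vempty] by simp
  next
   case 2
   then show ?thesis using that[of "vsucc n"] eq[OF Ord_nat, of "vsucc n"] by auto
  qed
  show "E y <= E ?t" using n unfolding eq[OF Ord_omega] by blast
 qed
 moreover have "x IN ?t" using eq[OF Ord_omega] by simp
 ultimately show ?thesis by blast
qed

lemma erec_eq: "dfun (%e. G (e 0) (e (Suc 0))) ==> erec G x = G x (vlam x (erec G))"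
 using erec_eq0 ex_transitive[of x] by blast

lemma set_induct:
 assumes "dpred (%e. P (e 0))" "!!x. (!!y. y IN x ==> P y) ==> P x" shows "P x"
proof (rule ccontr)
 assume n: "~P x"
 obtain t where t: "transitive_set t" "x IN t" using ex_transitive by blast
 have "dpred (%e. ~P (e 0))" by (intro dint assms)
 from set_minimal[of "%x. ~P x", OF this t(2) n] obtain y where "y IN t" "~P y" "ALL z:E t. z IN y --> ~~P z"
  by blast
 then show False using assms(2)[of y] t unfolding transitive_set_def by blast
qed

subsection \<open>The Mostowski collapse\<close>

text \<open>The Mostowski collapse of \<open>N\<close>, extended to arguments outside
  \<open>N\<close>: only the members that lie in \<open>N\<close> are retained.\<close>

definition col :: "'v::zfc => 'v => 'v" where
 "col N x = erec (%x f. vimg (ap f) (vsep x (%y. y IN N))) x"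

lemma [dint]: "dfun f ==> dfun g ==> dfun (%e. col (f e) (g e))"
 by (rule dfun_comp2[where K = col]) (unfold col_def, intro dint)

lemma elts_col: "E (col N x) = col N ` (E x Int E N)"
proof -
 let ?G = "%x f. vimg (ap f) (vsep x (%y. y IN N))"
 have "dfun (%e. ?G (e 0) (e (Suc 0)))" by (intro dint)
 from erec_eq[OF this, of x] have "col N x = ?G x (vlam x (col N))" unfolding col_def .
 moreover have "dfun (%e. ap (vlam x (col N)) (e 0))" by (intro dint)
 moreover have "dpred (%e. e 0 IN N)" by (intro dint)
 moreover have "dfun (%e. col N (e 0))" by (intro dint)
 ultimately show ?thesis by (auto simp: elts_vimg elts_vsep ap_vlam)
qed

text \<open>Injectivity on \<open>N\<close> ensures that an element of \<open>N\<close> whose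
  collapse lies in the image of \<open>M\<close> belongs to \<open>M\<close> itself, so both sides
  retain the same members. This compares a small hull with its image under the collapse of a larger
  one.\<close>

lemma col_col:
 assumes "E M <= E N" "!!x y. x IN N ==> y IN N ==> col N x = col N y ==> x = y" "x IN N"
 shows "col (vimg (col N) M) (col N x) = col M x"
proof -
 have d: "dfun (%e. col N (e 0))" by (intro dint)
 have "dpred (%e. e 0 IN N --> col (vimg (col N) M) (col N (e 0)) = col M (e 0))" by (intro dint)
 then have "x IN N --> col (vimg (col N) M) (col N x) = col M x"
 proof (rule set_induct)
  fix x assume IH: "!!y. y IN x ==> y IN N --> col (vimg (col N) M) (col N y) = col M y"
  show "x IN N --> col (vimg (col N) M) (col N x) = col M x"
  proof
   assume x: "x IN N"
   have "E (col N x) Int E (vimg (col N) M) = col N ` (E x Int E M)"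
    unfolding elts_col[of N x] elts_vimg[OF d] using assms by blast
   then have "E (col (vimg (col N) M) (col N x)) = col (vimg (col N) M) ` col N ` (E x Int E M)"
    using elts_col[of "vimg (col N) M" "col N x"] by simp
   also have "... = col M ` (E x Int E M)"
    unfolding image_image by (rule image_cong) (use IH assms in auto)
   also have "... = E (col M x)" by (simp add: elts_col)
   finally show "col (vimg (col N) M) (col N x) = col M x" by (rule extensionality)
  qed
 qed
 then show ?thesis using assms by blast
qed

lemma col_Ord: "Ord al ==> Ord (col N al)"
proof -
 have "dpred (%e. Ord (col N (e 0)))" by (intro dint)
 then show "Ord al ==> Ord (col N al)"
 proof (rule Ord_induct)
  fix al assume al: "Ord al" "!!bt. bt IN al ==> Ord (col N bt)"
  show "Ord (col N al)"
  proof (rule OrdI)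
   fix z assume "z IN (col N al)"
   then obtain bt where bt: "bt IN al" "bt IN N" "z = col N bt" by (auto simp: elts_col)
   then show "Ord z" using al by blast
   show "E z <= E (col N al)" using bt Ord_sub[OF al(1) bt(1)] unfolding bt(3) elts_col by blast
  qed
 qed
qed

lemma col_id:
 assumes "transitive_set a" "E a <= E N" "x IN a | x = a" shows "col N x = x"
proof -
 have "dpred (%e. e 0 IN a | e 0 = a --> col N (e 0) = e 0)" by (intro dint)
 then have "x IN a | x = a --> col N x = x"
 proof (rule set_induct)
  fix x assume IH: "!!y. y IN x ==> y IN a | y = a --> col N y = y"
  show "x IN a | x = a --> col N x = x"
  proof
   assume "x IN a | x = a"
   then have xa: "E x <= E a" using assms(1) unfolding transitive_set_def by blast
   have "E (col N x) = col N ` E x" using xa assms(2) unfolding elts_col by blast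
   also have "... = E x" using IH xa by force
   finally show "col N x = x" by (rule extensionality)
  qed
 qed
 then show ?thesis using assms by blast
qed

definition otp :: "'v::zfc => 'v" where "otp N = vimg (col N) N"

lemma [dint]: "dfun f ==> dfun (%e. otp (f e))"
 by (rule dfun_comp1[where K = otp]) (unfold otp_def, intro dint)

lemma elts_otp: "E (otp N) = col N ` E N"
proof -
 have "dfun (%e. col N (e 0))" by (intro dint)
 then show ?thesis unfolding otp_def by (rule elts_vimg)
qed

context
 fixes N :: "'v::zfc"
 assumes N: "!!x. x IN N ==> Ord x"
begin

lemma col_mono: "x IN N ==> x IN y ==> col N x IN (col N y)"
 by (auto simp: elts_col)

lemma col_inj: "x IN N ==> y IN N ==> col N x = col N y ==> x = y"
 using Ord_linear[OF N N, of x y] col_mono[of x y] col_mono[of y x] mem_not_refl by metis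

lemma Ord_otp: "Ord (otp N)"
proof (rule OrdI)
 fix x assume "x IN (otp N)"
 then obtain y where y: "y IN N" "x = col N y" by (auto simp: elts_otp)
 then show "Ord x" using N col_Ord by blast
 show "E x <= E (otp N)" unfolding y elts_otp elts_col by blast
qed

lemma col_le: "Ord al ==> E (col N al) <= E al"
proof -
 have "dpred (%e. E (col N (e 0)) <= E (e 0))" by (intro dint)
 then show "Ord al ==> E (col N al) <= E al"
 proof (rule Ord_induct)
  fix al assume al: "Ord al" "!!bt. bt IN al ==> E (col N bt) <= E bt"
  show "E (col N al) <= E al"
  proof
   fix z assume "z IN (col N al)"
   then obtain bt where bt: "bt IN al" "z = col N bt" by (auto simp: elts_col)
   have o: "Ord bt" using al bt Ord_in_Ord by blast
   have "z IN bt | z = bt" using al(2)[OF bt(1)] Ord_subset_iff[OF col_Ord[OF o] o] bt by metis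
   then show "z IN al" using bt Ord_trans[OF al(1)] by blast
  qed
 qed
qed

end

subsection \<open>Hartogs numbers\<close>

definition hart :: "'v::zfc => 'v" where
 "hart A = set_of {al. Ord al & card_le al A}"

lemma omega1_hart: "omega1 = hart omega" by (simp add: omega1_def hart_def)
lemma omega2_hart: "omega2 = hart omega1" by (simp add: omega2_def hart_def)

text \<open>The order that \<open>f\<close> transports from \<open>al\<close> to \<open>A\<close>.
  It is a subset of the square of \<open>A\<close>, so replacement over a power set bounds the
  ordinals that inject into \<open>A\<close>. Reflexivity keeps the field visible: the strict orders
  of the ordinals 0 and 1 would both be empty.\<close>

definition ord_graph :: "'v::zfc => 'v => 'v" where
 "ord_graph f al = vUN al (%ga. vimg (%bt. vpair (ap f bt) (ap f ga)) (vsucc ga))"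

lemma [dint]: "dfun f ==> dfun g ==> dfun (%e. ord_graph (f e) (g e))"
 by (rule dfun_comp2[where K = ord_graph]) (unfold ord_graph_def, intro dint)

lemma mem_ord_graph: "z IN (ord_graph f al) <-> (EX ga:E al. EX bt:E (vsucc ga). z = vpair (ap f bt) (ap f ga))"
proof -
 have "dfun (%e. vimg (%bt. vpair (ap f bt) (ap f (e 0))) (vsucc (e 0)))" "dfun (%e. vpair (ap f (e 0)) (ap f ga))" for ga
  by (intro dint)+
 then show ?thesis unfolding ord_graph_def by (auto simp: elts_vUN elts_vimg)
qed

text \<open>Two enumerations of the same ordering agree: by induction on \<open>bt\<close>, its
  image and the element with that image on the other side have the same predecessors.\<close>

lemma ord_graph_unique0:
 assumes "Ord al" "Ord al'" "is_injection f al A" "is_injection f' al' A" "ord_graph f al = ord_graph f' al'"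
  "bt IN al"
 shows "bt IN al' & ap f bt = ap f' bt"
proof -
 have i: "!!x y. x IN al ==> y IN al ==> ap f x = ap f y ==> x = y"
  "!!x y. x IN al' ==> y IN al' ==> ap f' x = ap f' y ==> x = y"
  using assms unfolding is_injection_iff by blast+
 have og: "vpair (ap h bt) (ap h ga) IN (ord_graph h dt) <-> bt = ga | bt IN ga"
  if dt: "Ord dt" "bt IN dt" "ga IN dt" "!!x y. x IN dt ==> y IN dt ==> ap h x = ap h y ==> x = y" for h bt ga dt
 proof
  assume "vpair (ap h bt) (ap h ga) IN (ord_graph h dt)"
  then obtain c b where c: "c IN dt" "b = c | b IN c" "ap h bt = ap h b" "ap h ga = ap h c"
   unfolding mem_ord_graph by auto
  have "b IN dt" using c Ord_trans[OF dt(1)] by blast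
  then have "bt = b" "ga = c" using dt c by blast+
  then show "bt = ga | bt IN ga" using c by simp
 next
  assume "bt = ga | bt IN ga"
  then show "vpair (ap h bt) (ap h ga) IN (ord_graph h dt)" unfolding mem_ord_graph using dt(3) by auto
 qed
 have g: "bt = ga | bt IN ga <-> vpair (ap f bt) (ap f ga) IN (ord_graph f al)" if "bt IN al" "ga IN al" for bt ga
  using og[OF assms(1) that i(1)] by blast
 have g': "bt = ga | bt IN ga <-> vpair (ap f' bt) (ap f' ga) IN (ord_graph f al)" if "bt IN al'" "ga IN al'" for bt ga
  unfolding assms(5) using og[OF assms(2) that i(2)] by blast
 have fld: "EX ga:E al'. ap f bt = ap f' ga" if "bt IN al" for bt
  using g[OF that that] unfolding assms(5) mem_ord_graph by auto
 have fld': "EX ga:E al. ap f' bt = ap f ga" if "bt IN al'" for bt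
  using g'[OF that that] unfolding mem_ord_graph by auto
 have "dpred (%e. e 0 IN al --> e 0 IN al' & ap f (e 0) = ap f' (e 0))" by (intro dint)
 then have "bt IN al --> bt IN al' & ap f bt = ap f' bt"
 proof (rule Ord_induct)
  show "Ord bt" using assms Ord_in_Ord by blast
  fix bt assume bt: "Ord bt" and IH: "!!ga. ga IN bt ==> ga IN al --> ga IN al' & ap f ga = ap f' ga"
  show "bt IN al --> bt IN al' & ap f bt = ap f' bt"
  proof
   assume b: "bt IN al"
   obtain dt where dt: "dt IN al'" "ap f bt = ap f' dt" using fld[OF b] by blast
   have "bt = dt"
   proof (rule ext, rule iffI)
    fix ga assume c: "ga IN bt"
    then have ca: "ga IN al" using b Ord_trans[OF assms(1)] by blast
    then have c': "ga IN al'" "ap f ga = ap f' ga" using IH[OF c] by auto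
    have "ga = dt | ga IN dt" using g[OF ca b] g'[OF c'(1) dt(1)] c c' dt by simp
    moreover have "ga ~= dt" using i(1)[OF ca b] c' dt c mem_not_refl by metis
    ultimately show "ga IN dt" by blast
   next
    fix ga' assume c: "ga' IN dt"
    then have ca: "ga' IN al'" using dt Ord_trans[OF assms(2)] by blast
    obtain ga where c': "ga IN al" "ap f' ga' = ap f ga" using fld'[OF ca] by blast
    have "ga = bt | ga IN bt" using g[OF c'(1) b] g'[OF ca dt(1)] c c' dt by simp
    moreover have "ga ~= bt" using i(2)[OF ca dt(1)] c' dt c mem_not_refl by metis
    ultimately have cb: "ga IN bt" by blast
    then have "ga IN al' & ap f ga = ap f' ga" using IH c' by blast
    then have "ga = ga'" using i(2) ca c' by metis
    then show "ga' IN bt" using cb by simp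
   qed
   then show "bt IN al' & ap f bt = ap f' bt" using dt by simp
  qed
 qed
 then show ?thesis using assms by blast
qed

lemma ord_graph_unique:
 assumes "Ord al" "Ord al'" "is_injection f al A" "is_injection f' al' A" "ord_graph f al = ord_graph f' al'"
 shows "al = al'"
 using ord_graph_unique0[OF assms] ord_graph_unique0[OF assms(2,1,4,3) assms(5)[symmetric]] by (intro ext) blast

lemma elts_hart: "E (hart A) = {al. Ord al & card_le al (A::'v::zfc)}"
proof -
 define h where "h r = vthe (%al. Ord al & (EX f. is_injection f al A & r = ord_graph f al))" for r
 have dh: "dfun (%e. h (e 0))" unfolding h_def by (intro dint)
 have dp: "dpred (%e. Ord (e 0) & card_le (e 0) A)" by (intro dint)
 have "EX r:E (vpow (vtimes A A)). al = h r" if al: "Ord al & card_le al A" for al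
 proof -
  obtain f where f: "is_injection f al A" using al unfolding card_le_def by blast
  then have t: "!!x. x IN al ==> ap f x IN A" unfolding is_injection_iff using ap_type by blast
  have "E (ord_graph f al) <= E (vtimes A A)"
   using t Ord_trans[of al] al by (auto simp: mem_ord_graph)
  moreover have "h (ord_graph f al) = al" unfolding h_def
  proof (rule vthe_eq)
   show "Ord al & (EX f'. is_injection f' al A & ord_graph f al = ord_graph f' al)" using al f by blast
   show "x = al" if "Ord x & (EX f'. is_injection f' x A & ord_graph f al = ord_graph f' x)" for x
    using that ord_graph_unique[of al x f A] al f by metis
  qed
  ultimately show ?thesis by (intro bexI[of _ "ord_graph f al"]) auto
 qed
 then have "x IN (vcol (%al. Ord al & card_le al A)) <-> Ord x & card_le x A" for x
  by (rule mem_vcol_subset[OF dh dp])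
 then have "E (vcol (%al. Ord al & card_le al A)) = {al. Ord al & card_le al A}" by blast
 then show ?thesis unfolding hart_def by (rule elts_set_of)
qed

lemma Ord_hart: "Ord (hart A)"
proof (rule OrdI)
 fix x assume x: "x IN (hart A)"
 then show "Ord x" by (simp add: elts_hart)
 show "E x <= E (hart A)"
 proof
  fix y assume "y IN x"
  then show "y IN (hart A)"
   using x Ord_in_Ord[of x] Ord_sub[of x y] card_le_trans[OF card_le_subset, of y x A] by (auto simp: elts_hart)
 qed
qed

lemma hart_not_card_le: "~card_le (hart A) A"
 using Ord_hart[of A] mem_not_refl[of "hart A"] by (auto simp: elts_hart)

lemma mem_omega1: "al : O1 <-> Ord al & card_le al omega"
 by (simp add: omega1_hart elts_hart)

lemma mem_omega2: "al IN omega2 <-> Ord al & card_le al omega1"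
 by (simp add: omega2_hart elts_hart)

lemma Ord_omega1 [simp]: "Ord omega1" by (simp add: omega1_hart Ord_hart)

lemma omega_in_omega1 [simp]: "omega : O1"
 by (simp add: mem_omega1 card_le_subset)

lemma omega_sub_omega1: "E omega <= O1"
 by (rule Ord_sub) simp_all

lemma zero_in_omega1 [simp]: "vempty : O1"
 using omega_sub_omega1 by auto

lemma vsucc_inject [simp]: "vsucc x = vsucc y <-> x = y"
proof
 assume "vsucc x = vsucc y"
 then have "insert x (E x) = insert y (E y)" by (metis elts_vsucc)
 then show "x = y" by (metis insertE insertI1 mem_not_sym)
qed simp

lemma vsucc_not_empty [simp]: "vsucc x ~= vempty" "vempty ~= vsucc x"
 by (metis elts_vempty elts_vsucc insert_not_empty)+

lemma succ_in_omega1 [simp]: assumes "al : O1" shows "vsucc al : O1"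
proof -
 have "card_le al omega" using assms by (simp add: mem_omega1)
 then obtain f where f: "ALL x:E al. ap f x IN omega" "ALL x:E al. ALL y:E al. ap f x = ap f y --> x = y"
  by (rule card_leE)
 have "dfun (%e. if e 0 = al then vempty else vsucc (ap f (e 0)))" by (intro dint)
 then have "card_le (vsucc al) omega" by (rule card_leI) (use f in \<open>auto split: if_splits\<close>)
 then show ?thesis using assms by (simp add: mem_omega1 Ord_vsucc)
qed

section \<open>The canonical pairing of ordinals\<close>

definition mx :: "'v::zfc => 'v => 'v" where "mx a b = (if a IN b then b else a)"

text \<open>Goedel's canonical order of pairs of ordinals. Comparing maxima first confines the
  predecessors of a pair to a square and hence to a set.\<close>

definition gl :: "'v::zfc => 'v => 'v => 'v => bool" where
 "gl a b c d <-> mx a b IN (mx c d) | mx a b = mx c d & (a IN c | a = c & b IN d)"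

definition glt :: "'v::zfc => 'v => bool" where
 "glt p q <-> (EX a b c d. p = vpair a b & q = vpair c d & Ord a & Ord b & Ord c & Ord d & gl a b c d)"

definition vsnd :: "'v::zfc => 'v" where "vsnd p = vthe (%y. EX x. p = vpair x y)"

text \<open>Goedel's pairing function: \<open>vsnd\<close> extracts the values from the function
  computed so far, so each pair receives the set of all earlier values, which is the ordinal of its
  position.\<close>

definition J :: "'v::zfc => 'v => 'v" where
 "J a b = rrec glt (%p f. vimg vsnd f) (vpair a b)"

lemma [dint]: "dfun f ==> dfun g ==> dfun (%e. mx (f e) (g e))"
 unfolding mx_def by (intro dint)

lemma [dint]: "dfun f ==> dfun g ==> dfun h ==> dfun k ==> dpred (%e. gl (f e) (g e) (h e) (k e))"
 unfolding gl_def by (intro dint)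

lemma [dint]: "dfun f ==> dfun g ==> dpred (%e. glt (f e) (g e))"
 by (rule dpred_comp2[where P = glt]) (unfold glt_def, intro dint)

lemma [dint]: "dfun f ==> dfun (%e. vsnd (f e))"
 by (rule dfun_comp1[where K = vsnd]) (unfold vsnd_def, intro dint)

lemma [dint]: "dfun f ==> dfun g ==> dfun (%e. J (f e) (g e))"
 by (rule dfun_comp2[where K = J]) (unfold J_def, intro dint)

lemma vsnd_vpair [simp]: "vsnd (vpair x y) = y"
 unfolding vsnd_def by (rule vthe_eq) auto

lemma Ord_le_trans: "Ord ga ==> al IN bt | al = bt ==> bt IN ga ==> al IN ga"
 using Ord_trans by metis

lemma Ord_mx: "Ord a ==> Ord b ==> Ord (mx a b)" by (simp add: mx_def)

lemma mx_upper:
 assumes "Ord a" "Ord b"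
 shows "a IN (mx a b) | a = mx a b" "b IN (mx a b) | b = mx a b" "mx a b = a | mx a b = b"
 using assms Ord_linear[of a b] by (auto simp: mx_def)

lemma gl_trans:
 assumes "gl a b c d" "gl c d p q" "Ord p" "Ord q" shows "gl a b p q"
 using assms Ord_trans[of p] Ord_trans[of q] Ord_trans[OF Ord_mx[OF assms(3,4)]] unfolding gl_def by metis

lemma gl_total:
 assumes "Ord a" "Ord b" "Ord c" "Ord d" shows "gl a b c d | (a = c & b = d) | gl c d a b"
 using Ord_linear[OF Ord_mx[OF assms(1,2)] Ord_mx[OF assms(3,4)]] Ord_linear[OF assms(1,3)] Ord_linear[OF assms(2,4)]
 unfolding gl_def by metis

lemma gl_bound:
 assumes "gl c d a b" "Ord a" "Ord b" "Ord c" "Ord d"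
 shows "c IN (vsucc (mx a b))" "d IN (vsucc (mx a b))"
proof -
 have m: "mx c d IN (vsucc (mx a b))" using assms(1) unfolding gl_def by auto
 have o: "Ord (vsucc (mx a b))" using assms Ord_mx Ord_vsucc by blast
 show "c IN (vsucc (mx a b))" "d IN (vsucc (mx a b))"
  using Ord_le_trans[OF o mx_upper(1)[OF assms(4,5)] m] Ord_le_trans[OF o mx_upper(2)[OF assms(4,5)] m] by auto
qed

text \<open>A member that is no pair of ordinals has no predecessors at all; otherwise minimise the
  maximum, then the first and then the second coordinate.\<close>

lemma glt_wf:
 assumes "E a ~= {}" shows "EX y:E a. ALL z:E a. ~glt z y"
proof (cases "ALL y:E a. EX c d. Ord c & Ord d & y = vpair c d")
 case True
 obtain y where "y IN a" using assms by blast
 then obtain c d where cd: "Ord c" "Ord d" "vpair c d IN a" using True by metis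
 let ?P = "%m. EX c d. Ord c & Ord d & vpair c d IN a & mx c d = m"
 let ?m = "vleast ?P"
 have d1: "dpred (%e. ?P (e 0))" by (intro dint)
 have m: "?P ?m" "!!bt. bt IN ?m ==> ~?P bt" using vleast[of ?P "mx c d", OF d1] cd Ord_mx by blast+
 let ?Q = "%c. Ord c & (EX d. Ord d & vpair c d IN a & mx c d = ?m)"
 have d2: "dpred (%e. ?Q (e 0))" by (intro dint)
 obtain c1 where "?Q c1" using m(1) by blast
 then have c: "?Q (vleast ?Q)" "!!bt. bt IN (vleast ?Q) ==> ~?Q bt" using vleast[of ?Q c1, OF d2] by blast+
 define c0 where "c0 = vleast ?Q"
 have c0: "?Q c0" "!!bt. bt IN c0 ==> ~?Q bt" using c unfolding c0_def by auto
 let ?S = "%d. Ord d & vpair c0 d IN a & mx c0 d = ?m"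
 have d3: "dpred (%e. ?S (e 0))" by (intro dint)
 obtain d1 where "?S d1" using c0 by blast
 then have d: "?S (vleast ?S)" "!!bt. bt IN (vleast ?S) ==> ~?S bt" using vleast[of ?S d1, OF d3] by blast+
 define d0 where "d0 = vleast ?S"
 have d0: "?S d0" "!!bt. bt IN d0 ==> ~?S bt" using d unfolding d0_def by auto
 show ?thesis
 proof (rule bexI[of _ "vpair c0 d0"], intro ballI notI)
  fix z assume z: "z IN a" "glt z (vpair c0 d0)"
  then obtain p q where pq: "z = vpair p q" "Ord p" "Ord q" "gl p q c0 d0" unfolding glt_def by auto
  then consider "mx p q IN ?m" | "mx p q = ?m" "p IN c0" | "mx p q = ?m" "p = c0" "q IN d0"
   using d0 unfolding gl_def by auto
  then show False
   using m(2)[of "mx p q"] c0(2)[of p] d0(2)[of q] pq z by cases auto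
 qed (use d0 in simp)
next
 case False
 then show ?thesis unfolding glt_def by blast
qed

lemma J_vcol: "E (J a b) = {J c d | c d. Ord c & Ord d & gl c d a b}" if o: "Ord a" "Ord b"
proof -
 let ?G = "%p f. vimg vsnd f"
 have dG: "dfun (%e. ?G (e 0) (e (Suc 0)))" by (intro dint)
 have dR: "dpred (%e. glt (e 0) (e (Suc 0)))" by (intro dint)
 let ?m = "vsucc (mx a b)" let ?t = "vtimes ?m ?m"
 have om: "Ord ?m" by (intro Ord_vsucc Ord_mx o)
 have cl: "rclosed glt ?t" unfolding rclosed_def
 proof (intro ballI allI impI)
  fix x y assume "x IN ?t" "glt y x"
  then obtain p q r s where y: "y = vpair p q" "x = vpair r s" "r IN ?m" "s IN ?m"
   and g: "gl p q r s" and os: "Ord p" "Ord q" "Ord r" "Ord s"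
   unfolding glt_def by auto
  have "mx r s IN ?m" using y mx_upper(3)[OF os(3,4)] by metis
  then have "E (vsucc (mx r s)) <= E ?m" using Ord_sub[OF om] by simp
  then show "y IN ?t" using gl_bound[OF g os(3,4,1,2)] y(1) by auto
 qed
 have x: "vpair a b IN ?t" using mx_upper[OF o] by auto
 have drec: "dfun (%e. rrec glt ?G (e 0))" by (intro dint)
 have e: "J a b = vimg vsnd (vlam (vsep ?t (%y. glt y (vpair a b))) (rrec glt ?G))"
  unfolding J_def using rrec_eq[OF dR dG glt_wf cl x] by simp
 have dp: "dpred (%e. glt (e 0) (vpair a b))" by (intro dint)
 have ds: "dfun (%e. vsnd (e 0))" by (intro dint)
 have s: "E (vsep ?t (%y. glt y (vpair a b))) = {y. glt y (vpair a b)}"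
  unfolding elts_vsep[OF dp] using cl x unfolding rclosed_def by blast
 have "E (J a b) = {rrec glt ?G y | y. glt y (vpair a b)}"
  unfolding e elts_vimg[OF ds] elts_vlam[OF drec] s by force
 also have "... = {J c d | c d. Ord c & Ord d & gl c d a b}"
  unfolding J_def glt_def using o by auto
 finally show ?thesis .
qed

lemma J_Ord: assumes "Ord a" "Ord b" shows "Ord (J a b)"
proof -
 have t: "transitive_set (J a b)" if o: "Ord a" "Ord b" for a b :: 'a
  unfolding transitive_set_def
 proof (intro ballI subsetI)
  fix z w assume "z IN (J a b)" "w IN z"
  then obtain c d where c: "Ord c" "Ord d" "gl c d a b" "w IN (J c d)" unfolding J_vcol[OF o] by blast
  then obtain p q where "Ord p" "Ord q" "gl p q c d" "w = J p q" unfolding J_vcol[OF c(1,2)] by blast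
  note this c
  then show "w IN (J a b)" using gl_trans[of p q c d a b] o unfolding J_vcol[OF o] by blast
 qed
 have "ALL z:E (J a b). transitive_set z" unfolding J_vcol[OF assms] using t by blast
 then show ?thesis unfolding Ord_def[of "J a b"] using t[OF assms] by blast
qed

lemma J_mono: "gl c d a b ==> Ord a ==> Ord b ==> Ord c ==> Ord d ==> J c d IN (J a b)"
 using J_vcol by blast

lemma J_inject: assumes "Ord a" "Ord b" "Ord c" "Ord d" shows "J a b = J c d <-> a = c & b = d"
 using gl_total[OF assms] J_mono assms mem_not_refl by metis

lemma zero_le: "Ord b ==> vempty IN b | b = vempty"
 using Ord_linear[of vempty b] by auto

lemma mx_0 [simp]: "Ord b ==> mx vempty b = b" "mx b vempty = b"
 using zero_le[of b] by (auto simp: mx_def)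

lemma J_ge_right0: "Ord b ==> E b <= E (J vempty b)"
proof -
 have "dpred (%e. E (e 0) <= E (J vempty (e 0)))" by (intro dint)
 then show "Ord b ==> E b <= E (J vempty b)"
 proof (rule Ord_induct)
  fix b :: 'a assume b: "Ord b" "!!c. c IN b ==> E c <= E (J vempty c)"
  show "E b <= E (J vempty b)"
  proof
   fix c assume c: "c IN b"
   have o: "Ord c" using b c Ord_in_Ord by blast
   have "J vempty c IN (J vempty b)" using J_mono[of vempty c vempty b] b o c by (simp add: gl_def)
   moreover have "c IN (J vempty c) | c = J vempty c" using b(2)[OF c] Ord_subset_iff[OF o J_Ord[OF Ord_vempty o]] by blast
   ultimately show "c IN (J vempty b)" using Ord_le_trans[OF J_Ord[OF Ord_vempty b(1)]] by metis
  qed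
 qed
qed

lemma J_ge_left0: "Ord b ==> E b <= E (J b vempty)"
proof -
 have "dpred (%e. E (e 0) <= E (J (e 0) vempty))" by (intro dint)
 then show "Ord b ==> E b <= E (J b vempty)"
 proof (rule Ord_induct)
  fix b :: 'a assume b: "Ord b" "!!c. c IN b ==> E c <= E (J c vempty)"
  show "E b <= E (J b vempty)"
  proof
   fix c assume c: "c IN b"
   have o: "Ord c" using b c Ord_in_Ord by blast
   have "J c vempty IN (J b vempty)" using J_mono[of c vempty b vempty] b o c by (simp add: gl_def)
   moreover have "c IN (J c vempty) | c = J c vempty" using b(2)[OF c] Ord_subset_iff[OF o J_Ord[OF o Ord_vempty]] by blast
   ultimately show "c IN (J b vempty)" using Ord_le_trans[OF J_Ord[OF b(1) Ord_vempty]] by metis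
  qed
 qed
qed

lemma gl_0: assumes "Ord a" "Ord b" shows "a = vempty | gl vempty b a b" "b = vempty | gl a vempty a b"
 using zero_le[OF assms(1)] zero_le[OF assms(2)] mx_upper[OF assms] unfolding gl_def mx_0(1)[OF assms(2)] mx_0(2) by auto

lemma J_ge_right: assumes "Ord a" "Ord b" shows "E b <= E (J a b)"
 using gl_0(1)[OF assms] J_ge_right0[OF assms(2)] J_mono[of vempty b a b] Ord_sub[OF J_Ord[OF assms]] assms by auto

lemma J_ge_left: assumes "Ord a" "Ord b" shows "E a <= E (J a b)"
 using gl_0(2)[OF assms] J_ge_left0[OF assms(1)] J_mono[of a vempty a b] Ord_sub[OF J_Ord[OF assms]] assms by auto

text \<open>Strictness is what permits recursion on codes: with a nonzero operation in the first
  place, a code exceeds the codes of all arguments.\<close>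

lemma J_gt_right: assumes "Ord a" "Ord b" "a ~= vempty" shows "b IN (J a b)"
proof -
 have g: "J vempty b IN (J a b)" using gl_0(1)[OF assms(1,2)] J_mono[of vempty b a b] assms by auto
 have "b IN (J vempty b) | b = J vempty b"
  using J_ge_right0[OF assms(2)] Ord_subset_iff[OF assms(2) J_Ord[OF Ord_vempty assms(2)]] by blast
 then show ?thesis using g Ord_le_trans[OF J_Ord[OF assms(1,2)]] by metis
qed

text \<open>The position of the pair (\<open>i\<close>, 0) is at least \<open>i\<close>, and the
  values below it are all taken at earlier pairs.\<close>

lemma J_surj: assumes "Ord i" shows "EX a b. Ord a & Ord b & J a b = i"
proof -
 have "i IN (J i vempty) | i = J i vempty"
  using J_ge_left0[OF assms] Ord_subset_iff[OF assms J_Ord[OF assms Ord_vempty]] by blast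
 then show ?thesis
 proof
  assume "i IN (J i vempty)"
  then show ?thesis unfolding J_vcol[OF assms Ord_vempty] by blast
 qed (use assms Ord_vempty in metis)
qed

definition K0 :: "'v::zfc => 'v" where "K0 i = vthe (%a. Ord a & (EX b. Ord b & J a b = i))"
definition K1 :: "'v::zfc => 'v" where "K1 i = vthe (%b. Ord b & (EX a. Ord a & J a b = i))"

lemma [dint]: "dfun f ==> dfun (%e. K0 (f e))"
 by (rule dfun_comp1[where K = K0]) (unfold K0_def, intro dint)

lemma [dint]: "dfun f ==> dfun (%e. K1 (f e))"
 by (rule dfun_comp1[where K = K1]) (unfold K1_def, intro dint)

lemma K0_J [simp]: "Ord a ==> Ord b ==> K0 (J a b) = a"
 unfolding K0_def by (rule vthe_eq) (auto simp: J_inject)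

lemma K1_J [simp]: "Ord a ==> Ord b ==> K1 (J a b) = b"
 unfolding K1_def by (rule vthe_eq) (auto simp: J_inject)

lemma J_K [simp]: "Ord i ==> J (K0 i) (K1 i) = i"
 using J_surj[of i] by auto

lemma K_Ord: assumes "Ord i" shows "Ord (K0 i)" "Ord (K1 i)"
 using J_surj[OF assms] by auto

text \<open>The pairs of natural numbers are enumerated in order type \<open>\<omega>\<close>, because each one except
  \<open>(0, 0)\<close> has an immediate predecessor.\<close>

lemma J_pred:
 assumes "Ord a" "Ord b" "Ord c" "Ord d" "gl c d a b" "!!x y. Ord x ==> Ord y ==> gl x y a b ==> ~gl c d x y"
 shows "J a b = vsucc (J c d)"
proof (rule extensionality)
 have "gl x y a b <-> gl x y c d | x = c & y = d" if "Ord x" "Ord y" for x y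
  using assms gl_total[of x y c d] gl_trans[of x y c d a b] that by blast
 then show "E (J a b) = E (vsucc (J c d))" using assms by (auto simp: J_vcol)
qed

text \<open>The immediate predecessors are: (b', b') for (0, b' + 1); (a', b) for (a' + 1, b) with
  a' + 1 < b; (a', a' + 1) for (a' + 1, 0); and (a, b') for (a, b' + 1) with b' + 1 at most
  a.\<close>

lemma nat_pred_ex:
 assumes "a IN omega" "b IN omega" "a ~= vempty | b ~= vempty"
 shows "EX c:E omega. EX d:E omega. gl c d a b & (ALL x y. Ord x --> Ord y --> gl x y a b --> ~gl c d x y)"
proof -
 have o: "Ord a" "Ord b" using assms Ord_nat by blast+
 have succ_mid: "x IN (vsucc n) ==> n ~: E x" for x n :: 'a using mem_not_sym mem_not_refl by auto
 show ?thesis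
 proof (cases "a IN b")
  case ab: True
  show ?thesis
  proof (cases "a = vempty")
   case True
   then obtain b' where b': "b' IN omega" "b = vsucc b'" using omega_cases assms ab by blast
   have "mx b' b' = b'" by (simp add: mx_def)
   moreover have "~gl b' b' x y" if "Ord x" "Ord y" "gl x y a b" for x y
   proof
    assume g: "gl b' b' x y"
    have 1: "mx x y IN b"
     using that(3) True b' mx_upper[OF that(1,2)] unfolding gl_def by (auto simp: mx_def split: if_splits)
    then have "mx x y = b' | mx x y IN b'" using b' by simp
    then show False using g mem_not_refl mem_not_sym mx_upper[OF that(1,2)] unfolding gl_def \<open>mx b' b' = b'\<close>
     by metis
   qed
   moreover have "gl b' b' a b" using b' True o by (simp add: gl_def \<open>mx b' b' = b'\<close>)
   ultimately show ?thesis using b' by blast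
  next
   case False
   then obtain a' where a': "a' IN omega" "a = vsucc a'" using omega_cases assms by blast
   have a'b: "a' IN b" using ab a' Ord_trans[OF o(2)] by auto
   have "~gl a' b x y" if xy: "Ord x" "Ord y" "gl x y a b" for x y
   proof
    assume g: "gl a' b x y"
    have "mx a' b = b" "mx a b = b" using a'b ab by (simp_all add: mx_def)
    then have m: "mx x y = b" and 2: "x IN a | x = a & y IN b" and 3: "a' IN x | a' = x & b IN y"
     using g xy(3) mem_not_sym mem_not_refl unfolding gl_def by metis+
    have "x IN a" using 2 m ab mx_upper(3)[OF xy(1,2)] mem_not_refl by metis
    then have "x = a'" using 3 a' mem_not_sym by auto
    then have "b IN y" using 3 mem_not_refl by blast
    then show False using mx_upper(2)[OF xy(1,2)] m mem_not_sym mem_not_refl by metis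
   qed
   moreover have "gl a' b a b" using a' a'b ab by (simp add: gl_def mx_def)
   ultimately show ?thesis using a' assms by blast
  qed
 next
  case ab: False
  then have m: "mx a b = a" by (simp add: mx_def)
  have an: "a ~= vempty" using ab assms zero_le[OF o(2)] by auto
  show ?thesis
  proof (cases "b = vempty")
   case True
   obtain a' where a': "a' IN omega" "a = vsucc a'" using omega_cases assms an by blast
   have m': "mx a' a = a" using a' by (simp add: mx_def)
   have "~gl a' a x y" if xy: "Ord x" "Ord y" "gl x y a b" for x y
   proof
    assume g: "gl a' a x y"
    have m2: "mx x y = a" and 2: "x IN a | x = a & y IN b" and 3: "a' IN x | a' = x & a IN y"
     using g xy(3) mem_not_sym mem_not_refl m m' unfolding gl_def by metis+
    have "x IN a" using 2 True by simp
    then have "a IN y" using 3 a' mem_not_sym by auto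
    then show False using mx_upper(2)[OF xy(1,2)] m2 mem_not_sym mem_not_refl by metis
   qed
   moreover have "gl a' a a b" using a' m m' by (simp add: gl_def)
   ultimately show ?thesis using a' assms by blast
  next
   case False
   then obtain b' where b': "b' IN omega" "b = vsucc b'" using omega_cases assms by blast
   have "a ~: E b'" using ab b' by simp
   then have m': "mx a b' = a" using b' by (simp add: mx_def)
   have "~gl a b' x y" if xy: "Ord x" "Ord y" "gl x y a b" for x y
   proof
    assume g: "gl a b' x y"
    have 2: "x IN a | x = a & y IN b" and 3: "a IN x | a = x & b' IN y"
     using g xy(3) mem_not_sym mem_not_refl m m' unfolding gl_def by metis+
    then show False using b' mem_not_sym mem_not_refl by auto
   qed
   moreover have "gl a b' a b" using b' m m' by (simp add: gl_def)
   ultimately show ?thesis using b' assms by blast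
  qed
 qed
qed

lemma J_nat: assumes "a IN omega" "b IN omega" shows "J a b IN omega"
proof -
 have "dpred (%e. ALL a:E omega. ALL b:E omega. J a b = e 0 --> e 0 IN omega)" by (intro dint)
 then have "ALL a':E omega. ALL b':E omega. J a' b' = J a b --> J a b IN omega"
 proof (rule Ord_induct)
  show "Ord (J a b)" using assms Ord_nat J_Ord by blast
  fix i :: 'a assume IH: "!!j. j IN i ==> ALL a:E omega. ALL b:E omega. J a b = j --> j IN omega"
  show "ALL a:E omega. ALL b:E omega. J a b = i --> i IN omega"
  proof (intro ballI impI)
   fix a b assume ab: "a IN omega" "b IN omega" "J a b = i"
   show "i IN omega"
   proof (cases "a = vempty & b = vempty")
    case True
    have "~gl c d vempty vempty" for c d :: 'a by (simp add: gl_def)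
    then have "E (J vempty vempty) = ({}::'a set)" unfolding J_vcol[OF Ord_vempty Ord_vempty] by simp
    then have "i = vempty" using True ab vempty_iff by metis
    then show ?thesis by simp
   next
    case False
    then obtain c d where cd: "c IN omega" "d IN omega" "gl c d a b"
     "ALL x y. Ord x --> Ord y --> gl x y a b --> ~gl c d x y" using nat_pred_ex[OF ab(1,2)] by blast
    then have "i = vsucc (J c d)" using J_pred[of a b c d] ab Ord_nat by metis
    then have "J c d IN i" by simp
    then have "J c d IN omega" using IH cd by blast
    then show ?thesis using \<open>i = vsucc (J c d)\<close> by simp
   qed
  qed
 qed
 then show ?thesis using assms by blast
qed

section \<open>The constructible hierarchy\<close>

lemma elts_snoc [simp]: "E (snoc n s x) = insert (vpair n x) (E s)"
proof -
 have "E (vun s (upair (vpair n x) (vpair n x))) = insert (vpair n x) (E s)" by auto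
 then show ?thesis unfolding snoc_def by (rule elts_set_of)
qed

lemma snoc_vun: "snoc n s x = vun s (upair (vpair n x) (vpair n x))"
 by (rule ext) auto

lemma [dint]: "dfun f ==> dfun g ==> dfun h ==> dfun (%e. snoc (f e) (g e) (h e))"
 unfolding snoc_vun by (intro dint)

lemma is_fun_snoc: "is_fun s n A ==> x IN A ==> is_fun (snoc n s x) (vsucc n) A"
 using mem_not_refl[of n] unfolding is_fun_def by auto

lemma ap_snoc_last: "is_fun s n A ==> x IN A ==> ap (snoc n s x) n = x"
 using ap_eq[OF is_fun_snoc, of s n A x n x] by simp

lemma ap_snoc: "is_fun s n A ==> x IN A ==> k IN n ==> ap (snoc n s x) k = ap s k"
 using ap_eq[OF is_fun_snoc, of s n A x k "ap s k"] vpair_ap[of s n A k] by simp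

lemma is_fun_empty: "is_fun s vempty A <-> s = vempty"
 unfolding is_fun_def by (auto simp: vempty_iff)

lemma is_fun_restrict: "is_fun f A B ==> E A' <= E A ==> is_fun (vlam A' (ap f)) A' B"
 by (rule is_fun_vlam) (auto intro: dint ap_type)

lemma snoc_restrict: assumes "is_fun s (vsucc n) A" shows "s = snoc n (vlam n (ap s)) (ap s n)"
proof (rule fun_ext[OF assms])
 have r: "is_fun (vlam n (ap s)) n A" by (rule is_fun_restrict[OF assms]) auto
 have x: "ap s n IN A" using ap_type[OF assms] by simp
 show "is_fun (snoc n (vlam n (ap s)) (ap s n)) (vsucc n) A" by (rule is_fun_snoc[OF r x])
 fix k assume "k IN (vsucc n)"
 then show "ap s k = ap (snoc n (vlam n (ap s)) (ap s n)) k"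
  using ap_snoc_last[OF r x] ap_snoc[OF r x, of k] ap_vlam[OF dfun_ap1, of k n s] by auto
qed

section \<open>Finitary relations definable over a set\<close>

definition dm :: "'v::zfc => 'v => 'v => 'v => 'v" where
 "dm A n i j = vsep (funs n A) (%s. ap s i IN (ap s j))"
definition de :: "'v::zfc => 'v => 'v => 'v => 'v" where
 "de A n i j = vsep (funs n A) (%s. ap s i = ap s j)"
text \<open>Complement is the case \<open>R = S\<close>, and intersection results from iteration, so
  that codes of formulas need a single Boolean constructor.\<close>

definition nand :: "'v::zfc => 'v => 'v => 'v => 'v" where
 "nand A n R S = vsep (funs n A) (%s. ~(s IN R & s IN S))"
definition pj :: "'v::zfc => 'v => 'v => 'v" where
 "pj A n R = vsep (funs n A) (%s. EX x:E A. snoc n s x IN R)"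
definition sec :: "'v::zfc => 'v => 'v => 'v => 'v" where
 "sec A n s R = vsep A (%x. snoc n s x IN R)"
definition itr :: "'v::zfc => 'v => 'v" where
 "itr R S = vsep R (%s. s IN S)"

lemma [dint]:
 assumes "dfun f" "dfun g" "dfun h" "dfun k"
 shows "dfun (%e. dm (f e) (g e) (h e) (k e))" "dfun (%e. de (f e) (g e) (h e) (k e))"
  "dfun (%e. nand (f e) (g e) (h e) (k e))" "dfun (%e. sec (f e) (g e) (h e) (k e))"
 by (rule dfun_comp4[where K = dm], unfold dm_def, intro dint, fact+,
  rule dfun_comp4[where K = de], unfold de_def, intro dint, fact+,
  rule dfun_comp4[where K = nand], unfold nand_def, intro dint, fact+,
  rule dfun_comp4[where K = sec], unfold sec_def, intro dint, fact+)

lemma [dint]: "dfun f ==> dfun g ==> dfun h ==> dfun (%e. pj (f e) (g e) (h e))"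
 by (rule dfun_comp3[where K = pj]) (unfold pj_def, intro dint)

lemma [dint]: "dfun f ==> dfun g ==> dfun (%e. itr (f e) (g e))"
 by (rule dfun_comp2[where K = itr]) (unfold itr_def, intro dint)

lemma mem_dm: "s IN (dm A n i j) <-> is_fun s n A & ap s i IN (ap s j)"
proof -
 have "dpred (%e. ap (e 0) i IN (ap (e 0) j))" by (intro dint)
 then show ?thesis unfolding dm_def by (simp add: elts_vsep)
qed

lemma mem_de: "s IN (de A n i j) <-> is_fun s n A & ap s i = ap s j"
proof -
 have "dpred (%e. ap (e 0) i = ap (e 0) j)" by (intro dint)
 then show ?thesis unfolding de_def by (simp add: elts_vsep)
qed

lemma mem_nand: "s IN (nand A n R S) <-> is_fun s n A & ~(s IN R & s IN S)"
proof -
 have "dpred (%e. ~(e 0 IN R & e 0 IN S))" by (intro dint)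
 from elts_vsep[OF this, of "funs n A"] show ?thesis unfolding nand_def by simp
qed

lemma mem_pj: "s IN (pj A n R) <-> is_fun s n A & (EX x:E A. snoc n s x IN R)"
proof -
 have "dpred (%e. EX x:E A. snoc n (e 0) x IN R)" by (intro dint)
 from elts_vsep[OF this, of "funs n A"] show ?thesis unfolding pj_def by simp
qed

lemma mem_sec: "x IN (sec A n s R) <-> x IN A & snoc n s x IN R"
proof -
 have "dpred (%e. snoc n s (e 0) IN R)" by (intro dint)
 then show ?thesis unfolding sec_def by (simp add: elts_vsep)
qed

lemma mem_itr: "x IN (itr R S) <-> x IN R & x IN S"
proof -
 have "dpred (%e. e 0 IN S)" by (intro dint)
 then show ?thesis unfolding itr_def by (simp add: elts_vsep)
qed

lemma set_of_ops:
 "i IN n ==> j IN n ==> set_of {s : E (funs n A). app s i IN (app s j)} = dm A n i j"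
 "i IN n ==> j IN n ==> set_of {s : E (funs n A). app s i = app s j} = de A n i j"
 "set_of (E (funs n A) - E R) = nand A n R R"
 "set_of (E R Int E S) = itr R S"
 "set_of {s : E (funs n A). EX x:E A. snoc n s x IN R} = pj A n R"
 by (rule set_of_eq, auto simp: mem_dm mem_de mem_nand mem_itr mem_pj app_ap[of _ n A])+

lemma definability_closed_iff: "definability_closed A D <->
  (ALL n:E omega. ALL i:E n. ALL j:E n. vpair n (dm A n i j) IN D & vpair n (de A n i j) IN D) &
  (ALL n:E omega. ALL R. vpair n R IN D --> vpair n (nand A n R R) IN D) &
  (ALL n:E omega. ALL R S. vpair n R IN D & vpair n S IN D --> vpair n (itr R S) IN D) &
  (ALL n:E omega. ALL R. vpair (vsucc n) R IN D --> vpair n (pj A n R) IN D)"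
 unfolding definability_closed_def by (simp add: set_of_ops del: mem_funs cong: ball_cong)

lemma [dint]: "dfun f ==> dfun g ==> dfun h ==> dpred (%e. definable_rel (f e) (g e) (h e))"
 by (rule dpred_comp3[where P = definable_rel]) (unfold definable_rel_def definability_closed_iff, intro dint)

definition allrel :: "'v::zfc => 'v" where
 "allrel A = vUN omega (%n. vimg (vpair n) (vpow (funs n A)))"

lemma mem_allrel: "z IN (allrel A) <-> (EX n:E omega. EX R. E R <= E (funs n A) & z = vpair n R)"
proof -
 have d: "dfun (%e. vimg (vpair (e 0)) (vpow (funs (e 0) A)))" by (intro dint)
 have e: "E (vimg (vpair n) B) = vpair n ` E B" for n B :: 'a by (rule elts_vimg) (intro dint)
 show ?thesis unfolding allrel_def elts_vUN[OF d] e by auto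
qed

lemma definable_rel_intros:
 "n IN omega ==> i IN n ==> j IN n ==> definable_rel A n (dm A n i j)"
 "n IN omega ==> i IN n ==> j IN n ==> definable_rel A n (de A n i j)"
 "n IN omega ==> definable_rel A n R ==> definable_rel A n (nand A n R R)"
 "n IN omega ==> definable_rel A n R ==> definable_rel A n S ==> definable_rel A n (itr R S)"
 "n IN omega ==> definable_rel A (vsucc n) R ==> definable_rel A n (pj A n R)"
 by (auto simp: definable_rel_def definability_closed_iff)

text \<open>The pairs satisfying \<open>P\<close> can be separated from the set
  \<open>allrel A\<close> of all candidates, and the result is closed under the generating
  operations; hence it contains every definable relation.\<close>

lemma definable_rel_induct:
 assumes "definable_rel A n R" "dpred (%e. P (e 0) (e (Suc 0)))"
  "!!n i j. n IN omega ==> i IN n ==> j IN n ==> P n (dm A n i j)"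
  "!!n i j. n IN omega ==> i IN n ==> j IN n ==> P n (de A n i j)"
  "!!n R. n IN omega ==> E R <= E (funs n A) ==> P n R ==> P n (nand A n R R)"
  "!!n R S. n IN omega ==> E R <= E (funs n A) ==> E S <= E (funs n A) ==> P n R ==> P n S ==> P n (itr R S)"
  "!!n R. n IN omega ==> E R <= E (funs (vsucc n) A) ==> P (vsucc n) R ==> P n (pj A n R)"
 shows "n IN omega & E R <= E (funs n A) & P n R"
proof -
 have dP: "!!f g. dfun f ==> dfun g ==> dpred (%e. P (f e) (g e))" by (rule dpred_comp2[where P = P, OF assms(2)])
 define D where "D = vsep (allrel A) (%z. EX n R. z = vpair n R & P n R)"
 have "dpred (%e. EX n R. e 0 = vpair n R & P n R)" by (intro dint dP)
 then have D: "vpair n R IN D <-> n IN omega & E R <= E (funs n A) & P n R" for n R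
  unfolding D_def by (auto simp: elts_vsep mem_allrel)
 have "definability_closed A D"
  unfolding definability_closed_iff D
  using assms(3-7) by (auto simp: mem_dm mem_de mem_nand mem_itr mem_pj)
 then have "vpair n R IN D" using assms(1) unfolding definable_rel_def by blast
 then show ?thesis unfolding D .
qed

lemma definable_rel_sub: assumes "definable_rel A n R" shows "n IN omega" "E R <= E (funs n A)"
proof -
 have "dpred (%e. True)" by (intro dint)
 from definable_rel_induct[OF assms, where P = "%_ _. True", OF this]
 show "n IN omega" "E R <= E (funs n A)" by blast+
qed

lemma definable_rel_nand:
 assumes "definable_rel A n R" "definable_rel A n S" shows "definable_rel A n (nand A n R S)"
proof -
 have "nand A n R S = nand A n (itr R S) (itr R S)" by (rule ext) (auto simp: mem_nand mem_itr)
 then show ?thesis using definable_rel_intros(3)[OF _ definable_rel_intros(4)] assms definable_rel_sub by metis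
qed

lemma Def_eq: "Def A = vsep (vpow A) (%X. EX n:E omega. EX s:E (funs n A). EX R. definable_rel A (vsucc n) R & X = sec A n s R)"
 and mem_Def: "X IN (Def A) <-> (EX n:E omega. EX s. is_fun s n A & (EX R. definable_rel A (vsucc n) R & X = sec A n s R))"
proof -
 let ?P = "%X. EX n:E omega. EX s:E (funs n A). EX R. definable_rel A (vsucc n) R & X = sec A n s R"
 have d: "dpred (%e. ?P (e 0))" by (intro dint)
 have sub: "E (sec A n s R) <= E A" for n s R by (auto simp: mem_sec)
 have e: "E (vsep (vpow A) ?P) = {X. ?P X}" unfolding elts_vsep[OF d] using sub by auto
 have "E X = {x : E A. snoc n s x IN R} <-> X = sec A n s R" for X n s R
  using extensionality[of X "sec A n s R"] mem_sec[of _ A n s R] by auto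
 then have "Def A = set_of {X. ?P X}" unfolding Def_def by simp
 then show "Def A = vsep (vpow A) ?P" using set_of_eq[OF e] by simp
 then show "X IN (Def A) <-> (EX n:E omega. EX s. is_fun s n A & (EX R. definable_rel A (vsucc n) R & X = sec A n s R))"
  using e by (simp add: Bex_def)
qed

lemma [dint]: "dfun f ==> dfun (%e. Def (f e))"
 by (rule dfun_comp1[where K = Def]) (unfold Def_eq, intro dint)

lemma Def_sub: "X IN (Def A) ==> E X <= E A"
 unfolding mem_Def by (auto simp: mem_sec)

text \<open>The formula "variable 1 is a member of variable 0", with \<open>x\<close> itself as the
  parameter in variable 0, defines \<open>x\<close>, and transitivity keeps the members of
  \<open>x\<close> inside \<open>A\<close>.\<close>

lemma Def_contains: assumes "transitive_set A" "x IN A" shows "x IN (Def A)"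
proof -
 let ?n = "vsucc (vempty::'a)"
 have n: "?n IN omega" by simp
 have s: "is_fun (snoc vempty vempty x) ?n A" by (rule is_fun_snoc) (simp_all add: is_fun_empty assms)
 have "definable_rel A (vsucc ?n) (dm A (vsucc ?n) ?n vempty)"
  by (rule definable_rel_intros(1)) auto
 moreover have "x = sec A ?n (snoc vempty vempty x) (dm A (vsucc ?n) ?n vempty)"
 proof (rule ext)
  fix y
  have *: "ap (snoc ?n (snoc vempty vempty x) y) ?n = y" "ap (snoc ?n (snoc vempty vempty x) y) vempty = x"
   "is_fun (snoc ?n (snoc vempty vempty x) y) (vsucc ?n) A" if "y IN A"
   using ap_snoc_last[OF s that] ap_snoc[OF s that, of vempty] is_fun_snoc[OF s that]
    ap_snoc_last[of vempty vempty A x] assms by (simp_all add: is_fun_empty)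
  show "y IN x <-> y IN (sec A ?n (snoc vempty vempty x) (dm A (vsucc ?n) ?n vempty))"
  proof (cases "y IN A")
   case True
   show ?thesis unfolding mem_sec mem_dm *[OF True] using *(3)[OF True] True by blast
  next
   case False
   then show ?thesis using assms unfolding mem_sec transitive_set_def by blast
  qed
 qed
 ultimately show ?thesis unfolding mem_Def using n s by blast
qed

text \<open>One uniform clause in place of the cases zero, successor and limit. It agrees with them
  because every stage is transitive and hence contained in its own \<open>Def\<close>.\<close>

definition Lf :: "'v::zfc => 'v" where
 "Lf ga = erec (%ga f. vUN ga (%bt. Def (ap f bt))) ga"

lemma [dint]: "dfun f ==> dfun (%e. Lf (f e))"
 by (rule dfun_comp1[where K = Lf]) (unfold Lf_def, intro dint)

lemma elts_Lf: "E (Lf ga) = (UN bt:E ga. E (Def (Lf bt)))"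
proof -
 let ?G = "%ga f. vUN ga (%bt. Def (ap f bt))"
 have "dfun (%e. ?G (e 0) (e (Suc 0)))" by (intro dint)
 from erec_eq[OF this, of ga] have e: "Lf ga = ?G ga (vlam ga Lf)" unfolding Lf_def .
 have d: "dfun (%e. Def (ap (vlam ga Lf) (e 0)))" by (intro dint)
 have a: "ap (vlam ga Lf) x = Lf x" if "x IN ga" for x by (rule ap_vlam[OF _ that]) (intro dint)
 show ?thesis unfolding e elts_vUN[OF d] by (simp add: a)
qed

lemma transitive_Def: "transitive_set A ==> transitive_set (Def A)"
 unfolding transitive_set_def[of "Def A"] using Def_sub Def_contains by blast

lemma transitive_Lf: "transitive_set (Lf ga)"
proof -
 have "dpred (%e. transitive_set (Lf (e 0)))" by (intro dint)
 then show ?thesis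
 proof (rule set_induct)
  fix ga :: 'a assume "!!bt. bt IN ga ==> transitive_set (Lf bt)"
  then have "!!bt. bt IN ga ==> transitive_set (Def (Lf bt))" using transitive_Def by blast
  then show "transitive_set (Lf ga)" unfolding transitive_set_def[of "Lf ga"] elts_Lf unfolding transitive_set_def by blast
 qed
qed

lemma Lf_sub_Def: "E (Lf ga) <= E (Def (Lf ga))"
 using Def_contains[OF transitive_Lf] by blast

lemma L_sequence_Lf:
 assumes "L_sequence al f" "Ord al" "bt IN (vsucc al)" shows "app f bt = Lf bt"
proof -
 obtain B where fB: "is_fun f (vsucc al) B" using assms(1) unfolding L_sequence_def by blast
 note app = app_ap[OF fB]
 have o: "Ord (vsucc al)" using assms Ord_vsucc by blast
 have f0: "ap f vempty = vempty"
  using assms(1) zero_le[OF o] app[of vempty] unfolding L_sequence_def by auto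
 have fs: "ap f (vsucc bt) = Def (ap f bt)" if "bt IN al" for bt
 proof -
  have "vsucc bt IN (vsucc al)"
   using that assms(2) Ord_linear[of "vsucc bt" al] Ord_vsucc[of bt] Ord_in_Ord[of al bt] mem_not_sym mem_not_refl by auto
  then show ?thesis using assms(1) that app[of bt] app[of "vsucc bt"] unfolding L_sequence_def by auto
 qed
 have fl: "E (ap f ga) = (UN bt:E ga. E (ap f bt))" if g: "ga IN (vsucc al)" "is_limit ga" for ga
 proof -
  have "!!bt. bt IN ga ==> app f bt = ap f bt" using app Ord_trans[OF o g(1)] by blast
  then have "(UN bt:E ga. E (app f bt)) = (UN bt:E ga. E (ap f bt))" by simp
  moreover have "app f ga = set_of (UN bt:E ga. E (app f bt))"
   using assms(1) g unfolding L_sequence_def by blast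
  ultimately have e: "ap f ga = set_of (UN bt:E ga. E (ap f bt))" using app[OF g(1)] by simp
  have "dfun (%e. ap f (e 0))" by (intro dint)
  from elts_set_of[OF elts_vUN[OF this]] show ?thesis unfolding e by blast
 qed
 have "dpred (%e. e 0 IN (vsucc al) --> ap f (e 0) = Lf (e 0))" by (intro dint)
 then have "bt IN (vsucc al) --> ap f bt = Lf bt"
 proof (rule Ord_induct)
  show "Ord bt" using Ord_in_Ord[OF o assms(3)] .
  fix bt assume bt: "Ord bt" and IH: "!!ga. ga IN bt ==> ga IN (vsucc al) --> ap f ga = Lf ga"
  show "bt IN (vsucc al) --> ap f bt = Lf bt"
  proof
   assume b: "bt IN (vsucc al)"
   have IH': "ap f ga = Lf ga" if "ga IN bt" for ga using IH that Ord_trans[OF o b] by blast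
   consider "bt = vempty" | ga where "Ord ga" "bt = vsucc ga" | "is_limit bt"
    using bt unfolding is_limit_def is_succ_def by blast
   then show "ap f bt = Lf bt"
   proof cases
    case 1
    have "Lf vempty = (vempty::'a)" unfolding vempty_iff elts_Lf by simp
    then show ?thesis using f0 1 by simp
   next
    case 2
    have "ga IN al" using b 2 Ord_trans[OF assms(2), of _ ga] by (auto dest: arg_cong[of _ _ E])
    then have "ap f bt = Def (Lf ga)" using fs[of ga] IH'[of ga] 2 by simp
    moreover have "E (Lf (vsucc ga)) = E (Def (Lf ga)) Un E (Lf ga)"
     unfolding elts_Lf[of "vsucc ga"] elts_Lf[of ga] by simp
    then have "E (Lf bt) = E (Def (Lf ga))" using Lf_sub_Def[of ga] 2 by blast
    ultimately show ?thesis using extensionality by metis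
   next
    case 3
    have s: "vsucc ga IN bt" if "ga IN bt" for ga
    proof -
     have "Ord ga" using bt that Ord_in_Ord by blast
     then have "vsucc ga ~= bt" "Ord (vsucc ga)" using 3 Ord_vsucc unfolding is_limit_def is_succ_def by blast+
     then show ?thesis using Ord_linear[OF _ bt, of "vsucc ga"] that mem_not_sym mem_not_refl by auto
    qed
    have "E (Lf ga) <= E (Lf bt)" if "ga IN bt" for ga
     using Lf_sub_Def[of ga] that unfolding elts_Lf[of bt] by blast
    moreover have "E (Def (Lf ga)) <= E (Lf (vsucc ga))" for ga unfolding elts_Lf[of "vsucc ga"] by simp
    ultimately have "E (Lf bt) = (UN ga:E bt. E (Lf ga))"
    proof (intro equalityI subsetI)
     fix x assume "x IN (Lf bt)"
     then obtain ga where "ga IN bt" "x IN (Def (Lf ga))" unfolding elts_Lf[of bt] by blast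
     then have "vsucc ga IN bt" "x IN (Lf (vsucc ga))" using s unfolding elts_Lf[of "vsucc ga"] by auto
     then show "x : (UN ga:E bt. E (Lf ga))" by blast
    qed blast
    then have "E (ap f bt) = E (Lf bt)" using fl[OF b 3] IH' by simp
    then show ?thesis by (rule extensionality)
   qed
  qed
 qed
 then have "ap f bt = Lf bt" using assms(3) by blast
 then show ?thesis using app[OF assms(3)] by simp
qed

lemma constructible_Lf: "constructible x ==> EX al. Ord al & x IN (Lf al)"
 unfolding constructible_def using L_sequence_Lf by (metis elts_vsucc insertI1)

subsection \<open>An enumeration by the ordinals\<close>

abbreviation "k1 == vsucc vempty"
abbreviation "k2 == vsucc k1"
abbreviation "k3 == vsucc k2"
abbreviation "k4 == vsucc k3"
abbreviation "k5 == vsucc k4"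
abbreviation "k6 == vsucc k5"
abbreviation "k7 == vsucc k6"
abbreviation "k8 == vsucc k7"

text \<open>Codes for the terms that build up the constructible universe: \<open>k\<close> is the operation and
  \<open>a, b, c, d\<close> are the codes of its arguments, except that for \<open>k \<in> {0, 1}\<close> the ordinal \<open>a\<close> is itself the argument.\<close>

definition Fop :: "'v::zfc => 'v => 'v => 'v => 'v => 'v => 'v" where
 "Fop k a A B C D =
  (if k = vempty then a else if k = k1 then Lf a else if k = k2 then snoc A B C
  else if k = k3 & B IN omega & C IN B & D IN B then dm A B C D
  else if k = k4 & B IN omega & C IN B & D IN B then de A B C D
  else if k = k5 & B IN omega then nand A B C D
  else if k = k6 & B IN omega then pj A B C
  else if k = k7 then sec A B C D else if k = k8 then upair A B else vempty)"

definition code5 :: "'v::zfc => 'v => 'v => 'v => 'v => 'v" where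
 "code5 k a b c d = J k (J (J a b) (J c d))"

text \<open>Recursion over codes. For the operation 0 the code need not exceed its arguments, but
  there the value is the ordinal \<open>a\<close> and no earlier value is consulted.\<close>

definition F :: "'v::zfc => 'v" where
 "F i = erec (%i f. Fop (K0 i) (K0 (K0 (K1 i))) (ap f (K0 (K0 (K1 i)))) (ap f (K1 (K0 (K1 i))))
           (ap f (K0 (K1 (K1 i)))) (ap f (K1 (K1 (K1 i))))) i"

lemma [dint]: "dfun f ==> dfun (%e. F (f e))"
 by (rule dfun_comp1[where K = F]) (unfold F_def Fop_def, intro dint)

lemma [dint]: "dfun f ==> dfun g ==> dfun h ==> dfun k ==> dfun l ==> dfun (%e. code5 (f e) (g e) (h e) (k e) (l e))"
 unfolding code5_def by (intro dint)

lemma Ord_code5: "Ord k ==> Ord a ==> Ord b ==> Ord c ==> Ord d ==> Ord (code5 k a b c d)"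
 unfolding code5_def by (intro J_Ord)

lemma code5_lt:
 assumes "Ord k" "Ord a" "Ord b" "Ord c" "Ord d" "k ~= vempty" "x = a | x = b | x = c | x = d"
 shows "x IN (code5 k a b c d)"
proof -
 let ?r = "J (J a b) (J c d)"
 have o: "Ord (J a b)" "Ord (J c d)" "Ord ?r" using assms J_Ord by blast+
 have x: "Ord x" using assms by blast
 have "E x <= E (J a b) | E x <= E (J c d)"
  using assms J_ge_left[of a b] J_ge_right[of a b] J_ge_left[of c d] J_ge_right[of c d] by blast
 then have "E x <= E ?r" using J_ge_left[OF o(1,2)] J_ge_right[OF o(1,2)] by blast
 then have "x IN ?r | x = ?r" using Ord_subset_iff[OF x o(3)] by blast
 moreover have "?r IN (code5 k a b c d)" unfolding code5_def by (rule J_gt_right[OF assms(1) o(3) assms(6)])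
 ultimately show ?thesis using Ord_le_trans[OF Ord_code5] assms by metis
qed

lemma code5_sel:
 assumes "Ord k" "Ord a" "Ord b" "Ord c" "Ord d"
 shows "K0 (code5 k a b c d) = k" "K0 (K0 (K1 (code5 k a b c d))) = a" "K1 (K0 (K1 (code5 k a b c d))) = b"
  "K0 (K1 (K1 (code5 k a b c d))) = c" "K1 (K1 (K1 (code5 k a b c d))) = d"
 unfolding code5_def using assms by (simp_all add: J_Ord)

lemma code5_ex: assumes "Ord i" obtains k a b c d where "Ord k" "Ord a" "Ord b" "Ord c" "Ord d" "i = code5 k a b c d"
proof -
 have "i = code5 (K0 i) (K0 (K0 (K1 i))) (K1 (K0 (K1 i))) (K0 (K1 (K1 i))) (K1 (K1 (K1 i)))"
  unfolding code5_def using assms K_Ord by (simp add: K_Ord)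
 then show ?thesis using that K_Ord assms by metis
qed

lemma F_code5:
 assumes o: "Ord k" "Ord a" "Ord b" "Ord c" "Ord d"
 shows "F (code5 k a b c d) = Fop k a (F a) (F b) (F c) (F d)"
proof -
 let ?G = "%i f. Fop (K0 i) (K0 (K0 (K1 i))) (ap f (K0 (K0 (K1 i)))) (ap f (K1 (K0 (K1 i))))
           (ap f (K0 (K1 (K1 i)))) (ap f (K1 (K1 (K1 i))))"
 let ?i = "code5 k a b c d"
 have "dfun (%e. ?G (e 0) (e (Suc 0)))" unfolding Fop_def by (intro dint)
 from erec_eq[OF this, of ?i] have e: "F ?i = ?G ?i (vlam ?i F)" unfolding F_def .
 have dF: "dfun (%e. F (e 0))" by (intro dint)
 show ?thesis
 proof (cases "k = vempty")
  case True
  then show ?thesis unfolding e code5_sel[OF o] by (simp add: Fop_def)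
 next
  case False
  then show ?thesis unfolding e code5_sel[OF o] using ap_vlam[OF dF code5_lt[OF o False]] by simp
 qed
qed

lemma Ord_ks [simp]: "Ord k1" "Ord k2" "Ord k3" "Ord k4" "Ord k5" "Ord k6" "Ord k7" "Ord k8"
 by (simp_all add: Ord_vsucc)

lemma F_kinds:
 assumes o: "Ord a" "Ord b" "Ord c" "Ord d"
 shows "F (code5 vempty a b c d) = a" "F (code5 k1 a b c d) = Lf a" "F (code5 k2 a b c d) = snoc (F a) (F b) (F c)"
  "F b IN omega ==> F c IN (F b) ==> F d IN (F b) ==> F (code5 k3 a b c d) = dm (F a) (F b) (F c) (F d)"
  "F b IN omega ==> F c IN (F b) ==> F d IN (F b) ==> F (code5 k4 a b c d) = de (F a) (F b) (F c) (F d)"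
  "F b IN omega ==> F (code5 k5 a b c d) = nand (F a) (F b) (F c) (F d)"
  "F b IN omega ==> F (code5 k6 a b c d) = pj (F a) (F b) (F c)"
  "F (code5 k7 a b c d) = sec (F a) (F b) (F c) (F d)" "F (code5 k8 a b c d) = upair (F a) (F b)"
 by (simp_all add: F_code5 o) (simp_all add: Fop_def)

definition inF :: "'v::zfc => bool" where "inF x <-> (EX i. Ord i & F i = x)"

lemma [dint]: "dfun f ==> dpred (%e. inF (f e))"
 by (rule dpred_comp1[where P = inF]) (unfold inF_def, intro dint)

lemma inF_Ord: "Ord a ==> inF a"
 unfolding inF_def using F_kinds(1)[of a vempty vempty vempty] Ord_code5[of vempty a vempty vempty vempty] by auto

lemma inF_Lf: "Ord a ==> inF (Lf a)"
 unfolding inF_def using F_kinds(2)[of a vempty vempty vempty] Ord_code5[of k1 a vempty vempty vempty] by auto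

lemma inF_ops:
 assumes "inF A" "inF B" "inF C" "inF D"
 shows "inF (snoc A B C)" "inF (sec A B C D)" "inF (upair A B)"
 "B IN omega ==> C IN B ==> D IN B ==> inF (dm A B C D)"
 "B IN omega ==> C IN B ==> D IN B ==> inF (de A B C D)"
 "B IN omega ==> inF (nand A B C D)" "B IN omega ==> inF (pj A B C)"
proof -
 obtain a where a: "Ord a" "F a = A" using assms(1) unfolding inF_def by blast
 obtain b where b: "Ord b" "F b = B" using assms(2) unfolding inF_def by blast
 obtain c where c: "Ord c" "F c = C" using assms(3) unfolding inF_def by blast
 obtain d where d: "Ord d" "F d = D" using assms(4) unfolding inF_def by blast
 note o = a(1) b(1) c(1) d(1) a(2) b(2) c(2) d(2)
 note F = F_kinds[OF o(1-4), unfolded o(5-8)]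
 have *: "Ord k ==> F (code5 k a b c d) = x ==> inF x" for k x
  unfolding inF_def using Ord_code5[of k a b c d] o(1-4) by (intro exI[of _ "code5 k a b c d"]) simp
 show "inF (snoc A B C)" "inF (sec A B C D)" "inF (upair A B)"
  by (rule *[OF Ord_ks(2) F(3)], rule *[OF Ord_ks(7) F(8)], rule *[OF Ord_ks(8) F(9)])
 show "B IN omega ==> C IN B ==> D IN B ==> inF (dm A B C D)"
 "B IN omega ==> C IN B ==> D IN B ==> inF (de A B C D)"
 "B IN omega ==> inF (nand A B C D)" "B IN omega ==> inF (pj A B C)"
  by (rule *[OF Ord_ks(3) F(4)], assumption+, rule *[OF Ord_ks(4) F(5)], assumption+,
    rule *[OF Ord_ks(5) F(6)], assumption+, rule *[OF Ord_ks(6) F(7)], assumption)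
qed

lemma inF_seq:
 assumes "!!x. x IN A ==> inF x" "n IN omega" "is_fun s n A" shows "inF s"
proof -
 have "dpred (%e. ALL s. is_fun s (e 0) A --> inF s)" by (intro dint)
 then have "ALL s. is_fun s n A --> inF s"
 proof (rule omega_induct[OF _ assms(2)])
  show "ALL s. is_fun s vempty A --> inF s" by (simp add: is_fun_empty inF_Ord)
  fix n assume n: "n IN omega" and IH: "ALL s. is_fun s n A --> inF s"
  show "ALL s. is_fun s (vsucc n) A --> inF s"
  proof (intro allI impI)
   fix s assume s: "is_fun s (vsucc n) A"
   have "is_fun (vlam n (ap s)) n A" by (rule is_fun_restrict[OF s]) auto
   then have 1: "inF (vlam n (ap s))" using IH by blast
   have 2: "inF (ap s n)" using assms(1) ap_type[OF s] by simp
   have 3: "inF n" using n Ord_nat inF_Ord by blast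
   show "inF s" using inF_ops(1)[OF 3 1 2 2] snoc_restrict[OF s] by simp
  qed
 qed
 then show ?thesis using assms by blast
qed

lemma itr_nand: "E R <= E (funs n A) ==> itr R S = nand A n (nand A n R S) (nand A n R S)"
 by (rule ext) (auto simp: mem_itr mem_nand)

lemma inF_Def:
 assumes "!!x. x IN A ==> inF x" "inF A" "X IN (Def A)" shows "inF X"
proof -
 obtain n s R where n: "n IN omega" "is_fun s n A" "definable_rel A (vsucc n) R" "X = sec A n s R"
  using assms(3) unfolding mem_Def by blast
 have nat: "inF m" if "m IN omega" for m :: 'a using that Ord_nat inF_Ord by blast
 have el: "inF i" if "n IN omega" "i IN n" for i n :: 'a using nat Ord_trans[OF Ord_omega] that by blast
 have "vsucc n IN omega & E R <= E (funs (vsucc n) A) & inF R"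
 proof (rule definable_rel_induct[OF n(3), where P = "%n R. inF R"])
  show "dpred (%e. inF (e (Suc 0)))" by (intro dint)
  show "inF (dm A n i j)" "inF (de A n i j)" if "n IN omega" "i IN n" "j IN n" for n i j
   using inF_ops(4,5)[OF assms(2) nat el el] that by blast+
  show nn: "inF (nand A n R R)" if "n IN omega" "inF R" for n R
   using inF_ops(6)[OF assms(2) nat] that by blast
  show "inF (itr R S)" if "n IN omega" "E R <= E (funs n A)" "inF R" "inF S" for n R S
   unfolding itr_nand[OF that(2)] using inF_ops(6)[OF assms(2) nat] that by blast
  show "inF (pj A n R)" if "n IN omega" "inF R" for n R
   using inF_ops(7)[OF assms(2) nat _ assms(2)] that by blast
 qed
 then have "inF R" by blast
 then show ?thesis using inF_ops(2)[OF assms(2) nat[OF n(1)] inF_seq[OF assms(1) n(1,2)]] n(4) by simp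
qed

text \<open>By induction on the stages: a new element is a section of a definable relation, and the
  stage, the finite parameter sequence and the relation are all built by the constructors.\<close>

lemma inF_all: assumes "ALL x::'v::zfc. constructible x" shows "inF (x::'v)"
proof -
 have "dpred (%e. ALL x:E (Lf (e 0)). inF x)" by (intro dint)
 then have "Ord al ==> ALL x:E (Lf al). inF x" for al :: 'v
 proof (rule Ord_induct)
  fix al :: 'v assume al: "Ord al" "!!bt. bt IN al ==> ALL x:E (Lf bt). inF x"
  then show "ALL x:E (Lf al). inF x"
   unfolding elts_Lf[of al] using inF_Def inF_Lf Ord_in_Ord by blast
 qed
 then show ?thesis using constructible_Lf assms by blast
qed

subsection \<open>Indices of formulas\<close>

text \<open>The arities at which \<open>i\<close> is a correct code of a formula over
  \<open>A\<close>. The whole set is computed at once because projection refers to the next higher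
  arity of the subformula.\<close>

definition fiS :: "'v::zfc => 'v => 'v" where
 "fiS A i = erec (%i f. vsep omega (%n. F (K0 (K0 (K1 i))) = A & F (K1 (K0 (K1 i))) = n &
  ((K0 i = k3 | K0 i = k4) & F (K0 (K1 (K1 i))) IN n & F (K1 (K1 (K1 i))) IN n |
   K0 i = k5 & n IN (ap f (K0 (K1 (K1 i)))) & n IN (ap f (K1 (K1 (K1 i)))) |
   K0 i = k6 & vsucc n IN (ap f (K0 (K1 (K1 i))))))) i"

definition fi :: "'v::zfc => 'v => 'v => bool" where "fi A n i <-> n IN (fiS A i)"

lemma [dint]: "dfun f ==> dfun g ==> dfun h ==> dpred (%e. fi (f e) (g e) (h e))"
 by (rule dpred_comp3[where P = fi]) (unfold fi_def fiS_def, intro dint)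

lemma fi_code5:
 assumes o: "Ord k" "Ord a" "Ord b" "Ord c" "Ord d"
 shows "fi A n (code5 k a b c d) <-> n IN omega & F a = A & F b = n &
  ((k = k3 | k = k4) & F c IN n & F d IN n | k = k5 & fi A n c & fi A n d | k = k6 & fi A (vsucc n) c)"
proof -
 let ?P = "%i f n. F (K0 (K0 (K1 i))) = A & F (K1 (K0 (K1 i))) = n &
  ((K0 i = k3 | K0 i = k4) & F (K0 (K1 (K1 i))) IN n & F (K1 (K1 (K1 i))) IN n |
   K0 i = k5 & n IN (ap f (K0 (K1 (K1 i)))) & n IN (ap f (K1 (K1 (K1 i)))) |
   K0 i = k6 & vsucc n IN (ap f (K0 (K1 (K1 i)))))"
 let ?G = "%i f. vsep omega (?P i f)"
 let ?i = "code5 k a b c d"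
 have "dfun (%e. ?G (e 0) (e (Suc 0)))" by (intro dint)
 from erec_eq[OF this, of ?i] have e: "fiS A ?i = ?G ?i (vlam ?i (fiS A))" unfolding fiS_def .
 have "dpred (%e. ?P ?i (vlam ?i (fiS A)) (e 0))" by (intro dint)
 from elts_vsep[OF this, of omega] have "fi A n ?i <-> n IN omega & ?P ?i (vlam ?i (fiS A)) n"
  unfolding fi_def e by blast
 then have 1: "fi A n ?i <-> n IN omega & F a = A & F b = n &
  ((k = k3 | k = k4) & F c IN n & F d IN n |
   k = k5 & n IN (ap (vlam ?i (fiS A)) c) & n IN (ap (vlam ?i (fiS A)) d) |
   k = k6 & vsucc n IN (ap (vlam ?i (fiS A)) c))"
  unfolding code5_sel[OF o] .
 have d: "dfun (%e. fiS A (e 0))" unfolding fiS_def by (intro dint)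
 have 2: "ap (vlam ?i (fiS A)) c = fiS A c" "ap (vlam ?i (fiS A)) d = fiS A d" if "k ~= vempty"
  using ap_vlam[OF d code5_lt[OF o that]] by simp_all
 show ?thesis
 proof (cases "k = vempty")
  case False
  show ?thesis unfolding fi_def[of A _ c] fi_def[of A _ d] using 1[unfolded 2[OF False]] by blast
 next
  case True
  then show ?thesis using 1 by simp
 qed
qed

lemma fi_sound: assumes "Ord i" "fi A n i" shows "definable_rel A n (F i)"
proof -
 have "dpred (%e. ALL n. fi A n (e 0) --> definable_rel A n (F (e 0)))" by (intro dint)
 then have "ALL n. fi A n i --> definable_rel A n (F i)"
 proof (rule Ord_induct[OF _ assms(1)])
  fix i assume i: "Ord i" and IH: "!!j. j IN i ==> ALL n. fi A n j --> definable_rel A n (F j)"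
  show "ALL n. fi A n i --> definable_rel A n (F i)"
  proof (intro allI impI)
   fix n assume f: "fi A n i"
   obtain k a b c d where o: "Ord k" "Ord a" "Ord b" "Ord c" "Ord d" "i = code5 k a b c d"
    using code5_ex[OF i] by metis
   have n: "n IN omega" "F a = A" "F b = n" and
    q: "(k = k3 | k = k4) & F c IN n & F d IN n | k = k5 & fi A n c & fi A n d | k = k6 & fi A (vsucc n) c"
    using f unfolding o(6) fi_code5[OF o(1-5)] by blast+
   have lt: "c IN i" "d IN i" if "k ~= vempty" using code5_lt[OF o(1-5) that] o(6) by auto
   note Fk = F_kinds[OF o(2-5), unfolded n]
   from q consider "k = k3" "F c IN n" "F d IN n" | "k = k4" "F c IN n" "F d IN n"
    | "k = k5" "fi A n c" "fi A n d" | "k = k6" "fi A (vsucc n) c" by blast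
   then show "definable_rel A n (F i)"
   proof cases
    case 1
    then show ?thesis unfolding o(6) using Fk(4)[OF n(1) 1(2,3)] definable_rel_intros(1)[OF n(1)] by simp
   next
    case 2
    then show ?thesis unfolding o(6) using Fk(5)[OF n(1) 2(2,3)] definable_rel_intros(2)[OF n(1)] by simp
   next
    case 3
    then have "c IN i" "d IN i" using lt by simp_all
    then have "definable_rel A n (F c)" "definable_rel A n (F d)" using IH 3 by blast+
    then show ?thesis unfolding o(6) using Fk(6)[OF n(1)] 3 definable_rel_nand by simp
   next
    case 4
    then have "c IN i" using lt by simp
    then have "definable_rel A (vsucc n) (F c)" using IH 4 by blast
    then show ?thesis unfolding o(6) using Fk(7)[OF n(1)] 4 definable_rel_intros(5)[OF n(1)] by simp
   qed
  qed
 qed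
 then show ?thesis using assms by blast
qed

definition ordi :: "'v::zfc => 'v" where "ordi bt = code5 vempty bt vempty vempty vempty"

lemma [dint]: "dfun f ==> dfun (%e. ordi (f e))"
 unfolding ordi_def by (intro dint)

lemma Ord_ordi: "Ord bt ==> Ord (ordi bt)" unfolding ordi_def by (intro Ord_code5) simp_all

lemma F_ordi: "Ord bt ==> F (ordi bt) = bt" unfolding ordi_def by (simp add: F_kinds)

text \<open>Every definable relation has a formula index in any class of ordinals that is closed under the
  constructors; this covers both the class of all ordinals and the Skolem hulls below.\<close>

lemma fi_complete_in:
 fixes A :: "'v::zfc"
 assumes "definable_rel A n R" "dpred (%e. Q (e 0))"
  and Q: "!!i. Q i ==> Ord i" "!!k a b c d. Q a ==> Q b ==> Q c ==> Q d ==> k IN omega ==> Q (code5 k a b c d)"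
   "!!n. n IN omega ==> Q (ordi n)"
  and dG: "dfun (%e. G (e 0))" "Q a0" "F a0 = B" "G B = A"
  and G: "!!n i j. n IN omega ==> i IN n ==> j IN n ==> G (dm B n i j) = dm A n i j"
   "!!n i j. n IN omega ==> i IN n ==> j IN n ==> G (de B n i j) = de A n i j"
   "!!n r s. n IN omega ==> Q r ==> Q s ==> G (nand B n (F r) (F s)) = nand A n (G (F r)) (G (F s))"
   "!!n r. n IN omega ==> Q r ==> G (pj B n (F r)) = pj A n (G (F r))"
 shows "EX r. Q r & fi B n r & G (F r) = R"
proof -
 have nat: "i IN omega" if "n IN omega" "i IN n" for i n :: 'v using that Ord_trans[OF Ord_omega] by blast
 have on: "Ord n" "Ord (ordi n)" "F (ordi n) = n" if "n IN omega" for n :: 'v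
  using that Ord_nat Ord_ordi F_ordi by blast+
 have a0: "Ord a0" using Q dG by blast
 have nandcase: "EX r. Q r & fi B n r & G (F r) = nand A n (G (F r1)) (G (F r2))"
  if n: "n IN omega" and r: "Q r1" "Q r2" "fi B n r1" "fi B n r2" for n r1 r2
 proof (intro exI conjI)
  let ?r = "code5 k5 a0 (ordi n) r1 r2"
  note o = a0 on(2)[OF n] Q(1)[OF r(1)] Q(1)[OF r(2)]
  show "Q ?r" using r n dG Q by simp
  show "fi B n ?r" unfolding fi_code5[OF Ord_ks(5) o] using r n dG(3) on(3)[OF n] by simp
  show "G (F ?r) = nand A n (G (F r1)) (G (F r2))"
   using F_kinds(6)[OF o] G(3)[OF n r(1,2)] on(3)[OF n] dG(3) n by simp
 qed
 have "n IN omega & E R <= E (funs n A) & (EX r. Q r & fi B n r & G (F r) = R)"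
 proof (rule definable_rel_induct[OF assms(1), where P = "%n R. EX r. Q r & fi B n r & G (F r) = R"])
  have q: "dfun f ==> dpred (%e. Q (f e))" for f by (rule dpred_comp1[where P = Q, OF assms(2)])
  have g: "dfun f ==> dfun (%e. G (f e))" for f by (rule dfun_comp1[where K = G, OF dG(1)])
  show "dpred (%e. EX r. Q r & fi B (e 0) r & G (F r) = e (Suc 0))" by (intro dint q g)
 next
  fix n i j :: 'v assume n: "n IN omega" "i IN n" "j IN n"
  note i = nat[OF n(1,2)] and j = nat[OF n(1,3)]
  note o = a0 on(2)[OF n(1)] on(2)[OF i] on(2)[OF j]
  have q: "Q (code5 k a0 (ordi n) (ordi i) (ordi j))" if "k IN omega" for k using dG Q n i j that by blast
  have "Q (code5 k3 a0 (ordi n) (ordi i) (ordi j)) & fi B n (code5 k3 a0 (ordi n) (ordi i) (ordi j)) &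
    G (F (code5 k3 a0 (ordi n) (ordi i) (ordi j))) = dm A n i j"
   unfolding fi_code5[OF Ord_ks(3) o] using q[of k3] F_kinds(4)[OF o] on(3)[OF n(1)] on(3)[OF i] on(3)[OF j] n dG(3) G(1)[OF n] by simp
  then show "EX r. Q r & fi B n r & G (F r) = dm A n i j" by blast
  have "Q (code5 k4 a0 (ordi n) (ordi i) (ordi j)) & fi B n (code5 k4 a0 (ordi n) (ordi i) (ordi j)) &
    G (F (code5 k4 a0 (ordi n) (ordi i) (ordi j))) = de A n i j"
   unfolding fi_code5[OF Ord_ks(4) o] using q[of k4] F_kinds(5)[OF o] on(3)[OF n(1)] on(3)[OF i] on(3)[OF j] n dG(3) G(2)[OF n] by simp
  then show "EX r. Q r & fi B n r & G (F r) = de A n i j" by blast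
 next
  fix n R :: 'v assume n: "n IN omega" and "EX r. Q r & fi B n r & G (F r) = R"
  then obtain r where r: "Q r" "fi B n r" "G (F r) = R" by blast
  then show "EX r. Q r & fi B n r & G (F r) = nand A n R R" using nandcase[OF n r(1,1,2,2)] by simp
 next
  fix n R S :: 'v assume n: "n IN omega" and sub: "E R <= E (funs n A)"
   and "EX r. Q r & fi B n r & G (F r) = R" "EX r. Q r & fi B n r & G (F r) = S"
  then obtain r s where r: "Q r" "fi B n r" "G (F r) = R" and s: "Q s" "fi B n s" "G (F s) = S" by blast
  obtain t where t: "Q t" "fi B n t" "G (F t) = nand A n R S" using nandcase[OF n r(1) s(1) r(2) s(2)] r s by auto
  show "EX r. Q r & fi B n r & G (F r) = itr R S"
   unfolding itr_nand[OF sub] using nandcase[OF n t(1,1,2,2)] t by simp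
 next
  fix n R :: 'v assume n: "n IN omega" and "EX r. Q r & fi B (vsucc n) r & G (F r) = R"
  then obtain r where r: "Q r" "fi B (vsucc n) r" "G (F r) = R" by blast
  let ?r = "code5 k6 a0 (ordi n) r r"
  note o = a0 on(2)[OF n] Q(1)[OF r(1)] Q(1)[OF r(1)]
  have "Q ?r & fi B n ?r & G (F ?r) = pj A n R"
   unfolding fi_code5[OF Ord_ks(6) o] using F_kinds(7)[OF o] Q r n dG(2,3) on(3)[OF n] G(4)[OF n r(1)] by simp
  then show "EX r. Q r & fi B n r & G (F r) = pj A n R" by blast
 qed
 then show ?thesis by blast
qed

subsection \<open>Skolem functions\<close>

text \<open>A witness for non-inclusion; through extensionality it makes the collapse of the coded
  sets injective.\<close>

definition g3 :: "'v::zfc => 'v" where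
 "g3 i = vleast (%k. F k IN (F (K0 i)) & F k ~: E (F (K1 i)))"
text \<open>The value is \<open>F i\<close> itself if this is an ordinal, and \<open>vempty\<close>
  otherwise. Closure under \<open>g4\<close> brings every ordinal that has a code back among the
  codes.\<close>

definition g4 :: "'v::zfc => 'v" where
 "g4 i = vleast (%k. k = F i)"
text \<open>A member witnessing that \<open>F i\<close> is not an ordinal, so that no set which is
  not an ordinal collapses to one.\<close>

definition g5 :: "'v::zfc => 'v" where
 "g5 i = vleast (%k. F k IN (F i) & ~(Ord (F k) & E (F k) <= E (F i)))"
text \<open>The least stage below \<open>K1 i\<close> over which the set is definable; it shows that
  the collapse of a stage is a stage.\<close>

definition g6 :: "'v::zfc => 'v" where
 "g6 i = vleast (%k. k IN (K1 i) & F (K0 i) IN (Def (Lf k)))"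
definition g7 :: "'v::zfc => 'v" where
 "g7 i = vleast (%k. vpair (K1 i) (F k) IN (F (K0 i)))"
text \<open>A witness for the existential quantifier in \<open>pj\<close>, with the set, the arity,
  the sequence and the relation packed into one ordinal.\<close>

definition g8 :: "'v::zfc => 'v" where
 "g8 i = vleast (%k. F k IN (F (K0 (K0 i))) &
  snoc (F (K1 (K0 i))) (F (K0 (K1 i))) (F k) IN (F (K1 (K1 i))))"
text \<open>One ordinal packs the arity, a code of the parameter sequence and the formula code of a
  definition of \<open>X\<close> over \<open>A\<close>.\<close>

definition dwit :: "'v::zfc => 'v => 'v => bool" where
 "dwit X A k <-> K0 k IN omega & is_fun (F (K0 (K1 k))) (K0 k) A & fi A (vsucc (K0 k)) (K1 (K1 k)) &
  X = sec A (K0 k) (F (K0 (K1 k))) (F (K1 (K1 k)))"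
definition g9 :: "'v::zfc => 'v" where
 "g9 i = vleast (dwit (F (K0 i)) (F (K1 i)))"

text \<open>Collecting the values in a set turns closure under nine functions into one inclusion,
  and their commutation with a collapse into one equation between images.\<close>

definition HH :: "'v::zfc => 'v" where
 "HH i = vun (upair (K0 i) (K1 i)) (vun (upair (g3 i) (g4 i)) (vun (upair (g5 i) (g6 i))
      (vun (upair (g7 i) (g8 i)) (upair (g9 i) (g9 i)))))"

lemma elts_HH: "E (HH i) = {K0 i, K1 i, g3 i, g4 i, g5 i, g6 i, g7 i, g8 i, g9 i}"
 unfolding HH_def by auto

lemma [dint]: "dfun f ==> dfun g ==> dfun h ==> dpred (%e. dwit (f e) (g e) (h e))"
 by (rule dpred_comp3[where P = dwit]) (unfold dwit_def, intro dint)

lemma [dint]: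
 assumes "dfun f"
 shows "dfun (%e. g3 (f e))" "dfun (%e. g4 (f e))" "dfun (%e. g5 (f e))" "dfun (%e. g6 (f e))"
  "dfun (%e. g7 (f e))" "dfun (%e. g8 (f e))" "dfun (%e. g9 (f e))"
 by (rule dfun_comp1[where K = g3], unfold g3_def, intro dint, fact,
  rule dfun_comp1[where K = g4], unfold g4_def, intro dint, fact,
  rule dfun_comp1[where K = g5], unfold g5_def, intro dint, fact,
  rule dfun_comp1[where K = g6], unfold g6_def, intro dint, fact,
  rule dfun_comp1[where K = g7], unfold g7_def, intro dint, fact,
  rule dfun_comp1[where K = g8], unfold g8_def, intro dint, fact,
  rule dfun_comp1[where K = g9], unfold g9_def, intro dint, fact)

lemma [dint]: "dfun f ==> dfun (%e. HH (f e))"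
 unfolding HH_def by (intro dint)

lemma vleast_none: "~(EX k. Ord k & P k) ==> vleast P = vempty"
 unfolding vleast_def vthe_def by auto

lemma Ord_vleast: "dpred (%e. P (e 0)) ==> Ord (vleast P)"
 using vleast(1)[of P] vleast_none[of P] by (cases "EX k. Ord k & P k") auto

lemma Ord_HH: assumes "Ord i" "k IN (HH i)" shows "Ord k"
proof -
 have "Ord (g3 i)" unfolding g3_def by (rule Ord_vleast) (intro dint)
 moreover have "Ord (g4 i)" unfolding g4_def by (rule Ord_vleast) (intro dint)
 moreover have "Ord (g5 i)" unfolding g5_def by (rule Ord_vleast) (intro dint)
 moreover have "Ord (g6 i)" unfolding g6_def by (rule Ord_vleast) (intro dint)
 moreover have "Ord (g7 i)" unfolding g7_def by (rule Ord_vleast) (intro dint)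
 moreover have "Ord (g8 i)" unfolding g8_def by (rule Ord_vleast) (intro dint)
 moreover have "Ord (g9 i)" unfolding g9_def by (rule Ord_vleast) (intro dint)
 ultimately show ?thesis using assms K_Ord unfolding elts_HH by auto
qed

definition closedN :: "'v::zfc => bool" where
 "closedN N <-> E omega <= E N & (ALL x:E N. Ord x) & (ALL x:E N. ALL y:E N. J x y IN N)
  & (ALL x:E N. E (HH x) <= E N)"

locale VL =
 fixes ty :: "'v::zfc itself"
 assumes V_eq_L: "ALL x::'v. constructible x"
begin

lemma F_surj: obtains i where "Ord i" "F i = (x::'v)"
 using inF_all[OF V_eq_L, of x] unfolding inF_def by blast

lemma fi_complete: assumes "definable_rel A n (R::'v)" shows "EX r. Ord r & fi A n r & F r = R"
proof -
 obtain a0 where a0: "Ord a0" "F a0 = A" by (rule F_surj)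
 show ?thesis
  by (rule fi_complete_in[OF assms, where Q = Ord and G = "%x. x" and B = A and ?a0.0 = a0])
   (auto intro: dint simp: a0 Ord_code5 Ord_nat Ord_ordi)
qed

lemma Def_dwit: "X IN (Def A) <-> (EX k. Ord k & dwit X A (k::'v))"
proof
 assume "X IN (Def A)"
 then obtain n s R where n: "n IN omega" "is_fun s n A" "definable_rel A (vsucc n) R" "X = sec A n s R"
  unfolding mem_Def by blast
 obtain r where r: "Ord r" "fi A (vsucc n) r" "F r = R" using fi_complete[OF n(3)] by blast
 obtain j where j: "Ord j" "F j = s" by (rule F_surj)
 have "Ord n" using n Ord_nat by blast
 then have "Ord (J n (J j r)) & dwit X A (J n (J j r))" unfolding dwit_def using n r j J_Ord[OF j(1) r(1)] by (simp add: J_Ord)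
 then show "EX k. Ord k & dwit X A k" by blast
next
 assume "EX k. Ord k & dwit X A k"
 then obtain k where k: "Ord k" "dwit X A k" by blast
 then have "definable_rel A (vsucc (K0 k)) (F (K1 (K1 k)))"
  using fi_sound[OF K_Ord(2)[OF K_Ord(2)]] unfolding dwit_def by blast
 then show "X IN (Def A)" using k unfolding mem_Def dwit_def by blast
qed

end

section \<open>Condensation\<close>

locale condense = VL ty for ty :: "'v::zfc itself" +
 fixes N :: 'v
 assumes closed: "closedN N"
begin

text \<open>\<open>M\<close> plays the part of an elementary submodel. Only the amount of
  elementarity that closure under \<open>HH\<close> and \<open>J\<close> provides is used, namely
  enough to commute with every constructor of \<open>F\<close>.\<close>

definition M :: 'v where "M = vimg F N"

abbreviation mu :: "'v => 'v" where "mu == col M"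

lemma N_Ord: "x IN N ==> Ord x" using closed unfolding closedN_def by blast
lemma N_omega: "n IN omega ==> n IN N" using closed unfolding closedN_def by blast
lemma N_zero: "vempty IN N" using N_omega zero_in_omega by blast
lemma N_J: "x IN N ==> y IN N ==> J x y IN N" using closed unfolding closedN_def by blast
lemma N_HH: "x IN N ==> k IN (HH x) ==> k IN N" using closed unfolding closedN_def by blast

lemma N_g:
 assumes "i IN N"
 shows "K0 i IN N" "K1 i IN N" "g3 i IN N" "g4 i IN N" "g5 i IN N" "g6 i IN N"
  "g7 i IN N" "g8 i IN N" "g9 i IN N"
 using N_HH[OF assms] unfolding elts_HH by blast+

lemma N_code5: "k IN N ==> a IN N ==> b IN N ==> c IN N ==> d IN N ==> code5 k a b c d IN N"
 unfolding code5_def by (intro N_J)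

lemma elts_M: "E M = F ` E N"
 unfolding M_def by (rule elts_vimg) (intro dint)

lemma M_F: "i IN N ==> F i IN M" by (simp add: elts_M)

lemma M_E: assumes "x IN M" obtains i where "i IN N" "Ord i" "F i = x"
 using assms N_Ord unfolding elts_M by blast

lemma M_diff: assumes "x IN M" "y IN M" "z IN x" "z ~: E y"
 shows "EX w:E M. w IN x & w ~: E y"
proof -
 obtain i where i: "i IN N" "Ord i" "F i = x" using assms(1) by (rule M_E)
 obtain j where j: "j IN N" "Ord j" "F j = y" using assms(2) by (rule M_E)
 obtain l where l: "Ord l" "F l = z" by (rule F_surj)
 let ?P = "%k. F k IN (F (K0 (J i j))) & F k ~: E (F (K1 (J i j)))"
 have "dpred (%e. ?P (e 0))" by (intro dint)
 from vleast(2)[of ?P l, OF this] have "?P (g3 (J i j))" using assms i j l unfolding g3_def by simp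
 then show ?thesis using M_F[OF N_g(3)[OF N_J[OF i(1) j(1)]]] i j by auto
qed

lemma mu_inj: assumes "x IN M" "y IN M" "mu x = mu y" shows "x = y"
proof -
 have "dpred (%e. e 0 IN M --> (ALL y:E M. mu (e 0) = mu y --> e 0 = y))" by (intro dint)
 then have "x IN M --> (ALL y:E M. mu x = mu y --> x = y)"
 proof (rule set_induct)
  fix x assume IH: "!!z. z IN x ==> z IN M --> (ALL y:E M. mu z = mu y --> z = y)"
  show "x IN M --> (ALL y:E M. mu x = mu y --> x = y)"
  proof (intro impI ballI)
   fix y assume x: "x IN M" and y: "y IN M" and e: "mu x = mu y"
   have 1: "z IN y" if "z IN x" "z IN M" for z
   proof -
    have "mu z IN (mu y)" using that e elts_col[of M x] by force
    then obtain w where "w IN y" "w IN M" "mu z = mu w" unfolding elts_col[of M y] by blast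
    then show ?thesis using IH that by blast
   qed
   have 2: "z IN x" if "z IN y" "z IN M" for z
   proof -
    have "mu z IN (mu x)" using that e elts_col[of M y] by force
    then obtain w where "w IN x" "w IN M" "mu z = mu w" unfolding elts_col[of M x] by blast
    then have "w = z" using IH that by metis
    then show ?thesis using \<open>w IN x\<close> by simp
   qed
   show "x = y"
   proof (rule ext)
    fix z show "z IN x <-> z IN y"
     using M_diff[OF x y, of z] M_diff[OF y x, of z] 1 2 by blast
   qed
  qed
 qed
 then show ?thesis using assms by blast
qed

lemma mu_eq_iff: "x IN M ==> y IN M ==> mu x = mu y <-> x = y"
 using mu_inj by blast

lemma mu_mem: "x IN M ==> x IN y ==> mu x IN (mu y)"
 by (simp add: elts_col)

lemma mu_memE: assumes "z IN (mu y)" obtains w where "w IN M" "w IN y" "z = mu w"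
 using assms unfolding elts_col by blast

lemma mu_mem_iff: assumes "x IN M" shows "mu x IN (mu y) <-> x IN y"
 using mu_mem[OF assms] mu_memE[of "mu x" y] mu_inj[OF assms] by metis

lemma mu_sub_iff: assumes "x IN M" "y IN M" shows "E (mu x) <= E (mu y) <-> E x <= E y"
proof
 assume s: "E (mu x) <= E (mu y)"
 show "E x <= E y"
 proof (rule ccontr)
  assume "~?thesis"
  then obtain z where "z IN x" "z ~: E y" by blast
  then obtain w where "w IN M" "w IN x" "w ~: E y" using M_diff[OF assms] by blast
  then show False using s mu_mem_iff[of w] by blast
 qed
qed (auto simp: elts_col)

lemma N_sub_M: assumes "bt IN N" shows "bt IN M"
proof -
 have "ordi bt IN N" unfolding ordi_def by (intro N_code5 N_zero assms)
 then show ?thesis using M_F[of "ordi bt"] F_ordi[OF N_Ord[OF assms]] by simp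
qed

lemma ordi_N: "bt IN N ==> ordi bt IN N"
 unfolding ordi_def by (intro N_code5 N_zero)

lemma M_Ord: assumes "x IN M" "Ord x" shows "x IN N"
proof -
 obtain i where i: "i IN N" "Ord i" "F i = x" using assms(1) by (rule M_E)
 have "g4 i = x" unfolding g4_def i(3) by (rule vleast_eq) (use assms mem_not_refl in auto)
 then show ?thesis using N_g(4)[OF i(1)] by simp
qed

text \<open>The ordinals in \<open>M\<close> are exactly the members of \<open>N\<close>, so
  collapsing the coded sets and collapsing the codes come to the same on ordinals. Hence one map
  acts on codes and on their values.\<close>

lemma mu_col: assumes "Ord bt" shows "mu bt = col N bt"
proof -
 have "dpred (%e. mu (e 0) = col N (e 0))" by (intro dint)
 then show ?thesis
 proof (rule Ord_induct[OF _ assms])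
  fix bt assume b: "Ord bt" "!!ga. ga IN bt ==> mu ga = col N ga"
  have "E bt Int E M = E bt Int E N" using M_Ord N_sub_M Ord_in_Ord[OF b(1)] by blast
  then have "E (mu bt) = col N ` (E bt Int E N)" unfolding elts_col[of M bt] using b(2) by auto
  then show "mu bt = col N bt" by (intro extensionality) (simp add: elts_col[of N bt])
 qed
qed

lemma mu_Ord: "Ord bt ==> Ord (mu bt)" by (rule col_Ord)

lemma mu_ordE: assumes "dt IN (mu bt)" "bt IN N"
 obtains ga where "ga IN N" "ga IN bt" "dt = mu ga"
proof -
 obtain w where "w IN M" "w IN bt" "dt = mu w" using assms(1) by (rule mu_memE)
 then show ?thesis using that M_Ord Ord_in_Ord[OF N_Ord[OF assms(2)]] by blast
qed

lemma mu_empty: "mu vempty = vempty" by (simp add: vempty_iff elts_col)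

lemma mu_nat: "n IN omega ==> mu n = n"
 by (rule col_id[of omega]) (use N_omega N_sub_M Ord_omega in \<open>auto simp: Ord_def\<close>)

lemma nat_M: "n IN omega ==> n IN M" using N_omega N_sub_M by blast

lemma mu_nat_iff: "x IN M ==> n IN omega ==> mu x = n <-> x = n"
 using mu_inj[of x n] mu_nat[of n] nat_M by metis

lemma mu_in_omega: "x IN M ==> mu x IN omega <-> x IN omega"
 using mu_nat_iff[of x "mu x"] mu_nat[of x] by metis

section \<open>The collapse on pairs, ordinal codes and finite sequences\<close>

lemma M_upair: "x IN M ==> y IN M ==> upair x y IN M"
proof -
 assume "x IN M" "y IN M"
 then obtain i j where i: "i IN N" "Ord i" "F i = x" and j: "j IN N" "Ord j" "F j = y" by (metis M_E)
 have "code5 k8 i j i i IN N" by (intro N_code5 i j N_omega) simp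
 then show ?thesis using M_F F_kinds(9)[OF i(2) j(2) i(2) i(2)] i j by metis
qed

lemma mu_upair: "x IN M ==> y IN M ==> mu (upair x y) = upair (mu x) (mu y)"
 by (rule extensionality) (auto simp: elts_col)

lemma M_vpair: "x IN M ==> y IN M ==> vpair x y IN M"
 unfolding vpair_upair by (intro M_upair)

lemma mu_vpair: "x IN M ==> y IN M ==> mu (vpair x y) = vpair (mu x) (mu y)"
 unfolding vpair_upair by (simp add: mu_upair M_upair)

lemma M_snoc: assumes "n IN M" "s IN M" "x IN M" shows "snoc n s x IN M"
proof -
 obtain a where a: "a IN N" "Ord a" "F a = n" using assms(1) by (rule M_E)
 obtain b where b: "b IN N" "Ord b" "F b = s" using assms(2) by (rule M_E)
 obtain c where c: "c IN N" "Ord c" "F c = x" using assms(3) by (rule M_E)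
 have "code5 k2 a b c c IN N" by (intro N_code5 a b c N_omega) simp
 then show ?thesis using M_F F_kinds(3)[OF a(2) b(2) c(2) c(2)] a b c by metis
qed

lemma mu_snoc: assumes "n IN M" "x IN M" shows "mu (snoc n s x) = snoc (mu n) (mu s) (mu x)"
 by (rule extensionality) (use M_vpair[OF assms] mu_vpair[OF assms] in \<open>auto simp: elts_col\<close>)

lemma mu_J: assumes "a IN N" "b IN N" shows "mu (J a b) = J (mu a) (mu b)"
proof -
 have mm: "mu x IN (mu y) <-> x IN y" if "x IN N" for x y using that mu_mem_iff N_sub_M by blast
 have me: "mu x = mu y <-> x = y" if "x IN N" "y IN N" for x y using that mu_eq_iff N_sub_M by blast
 have mmx: "mu (mx a b) = mx (mu a) (mu b)" "mx a b IN N" if "a IN N" "b IN N" for a b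
  unfolding mx_def using mm[OF that(1)] that by auto
 have gl: "gl (mu c) (mu d) (mu a) (mu b) <-> gl c d a b"
  if "a IN N" "b IN N" "c IN N" "d IN N" for a b c d
  unfolding gl_def using mmx mm me that by metis
 have "dpred (%e. ALL a:E N. ALL b:E N. J a b = e 0 --> mu (e 0) = J (mu a) (mu b))" by (intro dint)
 then have "ALL a':E N. ALL b':E N. J a' b' = J a b --> mu (J a b) = J (mu a') (mu b')"
 proof (rule Ord_induct)
  show "Ord (J a b)" using assms N_Ord J_Ord by blast
  fix i assume IH: "!!j. j IN i ==> ALL a:E N. ALL b:E N. J a b = j --> mu j = J (mu a) (mu b)"
  show "ALL a:E N. ALL b:E N. J a b = i --> mu i = J (mu a) (mu b)"
  proof (intro ballI impI)
   fix a b assume a: "a IN N" and b: "b IN N" and i: "J a b = i"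
   have o: "Ord a" "Ord b" using a b N_Ord by blast+
   note o' = mu_Ord[OF o(1)] mu_Ord[OF o(2)]
   show "mu i = J (mu a) (mu b)"
   proof (rule ext, rule iffI)
    fix z assume "z IN (mu i)"
    then obtain x where x: "x IN N" "x IN i" "z = mu x" using mu_ordE N_J[OF a b] i by metis
    then obtain c d where c: "Ord c" "Ord d" "gl c d a b" "x = J c d" using J_vcol[OF o] i by blast
    then have "c = K0 x" "d = K1 x" by simp_all
    then have cd: "c IN N" "d IN N" using N_g(1,2)[OF x(1)] by simp_all
    have "z = J (mu c) (mu d)" using IH[OF x(2)] cd c x by blast
    moreover have "gl (mu c) (mu d) (mu a) (mu b)" using gl a b cd c by blast
    ultimately show "z IN (J (mu a) (mu b))" using J_mono[OF _ o'] mu_Ord c by blast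
   next
    fix z assume "z IN (J (mu a) (mu b))"
    then obtain p q where p: "Ord p" "Ord q" "gl p q (mu a) (mu b)" "z = J p q" unfolding J_vcol[OF o'] by blast
    \<comment> \<open>The maximum of a pair from \<open>N\<close> is one of its coordinates and so
      lies in \<open>N\<close>; an ordinal at most its collapse is the collapse of a member of
      \<open>N\<close>.\<close>
    have "p IN (vsucc (mu (mx a b)))" "q IN (vsucc (mu (mx a b)))"
     using gl_bound[OF p(3) o' p(1,2)] mmx[OF a b] by simp_all
    then have "EX c:E N. p = mu c" "EX d:E N. q = mu d"
     using mu_ordE[OF _ mmx(2)[OF a b]] mmx(2)[OF a b] by (metis elts_vsucc insertE)+
    then obtain c d where c: "c IN N" "p = mu c" "d IN N" "q = mu d" by blast
    have "gl c d a b" using p gl a b c by blast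
    then have ci: "J c d IN i" using J_mono o N_Ord c i by blast
    then have "mu (J c d) = z" using IH[OF ci] c p by blast
    then show "z IN (mu i)" using mu_mem[OF N_sub_M[OF N_J[OF c(1,3)]] ci] by simp
   qed
  qed
 qed
 then show ?thesis using assms by blast
qed

lemma mu_code5:
 assumes "k IN N" "a IN N" "b IN N" "c IN N" "d IN N"
 shows "mu (code5 k a b c d) = code5 (mu k) (mu a) (mu b) (mu c) (mu d)"
 unfolding code5_def using assms by (simp add: mu_J N_J)

lemma mu_K: assumes "i IN N" shows "mu (K0 i) = K0 (mu i)" "mu (K1 i) = K1 (mu i)"
proof -
 have "mu (J (K0 i) (K1 i)) = J (mu (K0 i)) (mu (K1 i))" by (intro mu_J N_g assms)
 then have "mu i = J (mu (K0 i)) (mu (K1 i))" using N_Ord[OF assms] by simp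
 then show "mu (K0 i) = K0 (mu i)" "mu (K1 i) = K1 (mu i)" using mu_Ord K_Ord[OF N_Ord[OF assms]] by simp_all
qed

lemma M_ap: assumes "s IN M" "xi IN N" "vpair xi y IN s" "!!z. vpair xi z IN s ==> z = y"
 shows "y IN M"
proof -
 obtain i where i: "i IN N" "Ord i" "F i = s" using assms(1) by (rule M_E)
 obtain l where l: "Ord l" "F l = y" by (rule F_surj)
 let ?P = "%k. vpair (K1 (J i xi)) (F k) IN (F (K0 (J i xi)))"
 have "dpred (%e. ?P (e 0))" by (intro dint)
 from vleast(2)[of ?P l, OF this] have "?P (g7 (J i xi))"
  using assms(3) N_Ord[OF assms(2)] i l unfolding g7_def by simp
 then have "vpair xi (F (g7 (J i xi))) IN s" using i N_Ord[OF assms(2)] by simp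
 then have "F (g7 (J i xi)) = y" by (rule assms(4))
 then show ?thesis using M_F[OF N_g(7)[OF N_J[OF i(1) assms(2)]]] by simp
qed

lemma mu_fun: assumes "s IN M" "is_fun s n A" "n IN omega"
 shows "is_fun (mu s) n (mu A)" "!!k. k IN n ==> ap s k IN M" "!!k. k IN n ==> ap (mu s) k = mu (ap s k)"
proof -
 have nat: "k IN omega" if "k IN n" for k using that assms(3) Ord_trans[OF Ord_omega] by blast
 show am: "ap s k IN M" if "k IN n" for k
  by (rule M_ap[OF assms(1) N_omega[OF nat[OF that]] vpair_ap[OF assms(2) that]]) (rule ap_eq[OF assms(2), symmetric])
 have d: "dfun (%e. mu (ap s (e 0)))" by (intro dint)
 have e: "mu s = vlam n (%k. mu (ap s k))"
 proof (rule extensionality)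
  have 1: "mu (vpair k (ap s k)) = vpair k (mu (ap s k))" "vpair k (ap s k) IN M" if "k IN n" for k
   using mu_vpair[OF nat_M[OF nat[OF that]] am[OF that]] mu_nat[OF nat[OF that]] M_vpair[OF nat_M[OF nat[OF that]] am[OF that]]
   by simp_all
  have q: "E s Int E M = {vpair k (ap s k) | k. k IN n}" using mem_is_fun[OF assms(2)] 1(2) by blast
  have "E (mu s) = mu ` {vpair k (ap s k) | k. k IN n}" unfolding elts_col[of M s] q ..
  then show "E (mu s) = E (vlam n (%k. mu (ap s k)))" unfolding elts_vlam[OF d] using 1(1) by force
 qed
 show "is_fun (mu s) n (mu A)" unfolding e by (rule is_fun_vlam[OF d]) (use am mu_mem ap_type[OF assms(2)] in blast)
 show "ap (mu s) k = mu (ap s k)" if "k IN n" for k unfolding e by (rule ap_vlam[OF d that])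
qed

text \<open>Induction on the length: the members of \<open>mu A\<close> are collapses of members of
  \<open>A\<close> in \<open>M\<close>, and \<open>M\<close> is closed under
  \<open>snoc\<close>.\<close>

lemma mu_fun_onto:
 assumes "A IN M" "n IN omega" "is_fun t n (mu A)" shows "EX s:E M. is_fun s n A & mu s = t"
proof -
 have "dpred (%e. ALL t. is_fun t (e 0) (mu A) --> (EX s:E M. is_fun s (e 0) A & mu s = t))" by (intro dint)
 then have "ALL t. is_fun t n (mu A) --> (EX s:E M. is_fun s n A & mu s = t)"
 proof (rule omega_induct[OF _ assms(2)])
  show "ALL t. is_fun t vempty (mu A) --> (EX s:E M. is_fun s vempty A & mu s = t)"
   using nat_M[OF zero_in_omega] mu_empty by (auto simp: is_fun_empty)
  fix n :: 'v assume n: "n IN omega" and IH: "ALL t. is_fun t n (mu A) --> (EX s:E M. is_fun s n A & mu s = t)"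
  show "ALL t. is_fun t (vsucc n) (mu A) --> (EX s:E M. is_fun s (vsucc n) A & mu s = t)"
  proof (intro allI impI)
   fix t assume t: "is_fun t (vsucc n) (mu A)"
   have "is_fun (vlam n (ap t)) n (mu A)" by (rule is_fun_restrict[OF t]) auto
   then obtain s where s: "s IN M" "is_fun s n A" "mu s = vlam n (ap t)" using IH by blast
   have "ap t n IN (mu A)" using ap_type[OF t] by simp
   then obtain x where x: "x IN M" "x IN A" "ap t n = mu x" by (rule mu_memE)
   have "mu (snoc n s x) = t" using mu_snoc[OF nat_M[OF n] x(1)] mu_nat[OF n] s x snoc_restrict[OF t] by simp
   then show "EX s:E M. is_fun s (vsucc n) A & mu s = t"
    using M_snoc[OF nat_M[OF n] s(1) x(1)] is_fun_snoc[OF s(2) x(2)] by blast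
  qed
 qed
 then show ?thesis using assms by blast
qed

lemma mu_fun_iff: "A IN M ==> s IN M ==> n IN omega ==> is_fun (mu s) n (mu A) <-> is_fun s n A"
 using mu_fun(1) mu_fun_onto mu_inj by metis

text \<open>Every sequence over \<open>mu A\<close> is the collapse of a sequence in
  \<open>M\<close> over \<open>A\<close>, so a relation only has to be compared on sequences of
  \<open>M\<close>.\<close>

lemma mu_rel:
 assumes A: "A IN M" and n: "n IN omega" and X: "!!s. s IN X ==> is_fun s n A" and Y: "!!t. t IN Y ==> is_fun t n (mu A)"
  and iff: "!!s. s IN M ==> is_fun s n A ==> s IN X <-> mu s IN Y"
 shows "mu X = Y"
proof (rule ext, rule iffI)
 fix t assume "t IN (mu X)"
 then show "t IN Y" using X iff by (metis mu_memE)
next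
 fix t assume t: "t IN Y"
 then obtain s where "s IN M" "is_fun s n A" "mu s = t" using mu_fun_onto[OF A n Y] by blast
 then show "t IN (mu X)" using iff t mu_mem by metis
qed

lemma mu_dm:
 assumes A: "A IN M" and n: "n IN omega" "i IN n" "j IN n"
 shows "mu (dm A n i j) = dm (mu A) n i j" "mu (de A n i j) = de (mu A) n i j"
proof -
 have f: "ap (mu s) k = mu (ap s k)" "ap s k IN M" if "s IN M" "is_fun s n A" "k IN n" for s k
  using mu_fun[OF that(1,2) n(1)] that(3) by blast+
 show "mu (dm A n i j) = dm (mu A) n i j"
  by (rule mu_rel[OF A n(1)])
   (auto simp: mem_dm f n mu_mem_iff mu_fun[OF _ _ n(1)])
 show "mu (de A n i j) = de (mu A) n i j"
  by (rule mu_rel[OF A n(1)])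
   (auto simp: mem_de f n mu_eq_iff mu_fun[OF _ _ n(1)])
qed

lemma mu_nand:
 assumes A: "A IN M" and n: "n IN omega" shows "mu (nand A n R S) = nand (mu A) n (mu R) (mu S)"
 by (rule mu_rel[OF A n]) (auto simp: mem_nand mu_mem_iff mu_fun[OF _ _ n])

text \<open>A witness for the quantifier may lie outside \<open>M\<close>, where the collapse
  discards it; \<open>g8\<close> replaces it by one in \<open>M\<close>.\<close>

lemma mu_pj:
 assumes A: "A IN M" and n: "n IN omega" and R: "R IN M" shows "mu (pj A n R) = pj (mu A) n (mu R)"
proof (rule mu_rel[OF A n])
 fix s assume s: "s IN M" "is_fun s n A"
 have "(EX x:E A. snoc n s x IN R) <-> (EX y:E (mu A). snoc n (mu s) y IN (mu R))"
 proof
  assume "EX x:E A. snoc n s x IN R"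
  then obtain x where x: "x IN A" "snoc n s x IN R" by blast
  obtain a where a: "a IN N" "Ord a" "F a = A" using A by (rule M_E)
  obtain b where b: "b IN N" "Ord b" "F b = n" using nat_M[OF n] by (rule M_E)
  obtain c where c: "c IN N" "Ord c" "F c = s" using s(1) by (rule M_E)
  obtain d where d: "d IN N" "Ord d" "F d = R" using R by (rule M_E)
  obtain l where l: "Ord l" "F l = x" by (rule F_surj)
  let ?i = "J (J a b) (J c d)"
  let ?P = "%k. F k IN (F (K0 (K0 ?i))) & snoc (F (K1 (K0 ?i))) (F (K0 (K1 ?i))) (F k) IN (F (K1 (K1 ?i)))"
  have iN: "?i IN N" by (intro N_J a b c d)
  have K: "K0 (K0 ?i) = a" "K1 (K0 ?i) = b" "K0 (K1 ?i) = c" "K1 (K1 ?i) = d"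
   using J_Ord[OF a(2) b(2)] J_Ord[OF c(2) d(2)] a b c d by simp_all
  have "dpred (%e. ?P (e 0))" by (intro dint)
  from vleast(2)[of ?P l, OF this] have "?P (g8 ?i)" using x a b c d l K unfolding g8_def by simp
  then have w: "F (g8 ?i) IN A" "snoc n s (F (g8 ?i)) IN R" "F (g8 ?i) IN M"
   using K a b c d M_F[OF N_g(8)[OF iN]] by simp_all
  have "snoc n (mu s) (mu (F (g8 ?i))) = mu (snoc n s (F (g8 ?i)))" using mu_snoc[OF nat_M[OF n] w(3)] mu_nat[OF n] by simp
  then have "snoc n (mu s) (mu (F (g8 ?i))) IN (mu R)" using mu_mem[OF M_snoc[OF nat_M[OF n] s(1) w(3)] w(2)] by simp
  then show "EX y:E (mu A). snoc n (mu s) y IN (mu R)" using mu_mem[OF w(3,1)] by blast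
 next
  assume "EX y:E (mu A). snoc n (mu s) y IN (mu R)"
  then obtain y where y: "y IN (mu A)" "snoc n (mu s) y IN (mu R)" by blast
  obtain x where x: "x IN M" "x IN A" "y = mu x" using y(1) by (rule mu_memE)
  have "snoc n (mu s) y = mu (snoc n s x)" using mu_snoc[OF nat_M[OF n] x(1)] mu_nat[OF n] x by simp
  then show "EX x:E A. snoc n s x IN R" using y x mu_mem_iff[OF M_snoc[OF nat_M[OF n] s(1) x(1)]] by auto
 qed
 then show "s IN (pj A n R) <-> mu s IN (pj (mu A) n (mu R))"
  unfolding mem_pj using s mu_fun(1)[OF s n] by blast
qed (simp_all add: mem_pj)

lemma mu_sec:
 assumes "n IN M" "s IN M"
 shows "mu (sec A n s R) = sec (mu A) (mu n) (mu s) (mu R)"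
proof (rule ext)
 fix y
 have "snoc (mu n) (mu s) (mu x) IN (mu R) <-> snoc n s x IN R" if "x IN M" for x
  using mu_snoc[OF assms(1) that, of s] mu_mem_iff[OF M_snoc[OF assms that]] by simp
 then show "y IN (mu (sec A n s R)) <-> y IN (sec (mu A) (mu n) (mu s) (mu R))"
  unfolding mem_sec elts_col[of M "sec A n s R"] elts_col[of M A] by (auto simp: mem_sec)
qed

lemma M_sec: assumes "A IN M" "n IN M" "s IN M" "R IN M" shows "sec A n s R IN M"
proof -
 obtain a where a: "a IN N" "Ord a" "F a = A" using assms(1) by (rule M_E)
 obtain b where b: "b IN N" "Ord b" "F b = n" using assms(2) by (rule M_E)
 obtain c where c: "c IN N" "Ord c" "F c = s" using assms(3) by (rule M_E)
 obtain d where d: "d IN N" "Ord d" "F d = R" using assms(4) by (rule M_E)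
 have "code5 k7 a b c d IN N" by (intro N_code5 a b c d N_omega) simp
 then show ?thesis using M_F F_kinds(8)[OF a(2) b(2) c(2) d(2)] a b c d by metis
qed

section \<open>Formula codes, definability and the stages under the collapse\<close>

lemma N_code5E: assumes "i IN N"
 obtains k a b c d where "k IN N" "a IN N" "b IN N" "c IN N" "d IN N"
  "Ord k" "Ord a" "Ord b" "Ord c" "Ord d" "i = code5 k a b c d"
proof -
 obtain k a b c d where o: "Ord k" "Ord a" "Ord b" "Ord c" "Ord d" "i = code5 k a b c d"
  using code5_ex[OF N_Ord[OF assms]] by metis
 have "k IN N" "a IN N" "b IN N" "c IN N" "d IN N"
  using N_g(1)[OF assms] N_g(1)[OF N_g(1)[OF N_g(2)[OF assms]]] N_g(2)[OF N_g(1)[OF N_g(2)[OF assms]]]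
   N_g(1)[OF N_g(2)[OF N_g(2)[OF assms]]] N_g(2)[OF N_g(2)[OF N_g(2)[OF assms]]]
  unfolding o(6) code5_sel[OF o(1-5)] by blast+
 then show ?thesis using that o by blast
qed

lemma fi_mu_sound:
 assumes A: "A IN M" and "r IN N" "fi A n r" shows "definable_rel (mu A) n (mu (F r))"
proof -
 have "dpred (%e. e 0 IN N --> (ALL n. fi A n (e 0) --> definable_rel (mu A) n (mu (F (e 0)))))" by (intro dint)
 then have "r IN N --> (ALL n. fi A n r --> definable_rel (mu A) n (mu (F r)))"
 proof (rule Ord_induct[OF _ N_Ord[OF assms(2)]])
  fix i assume IH: "!!j. j IN i ==> j IN N --> (ALL n. fi A n j --> definable_rel (mu A) n (mu (F j)))"
  show "i IN N --> (ALL n. fi A n i --> definable_rel (mu A) n (mu (F i)))"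
  proof (intro allI impI)
   fix n assume i: "i IN N" and f: "fi A n i"
   obtain k a b c d where m: "k IN N" "a IN N" "b IN N" "c IN N" "d IN N"
    and o: "Ord k" "Ord a" "Ord b" "Ord c" "Ord d" "i = code5 k a b c d" using i by (rule N_code5E)
   have n: "n IN omega" "F a = A" "F b = n" and
    q: "(k = k3 | k = k4) & F c IN n & F d IN n | k = k5 & fi A n c & fi A n d | k = k6 & fi A (vsucc n) c"
    using f unfolding o(6) fi_code5[OF o(1-5)] by blast+
   have lt: "c IN i" "d IN i" if "k ~= vempty" using code5_lt[OF o(1-5) that] o(6) by auto
   note Fk = F_kinds[OF o(2-5), unfolded n]
   from q consider "k = k3" "F c IN n" "F d IN n" | "k = k4" "F c IN n" "F d IN n"
    | "k = k5" "fi A n c" "fi A n d" | "k = k6" "fi A (vsucc n) c" by blast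
   then show "definable_rel (mu A) n (mu (F i))"
   proof cases
    case 1
    then show ?thesis unfolding o(6) using Fk(4)[OF n(1) 1(2,3)] definable_rel_intros(1)[OF n(1)] mu_dm(1)[OF A n(1)] by simp
   next
    case 2
    then show ?thesis unfolding o(6) using Fk(5)[OF n(1) 2(2,3)] definable_rel_intros(2)[OF n(1)] mu_dm(2)[OF A n(1)] by simp
   next
    case 3
    then have "c IN i" "d IN i" using lt by simp_all
    then have "definable_rel (mu A) n (mu (F c))" "definable_rel (mu A) n (mu (F d))" using IH 3 m by blast+
    then show ?thesis unfolding o(6) using Fk(6)[OF n(1)] 3 definable_rel_nand mu_nand[OF A n(1)] by simp
   next
    case 4
    then have "c IN i" using lt by simp
    then have "definable_rel (mu A) (vsucc n) (mu (F c))" using IH 4 m by blast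
    then show ?thesis unfolding o(6) using Fk(7)[OF n(1)] 4 definable_rel_intros(5)[OF n(1)] mu_pj[OF A n(1) M_F[OF m(4)]] by simp
   qed
  qed
 qed
 then show ?thesis using assms by blast
qed

lemma mu_Def: assumes A: "A IN M" and X: "X IN M" "X IN (Def A)" shows "mu X IN (Def (mu A))"
proof -
 obtain a where a: "a IN N" "Ord a" "F a = A" using A by (rule M_E)
 obtain b where b: "b IN N" "Ord b" "F b = X" using X(1) by (rule M_E)
 obtain l where l: "Ord l" "dwit X A l" using X(2) unfolding Def_dwit by blast
 have "dpred (%e. dwit X A (e 0))" by (intro dint)
 from vleast(2)[of "dwit X A" l, OF this l] have w0: "dwit X A (g9 (J b a))" unfolding g9_def using a b by simp
 define k where "k = g9 (J b a)"
 have k: "k IN N" unfolding k_def by (intro N_g N_J a b)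
 have w: "K0 k IN omega" "is_fun (F (K0 (K1 k))) (K0 k) A" "fi A (vsucc (K0 k)) (K1 (K1 k))"
  "X = sec A (K0 k) (F (K0 (K1 k))) (F (K1 (K1 k)))" using w0 unfolding k_def[symmetric] dwit_def by blast+
 have s: "F (K0 (K1 k)) IN M" by (intro M_F N_g k)
 have "mu X = sec (mu A) (K0 k) (mu (F (K0 (K1 k)))) (mu (F (K1 (K1 k))))"
  using mu_sec[OF nat_M[OF w(1)] s] w(4) mu_nat[OF w(1)] by simp
 moreover have "definable_rel (mu A) (vsucc (K0 k)) (mu (F (K1 (K1 k))))" by (rule fi_mu_sound[OF A _ w(3)]) (intro N_g k)
 ultimately show ?thesis unfolding mem_Def using w(1) mu_fun(1)[OF s w(2,1)] by blast
qed

text \<open>A formula is built from natural numbers and the code of its domain, all available in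
  \<open>N\<close>; hence its code over \<open>A\<close> can be formed in \<open>N\<close>, and the
  parameters are lifted by \<open>mu_fun_onto\<close>.\<close>

lemma mu_Def_onto: assumes A: "A IN M" and Y: "Y IN (Def (mu A))"
 shows "EX X:E M. X IN (Def A) & mu X = Y"
proof -
 obtain n t R where n: "n IN omega" "is_fun t n (mu A)" "definable_rel (mu A) (vsucc n) R" "Y = sec (mu A) n t R"
  using Y unfolding mem_Def by blast
 obtain s where s: "s IN M" "is_fun s n A" "mu s = t" using mu_fun_onto[OF A n(1,2)] by blast
 obtain a where a: "a IN N" "Ord a" "F a = A" using A by (rule M_E)
 have "EX r. r IN N & fi A (vsucc n) r & mu (F r) = R"
 proof (rule fi_complete_in[OF n(3), where Q = "%r. r IN N" and G = mu and B = A and ?a0.0 = a])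
  show "dpred (%e. e 0 IN N)" "dfun (%e. mu (e 0))" by (intro dint)+
  show "code5 k a b c d IN N" if "a IN N" "b IN N" "c IN N" "d IN N" "k IN omega" for k a b c d
   using that N_code5 N_omega by blast
  show "ordi n IN N" if "n IN omega" for n using that ordi_N N_omega by blast
  show "mu (nand A n (F r) (F s)) = nand (mu A) n (mu (F r)) (mu (F s))" if "n IN omega" for n r s
   using mu_nand[OF A that] .
  show "mu (pj A n (F r)) = pj (mu A) n (mu (F r))" if "n IN omega" "r IN N" for n r
   using mu_pj[OF A that(1) M_F[OF that(2)]] .
 qed (use N_Ord a mu_dm[OF A] in auto)
 then obtain r where r: "r IN N" "fi A (vsucc n) r" "mu (F r) = R" by blast
 let ?X = "sec A n s (F r)"
 have "mu ?X = Y" using mu_sec[OF nat_M[OF n(1)] s(1)] s r n mu_nat[OF n(1)] by simp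
 moreover have "?X IN M" by (rule M_sec[OF A nat_M[OF n(1)] s(1) M_F[OF r(1)]])
 moreover have "?X IN (Def A)" unfolding mem_Def using n(1) s(2) fi_sound[OF N_Ord[OF r(1)] r(2)] by blast
 ultimately show ?thesis by blast
qed

lemma mu_Def_iff: "A IN M ==> X IN M ==> mu X IN (Def (mu A)) <-> X IN (Def A)"
 using mu_Def mu_Def_onto mu_inj by metis

lemma M_Lf: assumes "bt IN N" shows "Lf bt IN M"
proof -
 have "code5 k1 bt bt bt bt IN N" by (intro N_code5 assms N_omega) simp
 then show ?thesis using M_F F_kinds(2) N_Ord[OF assms] by metis
qed

text \<open>An element of \<open>Lf bt\<close> in \<open>M\<close> is definable over a stage whose
  index \<open>g6\<close> finds in \<open>N\<close>; conversely, elements of later collapsed stages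
  are lifted by \<open>mu_Def_onto\<close>.\<close>

lemma mu_Lf: assumes "bt IN N" shows "mu (Lf bt) = Lf (mu bt)"
proof -
 have "dpred (%e. e 0 IN N --> mu (Lf (e 0)) = Lf (mu (e 0)))" by (intro dint)
 then have "bt IN N --> mu (Lf bt) = Lf (mu bt)"
 proof (rule Ord_induct[OF _ N_Ord[OF assms]])
  fix bt assume IH: "!!ga. ga IN bt ==> ga IN N --> mu (Lf ga) = Lf (mu ga)"
  show "bt IN N --> mu (Lf bt) = Lf (mu bt)"
  proof
   assume b: "bt IN N"
   show "mu (Lf bt) = Lf (mu bt)"
   proof (rule ext, rule iffI)
    fix z assume "z IN (mu (Lf bt))"
    then obtain x where x: "x IN M" "x IN (Lf bt)" "z = mu x" by (rule mu_memE)
    obtain i where i: "i IN N" "Ord i" "F i = x" using x(1) by (rule M_E)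
    obtain l where l: "l IN bt" "x IN (Def (Lf l))" using x(2) unfolding elts_Lf by blast
    let ?P = "%k. k IN (K1 (J i bt)) & F (K0 (J i bt)) IN (Def (Lf k))"
    have "dpred (%e. ?P (e 0))" by (intro dint)
    from vleast(2)[of ?P l, OF this] have "?P (g6 (J i bt))"
     unfolding g6_def using l i Ord_in_Ord[OF N_Ord[OF b]] N_Ord[OF b] by simp
    then have g: "g6 (J i bt) IN bt" "x IN (Def (Lf (g6 (J i bt))))" using i N_Ord[OF b] by simp_all
    have gN: "g6 (J i bt) IN N" by (intro N_g N_J i b)
    have "z IN (Def (Lf (mu (g6 (J i bt)))))" using mu_Def[OF M_Lf[OF gN] x(1) g(2)] IH[OF g(1)] gN x by simp
    then show "z IN (Lf (mu bt))" unfolding elts_Lf[of "mu bt"] using mu_mem[OF N_sub_M[OF gN] g(1)] by blast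
   next
    fix z assume "z IN (Lf (mu bt))"
    then obtain dt where d: "dt IN (mu bt)" "z IN (Def (Lf dt))" unfolding elts_Lf by blast
    obtain ga where g: "ga IN N" "ga IN bt" "dt = mu ga" using mu_ordE[OF d(1) b] by blast
    then have "z IN (Def (mu (Lf ga)))" using IH d by simp
    then obtain X where X: "X IN M" "X IN (Def (Lf ga))" "mu X = z" using mu_Def_onto[OF M_Lf[OF g(1)]] by blast
    then have "X IN (Lf bt)" unfolding elts_Lf[of bt] using g by blast
    then show "z IN (mu (Lf bt))" using mu_mem[OF X(1)] X by blast
   qed
  qed
 qed
 then show ?thesis using assms by blast
qed

text \<open>The guards in \<open>Fop\<close> force arities to be natural numbers, which
  \<open>mu\<close> fixes; only for these is the collapse known to carry relations on sequences to
  the corresponding relations over \<open>mu A\<close>.\<close>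

lemma mu_Fop:
 assumes k: "k IN N" "a IN N" and M: "A IN M" "B IN M" "C IN M" "D IN M"
 shows "mu (Fop k a A B C D) = Fop (mu k) (mu a) (mu A) (mu B) (mu C) (mu D)"
proof -
 have kk: "mu k = n <-> k = n" if "n IN omega" for n using mu_nat_iff[OF N_sub_M[OF k(1)] that] .
 have B: "mu B = B" "mu C = C" "mu D = D" if "B IN omega" "C IN B" "D IN B"
  using mu_nat Ord_trans[OF Ord_omega] that by blast+
 have c: "mu B IN omega & mu C IN (mu B) & mu D IN (mu B) <-> B IN omega & C IN B & D IN B"
  using mu_in_omega M mu_mem_iff by blast
 have d: "mu (dm A B C D) = dm (mu A) (mu B) (mu C) (mu D)" "mu (de A B C D) = de (mu A) (mu B) (mu C) (mu D)"
  if "B IN omega & C IN B & D IN B" using mu_dm[OF M(1)] that B by simp_all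
 have n: "mu (nand A B C D) = nand (mu A) (mu B) (mu C) (mu D)" "mu (pj A B C) = pj (mu A) (mu B) (mu C)" if "B IN omega"
  using mu_nand[OF M(1) that] mu_pj[OF M(1) that M(3)] mu_nat[OF that] by simp_all
 show ?thesis unfolding Fop_def
  using kk[of vempty] kk[of k1] kk[of k2] kk[of k3] kk[of k4] kk[of k5] kk[of k6] kk[of k7] kk[of k8] c d n
   mu_in_omega[OF M(2)] mu_Lf[OF k(2)] mu_snoc[OF M(1,3), of B] mu_sec[OF M(2,3), of A D] mu_upair[OF M(1,2)] mu_empty
  by simp
qed

lemma mu_F: assumes "i IN N" shows "mu (F i) = F (mu i)"
proof -
 have "dpred (%e. e 0 IN N --> mu (F (e 0)) = F (mu (e 0)))" by (intro dint)
 then have "i IN N --> mu (F i) = F (mu i)"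
 proof (rule Ord_induct[OF _ N_Ord[OF assms]])
  fix i assume IH: "!!j. j IN i ==> j IN N --> mu (F j) = F (mu j)"
  show "i IN N --> mu (F i) = F (mu i)"
  proof
   assume i: "i IN N"
   obtain k a b c d where m: "k IN N" "a IN N" "b IN N" "c IN N" "d IN N"
    and o: "Ord k" "Ord a" "Ord b" "Ord c" "Ord d" "i = code5 k a b c d" using i by (rule N_code5E)
   have 1: "mu (F i) = Fop (mu k) (mu a) (mu (F a)) (mu (F b)) (mu (F c)) (mu (F d))"
    unfolding o(6) F_code5[OF o(1-5)] by (rule mu_Fop) (intro m M_F)+
   have 2: "F (mu i) = Fop (mu k) (mu a) (F (mu a)) (F (mu b)) (F (mu c)) (F (mu d))"
    unfolding o(6) mu_code5[OF m] by (intro F_code5 mu_Ord o)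
   show "mu (F i) = F (mu i)"
   proof (cases "k = vempty")
    case True
    then show ?thesis unfolding 1 2 using mu_empty by (simp add: Fop_def)
   next
    case False
    have "x IN i" if "x = a | x = b | x = c | x = d" for x using code5_lt[OF o(1-5) False that] o(6) by simp
    then show ?thesis unfolding 1 2 using IH m by simp
   qed
  qed
 qed
 then show ?thesis using assms by blast
qed

lemma M_Ord_iff: assumes "x IN M" shows "Ord (mu x) <-> Ord x"
proof -
 have "dpred (%e. e 0 IN M --> Ord (mu (e 0)) --> Ord (e 0))" by (intro dint)
 then have "x IN M --> Ord (mu x) --> Ord x"
 proof (rule set_induct)
  fix x assume IH: "!!y. y IN x ==> y IN M --> Ord (mu y) --> Ord y"
  show "x IN M --> Ord (mu x) --> Ord x"
  proof (intro impI, rule ccontr)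
   assume x: "x IN M" "Ord (mu x)" and no: "~Ord x"
   obtain i where i: "i IN N" "Ord i" "F i = x" using x(1) by (rule M_E)
   obtain y where y: "y IN x" "~(Ord y & E y <= E x)" using no OrdI by blast
   obtain l where l: "Ord l" "F l = y" by (rule F_surj)
   let ?P = "%k. F k IN (F i) & ~(Ord (F k) & E (F k) <= E (F i))"
   have "dpred (%e. ?P (e 0))" by (intro dint)
   from vleast(2)[of ?P l, OF this] have "?P (g5 i)" using y i l unfolding g5_def by simp
   then have w: "F (g5 i) IN x" "~(Ord (F (g5 i)) & E (F (g5 i)) <= E x)" "F (g5 i) IN M"
    using i M_F[OF N_g(5)[OF i(1)]] by simp_all
   have m: "mu (F (g5 i)) IN (mu x)" by (rule mu_mem[OF w(3,1)])
   have "Ord (F (g5 i))" using IH[OF w(1)] w(3) Ord_in_Ord[OF x(2) m] by blast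
   moreover have "E (F (g5 i)) <= E x" using Ord_sub[OF x(2) m] mu_sub_iff[OF w(3) x(1)] by blast
   ultimately show False using w by blast
  qed
 qed
 then show ?thesis using assms mu_Ord by blast
qed

lemma fi_mu: assumes A: "A IN M" and "r IN N" "n IN omega" shows "fi (mu A) n (mu r) <-> fi A n r"
proof -
 have "dpred (%e. e 0 IN N --> (ALL n:E omega. fi (mu A) n (mu (e 0)) <-> fi A n (e 0)))" by (intro dint)
 then have "r IN N --> (ALL n:E omega. fi (mu A) n (mu r) <-> fi A n r)"
 proof (rule Ord_induct[OF _ N_Ord[OF assms(2)]])
  fix i assume IH: "!!j. j IN i ==> j IN N --> (ALL n:E omega. fi (mu A) n (mu j) <-> fi A n j)"
  show "i IN N --> (ALL n:E omega. fi (mu A) n (mu i) <-> fi A n i)"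
  proof (intro impI ballI)
   fix n :: 'v assume i: "i IN N" and n: "n IN omega"
   obtain k a b c d where m: "k IN N" "a IN N" "b IN N" "c IN N" "d IN N"
    and o: "Ord k" "Ord a" "Ord b" "Ord c" "Ord d" "i = code5 k a b c d" using i by (rule N_code5E)
   have kk: "mu k = m <-> k = m" if "m IN omega" for m using mu_nat_iff[OF N_sub_M[OF m(1)] that] .
   have e: "mu (F b) = n <-> F b = n" "mu (F a) = mu A <-> F a = A" using mu_nat_iff[OF M_F[OF m(3)] n] mu_eq_iff[OF M_F[OF m(2)] A] .
   have g: "mu x IN n <-> x IN n" if "x IN M" for x using mu_mem_iff[OF that, of n] mu_nat[OF n] by simp
   have IH': "fi (mu A) n' (mu c) <-> fi A n' c" "fi (mu A) n' (mu d) <-> fi A n' d" if "n' IN omega" "k ~= vempty" for n'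
    using IH code5_lt[OF o(1-5) that(2)] that m unfolding o(6) by blast+
   show "fi (mu A) n (mu i) <-> fi A n i"
    unfolding o(6) mu_code5[OF m] fi_code5[OF o(1-5)]
     fi_code5[OF mu_Ord[OF o(1)] mu_Ord[OF o(2)] mu_Ord[OF o(3)] mu_Ord[OF o(4)] mu_Ord[OF o(5)]]
     mu_F[OF m(2), symmetric] mu_F[OF m(3), symmetric] mu_F[OF m(4), symmetric] mu_F[OF m(5), symmetric] e
     g[OF M_F[OF m(4)]] g[OF M_F[OF m(5)]]
    using kk[of k3] kk[of k4] kk[of k5] kk[of k6] IH'[OF n] IH'[OF succ_in_omega[OF n]] by (cases "k = vempty") auto
  qed
 qed
 then show ?thesis using assms by blast
qed

text \<open>Below the collapse of the least witness there are only collapses of members of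
  \<open>N\<close>, so minimality is preserved. If \<open>ph\<close> has no witness then, by the
  last premise, neither has \<open>ps\<close>, and both sides are \<open>vempty\<close>.\<close>

lemma sk_commute:
 assumes "dpred (%e. ph (e 0))" "vleast ph IN N" "!!k. k IN N ==> ps (mu k) <-> ph k"
  "!!k. Ord k ==> ps k ==> EX k. Ord k & ph k"
 shows "mu (vleast ph) = vleast ps"
proof (cases "EX k. Ord k & ph k")
 case True
 then obtain k where k: "Ord k" "ph k" by blast
 note v = vleast[OF assms(1) k]
 show ?thesis
 proof (rule vleast_eq[symmetric])
  show "Ord (mu (vleast ph))" using v(1) mu_Ord by blast
  show "ps (mu (vleast ph))" using v(2) assms(2,3) by blast
  fix dt assume "dt IN (mu (vleast ph))"
  then obtain ga where "ga IN N" "ga IN (vleast ph)" "dt = mu ga" using assms(2) by (rule mu_ordE)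
  then show "~ps dt" using v(4) assms(3) by blast
 qed
next
 case False
 then have "~(EX k. Ord k & ps k)" using assms(4) by blast
 then show ?thesis using vleast_none False mu_empty by metis
qed

text \<open>Commutation with the Skolem functions, and not only with \<open>F\<close>, is what makes
  the collapse of a hull a hull again. A witness for a collapsed membership statement is a member of
  a collapsed set and thus itself a collapse.\<close>

lemma mu_g:
 assumes i: "i IN N"
 shows "mu (g3 i) = g3 (mu i)" "mu (g4 i) = g4 (mu i)" "mu (g5 i) = g5 (mu i)" "mu (g6 i) = g6 (mu i)"
  "mu (g7 i) = g7 (mu i)" "mu (g8 i) = g8 (mu i)" "mu (g9 i) = g9 (mu i)"
proof -
 have K: "K0 i IN N" "K1 i IN N" using N_g[OF i] by blast+
 have ex: "EX k. Ord k & F k = x" for x :: 'v by (metis F_surj)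
 note m = M_F[OF i] M_F[OF K(1)] M_F[OF K(2)]
 note mi = mu_mem_iff[OF M_F]
 note F1 = mu_F[symmetric] mu_K[symmetric]
 show "mu (g3 i) = g3 (mu i)" unfolding g3_def
 proof (rule sk_commute)
  show "vleast (%k. F k IN (F (K0 i)) & F k ~: E (F (K1 i))) IN N" using N_g(3)[OF i] unfolding g3_def .
  fix k assume "F k IN (F (K0 (mu i))) & F k ~: E (F (K1 (mu i)))"
  then have k: "F k IN (mu (F (K0 i)))" "F k ~: E (mu (F (K1 i)))" using i K by (simp_all add: F1)
  obtain w where w: "w IN M" "w IN (F (K0 i))" "F k = mu w" using k(1) by (rule mu_memE)
  have "w ~: E (F (K1 i))" using w k(2) mu_mem by metis
  then show "EX k. Ord k & F k IN (F (K0 i)) & F k ~: E (F (K1 i))" using ex[of w] w by metis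
 qed (intro dint, simp add: F1 i K mi)
 show "mu (g4 i) = g4 (mu i)" unfolding g4_def
 proof (rule sk_commute)
  show "vleast (%k. k = F i) IN N" using N_g(4)[OF i] unfolding g4_def .
  fix k assume "Ord k" "k = F (mu i)"
  then show "EX k. Ord k & k = F i" using M_Ord_iff[OF m(1)] mu_F[OF i] by metis
 qed (intro dint, use i mu_eq_iff[OF N_sub_M m(1)] mu_F[OF i] in auto)
 show "mu (g5 i) = g5 (mu i)" unfolding g5_def
 proof (rule sk_commute)
  show "vleast (%k. F k IN (F i) & ~(Ord (F k) & E (F k) <= E (F i))) IN N" using N_g(5)[OF i] unfolding g5_def .
  show "F (mu k) IN (F (mu i)) & ~(Ord (F (mu k)) & E (F (mu k)) <= E (F (mu i))) <->
    F k IN (F i) & ~(Ord (F k) & E (F k) <= E (F i))" if k: "k IN N" for k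
   unfolding mu_F[OF k, symmetric] mu_F[OF i, symmetric] mi[OF k] M_Ord_iff[OF M_F[OF k]] mu_sub_iff[OF M_F[OF k] m(1)] ..
  fix k assume "F k IN (F (mu i)) & ~(Ord (F k) & E (F k) <= E (F (mu i)))"
  then have k: "F k IN (mu (F i))" "~(Ord (F k) & E (F k) <= E (mu (F i)))" using mu_F[OF i] by simp_all
  obtain w where w: "w IN M" "w IN (F i)" "F k = mu w" using k(1) by (rule mu_memE)
  have "~(Ord w & E w <= E (F i))" using k(2) w M_Ord_iff[OF w(1)] mu_sub_iff[OF w(1) m(1)] by simp
  then show "EX k. Ord k & F k IN (F i) & ~(Ord (F k) & E (F k) <= E (F i))" using ex[of w] w by metis
 qed (intro dint)
 show "mu (g6 i) = g6 (mu i)" unfolding g6_def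
 proof (rule sk_commute)
  show "vleast (%k. k IN (K1 i) & F (K0 i) IN (Def (Lf k))) IN N" using N_g(6)[OF i] unfolding g6_def .
  show *: "mu k IN (K1 (mu i)) & F (K0 (mu i)) IN (Def (Lf (mu k))) <-> k IN (K1 i) & F (K0 i) IN (Def (Lf k))"
   if k: "k IN N" for k
   unfolding mu_K[OF i, symmetric] mu_F[OF K(1), symmetric] mu_Lf[OF k, symmetric] mu_mem_iff[OF N_sub_M[OF k]] mu_Def_iff[OF M_Lf[OF k] m(2)] ..
  fix k assume k: "k IN (K1 (mu i)) & F (K0 (mu i)) IN (Def (Lf k))"
  then have "k IN (mu (K1 i))" using mu_K[OF i] by simp
  then obtain c where c: "c IN N" "c IN (K1 i)" "k = mu c" using K(2) by (rule mu_ordE)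
  then show "EX k. Ord k & k IN (K1 i) & F (K0 i) IN (Def (Lf k))" using *[OF c(1)] k N_Ord by blast
 qed (intro dint)
 show "mu (g7 i) = g7 (mu i)" unfolding g7_def
 proof (rule sk_commute)
  show "vleast (%k. vpair (K1 i) (F k) IN (F (K0 i))) IN N" using N_g(7)[OF i] unfolding g7_def .
  show "vpair (K1 (mu i)) (F (mu k)) IN (F (K0 (mu i))) <-> vpair (K1 i) (F k) IN (F (K0 i))" if k: "k IN N" for k
   unfolding mu_K[OF i, symmetric] mu_F[OF K(1), symmetric] mu_F[OF k, symmetric] mu_vpair[OF N_sub_M[OF K(2)] M_F[OF k], symmetric]
    mu_mem_iff[OF M_vpair[OF N_sub_M[OF K(2)] M_F[OF k]]] ..
  fix k assume "vpair (K1 (mu i)) (F k) IN (F (K0 (mu i)))"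
  then have k: "vpair (mu (K1 i)) (F k) IN (mu (F (K0 i)))" using i K by (simp add: F1)
  obtain p where p: "p IN M" "p IN (F (K0 i))" "vpair (mu (K1 i)) (F k) = mu p" using k by (rule mu_memE)
  have "upair (mu (K1 i)) (F k) IN (mu p)" unfolding p(3)[symmetric] vpair_upair by simp
  then obtain q where q: "q IN M" "q IN p" "upair (mu (K1 i)) (F k) = mu q" by (rule mu_memE)
  have "F k IN (mu q)" unfolding q(3)[symmetric] by simp
  then obtain w where w: "w IN M" "w IN q" "F k = mu w" by (rule mu_memE)
  have "mu p = mu (vpair (K1 i) w)" using p w mu_vpair[OF N_sub_M[OF K(2)] w(1)] by simp
  then have "p = vpair (K1 i) w" using mu_inj[OF p(1) M_vpair[OF N_sub_M[OF K(2)] w(1)]] by simp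
  then show "EX k. Ord k & vpair (K1 i) (F k) IN (F (K0 i))" using ex[of w] p by metis
 qed (intro dint)
 note KK = N_g(1)[OF K(1)] N_g(2)[OF K(1)] N_g(1)[OF K(2)] N_g(2)[OF K(2)]
 note FK = mu_K[OF i, symmetric] mu_K[OF K(1), symmetric] mu_K[OF K(2), symmetric]
  mu_F[OF KK(1), symmetric] mu_F[OF KK(2), symmetric] mu_F[OF KK(3), symmetric] mu_F[OF KK(4), symmetric]
 note mKK = M_F[OF KK(1)] M_F[OF KK(2)] M_F[OF KK(3)] M_F[OF KK(4)]
 show "mu (g8 i) = g8 (mu i)" unfolding g8_def
 proof (rule sk_commute)
  show "vleast (%k. F k IN (F (K0 (K0 i))) & snoc (F (K1 (K0 i))) (F (K0 (K1 i))) (F k) IN (F (K1 (K1 i)))) IN N"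
   using N_g(8)[OF i] unfolding g8_def .
  have *: "mu w IN (F (K0 (K0 (mu i)))) & snoc (F (K1 (K0 (mu i)))) (F (K0 (K1 (mu i)))) (mu w) IN (F (K1 (K1 (mu i)))) <->
    w IN (F (K0 (K0 i))) & snoc (F (K1 (K0 i))) (F (K0 (K1 i))) w IN (F (K1 (K1 i)))" if w: "w IN M" for w
   unfolding FK mu_snoc[OF mKK(2) w, symmetric] mu_mem_iff[OF w] mu_mem_iff[OF M_snoc[OF mKK(2,3) w]] ..
  show "F (mu k) IN (F (K0 (K0 (mu i)))) & snoc (F (K1 (K0 (mu i)))) (F (K0 (K1 (mu i)))) (F (mu k)) IN (F (K1 (K1 (mu i)))) <->
    F k IN (F (K0 (K0 i))) & snoc (F (K1 (K0 i))) (F (K0 (K1 i))) (F k) IN (F (K1 (K1 i)))" if k: "k IN N" for k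
   using *[OF M_F[OF k]] mu_F[OF k] by simp
  fix k assume k: "F k IN (F (K0 (K0 (mu i)))) & snoc (F (K1 (K0 (mu i)))) (F (K0 (K1 (mu i)))) (F k) IN (F (K1 (K1 (mu i))))"
  then have "F k IN (mu (F (K0 (K0 i))))" unfolding FK by blast
  then obtain w where w: "w IN M" "w IN (F (K0 (K0 i)))" "F k = mu w" by (rule mu_memE)
  then show "EX k. Ord k & F k IN (F (K0 (K0 i))) & snoc (F (K1 (K0 i))) (F (K0 (K1 i))) (F k) IN (F (K1 (K1 i)))"
   using *[OF w(1)] k ex[of w] by metis
 qed (intro dint)
 show "mu (g9 i) = g9 (mu i)" unfolding g9_def
 proof (rule sk_commute)
  show "vleast (dwit (F (K0 i)) (F (K1 i))) IN N" using N_g(9)[OF i] unfolding g9_def .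
  show "dpred (%e. dwit (F (K0 i)) (F (K1 i)) (e 0))" by (intro dint)
  show "dwit (F (K0 (mu i))) (F (K1 (mu i))) (mu k) <-> dwit (F (K0 i)) (F (K1 i)) k" if k: "k IN N" for k
  proof -
   note kN = N_g(1)[OF k] N_g(2)[OF k] N_g(1)[OF N_g(2)[OF k]] N_g(2)[OF N_g(2)[OF k]]
   have e: "F (K0 (mu i)) = mu (F (K0 i))" "F (K1 (mu i)) = mu (F (K1 i))" "K0 (mu k) = mu (K0 k)"
    "F (K0 (K1 (mu k))) = mu (F (K0 (K1 k)))" "K1 (K1 (mu k)) = mu (K1 (K1 k))" "F (K1 (K1 (mu k))) = mu (F (K1 (K1 k)))"
    using mu_F[OF K(1)] mu_F[OF K(2)] mu_K[OF i] mu_K[OF k] mu_K[OF kN(2)] mu_F[OF kN(3)] mu_F[OF kN(4)] by simp_all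
   show ?thesis
   proof (cases "K0 k IN omega")
    case True
    have "mu (F (K0 i)) = sec (mu (F (K1 i))) (mu (K0 k)) (mu (F (K0 (K1 k)))) (mu (F (K1 (K1 k)))) <->
      F (K0 i) = sec (F (K1 i)) (K0 k) (F (K0 (K1 k))) (F (K1 (K1 k)))"
     unfolding mu_sec[OF N_sub_M[OF kN(1)] M_F[OF kN(3)], symmetric]
     by (rule mu_eq_iff[OF m(2) M_sec[OF m(3) N_sub_M[OF kN(1)] M_F[OF kN(3)] M_F[OF kN(4)]]])
    then show ?thesis unfolding dwit_def e
     using mu_nat[OF True] mu_fun_iff[OF m(3) M_F[OF kN(3)] True] fi_mu[OF m(3) kN(4) succ_in_omega[OF True]] True mu_F[OF kN(4)] by simp
   next
    case False
    then show ?thesis unfolding dwit_def e using mu_in_omega[OF N_sub_M[OF kN(1)]] by simp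
   qed
  qed
  fix k assume k: "Ord k" "dwit (F (K0 (mu i))) (F (K1 (mu i))) k"
  then have "mu (F (K0 i)) IN (Def (mu (F (K1 i))))" unfolding Def_dwit using mu_F[OF K(1)] mu_F[OF K(2)] mu_K[OF i] by auto
  then have "F (K0 i) IN (Def (F (K1 i)))" unfolding mu_Def_iff[OF m(3,2)] .
  then show "EX k. Ord k & dwit (F (K0 i)) (F (K1 i)) k" unfolding Def_dwit .
 qed
qed

text \<open>What the construction of the tree uses of condensation is expressed by ordinals and
  \<open>col N\<close> alone; the coded sets and \<open>M\<close> disappear from view.\<close>

theorem condensation:
 shows "a IN N ==> b IN N ==> col N (J a b) = J (col N a) (col N b)"
  "i IN N ==> E (HH (col N i)) = col N ` E (HH i)"
  "i IN N ==> col N (g4 i) = g4 (col N i)" "i IN N ==> col N (g7 i) = g7 (col N i)"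
proof -
 show "a IN N ==> b IN N ==> col N (J a b) = J (col N a) (col N b)"
  using mu_J mu_col N_Ord J_Ord by metis
 have e: "col N x = mu x" if "x IN N" for x using mu_col[OF N_Ord[OF that]] by simp
 show "E (HH (col N i)) = col N ` E (HH i)" if i: "i IN N"
  unfolding elts_HH using mu_g[OF i] mu_K[OF i] N_g[OF i] by (simp add: e i)
 show "i IN N ==> col N (g4 i) = g4 (col N i)" "i IN N ==> col N (g7 i) = g7 (col N i)"
  using mu_g N_g e by metis+
qed

end

section \<open>Choice and cardinality\<close>

text \<open>A global choice function: since \<open>F\<close> is onto, the least code of an instance
  selects one. Being definable, the choice may be made inside separations, images and
  recursions.\<close>

definition chs :: "('v::zfc => bool) => 'v" where "chs P = F (vleast (%i. P (F i)))"

lemma [dint]: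
 fixes P :: "'v::zfc => (nat => 'v) => bool"
 assumes "dpred (%e. P (e 0) (%n. e (Suc n)))" shows "dfun (%e. chs (%x. P x e))"
proof -
 have "dfun (%e. F (e 0) :: 'v)" by (intro dint)
 then have "dfun (if n = 0 then (%e::nat => 'v. F (e 0)) else (%e. e n))" for n by (simp add: dfun_var)
 from dpred_subst_all[OF assms, of "%n. if n = 0 then (%e. F (e 0)) else (%e. e n)", OF this]
 have "dpred (%e. P (F (e 0)) (%n. e (Suc n)))" by simp
 then show ?thesis unfolding chs_def by (intro dint)
qed

text \<open>\<open>op\<close> is set-valued, so one binary operation expresses closure under any
  finite list of functions.\<close>

definition clo_it :: "('v::zfc => 'v => 'v) => 'v => 'v => 'v" where
 "clo_it op G n = erec (%n f. vun G (vUN n (%m. vUN (ap f m) (%x. vUN (ap f m) (%y. op x y))))) n"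

definition clo :: "('v::zfc => 'v => 'v) => 'v => 'v" where
 "clo op G = clo_it op G omega"

lemma dfun_clo_it [dint]:
 assumes op: "dfun (%e. op (%n. e (Suc (Suc n))) (e 0) (e (Suc 0)))" and G: "dfun G" and n: "dfun n"
 shows "dfun (%e. clo_it (op e) (G e) (n e))"
proof -
 have op': "dfun (%e. op (%n. p n e) (q e) (a e))" if "!!n. dfun (p n)" "dfun q" "dfun a" for p q a
 proof -
  have "dfun (case n of 0 => q | Suc m => (case m of 0 => a | Suc k => p k))" for n
   using that by (auto split: nat.split)
  from dfun_subst_all[OF op, of "%n. case n of 0 => q | Suc m => (case m of 0 => a | Suc k => p k)", OF this]
  show ?thesis by simp
 qed
 have G': "dfun (%e. G (%n. p n e))" if "!!n. dfun (p n)" for p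
  using dfun_subst_all[OF G that] by simp
 show ?thesis unfolding clo_it_def by (intro dint op' G' n)
qed

lemma [dint]:
 assumes "dfun (%e. op (%n. e (Suc (Suc n))) (e 0) (e (Suc 0)))" "dfun G"
 shows "dfun (%e. clo (op e) (G e))"
 unfolding clo_def by (intro dfun_clo_it assms dint)

context
 fixes op :: "'v::zfc => 'v => 'v"
 assumes dop: "dfun (%e. op (e 0) (e (Suc 0)))"
begin

lemma dop': "dfun f ==> dfun g ==> dfun (%e. op (f e) (g e))"
 by (rule dfun_comp2[where K = op, OF dop])

lemma elts_clo_it:
 "E (clo_it op G n) = E G Un (UN m:E n. UN x:E (clo_it op G m). UN y:E (clo_it op G m). E (op x y))"
proof -
 let ?G = "%n f. vun G (vUN n (%m. vUN (ap f m) (%x. vUN (ap f m) (%y. op x y))))"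
 have "dfun (%e. ?G (e 0) (e (Suc 0)))" by (intro dint dop')
 from erec_eq[OF this, of n] have e: "clo_it op G n = ?G n (vlam n (clo_it op G))" unfolding clo_it_def .
 have d0: "dfun (%e. clo_it op G (e 0))" by (intro dint dop')
 have d1: "dfun (%e. vUN (ap (vlam n (clo_it op G)) (e 0)) (%x. vUN (ap (vlam n (clo_it op G)) (e 0)) (%y. op x y)))" by (intro dint dop')
 have d2: "dfun (%e. vUN A (%y. op (e 0) y))" for A by (intro dint dop')
 have d3: "dfun (%e. op x (e 0))" for x by (intro dint dop')
 show ?thesis unfolding e elts_vun elts_vUN[OF d1] elts_vUN[OF d2] elts_vUN[OF d3] by (simp add: ap_vlam[OF d0])
qed

lemma clo_it_mono: "E m <= E n ==> E (clo_it op G m) <= E (clo_it op G n)"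
 unfolding elts_clo_it[of G m] elts_clo_it[of G n] by (intro Un_mono UN_mono subset_refl)

lemma clo_eq: "E (clo op G) = (UN n:E omega. E (clo_it op G n))"
proof (rule equalityI)
 show "E (clo op G) <= (UN n:E omega. E (clo_it op G n))"
 proof
  fix z assume "z IN (clo op G)"
  then consider "z IN G" | m where "m IN omega" "z : (UN x:E (clo_it op G m). UN y:E (clo_it op G m). E (op x y))"
   unfolding clo_def elts_clo_it[of G omega] by blast
  then show "z : (UN n:E omega. E (clo_it op G n))"
  proof cases
   case 1
   then have "z IN (clo_it op G vempty)" unfolding elts_clo_it[of G vempty] by simp
   then show ?thesis using zero_in_omega by blast
  next
   case 2
   then have "z IN (clo_it op G (vsucc m))" unfolding elts_clo_it[of G "vsucc m"] by auto
   then show ?thesis using succ_in_omega[OF 2(1)] by blast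
  qed
 qed
 have "E (clo_it op G n) <= E (clo op G)" if "n IN omega" for n
  unfolding clo_def by (rule clo_it_mono) (rule Ord_sub[OF Ord_omega that])
 then show "(UN n:E omega. E (clo_it op G n)) <= E (clo op G)" by blast
qed

lemma clo_base: "E G <= E (clo op G)"
 unfolding clo_def elts_clo_it[of G omega] by blast

lemma clo_closed: assumes "x IN (clo op G)" "y IN (clo op G)" shows "E (op x y) <= E (clo op G)"
proof -
 obtain n m where nm: "n IN omega" "x IN (clo_it op G n)" "m IN omega" "y IN (clo_it op G m)"
  using assms unfolding clo_eq by blast
 have "E n <= E m | E m <= E n" using Ord_linear[of n m] nm Ord_nat Ord_sub by blast
 then obtain k where "k IN omega" "x IN (clo_it op G k)" "y IN (clo_it op G k)"
  using nm clo_it_mono by blast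
 then show ?thesis unfolding clo_def elts_clo_it[of G omega] by blast
qed

lemma clo_least:
 assumes "E G <= E H" "!!x y. x IN H ==> y IN H ==> E (op x y) <= E H"
 shows "E (clo op G) <= E H"
proof -
 have "dpred (%e. E (clo_it op G (e 0)) <= E H)" by (intro dint dop')
 then have "n IN omega ==> E (clo_it op G n) <= E H" for n
 proof (rule Ord_induct[OF _ Ord_nat])
  fix n assume IH: "!!m. m IN n ==> E (clo_it op G m) <= E H"
  show "E (clo_it op G n) <= E H"
  proof
   fix z assume "z IN (clo_it op G n)"
   then consider "z IN G" | m x y where "m IN n" "x IN (clo_it op G m)" "y IN (clo_it op G m)" "z IN (op x y)"
    unfolding elts_clo_it[of G n] by blast
   then show "z IN H"
   proof cases
    case 2
    then have "x IN H" "y IN H" using IH by blast+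
    then show ?thesis using assms(2) 2(4) by blast
   qed (use assms in blast)
  qed
 qed
 then show ?thesis unfolding clo_eq by blast
qed

lemma clo_mono: "E G <= E G' ==> E (clo op G) <= E (clo op G')"
 by (rule clo_least) (use clo_base[of G'] clo_closed in blast)+

end

context VL
begin

lemma chs: "dpred (%e. P (e 0)) ==> P (x::'v) ==> P (chs P)"
proof -
 assume d: "dpred (%e. P (e 0))" and x: "P x"
 obtain i where i: "Ord i" "F i = x" by (rule F_surj)
 have dF: "dfun (%e. F (e 0))" by (intro dint)
 have "dpred (%e. P (F (e 0)))" by (rule dpred_comp1[OF d dF])
 from vleast(2)[of "%i. P (F i)" i, OF this] i x show ?thesis unfolding chs_def by blast
qed

section \<open>Cardinal arithmetic by global choice\<close>

lemma card_le_vimg: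
 fixes A :: 'v
 assumes "dfun (%e. f (e 0))" "card_le A ka" shows "card_le (vimg f A) ka"
proof -
 have df: "dfun g ==> dfun (%e. f (g e))" for g by (rule dfun_comp1[where K = f, OF assms(1)])
 define g where "g y = chs (%x. x IN A & f x = y)" for y
 have dg: "dfun (%e. g (e 0))" unfolding g_def by (intro dint df)
 have g: "g y IN A & f (g y) = y" if y: "y IN (vimg f A)" for y
 proof -
  obtain x where x: "x IN A & f x = y" using y unfolding elts_vimg[OF assms(1)] by blast
  have "dpred (%e. e 0 IN A & f (e 0) = y)" by (intro dint df)
  from chs[OF this x] show ?thesis unfolding g_def .
 qed
 have "card_le (vimg f A) A" by (rule card_leI[OF dg]) (use g in metis)+
 then show ?thesis using assms(2) card_le_trans by blast
qed

lemma card_le_surj: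
 fixes A B :: 'v
 assumes "dfun (%e. f (e 0))" "card_le A ka" "!!y. y IN B ==> EX x:E A. y = f x" shows "card_le B ka"
proof -
 have "E B <= E (vimg f A)" unfolding elts_vimg[OF assms(1)] using assms(3) by blast
 then show ?thesis using card_le_trans[OF card_le_subset card_le_vimg[OF assms(1,2)]] by blast
qed

lemma card_le_vUN:
 fixes I :: 'v
 assumes dX: "dfun (%e. X (e 0))" and I: "card_le I ka" and X: "!!i. i IN I ==> card_le (X i) ka" and sq: "card_le (vtimes ka ka) ka"
 shows "card_le (vUN I X) ka"
proof -
 have dX': "dfun g ==> dfun (%e. X (g e))" for g by (rule dfun_comp1[where K = X, OF dX])
 obtain g where g: "ALL x:E I. ap g x IN ka" "ALL x:E I. ALL y:E I. ap g x = ap g y --> x = y" using I by (rule card_leE)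
 define c where "c z = chs (%i. i IN I & z IN (X i))" for z
 define h where "h i = chs (%f. is_injection f (X i) ka)" for i
 have dc: "dfun f ==> dfun (%e. c (f e))" for f by (rule dfun_comp1[where K = c]) (unfold c_def, intro dint dX')
 have dh: "dfun f ==> dfun (%e. h (f e))" for f by (rule dfun_comp1[where K = h]) (unfold h_def, intro dint dX')
 have c: "c z IN I & z IN (X (c z))" if z: "z IN (vUN I X)" for z
 proof -
  obtain x where x: "x IN I & z IN (X x)" using z unfolding elts_vUN[OF dX] by blast
  have "dpred (%e. e 0 IN I & z IN (X (e 0)))" by (intro dint dX')
  from chs[OF this x] show ?thesis unfolding c_def .
 qed
 have h: "is_injection (h i) (X i) ka" if i: "i IN I" for i
 proof -
  obtain f where f: "is_injection f (X i) ka" using X[OF i] unfolding card_le_def by blast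
  have "dpred (%e. is_injection (e 0) (X i) ka)" by (intro dint dX')
  from chs[OF this f] show ?thesis unfolding h_def .
 qed
 have "dfun (%e. vpair (ap g (c (e 0))) (ap (h (c (e 0))) (e 0)))" by (intro dint dc dh)
 then have "card_le (vUN I X) (vtimes ka ka)"
 proof (rule card_leI)
  fix z assume z: "z IN (vUN I X)"
  have "ap (h (c z)) z IN ka" using h c[OF z] ap_type unfolding is_injection_iff by blast
  then show "vpair (ap g (c z)) (ap (h (c z)) z) IN (vtimes ka ka)" using g c[OF z] by auto
 next
  fix x y assume x: "x IN (vUN I X)" and y: "y IN (vUN I X)"
   and e: "vpair (ap g (c x)) (ap (h (c x)) x) = vpair (ap g (c y)) (ap (h (c y)) y)"
  have "c x = c y" using e g c[OF x] c[OF y] by auto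
  then show "x = y" using e h[of "c x"] c[OF x] c[OF y] unfolding is_injection_iff by auto
 qed
 then show ?thesis using sq card_le_trans by blast
qed

lemma omega_square: "card_le (vtimes omega omega) (omega::'v)"
proof -
 define f where "f z = J (vthe (%x. EX y. z = vpair x y)) (vsnd z)" for z :: 'v
 have d: "dfun (%e. f (e 0))" unfolding f_def by (intro dint)
 have "vthe (%x'. EX y'. vpair x y = vpair x' y') = x" for x y :: 'v by (rule vthe_eq) auto
 then have f: "f (vpair x y) = J x y" for x y unfolding f_def by simp
 show ?thesis by (rule card_leI[OF d]) (auto simp: f J_nat J_inject Ord_nat)
qed

lemma countable_UN: "dfun (%e. X (e 0)) ==> vcountable I ==> (!!i. i IN I ==> vcountable (X i)) ==> vcountable (vUN I (X :: 'v => 'v))"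
 unfolding vcountable_def using card_le_vUN omega_square by blast

text \<open>Regularity of \<open>omega1\<close>: the union of the successors of the values is
  transitive and a countable union of countable sets.\<close>

lemma omega1_sup:
 fixes W :: 'v
 assumes "dfun (%e. f (e 0))" "vcountable W" "!!x. x IN W ==> f x : O1"
 shows "EX dt:O1. ALL x:E W. f x IN dt"
proof -
 have df: "dfun g ==> dfun (%e. f (g e))" for g by (rule dfun_comp1[where K = f, OF assms(1)])
 have d: "dfun (%e. vsucc (f (e 0)))" by (intro dint df)
 let ?u = "vUN W (%x. vsucc (f x))"
 have "vcountable ?u" by (rule countable_UN[OF d assms(2)]) (use assms(3) in \<open>simp add: vcountable_def mem_omega1[symmetric] succ_in_omega1 mem_omega1[THEN iffD1]\<close>)
 moreover have "Ord ?u"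
 proof (rule OrdI)
  fix x assume "x IN ?u"
  then obtain w where w: "w IN W" "x IN (vsucc (f w))" unfolding elts_vUN[OF d] by blast
  have o: "Ord (vsucc (f w))" using assms(3)[OF w(1)] mem_omega1 Ord_vsucc by blast
  show "Ord x" using Ord_in_Ord[OF o w(2)] .
  show "E x <= E ?u" unfolding elts_vUN[OF d] using Ord_sub[OF o w(2)] w(1) by blast
 qed
 ultimately have "?u : O1" by (simp add: mem_omega1 vcountable_def)
 moreover have "ALL x:E W. f x IN ?u" unfolding elts_vUN[OF d] by auto
 ultimately show ?thesis by blast
qed

lemma clo_card:
 fixes op :: "'v => 'v => 'v"
 assumes dop: "dfun (%e. op (e 0) (e (Suc 0)))" and G: "card_le G ka" and op: "!!x y. card_le (op x y) ka"
  and om: "card_le omega ka" and sq: "card_le (vtimes ka ka) ka" and un: "!!A B. card_le A ka ==> card_le B ka ==> card_le (vun A B) ka"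
 shows "card_le (clo op G) ka"
proof -
 note d = dop'[OF dop]
 have dit: "dfun f ==> dfun (%e. clo_it op G (f e))" for f by (intro dint d)
 have eq: "clo_it op G n = vun G (vUN n (%m. vUN (clo_it op G m) (%x. vUN (clo_it op G m) (%y. op x y))))" for n
 proof (rule extensionality)
  have d1: "dfun (%e. vUN (clo_it op G (e 0)) (%x. vUN (clo_it op G (e 0)) (%y. op x y)))" by (intro dint d)
  have d2: "dfun (%e. vUN A (%y. op (e 0) y))" for A by (intro dint d)
  have d3: "dfun (%e. op x (e 0))" for x by (intro dint d)
  show "E (clo_it op G n) = E (vun G (vUN n (%m. vUN (clo_it op G m) (%x. vUN (clo_it op G m) (%y. op x y)))))"
   unfolding elts_vun elts_vUN[OF d1] elts_vUN[OF d2] elts_vUN[OF d3] by (rule elts_clo_it[OF dop])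
 qed
 have "dpred (%e. card_le (clo_it op G (e 0)) ka)" by (intro dint d)
 then have c: "card_le (clo_it op G n) ka" if "n IN omega | n = omega" for n
 proof -
  have o: "Ord n" using that Ord_nat by auto
  have "dpred (%e. e 0 IN omega | e 0 = omega --> card_le (clo_it op G (e 0)) ka)" by (intro dint d)
  then have "n IN omega | n = omega --> card_le (clo_it op G n) ka"
  proof (rule Ord_induct[OF _ o])
   fix n assume IH: "!!m. m IN n ==> m IN omega | m = omega --> card_le (clo_it op G m) ka"
   show "n IN omega | n = omega --> card_le (clo_it op G n) ka"
   proof
    assume n: "n IN omega | n = omega"
    then have sub: "E n <= E omega" using Ord_sub[OF Ord_omega] by blast
    have d1: "dfun (%e. vUN (clo_it op G (e 0)) (%x. vUN (clo_it op G (e 0)) (%y. op x y)))" by (intro dint d)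
    have d2: "dfun (%e. vUN A (%y. op (e 0) y))" for A by (intro dint d)
    have d3: "dfun (%e. op x (e 0))" for x by (intro dint d)
    have m: "card_le (clo_it op G m) ka" if "m IN n" for m using IH[OF that] sub that by blast
    show "card_le (clo_it op G n) ka" unfolding eq[of n]
     by (intro un G card_le_vUN[OF d1] card_le_vUN[OF d2] card_le_vUN[OF d3] sq op m card_le_trans[OF card_le_subset[OF sub] om])
   qed
  qed
  then show ?thesis using that by blast
 qed
 then show ?thesis unfolding clo_def by blast
qed

lemma countable_upair: "card_le (upair A B) (omega::'v)"
proof -
 have "dfun (%e. if e 0 = A then vempty else k1)" by (intro dint)
 then show ?thesis by (rule card_leI) (auto split: if_splits)
qed

lemma countable_vun: "card_le A omega ==> card_le B omega ==> card_le (vun A B) (omega::'v)"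
proof -
 assume a: "card_le A omega" "card_le B omega"
 have d: "dfun (%e. e 0)" by (intro dint)
 have "card_le (vUN (upair A B) (%x. x)) omega" by (rule card_le_vUN[OF d countable_upair _ omega_square]) (use a in auto)
 moreover have "vUN (upair A B) (%x. x) = vun A B" by (rule extensionality) (simp add: elts_vUN[OF d])
 ultimately show ?thesis by simp
qed

lemma clo_countable:
 fixes op :: "'v => 'v => 'v"
 assumes "dfun (%e. op (e 0) (e (Suc 0)))" "card_le G omega" "!!x y. card_le (op x y) omega"
 shows "card_le (clo op G) omega"
 by (rule clo_card[OF assms _ omega_square countable_vun]) (rule card_le_subset, simp)

end

section \<open>Stationary sets\<close>

locale KT = VL ty for ty :: "'v::zfc itself" +
 fixes p :: 'v
 assumes p: "is_bijection p (vtimes omega1 omega1) omega1"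
begin

definition pr :: "'v => 'v => 'v" where "pr x y = ap p (vpair x y)"
definition q0 :: "'v => 'v" where "q0 z = vthe (%x. x : O1 & (EX y:O1. pr x y = z))"
definition q1 :: "'v => 'v" where "q1 z = vthe (%y. y : O1 & (EX x:O1. pr x y = z))"

lemma [dint]: "dfun f ==> dfun g ==> dfun (%e. pr (f e) (g e))"
 unfolding pr_def by (intro dint)

lemma [dint]: assumes "dfun f" shows "dfun (%e. q0 (f e))" "dfun (%e. q1 (f e))"
 by (rule dfun_comp1[where K = q0], unfold q0_def, intro dint, fact, rule dfun_comp1[where K = q1], unfold q1_def, intro dint, fact)

lemma pr_type [simp]: "x : O1 ==> y : O1 ==> pr x y : O1"
 unfolding pr_def using p ap_type[of p "vtimes omega1 omega1" omega1 "vpair x y"] unfolding is_bijection_iff by auto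

lemma pr_inject: "x : O1 ==> y : O1 ==> x' : O1 ==> y' : O1 ==>
  pr x y = pr x' y' <-> x = x' & y = y'"
proof -
 assume a: "x : O1" "y : O1" "x' : O1" "y' : O1"
 have "ALL x:E (vtimes omega1 omega1). ALL y:E (vtimes omega1 omega1). ap p x = ap p y --> x = y"
  using p unfolding is_bijection_iff by blast
 moreover have "vpair x y IN (vtimes omega1 omega1)" "vpair x' y' IN (vtimes omega1 omega1)" using a by auto
 ultimately have "ap p (vpair x y) = ap p (vpair x' y') --> vpair x y = vpair x' y'" by blast
 then show ?thesis unfolding pr_def by auto
qed

lemma q_pr [simp]: assumes "x : O1" "y : O1" shows "q0 (pr x y) = x" "q1 (pr x y) = y"
 unfolding q0_def q1_def by (rule vthe_eq; use assms pr_inject in blast)+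

lemma pr_q: assumes "z : O1" shows "q0 z : O1" "q1 z : O1" "pr (q0 z) (q1 z) = z"
proof -
 have "EX u:E (vtimes omega1 omega1). ap p u = z" using p assms unfolding is_bijection_iff by blast
 then obtain x y where "x : O1" "y : O1" "pr x y = z" unfolding pr_def by auto
 then show "q0 z : O1" "q1 z : O1" "pr (q0 z) (q1 z) = z" using q_pr by metis+
qed

lemma omega1_square: "card_le (vtimes omega1 omega1) (omega1::'v)"
 using p unfolding card_le_def is_bijection_iff is_injection_iff by blast

lemma card_le_omega1: "card_le A omega ==> card_le A (omega1::'v)"
 using card_le_trans card_le_subset[OF omega_sub_omega1] by blast

lemma omega1_vun: "card_le A omega1 ==> card_le B omega1 ==> card_le (vun A B) (omega1::'v)"
proof -
 assume a: "card_le A omega1" "card_le B omega1"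
 have d: "dfun (%e. e 0)" by (intro dint)
 have "card_le (vUN (upair A B) (%x. x)) omega1"
  by (rule card_le_vUN[OF d card_le_omega1[OF countable_upair] _ omega1_square]) (use a in auto)
 moreover have "vUN (upair A B) (%x. x) = vun A B" by (rule extensionality) (simp add: elts_vUN[OF d])
 ultimately show ?thesis by simp
qed

text \<open>The sets of closure points of functions \<open>g\<close> stand for the clubs. The
  additional clauses make each closure point a limit above \<open>omega\<close> that is closed under
  the fixed pairing, so that pairs can be used as indices in diagonal arguments.\<close>

definition cpt :: "'v => 'v => bool" where
 "cpt g xi <-> xi : O1 & omega IN xi & (ALL eh:E xi. vsucc eh IN xi) &
  (ALL eh:E xi. ALL zt:E xi. pr eh zt IN xi) & (ALL eh:E xi. ap g eh IN xi)"

definition stat :: "'v => bool" where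
 "stat A <-> (ALL g. bfun g --> (EX xi:E A. cpt g xi))"

lemma [dint]: "dfun f ==> dfun g ==> dpred (%e. cpt (f e) (g e))"
 by (rule dpred_comp2[where P = cpt]) (unfold cpt_def, intro dint)

lemma Ord_o1: "x : O1 ==> Ord x" using Ord_in_Ord[OF Ord_omega1] .

lemma cpt_ex: assumes g: "bfun g" and "dt : O1" shows "EX xi. cpt g xi & dt IN xi"
proof -
 \<comment> \<open>Adding the members of \<open>x\<close> makes the closure transitive, hence an
   ordinal; the value \<open>vempty\<close> outside \<open>omega1\<close> keeps all values of
   \<open>op\<close> countable.\<close>
 define op where "op x y = (if x : O1 & y : O1
  then vun x (vun (upair (vsucc x) (pr x y)) (upair (ap g x) (ap g x))) else vempty)" for x y
 have dop: "dfun (%e. op (e 0) (e (Suc 0)))" unfolding op_def by (intro dint)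
 let ?N = "clo op (upair omega dt)"
 have op: "op x y = vun x (vun (upair (vsucc x) (pr x y)) (upair (ap g x) (ap g x)))" if "x : O1" "y : O1" for x y
  using that by (simp add: op_def)
 have "card_le (op x y) omega" for x y
 proof (cases "x : O1 & y : O1")
  case True
  then have "card_le x omega" by (simp add: mem_omega1)
  then show ?thesis using countable_vun[OF _ countable_vun[OF countable_upair countable_upair]] op True by auto
 next
  case False
  then have "op x y = vempty" by (simp only: op_def if_False)
  then show ?thesis by (simp add: card_le_subset)
 qed
 then have c: "card_le ?N omega" by (intro clo_countable dop countable_upair)
 have sub: "E ?N <= O1"
 proof (rule clo_least[OF dop])
  show "E (upair omega dt) <= O1" using assms by auto
  show "E (op x y) <= O1" if "x : O1" "y : O1" for x y
   using that Ord_sub[OF Ord_omega1] ap_type[OF g] by (auto simp: op_def)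
 qed
 have cl: "E x <= E ?N & vsucc x IN ?N & pr x y IN ?N & ap g x IN ?N" if "x IN ?N" "y IN ?N" for x y
 proof -
  have "op x y = vun x (vun (upair (vsucc x) (pr x y)) (upair (ap g x) (ap g x)))" using op sub that by blast
  then show ?thesis using clo_closed[OF dop that] by simp
 qed
 have o: "Ord ?N" by (rule OrdI) (use sub Ord_o1 cl in blast)+
 have "?N : O1" using o c by (simp add: mem_omega1)
 moreover have "omega IN ?N" "dt IN ?N" using clo_base[OF dop, of "upair omega dt"] by auto
 ultimately show ?thesis unfolding cpt_def using cl by blast
qed

text \<open>The diagonal intersection of clubs: a single function holds all the \<open>G z\<close>
  along the pairing, and its closure points are closed under that pairing.\<close>

lemma cpt_diag:
 assumes dG: "dfun (%e. G (e 0))" and G: "!!z. z : O1 ==> bfun (G z)"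
 shows "EX g. bfun g & (ALL xi. cpt g xi --> (ALL z:E xi. cpt (G z) xi))"
proof -
 have dG': "dfun f ==> dfun (%e. G (f e))" for f by (rule dfun_comp1[where K = G, OF dG])
 let ?g = "vlam omega1 (%u. ap (G (q0 u)) (q1 u))"
 have d: "dfun (%e. ap (G (q0 (e 0))) (q1 (e 0)))" by (intro dint dG')
 have "is_fun ?g omega1 omega1" by (rule is_fun_vlam[OF d]) (use ap_type[OF G] pr_q in blast)
 moreover have "cpt (G z) xi" if c: "cpt ?g xi" and z: "z IN xi" for xi z
 proof -
  have o: "eh : O1" if "eh IN xi" for eh using c that Ord_trans[OF Ord_omega1] unfolding cpt_def by blast
  have "ap (G z) eh IN xi" if eh: "eh IN xi" for eh
  proof -
   have "pr z eh IN xi" using c z eh unfolding cpt_def by blast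
   then have "ap ?g (pr z eh) IN xi" using c unfolding cpt_def by blast
   then show ?thesis using ap_vlam[OF d, of "pr z eh" omega1] o[OF z] o[OF eh] by simp
  qed
  then show ?thesis using c unfolding cpt_def by blast
 qed
 ultimately show ?thesis by blast
qed

text \<open>A diagonal family with \<open>g\<close> at index 0 and \<open>h\<close> at all other
  indices; both 0 and \<open>omega\<close> lie below every closure point.\<close>

lemma cpt_and:
 assumes "bfun g" "bfun h"
 obtains k where "bfun k" "ALL xi. cpt k xi --> cpt g xi & cpt h xi"
proof -
 have d: "dfun (%e. if e 0 = vempty then g else h)" by (intro dint)
 have G: "bfun (if z = vempty then g else h)" for z using assms by simp
 obtain k where k: "bfun k" "ALL xi. cpt k xi --> (ALL z:E xi. cpt (if z = vempty then g else h) xi)"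
  using cpt_diag[OF d G] by blast
 have "cpt g xi & cpt h xi" if c: "cpt k xi" for xi
 proof -
  have "vempty IN xi" "omega IN xi" using c Ord_trans[OF Ord_o1, of xi omega] zero_in_omega unfolding cpt_def by blast+
  moreover have "omega ~= (vempty::'v)" using zero_in_omega elts_vempty by (metis empty_iff)
  ultimately show ?thesis using k(2)[rule_format, OF c, of vempty] k(2)[rule_format, OF c, of omega] by simp
 qed
 then have "ALL xi. cpt k xi --> cpt g xi & cpt h xi" by blast
 then show ?thesis using that k by blast
qed

lemma stat_omega1: "stat omega1"
 unfolding stat_def using cpt_ex[OF _ zero_in_omega1] unfolding cpt_def by blast

lemma stat_cpt: assumes "stat A" "bfun g" shows "stat (vsep A (cpt g))"
proof -
 have e: "E (vsep A (cpt g)) = {xi : E A. cpt g xi}" by (rule elts_vsep) (intro dint)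
 show ?thesis unfolding stat_def
 proof (intro allI impI)
  fix h :: 'v assume "bfun h"
  then obtain k where "bfun k" "ALL xi. cpt k xi --> cpt h xi & cpt g xi" using cpt_and[OF _ assms(2)] by metis
  then show "EX xi:E (vsep A (cpt g)). cpt h xi" using assms(1) unfolding stat_def e by blast
 qed
qed

lemma stat_unbounded: assumes "stat A" "dt : O1" shows "EX xi:E A. dt IN xi & xi : O1"
proof -
 have d: "dfun (%e. dt)" by (intro dint)
 have "is_fun (vlam omega1 (%_. dt)) omega1 omega1" by (rule is_fun_vlam[OF d]) (rule assms)
 then obtain xi where x: "xi IN A" "cpt (vlam omega1 (%_. dt)) xi" using assms unfolding stat_def by blast
 have "vempty IN xi" using x Ord_trans[OF Ord_o1, of xi omega] unfolding cpt_def by auto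
 then have "ap (vlam omega1 (%_. dt)) vempty IN xi" using x unfolding cpt_def by blast
 then show ?thesis using x ap_vlam[OF d zero_in_omega1] unfolding cpt_def by auto
qed

lemma stat_split: assumes "stat A" "dpred (%e. P (e 0))" shows "stat (vsep A P) | stat (vsep A (%xi. ~P xi))"
proof (rule ccontr)
 have d: "dpred (%e. ~P (e 0))" by (intro dint assms)
 assume "~?thesis"
 then obtain g h where "bfun g" "ALL xi:E (vsep A P). ~cpt g xi"
  "bfun h" "ALL xi:E (vsep A (%xi. ~P xi)). ~cpt h xi" unfolding stat_def by blast
 moreover from this obtain k where "bfun k" "ALL xi. cpt k xi --> cpt g xi & cpt h xi" using cpt_and by metis
 ultimately show False using assms(1) unfolding stat_def elts_vsep[OF assms(2)] elts_vsep[OF d] by blast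
qed

text \<open>Pressing down with a countable set of values for each \<open>eh\<close>: the pair of
  \<open>eh\<close> and the index of \<open>h xi\<close> in \<open>W eh\<close> is coded by an
  ordinal below the closure point \<open>xi\<close>. If each fibre missed a club, the diagonal
  intersection of these clubs would miss \<open>A\<close>.\<close>

lemma fodor:
 assumes A: "stat A" and dh: "dfun (%e. h (e 0))" and dW: "dfun (%e. W (e 0))"
  and W: "!!eh. eh : O1 ==> vcountable (W eh)" and h: "!!xi. xi IN A ==> EX eh:E xi. h xi IN (W eh)"
 shows "EX w. stat (vsep A (%xi. h xi = w))"
proof (rule ccontr)
 assume no: "~?thesis"
 have dh': "dfun f ==> dfun (%e. h (f e))" for f by (rule dfun_comp1[where K = h, OF dh])
 have dW': "dfun f ==> dfun (%e. W (f e))" for f by (rule dfun_comp1[where K = W, OF dW])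
 define gw where "gw w = chs (%g. bfun g & (ALL xi:E A. h xi = w --> ~cpt g xi))" for w
 have gw: "bfun (gw w) & (ALL xi:E A. h xi = w --> ~cpt (gw w) xi)" for w
 proof -
  have d: "dpred (%e. h (e 0) = w)" by (intro dint dh')
  have "~stat (vsep A (%xi. h xi = w))" using no by blast
  then obtain g where g: "bfun g & (ALL xi:E A. h xi = w --> ~cpt g xi)"
   unfolding stat_def elts_vsep[OF d] by blast
  have "dpred (%e. bfun (e 0) & (ALL xi:E A. h xi = w --> ~cpt (e 0) xi))" by (intro dint dh')
  from chs[OF this g] show ?thesis unfolding gw_def .
 qed
 have dgw: "dfun f ==> dfun (%e. gw (f e))" for f by (rule dfun_comp1[where K = gw]) (unfold gw_def, intro dint dh')
 define i where "i eh = chs (%f. is_injection f (W eh) omega)" for eh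
 have i: "is_injection (i eh) (W eh) omega" if e: "eh : O1" for eh
 proof -
  obtain f where f: "is_injection f (W eh) omega" using W[OF e] unfolding vcountable_def card_le_def by blast
  have "dpred (%e. is_injection (e 0) (W eh) omega)" by (intro dint)
  from chs[OF this f] show ?thesis unfolding i_def .
 qed
 have di: "dfun f ==> dfun (%e. i (f e))" for f by (rule dfun_comp1[where K = i]) (unfold i_def, intro dint dW')
 define wv where "wv eh n = vthe (%w. w IN (W eh) & ap (i eh) w = n)" for eh n
 have dwv: "dfun f ==> dfun g ==> dfun (%e. wv (f e) (g e))" for f g
  by (rule dfun_comp2[where K = wv]) (unfold wv_def, intro dint dW' di)
 have "dfun (%e. gw (wv (q0 (e 0)) (q1 (e 0))))" by (intro dgw dwv dint)
 from cpt_diag[OF this] gw obtain g where g: "bfun g"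
  "ALL xi. cpt g xi --> (ALL z:E xi. cpt (gw (wv (q0 z) (q1 z))) xi)" by blast
 obtain xi where x: "xi IN A" "cpt g xi" using A g unfolding stat_def by blast
 obtain eh where e: "eh IN xi" "h xi IN (W eh)" using h[OF x(1)] by blast
 have eo: "eh : O1" using e x Ord_trans[OF Ord_omega1] unfolding cpt_def by blast
 let ?n = "ap (i eh) (h xi)"
 have n: "?n IN omega" using i[OF eo] ap_type e(2) unfolding is_injection_iff by blast
 then have n': "?n IN xi" "?n : O1" using x Ord_trans[OF Ord_o1, of xi omega] omega_sub_omega1 unfolding cpt_def by blast+
 have "wv eh ?n = h xi" unfolding wv_def by (rule vthe_eq) (use e i[OF eo] in \<open>auto simp: is_injection_iff\<close>)
 moreover have "pr eh ?n IN xi" using x e n' unfolding cpt_def by blast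
 ultimately have "cpt (gw (h xi)) xi" using g(2) x q_pr[OF eo n'(2)] by metis
 then show False using gw x by blast
qed

section \<open>Ordinals as codes of functions\<close>

text \<open>\<open>g7\<close> finds a code of the value and \<open>g4\<close> turns it into the
  ordinal, so \<open>v\<close> inherits commutation with collapses. Every \<open>i\<close> receives
  ordinal values, even one that codes no function.\<close>

definition v :: "'v => 'v => 'v" where "v i xi = g4 (g7 (J i xi))"

lemma [dint]: "dfun f ==> dfun g ==> dfun (%e. v (f e) (g e))"
 unfolding v_def by (intro dint)

lemma Ord_g4: "Ord (g4 (i::'v))" unfolding g4_def by (rule Ord_vleast) (intro dint)

lemma Ord_v: "Ord (v i xi)" unfolding v_def by (rule Ord_g4)

lemma v_eq:
 assumes "Ord i" "Ord xi" "vpair xi y IN (F i)" "!!z. vpair xi z IN (F i) ==> z = y" "Ord y"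
 shows "v i xi = y"
proof -
 obtain l where l: "Ord l" "F l = y" by (rule F_surj)
 let ?P = "%k. vpair (K1 (J i xi)) (F k) IN (F (K0 (J i xi)))"
 have "dpred (%e. ?P (e 0))" by (intro dint)
 from vleast(2)[of ?P l, OF this] have "?P (g7 (J i xi))" using assms(1-3) l unfolding g7_def by simp
 then have "vpair xi (F (g7 (J i xi))) IN (F i)" using assms(1,2) by simp
 then have "F (g7 (J i xi)) = y" by (rule assms(4))
 then show ?thesis unfolding v_def g4_def by (intro vleast_eq) (use assms(5) mem_not_refl in auto)
qed

lemma v_fun: assumes "is_fun f A B" "!!x. x IN A ==> Ord x" "!!x. x IN B ==> Ord x"
 obtains i where "Ord i" "ALL xi:E A. v i xi = ap f xi"
proof -
 obtain i where i: "Ord i" "F i = f" by (rule F_surj)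
 have "v i xi = ap f xi" if x: "xi IN A" for xi
 proof (rule v_eq[OF i(1) assms(2)[OF x]])
  show "vpair xi (ap f xi) IN (F i)" using i vpair_ap[OF assms(1) x] by simp
  show "z = ap f xi" if "vpair xi z IN (F i)" for z using that i ap_eq[OF assms(1), of xi z] by simp
  show "Ord (ap f xi)" by (rule assms(3)[OF ap_type[OF assms(1) x]])
 qed
 then show ?thesis using that i by blast
qed

definition opN :: "'v => 'v => 'v" where "opN x y = vun (HH x) (upair (J x y) (J x y))"

lemma [dint]: "dfun f ==> dfun g ==> dfun (%e. opN (f e) (g e))"
 unfolding opN_def by (intro dint)

lemma HH_countable: "card_le (HH x) (omega::'v)"
 unfolding HH_def by (intro countable_vun countable_upair)

lemma clo_Ord:
 assumes d: "dfun (%e. op (e 0) (e (Suc 0)))" and "!!x. x IN G ==> Ord x"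
  "!!x y z. Ord x ==> Ord y ==> z IN (op x y) ==> Ord z" "x IN (clo op (G::'v))"
 shows "Ord x"
proof -
 have e: "E (vsep (clo op G) Ord) = {x : E (clo op G). Ord x}" by (rule elts_vsep) (intro dint)
 have "E (clo op G) <= E (vsep (clo op G) Ord)"
  by (rule clo_least[OF d]; unfold e) (use assms clo_base[OF d, of G] clo_closed[OF d] in blast)+
 then show ?thesis using assms e by blast
qed

lemma closedN_v:
 assumes "closedN N" "i IN N" "xi IN N"
 shows "v i xi IN N" "col N (v i xi) = v (col N i) (col N xi)"
proof -
 interpret condense ty N by unfold_locales (rule assms)
 show "v i xi IN N" unfolding v_def by (intro N_g N_J assms)
 show "col N (v i xi) = v (col N i) (col N xi)" unfolding v_def
  using condensation(1)[OF assms(2,3)] condensation(4)[OF N_J[OF assms(2,3)]] condensation(3)[OF N_g(7)[OF N_J[OF assms(2,3)]]] by simp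
qed

text \<open>By condensation, a function on a small ordinal has a small code.\<close>

lemma v_small:
 assumes ka: "card_le dt ka" "card_le omega ka" "card_le (vtimes ka ka) ka" "!!A B. card_le A ka ==> card_le B ka ==> card_le (vun A B) ka"
  and o: "Ord dt" "E omega <= E dt" "Ord i"
 shows "EX j. Ord j & card_le j (ka::'v) & (ALL xi:E dt. v i xi IN dt --> v j xi = v i xi)"
proof -
 have d: "dfun (%e. opN (e 0) (e (Suc 0)))" by (intro dint)
 let ?G = "vun dt (upair i i)" let ?N = "clo opN ?G"
 have ct: "card_le A ka" if "card_le A omega" for A using that ka(2) card_le_trans by blast
 have opc: "card_le (opN x y) ka" for x y unfolding opN_def by (intro ct countable_vun HH_countable countable_upair)
 have c: "card_le ?N ka" by (rule clo_card[OF d _ opc ka(2,3,4)]) (intro ka(4) ka(1) ct[OF countable_upair])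
 have No: "Ord x" if "x IN ?N" for x
  by (rule clo_Ord[OF d _ _ that]) (use o Ord_in_Ord[OF o(1)] Ord_HH J_Ord in \<open>auto simp: opN_def\<close>)
 have b: "E dt <= E ?N" "i IN ?N" using clo_base[OF d, of ?G] by auto
 have cl: "closedN ?N" unfolding closedN_def
  using No b o(2) clo_closed[OF d, of _ ?G] unfolding opN_def by auto
 have id: "col ?N x = x" if "x IN dt" for x
  by (rule col_id[of dt]) (use o(1) b that in \<open>auto simp: Ord_def\<close>)
 have dc: "dfun (%e. col ?N (e 0))" by (intro dint)
 have "card_le (otp ?N) ka" unfolding otp_def by (rule card_le_vimg[OF dc c])
 moreover have "E (col ?N i) <= E (otp ?N)" unfolding elts_col elts_otp by blast
 ultimately have "card_le (col ?N i) ka" using card_le_trans card_le_subset by blast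
 moreover have "v (col ?N i) xi = v i xi" if x: "xi IN dt" "v i xi IN dt" for xi
  using closedN_v(2)[OF cl b(2), of xi] b(1) x id[OF x(1)] id[OF x(2)] by auto
 ultimately show ?thesis using col_Ord[OF o(3)] by blast
qed

text \<open>The size \<open>omega1\<close> instance of condensation: each point of the space has a
  code below \<open>omega2\<close>. This gives the bound on the number of branches when there is a
  counterexample.\<close>

lemma v_baire: assumes "bfun f" shows "EX i. Ord i & card_le i omega1 & (ALL xi:O1. v i xi = ap f xi)"
proof -
 obtain i where i: "Ord i" "ALL xi:O1. v i xi = ap f xi" using v_fun[OF assms Ord_o1 Ord_o1] by blast
 have "EX j. Ord j & card_le j omega1 & (ALL xi:O1. v i xi : O1 --> v j xi = v i xi)"
  by (rule v_small[OF card_le_subset card_le_subset omega1_square omega1_vun Ord_omega1 _ i(1)]) (use omega_sub_omega1 in auto)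
 then show ?thesis using i ap_type[OF assms] by auto
qed

text \<open>CH in the form used below: countable sequences have countable codes. The ordinal
  \<open>ga\<close> is taken above \<open>dt\<close>, above all values and above
  \<open>omega\<close>, so that the collapse fixes arguments and values.\<close>

lemma v_node: assumes dt: "dt : O1" and f: "is_fun f dt omega1" shows "EX j:O1. ALL xi:E dt. v j xi = ap f xi"
proof -
 have dto: "!!x. x IN dt ==> Ord x" using Ord_in_Ord[OF Ord_o1[OF dt]] .
 obtain i where i: "Ord i" "ALL xi:E dt. v i xi = ap f xi" using v_fun[OF f dto Ord_o1] by blast
 have df: "dfun (%e. ap f (e 0))" by (intro dint)
 obtain ep where e: "ep : O1" "ALL x:E dt. ap f x IN ep"
 proof -
  have "vcountable dt" using dt by (simp add: mem_omega1 vcountable_def)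
  from omega1_sup[OF df this ap_type[OF f]] show ?thesis using that by blast
 qed
 obtain ga where g: "ga : O1" "E dt <= E ga" "E ep <= E ga" "E omega <= E ga"
 proof -
  have mx: "EX ga:O1. E a <= E ga & E b <= E ga" if "a : O1" "b : O1" for a b
   using Ord_linear[OF Ord_o1 Ord_o1, of a b] that Ord_sub Ord_o1 by blast
  obtain a where "a : O1" "E dt <= E a" "E ep <= E a" using mx[OF dt e(1)] by blast
  then show ?thesis using that mx[OF _ omega_in_omega1] by (metis subset_trans)
 qed
 have "EX j. Ord j & card_le j omega & (ALL xi:E ga. v i xi IN ga --> v j xi = v i xi)"
  by (rule v_small[OF _ card_le_subset omega_square countable_vun _ _ i(1)]) (use g mem_omega1 in auto)
 then obtain j where "Ord j" "card_le j omega" "ALL xi:E ga. v i xi IN ga --> v j xi = v i xi" by blast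
 moreover from this have "j : O1" by (simp add: mem_omega1)
 moreover have "v i xi = ap f xi & xi IN ga & v i xi IN ga" if "xi IN dt" for xi using that i e g by auto
 ultimately have "ALL xi:E dt. v j xi = ap f xi" "j : O1" by metis+
 then show ?thesis by blast
qed

end

section \<open>Hulls and their collapses\<close>

definition rs :: "'v::zfc => 'v => 'v" where "rs f eh = vlam eh (ap f)"

lemma [dint]: "dfun f ==> dfun g ==> dfun (%e. rs (f e) (g e))"
 by (rule dfun_comp2[where K = rs]) (unfold rs_def, intro dint)

lemma col_memI: "x IN N ==> x IN y ==> col N x IN (col N y)"
 unfolding elts_col by blast

lemma ap_rs [simp]: "th IN eh ==> ap (rs f eh) th = ap f th"
 unfolding rs_def by (rule ap_vlam) (intro dint)

lemma rs_rs: "E eh <= E xi ==> rs (rs f xi) eh = rs f eh"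
 unfolding rs_def[of _ eh] by (rule vlam_cong) auto

lemma rs_cong: "(!!th. th IN eh ==> ap f th = ap g th) ==> rs f eh = rs g eh"
 unfolding rs_def by (rule vlam_cong)

lemma rs_eqD: "rs f eh = rs g eh ==> th IN eh ==> ap f th = ap g th"
 using ap_rs[of th eh f] ap_rs[of th eh g] by simp

lemma rs_id: "is_fun f A B ==> rs f A = f"
 unfolding rs_def by (rule vlam_eta)

lemma is_fun_rs: "is_fun f A B ==> E A' <= E A ==> is_fun (rs f A') A' B"
 unfolding rs_def by (rule is_fun_restrict)

definition gen :: "'v::zfc => 'v => 'v => 'v" where "gen eh j k = vun eh (upair j k)"

lemma [dint]: "dfun f ==> dfun g ==> dfun h ==> dfun (%e. gen (f e) (g e) (h e))"
 unfolding gen_def by (intro dint)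

lemma elts_gen: "E (gen eh j k) = E eh Un {j, k}"
 unfolding gen_def by simp

locale KR = KT ty p for ty :: "'v::zfc itself" and p :: 'v +
 fixes Rs :: 'v
begin

text \<open>For \<open>\<alpha> \<le> \<omega>\<^sub>1\<close> every ordinal codes a function from \<open>\<alpha>\<close> to \<open>\<alpha>\<close>.\<close>

definition va :: "'v => 'v => 'v => 'v" where
 "va al i eh = (if v i eh IN al then v i eh else vempty)"

definition fa :: "'v => 'v => 'v => 'v => 'v => bool" where
 "fa al x i j eh <-> vpair (rs x eh) (vpair (vlam eh (va al i)) (vlam eh (va al j))) ~: E Rs"

definition fl :: "'v => 'v => 'v => 'v => bool" where
 "fl al x i j <-> (EX eh:E al. fa al x i j eh)"

text \<open>With the first failure in the hull, failure somewhere below \<open>al\<close> already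
  shows below the trace \<open>xi\<close>, and so it is preserved by the collapse.\<close>

definition tt :: "'v => 'v => 'v => 'v => 'v" where
 "tt al x i j = vleast (%eh. eh IN al & fa al x i j eh)"

text \<open>The disjunct \<open>j = m\<close> supplies a default: for an ordinal \<open>m\<close>
  the value is at most \<open>m\<close>, and it equals \<open>m\<close> exactly when there is no
  witness below \<open>m\<close>.\<close>

definition ww :: "'v => 'v => 'v => 'v => 'v" where
 "ww al x m i = vleast (%j. j = m | j IN m & ~fl al x i j)"

text \<open>The supremum of the successors of the first \<open>omega\<close> values. Its presence in
  the hull means that a code of a sequence with supremum \<open>xi\<close> brings \<open>xi\<close>
  along.\<close>

definition ss :: "'v => 'v => 'v" where
 "ss al i = vUN omega (%n. vsucc (va al i n))"

definition hop :: "'v => 'v => 'v => 'v => 'v" where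
 "hop al x a b = vun (HH a) (vun (upair (J a b) (ss al a)) (upair (tt al x a b) (ww al x a b)))"

definition hull :: "'v => 'v => 'v => 'v" where
 "hull al x G = clo (hop al x) G"

lemma [dint]: "dfun f ==> dfun g ==> dfun h ==> dfun (%e. va (f e) (g e) (h e))"
 unfolding va_def by (intro dint)

lemma [dint]: "dfun f ==> dfun g ==> dfun h ==> dfun k ==> dfun l ==> dpred (%e. fa (f e) (g e) (h e) (k e) (l e))"
 by (rule dpred_comp5[where P = fa]) (unfold fa_def, intro dint)

lemma [dint]: "dfun f ==> dfun g ==> dfun h ==> dfun k ==> dpred (%e. fl (f e) (g e) (h e) (k e))"
 by (rule dpred_comp4[where P = fl]) (unfold fl_def, intro dint)

lemma [dint]: "dfun f ==> dfun g ==> dfun h ==> dfun k ==> dfun (%e. tt (f e) (g e) (h e) (k e))"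
 by (rule dfun_comp4[where K = tt]) (unfold tt_def, intro dint)

lemma [dint]: "dfun f ==> dfun g ==> dfun h ==> dfun k ==> dfun (%e. ww (f e) (g e) (h e) (k e))"
 by (rule dfun_comp4[where K = ww]) (unfold ww_def, intro dint)

lemma [dint]: "dfun f ==> dfun g ==> dfun (%e. ss (f e) (g e))"
 by (rule dfun_comp2[where K = ss]) (unfold ss_def, intro dint)

lemma [dint]: "dfun f ==> dfun g ==> dfun h ==> dfun k ==> dfun (%e. hop (f e) (g e) (h e) (k e))"
 unfolding hop_def by (intro dint)

lemma dhop: "dfun (%e. hop al x (e 0) (e (Suc 0)))" by (intro dint)

lemma [dint]: assumes "dfun f" "dfun g" "dfun h" shows "dfun (%e. hull (f e) (g e) (h e))"
 by (rule dfun_comp3[where K = hull, OF _ assms]) (unfold hull_def, intro dint)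

lemma elts_ss: "E (ss al i) = (UN n:E omega. insert (va al i n) (E (va al i n)))"
proof -
 have "dfun (%e. vsucc (va al i (e 0)))" by (intro dint)
 from elts_vUN[OF this] show ?thesis unfolding ss_def by simp
qed

lemma Ord_va: "Ord (va al i eh)" unfolding va_def using Ord_v by simp

lemma va_in: "vempty IN al ==> va al i eh IN al" unfolding va_def by simp

lemma Ord_ss: "Ord (ss al i)"
proof (rule OrdI)
 fix y assume "y IN (ss al i)"
 then obtain n where n: "n IN omega" "y IN (vsucc (va al i n))" unfolding elts_ss by auto
 have o: "Ord (vsucc (va al i n))" by (rule Ord_vsucc[OF Ord_va])
 show "Ord y" by (rule Ord_in_Ord[OF o n(2)])
 have "E y <= E (vsucc (va al i n))" by (rule Ord_sub[OF o n(2)])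
 then show "E y <= E (ss al i)" unfolding elts_ss using n(1) by auto
qed

lemma hop_mem: "E (hop al x a b) = E (HH a) Un {J a b, ss al a, tt al x a b, ww al x a b}"
 unfolding hop_def by auto

lemma hop_Ord: assumes "Ord a" "Ord b" "z IN (hop al x a b)" shows "Ord z"
proof -
 have "Ord (tt al x a b)" unfolding tt_def by (rule Ord_vleast) (intro dint)
 moreover have "Ord (ww al x a b)" unfolding ww_def by (rule Ord_vleast) (intro dint)
 ultimately show ?thesis using assms Ord_HH[OF assms(1)] J_Ord[OF assms(1,2)] Ord_ss unfolding hop_mem by blast
qed

lemma hull_base: "E G <= E (hull al x G)" unfolding hull_def by (rule clo_base[OF dhop])

lemma hull_mono: "E G <= E G' ==> E (hull al x G) <= E (hull al x G')" unfolding hull_def by (rule clo_mono[OF dhop])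

lemma hull_closed: "a IN (hull al x G) ==> b IN (hull al x G) ==> E (hop al x a b) <= E (hull al x G)"
 unfolding hull_def by (rule clo_closed[OF dhop])

lemma hull_least: "E G <= E H ==> (!!a b. a IN H ==> b IN H ==> E (hop al x a b) <= E H) ==> E (hull al x G) <= E H"
 unfolding hull_def by (rule clo_least[OF dhop])

lemma hull_countable: "card_le G omega ==> card_le (hull al x G) omega"
 unfolding hull_def by (rule clo_countable[OF dhop]) (unfold hop_def, auto intro: countable_vun HH_countable countable_upair)

definition hclosed :: "'v => 'v => 'v => bool" where
 "hclosed al x N <-> E omega <= E N & (ALL a:E N. Ord a) & (ALL a:E N. ALL b:E N. E (hop al x a b) <= E N)"

lemma hclosed_hull: assumes "E omega <= E G" "!!a. a IN G ==> Ord a" shows "hclosed al x (hull al x G)"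
proof -
 have "Ord a" if "a IN (hull al x G)" for a
  by (rule clo_Ord[OF dhop assms(2) hop_Ord that[unfolded hull_def]])
 then show ?thesis unfolding hclosed_def using assms(1) hull_base[of G] hull_closed by blast
qed

lemma gen_mono: "E eh <= E xi ==> E (hull al x (gen eh j k)) <= E (hull al x (gen xi j k))"
 by (rule hull_mono) (auto simp: elts_gen)

text \<open>The hulls of the smaller \<open>eh\<close> form an increasing chain, so their union is
  closed under the binary \<open>hop\<close>; since \<open>xi\<close> is a limit, it contains all
  generators.\<close>

lemma hull_finitary:
 assumes o: "Ord xi" "vempty IN xi" and l: "ALL eh:E xi. vsucc eh IN xi" and a: "a IN (hull al x (gen xi j k))"
 shows "EX eh:E xi. a IN (hull al x (gen eh j k))"
proof -
 let ?h = "%eh. hull al x (gen eh j k)"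
 have d: "dfun (%e. ?h (e 0))" by (intro dint)
 have "E (hull al x (gen xi j k)) <= E (vUN xi ?h)"
 proof (rule hull_least; unfold elts_vUN[OF d])
  have "b IN (?h (vsucc b))" if "b IN xi" for b using hull_base[of "gen (vsucc b) j k"] by (auto simp: elts_gen)
  moreover have "j IN (?h vempty)" "k IN (?h vempty)" using hull_base[of "gen vempty j k"] by (auto simp: elts_gen)
  ultimately show "E (gen xi j k) <= (UN eh:E xi. E (?h eh))" using l o(2) unfolding elts_gen by blast
  fix a b assume "a : (UN eh:E xi. E (?h eh))" "b : (UN eh:E xi. E (?h eh))"
  then obtain eh zt where e: "eh IN xi" "a IN (?h eh)" "zt IN xi" "b IN (?h zt)" by blast
  have "E eh <= E zt | E zt <= E eh"
   using Ord_linear[OF Ord_in_Ord[OF o(1) e(1)] Ord_in_Ord[OF o(1) e(3)]] Ord_sub Ord_in_Ord[OF o(1)] e by blast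
  then obtain th where "th IN xi" "a IN (?h th)" "b IN (?h th)" using gen_mono e by blast
  then show "E (hop al x a b) <= (UN eh:E xi. E (?h eh))" using hull_closed[of a _ _ _ b] by blast
 qed
 then show ?thesis using a elts_vUN[OF d] by auto
qed

section \<open>Collapse of a closed set whose trace on \<open>al\<close> is an ordinal
  \<open>xi\<close>\<close>

context
 fixes al x N xi :: 'v
 assumes hc: "hclosed al x N" and Nxi: "E N Int E al = E xi" and om: "omega IN xi" and oal: "Ord al" and oxi: "Ord xi"
begin

lemma h_closedN: "closedN N"
 using hc unfolding hclosed_def closedN_def hop_mem by blast

lemma h_Ord: "a IN N ==> Ord a" using hc unfolding hclosed_def by blast

lemma h_mem: assumes "a IN N" "b IN N" shows "J a b IN N" "ss al a IN N" "tt al x a b IN N" "ww al x a b IN N" "E (HH a) <= E N"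
 using hc assms unfolding hclosed_def hop_mem by blast+

lemma h_sub: "E xi <= E N" "E xi <= E al" using Nxi by blast+

lemma h_zero: "vempty IN xi" using Ord_trans[OF oxi om zero_in_omega] .

lemma h_id: "a IN xi ==> col N a = a"
 by (rule col_id[of xi]) (use h_sub oxi in \<open>auto simp: Ord_def\<close>)

lemma h_id': "Ord a ==> E a <= E xi ==> col N a = a"
 by (rule col_id[of a]) (use h_sub in \<open>auto simp: Ord_def\<close>)

text \<open>A member of \<open>N\<close> outside \<open>al\<close> lies above all of
  \<open>xi\<close>, and the collapse fixes \<open>xi\<close> pointwise, so it is not sent below
  \<open>xi\<close>.\<close>

lemma h_lt: assumes "a IN N" shows "col N a IN xi <-> a IN al"
proof
 assume "a IN al" then have "a IN xi" using assms Nxi by blast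
 then show "col N a IN xi" using h_id[of a] by simp
next
 assume c: "col N a IN xi"
 show "a IN al"
 proof (rule ccontr)
  assume "a ~: E al"
  then have "E al <= E a" using Ord_not_mem[OF h_Ord[OF assms] oal] by blast
  then have "col N a IN a" "col N a IN N" using c h_sub by blast+
  then have "col N (col N a) IN (col N a)" using col_memI by blast
  then show False unfolding h_id[OF c] using mem_not_refl by blast
 qed
qed

text \<open>The cut-off at \<open>al\<close> becomes the cut-off at \<open>xi\<close>: a value in
  \<open>N\<close> is below \<open>al\<close> iff its collapse is below \<open>xi\<close>, and then
  it does not move.\<close>

lemma h_va: assumes "a IN N" "eh IN xi" shows "va xi (col N a) eh = va al a eh"
proof -
 have n: "eh IN N" using assms h_sub by blast
 have e: "col N (v a eh) = v (col N a) eh" using closedN_v(2)[OF h_closedN assms(1) n] h_id[OF assms(2)] by simp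
 have i: "v a eh IN N" by (rule closedN_v(1)[OF h_closedN assms(1) n])
 show ?thesis
 proof (cases "v a eh IN al")
  case True
  then have "v a eh IN xi" using i Nxi by blast
  then have "v (col N a) eh = v a eh" "v a eh IN xi" using h_id e by simp_all
  then show ?thesis unfolding va_def using True by simp
 next
  case False
  then have "v (col N a) eh ~: E xi" using h_lt[OF i] e by simp
  then show ?thesis unfolding va_def using False by simp
 qed
qed

lemma h_vlam: assumes "a IN N" "eh IN xi" shows "vlam eh (va xi (col N a)) = vlam eh (va al a)"
 by (rule vlam_cong) (rule h_va[OF assms(1) Ord_trans[OF oxi assms(2)]])

lemma h_fa: assumes "a IN N" "b IN N" "eh IN xi" shows "fa xi (rs x xi) (col N a) (col N b) eh <-> fa al x a b eh"
 unfolding fa_def h_vlam[OF assms(1,3)] h_vlam[OF assms(2,3)] rs_rs[OF Ord_sub[OF oxi assms(3)]] by simp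

text \<open>The first failure is in \<open>N\<close> and below \<open>al\<close>, hence below
  \<open>xi\<close>, where ordinals are fixed and \<open>fa\<close> does not change.\<close>

lemma h_tt: assumes "a IN N" "b IN N"
 shows "col N (tt al x a b) = tt xi (rs x xi) (col N a) (col N b)" "fl xi (rs x xi) (col N a) (col N b) <-> fl al x a b"
proof -
 have d: "dpred (%e. e 0 IN al & fa al x a b (e 0))" by (intro dint)
 have "col N (tt al x a b) = tt xi (rs x xi) (col N a) (col N b) & (fl xi (rs x xi) (col N a) (col N b) <-> fl al x a b)"
 proof (cases "fl al x a b")
  case True
  then obtain eh where h: "eh IN al & fa al x a b eh" unfolding fl_def by blast
  have o: "Ord eh" using h Ord_in_Ord[OF oal] by blast
  note t = vleast[where P = "%eh. eh IN al & fa al x a b eh", OF d o h, folded tt_def]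
  have tx: "tt al x a b IN xi" using t(2) h_mem(3)[OF assms] Nxi by blast
  then have f: "fa xi (rs x xi) (col N a) (col N b) (tt al x a b)" using h_fa[OF assms] t(2) by blast
  have "tt xi (rs x xi) (col N a) (col N b) = tt al x a b" unfolding tt_def[of xi]
  proof (rule vleast_eq[OF t(1)])
   fix bt assume b: "bt IN (tt al x a b)"
   show "~(bt IN xi & fa xi (rs x xi) (col N a) (col N b) bt)" using t(4)[OF b] h_fa[OF assms] h_sub by blast
  qed (use tx f in blast)
  then show ?thesis using h_id[OF tx] True tx f unfolding fl_def by auto
 next
  case False
  then have n: "~fl xi (rs x xi) (col N a) (col N b)" unfolding fl_def using h_fa[OF assms] h_sub by blast
  have "tt al x a b = vempty" unfolding tt_def by (rule vleast_none) (use False in \<open>auto simp: fl_def\<close>)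
  moreover have "tt xi (rs x xi) (col N a) (col N b) = vempty" unfolding tt_def by (rule vleast_none) (use n in \<open>auto simp: fl_def\<close>)
  ultimately show ?thesis using h_id[OF h_zero] False n by simp
 qed
 then show "col N (tt al x a b) = tt xi (rs x xi) (col N a) (col N b)" "fl xi (rs x xi) (col N a) (col N b) <-> fl al x a b" by blast+
qed

lemma h_ww: assumes "m IN N" "i IN N" shows "col N (ww al x m i) = ww xi (rs x xi) (col N m) (col N i)"
proof -
 let ?P = "%j. j = m | j IN m & ~fl al x i j"
 have d: "dpred (%e. ?P (e 0))" by (intro dint)
 have om: "Ord m" by (rule h_Ord[OF assms(1)])
 note w = vleast[of ?P, OF d om, folded ww_def]
 have wN: "ww al x m i IN N" by (rule h_mem(4)[OF assms])
 have "ww xi (rs x xi) (col N m) (col N i) = col N (ww al x m i)" unfolding ww_def[of xi]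
 proof (rule vleast_eq)
  show "Ord (col N (ww al x m i))" by (rule col_Ord[OF h_Ord[OF wN]])
  have "ww al x m i = m | ww al x m i IN m & ~fl al x i (ww al x m i)" using w(2) by blast
  then show "col N (ww al x m i) = col N m | col N (ww al x m i) IN (col N m) & ~fl xi (rs x xi) (col N i) (col N (ww al x m i))"
   using h_tt(2)[OF assms(2) wN] col_memI[OF wN] by auto
 next
  fix bt assume "bt IN (col N (ww al x m i))"
  then obtain b where b: "b IN N" "b IN (ww al x m i)" "bt = col N b" unfolding elts_col by blast
  have "E (ww al x m i) <= E m" using w(3)[OF _ om] by blast
  then have bm: "b IN m" using b by blast
  then have "fl al x i b" using w(4)[OF _ b(2)] by blast
  then have "fl xi (rs x xi) (col N i) bt" using h_tt(2)[OF assms(2) b(1)] b(3) by simp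
  moreover have "bt ~= col N m" using col_memI[OF b(1) bm] b(3) mem_not_refl by metis
  ultimately show "~(bt = col N m | bt IN (col N m) & ~fl xi (rs x xi) (col N i) bt)" by blast
 qed
 then show ?thesis by simp
qed

lemma h_ss0: assumes "a IN N" shows "ss xi (col N a) = ss al a"
proof (rule extensionality)
 have "va xi (col N a) n = va al a n" if "n IN omega" for n
  by (rule h_va[OF assms Ord_trans[OF oxi om that]])
 then show "E (ss xi (col N a)) = E (ss al a)" unfolding elts_ss by simp
qed

lemma h_ss: assumes "a IN N" shows "col N (ss al a) = ss xi (col N a)"
proof -
 have "E (ss xi (col N a)) <= E xi" unfolding elts_ss using va_in[OF h_zero] Ord_sub[OF oxi] by blast
 then show ?thesis using h_id'[OF Ord_ss] h_ss0[OF assms] by metis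
qed

lemma h_hop: assumes "a IN N" "b IN N" shows "E (hop xi (rs x xi) (col N a) (col N b)) = col N ` E (hop al x a b)"
proof -
 interpret condense ty N by unfold_locales (rule h_closedN)
 show ?thesis unfolding hop_mem condensation(2)[OF assms(1)] image_Un image_insert image_empty
  condensation(1)[OF assms] h_ss[OF assms(1)] h_tt(1)[OF assms] h_ww[OF assms] by simp
qed

text \<open>Both inclusions follow from minimality of a hull, since \<open>hop\<close> commutes with
  the collapse on \<open>N\<close>.\<close>

lemma h_hull: assumes G: "E G <= E N" shows "vimg (col N) (hull al x G) = hull xi (rs x xi) (vimg (col N) G)"
proof (rule extensionality, rule equalityI)
 let ?H = "hull xi (rs x xi) (vimg (col N) G)"
 have d: "dfun (%e. col N (e 0))" by (intro dint)
 have HN: "E (hull al x G) <= E N" by (rule hull_least[OF G]) (use hc in \<open>simp add: hclosed_def\<close>)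
 have dp: "dpred (%e. col N (e 0) IN ?H)" by (intro dint)
 note e = elts_vsep[where P = "%a. col N a IN ?H", OF dp]
 have "E (hull al x G) <= E (vsep N (%a. col N a IN ?H))"
 proof (rule hull_least; unfold e)
  show "E G <= {a : E N. col N a IN ?H}" using G hull_base[of "vimg (col N) G" xi "rs x xi"] unfolding elts_vimg[OF d] by blast
  fix a b assume ab: "a : {a : E N. col N a IN ?H}" "b : {a : E N. col N a IN ?H}"
  then have "E (hop xi (rs x xi) (col N a) (col N b)) <= E ?H" using hull_closed by blast
  moreover have "E (hop al x a b) <= E N" using ab hc unfolding hclosed_def by blast
  ultimately show "E (hop al x a b) <= {a : E N. col N a IN ?H}" using h_hop[of a b] ab by blast
 qed
 then show "E (vimg (col N) (hull al x G)) <= E ?H" unfolding elts_vimg[OF d] e by blast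
 show "E ?H <= E (vimg (col N) (hull al x G))"
 proof (rule hull_least; unfold elts_vimg[OF d])
  show "col N ` E G <= col N ` E (hull al x G)" using hull_base by blast
  fix a b assume "a : col N ` E (hull al x G)" "b : col N ` E (hull al x G)"
  then obtain a' b' where ab: "a' IN (hull al x G)" "b' IN (hull al x G)" "a = col N a'" "b = col N b'" by blast
  then have "E (hop xi (rs x xi) a b) = col N ` E (hop al x a' b')" using h_hop HN by blast
  moreover have "E (hop al x a' b') <= E (hull al x G)" by (rule hull_closed[OF ab(1,2)])
  ultimately show "E (hop xi (rs x xi) a b) <= col N ` E (hull al x G)" by blast
 qed
qed

lemma h_gen: assumes "E eh <= E xi" shows "vimg (col N) (gen eh j k) = gen eh (col N j) (col N k)"
proof (rule extensionality)
 have d: "dfun (%e. col N (e 0))" by (intro dint)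
 have "col N ` E eh = E eh" using assms h_id by force
 then show "E (vimg (col N) (gen eh j k)) = E (gen eh (col N j) (col N k))" unfolding elts_vimg[OF d] elts_gen by (simp add: image_Un)
qed

lemma h_hull_gen: assumes "j IN N" "k IN N" "E eh <= E xi"
 shows "vimg (col N) (hull al x (gen eh j k)) = hull xi (rs x xi) (gen eh (col N j) (col N k))" "E (hull al x (gen eh j k)) <= E N"
proof -
 have G: "E (gen eh j k) <= E N" using assms h_sub unfolding elts_gen by blast
 show "vimg (col N) (hull al x (gen eh j k)) = hull xi (rs x xi) (gen eh (col N j) (col N k))"
  using h_hull[OF G] h_gen[OF assms(3)] by simp
 show "E (hull al x (gen eh j k)) <= E N" by (rule hull_least[OF G]) (use hc in \<open>simp add: hclosed_def\<close>)
qed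

text \<open>A collapse in two steps: the smaller hull is moved by \<open>col N\<close> and then
  collapsed, which \<open>col_col\<close> identifies with its direct collapse.\<close>

lemma h_col: assumes "j IN N" "k IN N" "E eh <= E xi" "a IN N"
 shows "col (hull xi (rs x xi) (gen eh (col N j) (col N k))) (col N a) = col (hull al x (gen eh j k)) a"
 unfolding h_hull_gen(1)[OF assms(1-3), symmetric] by (rule col_col[OF h_hull_gen(2)[OF assms(1-3)] _ assms(4)]) (rule col_inj[OF h_Ord])

lemma h_hull_int: assumes "j IN N" "k IN N" "E eh <= E xi"
 shows "E (hull xi (rs x xi) (gen eh (col N j) (col N k))) Int E xi = E (hull al x (gen eh j k)) Int E al"
proof -
 have d: "dfun (%e. col N (e 0))" by (intro dint)
 note s = h_hull_gen(2)[OF assms]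
 have e: "E (hull xi (rs x xi) (gen eh (col N j) (col N k))) = col N ` E (hull al x (gen eh j k))"
  using h_hull_gen(1)[OF assms] elts_vimg[OF d, of "hull al x (gen eh j k)"] by simp
 show ?thesis unfolding e
 proof (rule equalityI; rule subsetI)
  fix a assume "a : col N ` E (hull al x (gen eh j k)) Int E xi"
  then obtain b where b: "b IN (hull al x (gen eh j k))" "a = col N b" "col N b IN xi" by blast
  then have "b IN al" using h_lt[of b] s by blast
  moreover from this have "col N b = b" using h_id[of b] b(1) s Nxi by blast
  ultimately show "a : E (hull al x (gen eh j k)) Int E al" using b by simp
 next
  fix a assume a: "a : E (hull al x (gen eh j k)) Int E al"
  then have "a IN xi" using s Nxi by blast
  then show "a : col N ` E (hull al x (gen eh j k)) Int E xi" using a h_id[of a] by (metis IntE IntI image_eqI)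
 qed
qed

end

section \<open>Branch functions and the countable bound on collapses\<close>

definition cc :: "'v => 'v => 'v => 'v => 'v => bool" where
 "cc al x j k xi <-> xi IN al & omega IN xi & (ALL a. a IN (hull al x (gen xi j k)) & a IN al --> a IN xi)"

text \<open>The successor separates genuine pairs from the value \<open>vempty\<close>, which marks
  the points outside the closed set.\<close>

definition bb :: "'v => 'v => 'v => 'v => 'v => 'v" where
 "bb al x j k xi = (if cc al x j k xi then vsucc (pr (col (hull al x (gen xi j k)) j) (col (hull al x (gen xi j k)) k)) else vempty)"

lemma [dint]: "dfun f ==> dfun g ==> dfun h ==> dfun k ==> dfun l ==> dpred (%e. cc (f e) (g e) (h e) (k e) (l e))"
 by (rule dpred_comp5[where P = cc]) (unfold cc_def, intro dint)

lemma [dint]: "dfun f ==> dfun g ==> dfun h ==> dfun k ==> dfun l ==> dfun (%e. bb (f e) (g e) (h e) (k e) (l e))"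
 unfolding bb_def by (intro dint)

lemma cc_int: assumes "Ord al" "xi IN al" "omega IN xi"
 shows "cc al x j k xi <-> E (hull al x (gen xi j k)) Int E al = E xi"
proof -
 have "E xi <= E (hull al x (gen xi j k))" using hull_base[of "gen xi j k"] unfolding elts_gen by blast
 moreover have "E xi <= E al" by (rule Ord_sub[OF assms(1,2)])
 ultimately show ?thesis unfolding cc_def using assms by blast
qed

lemma hclosed_gen: assumes "omega IN xi" "Ord xi" "Ord j" "Ord k" shows "hclosed al x (hull al x (gen xi j k))"
 by (rule hclosed_hull) (use assms Ord_sub Ord_in_Ord in \<open>auto simp: elts_gen\<close>)

text \<open>The coherence behind the tree: below \<open>xi\<close> the function can be recomputed
  from the two collapsed ordinals and \<open>rs x xi\<close>, so an initial segment is described by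
  countable data.\<close>

lemma bb_collapse:
 assumes h: "hclosed al x N" "E N Int E al = E xi" "omega IN xi" "Ord al" "Ord xi" and jk: "j IN N" "k IN N" and e: "eh IN xi"
 shows "bb xi (rs x xi) (col N j) (col N k) eh = bb al x j k eh"
proof -
 have s: "E eh <= E xi" by (rule Ord_sub[OF h(5) e])
 have ea: "eh IN al" using e h(2) by blast
 have "cc xi (rs x xi) (col N j) (col N k) eh <-> cc al x j k eh"
 proof (cases "omega IN eh")
  case True
  show ?thesis unfolding cc_int[OF h(5) e True] cc_int[OF h(4) ea True] h_hull_int[OF h jk s] by simp
 next
  case False then show ?thesis unfolding cc_def by blast
 qed
 then show ?thesis unfolding bb_def h_col[OF h jk s jk(1)] h_col[OF h jk s jk(2)] by simp
qed

text \<open>The least code of a sequence of length \<open>omega\<close> whose values have the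
  supremum of successors \<open>xi\<close>.\<close>

definition ff :: "'v => 'v" where "ff xi = vleast (%q. ss xi q = xi)"

lemma [dint]: "dfun f ==> dfun (%e. ff (f e))"
 by (rule dfun_comp1[where K = ff]) (unfold ff_def, intro dint)

text \<open>An enumeration of \<open>xi\<close> of length \<open>omega\<close> has a countable code
  by \<open>v_node\<close>. As every member of \<open>xi\<close> is among the values, the supremum
  of the successors is \<open>xi\<close>.\<close>

lemma ff: assumes x: "xi : O1" and om: "omega IN xi" shows "ff xi : O1" "ss xi (ff xi) = xi"
proof -
 obtain i where i: "is_injection i xi omega" using x unfolding mem_omega1 card_le_def by blast
 define e where "e n = (if EX eh:E xi. ap i eh = n then vthe (%eh. eh IN xi & ap i eh = n) else vempty)" for n
 have de: "dfun (%e'. e (e' 0))" unfolding e_def by (intro dint)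
 have z: "vempty IN xi" using Ord_trans[OF Ord_o1[OF x] om zero_in_omega] .
 have ei: "e (ap i eh) = eh" if h: "eh IN xi" for eh
 proof -
  have "vthe (%zt. zt IN xi & ap i zt = ap i eh) = eh" by (rule vthe_eq) (use h i in \<open>auto simp: is_injection_iff\<close>)
  then show ?thesis unfolding e_def using h by auto
 qed
 have ex: "e n IN xi" for n
 proof (cases "EX eh:E xi. ap i eh = n")
  case True then obtain eh where "eh IN xi" "ap i eh = n" by blast
  then show ?thesis using ei[of eh] by simp
 next
  case False then have "e n = vempty" unfolding e_def by (rule if_not_P) then show ?thesis using z by simp
 qed
 have "is_fun (vlam omega e) omega omega1" by (rule is_fun_vlam[OF de]) (use ex Ord_sub[OF Ord_omega1 x] in blast)
 from v_node[OF omega_in_omega1 this] obtain q where q: "q : O1" "ALL n:E omega. v q n = ap (vlam omega e) n" by blast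
 have vq: "va xi q n = e n" if "n IN omega" for n unfolding va_def using q(2) ap_vlam[OF de that] that ex by simp
 have "ss xi q = xi"
 proof (rule extensionality, rule equalityI)
  show "E (ss xi q) <= E xi" unfolding elts_ss using va_in[OF z] Ord_sub[OF Ord_o1[OF x]] by blast
  have "eh IN (ss xi q)" if "eh IN xi" for eh
  proof -
   have "ap i eh IN omega" using i that ap_type unfolding is_injection_iff by blast
   moreover from this have "va xi q (ap i eh) = eh" using vq[of "ap i eh"] ei[OF that] by simp
   ultimately show ?thesis unfolding elts_ss by (intro UN_I[of "ap i eh"]) simp_all
  qed
  then show "E xi <= E (ss xi q)" by blast
 qed
 moreover have d: "dpred (%e. ss xi (e 0) = xi)" by (intro dint)
 ultimately have "Ord (ff xi)" "ss xi (ff xi) = xi" "E (ff xi) <= E q" unfolding ff_def using vleast[OF d Ord_o1[OF q(1)]] Ord_o1[OF q(1)] by blast+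
 moreover from this have "ff xi : O1" using Ord_subset_iff[of "ff xi" q] Ord_o1[OF q(1)] q(1) Ord_trans[OF Ord_omega1 q(1)] by blast
 ultimately show "ff xi : O1" "ss xi (ff xi) = xi" by blast+
qed

text \<open>If \<open>ff xi\<close> were the collapse of some \<open>a\<close> in \<open>N\<close>,
  then \<open>ss al a\<close> would equal \<open>xi\<close>, and closure of \<open>N\<close> would
  put \<open>xi\<close> into the trace \<open>xi\<close>.\<close>

lemma otp_le_ff:
 assumes h: "hclosed al x N" "E N Int E al = E xi" "omega IN xi" "Ord al" "Ord xi" and x: "xi IN al" "xi : O1"
 shows "E (otp N) <= E (ff xi)"
proof -
 have No: "!!a. a IN N ==> Ord a" by (rule h_Ord[OF h])
 have "ff xi ~: E (otp N)"
 proof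
  assume "ff xi IN (otp N)"
  then obtain a where a: "a IN N" "ff xi = col N a" unfolding elts_otp by blast
  have "ss al a = xi" using h_ss0[OF h a(1)] ff(2)[OF x(2) h(3)] a(2) by simp
  then have "xi : E N Int E al" using h_mem(2)[OF h a(1) a(1)] x(1) by simp
  then show False using h(2) mem_not_refl by blast
 qed
 then show ?thesis using Ord_not_mem[OF Ord_o1[OF ff(1)[OF x(2) h(3)]] Ord_otp[OF No]] by blast
qed

definition Q :: "'v => 'v => 'v => 'v => bool" where
 "Q al x j k <-> Ord k & j IN k & (ALL i:E k. EX j':E k. ~fl al x i j')"

text \<open>The last clause says that the pair is fully collapsed: \<open>xi\<close>,
  \<open>j\<close> and \<open>k\<close> generate every ordinal below \<open>k\<close>. It lets the
  least witnesses below \<open>k\<close> be traced back to a smaller hull.\<close>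

definition PP :: "'v => 'v => 'v => 'v => bool" where
 "PP xi x j k <-> xi : O1 & omega IN xi & Q xi x j k & k IN (ff xi) & E k <= E (hull xi x (gen xi j k))"

lemma [dint]: "dfun f ==> dfun g ==> dfun h ==> dfun k ==> dpred (%e. PP (f e) (g e) (h e) (k e))"
 by (rule dpred_comp4[where P = PP]) (unfold PP_def Q_def, intro dint)

text \<open>Goodness survives because the hull contains the least witness \<open>ww\<close> for each
  of its codes below \<open>k\<close>; \<open>otp_le_ff\<close> gives the bound, and the collapse of
  a hull is a hull.\<close>

lemma PP_down:
 assumes q: "Q al x j k" and c: "cc al x j k xi" and o: "Ord al" "xi : O1"
 shows "PP xi (rs x xi) (col (hull al x (gen xi j k)) j) (col (hull al x (gen xi j k)) k)"
proof -
 let ?H = "hull al x (gen xi j k)"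
 have ok: "Ord k" "Ord j" "j IN k" using q Ord_in_Ord unfolding Q_def by blast+
 have c': "xi IN al" "omega IN xi" using c unfolding cc_def by blast+
 have ox: "Ord xi" by (rule Ord_o1[OF o(2)])
 have h: "hclosed al x ?H" "E ?H Int E al = E xi" "omega IN xi" "Ord al" "Ord xi"
  using hclosed_gen[OF c'(2) ox ok(2,1)] c cc_int[OF o(1) c'] c' o ox by blast+
 have jk: "j IN ?H" "k IN ?H" using hull_base[of "gen xi j k"] unfolding elts_gen by blast+
 have "EX j':E (col ?H k). ~fl xi (rs x xi) i' j'" if i': "i' IN (col ?H k)" for i'
 proof -
  obtain i where i: "i IN k" "i IN ?H" "i' = col ?H i" using i' unfolding elts_col by blast
  let ?P = "%j. j = k | j IN k & ~fl al x i j"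
  have d: "dpred (%e. ?P (e 0))" by (intro dint)
  obtain j' where j': "j' IN k" "~fl al x i j'" using q i(1) unfolding Q_def by blast
  have oj: "Ord j'" by (rule Ord_in_Ord[OF ok(1) j'(1)])
  have pj: "?P j'" using j' by blast
  note w = vleast[of ?P, OF d oj pj, folded ww_def]
  have "E (ww al x k i) <= E j'" using w(3)[OF oj pj] .
  then have "ww al x k i ~= k" using j'(1) mem_not_refl[of j'] by auto
  then have wk: "ww al x k i IN k" "~fl al x i (ww al x k i)" using w(2) by blast+
  have wH: "ww al x k i IN ?H" by (rule h_mem(4)[OF h jk(2) i(2)])
  show ?thesis using h_tt(2)[OF h i(2) wH] wk(2) i(3) col_memI[OF wH wk(1)] by blast
 qed
 then have "Q xi (rs x xi) (col ?H j) (col ?H k)" unfolding Q_def using col_Ord[OF ok(1)] col_memI[OF jk(1) ok(3)] by blast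
 moreover have "col ?H k IN (ff xi)" using otp_le_ff[OF h c'(1) o(2)] jk(2) unfolding elts_otp by blast
 moreover have "E (col ?H k) <= E (hull xi (rs x xi) (gen xi (col ?H j) (col ?H k)))"
 proof -
  have d: "dfun (%e. col ?H (e 0))" by (intro dint)
  have "E (hull xi (rs x xi) (gen xi (col ?H j) (col ?H k))) = col ?H ` E ?H"
   using h_hull_gen(1)[OF h jk subset_refl] elts_vimg[OF d, of ?H] by simp
  then show ?thesis unfolding elts_col by blast
 qed
 ultimately show ?thesis unfolding PP_def using o(2) c'(2) by blast
qed

text \<open>A member of the hull at \<open>xi\<close> is already generated at some smaller ordinal
  and thus caught by one of the cofinally many points \<open>zt\<close>.\<close>

lemma cc_closed:
 assumes o: "Ord al" "xi IN al" "vempty IN xi" and u: "ALL eh:E xi. EX zt:E xi. eh IN zt & cc al x j k zt"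
 shows "cc al x j k xi"
proof -
 have ox: "Ord xi" by (rule Ord_in_Ord[OF o(1,2)])
 have l: "ALL eh:E xi. vsucc eh IN xi"
 proof
  fix eh assume e: "eh IN xi"
  then obtain zt where z: "zt IN xi" "eh IN zt" using u by blast
  have "Ord eh" "Ord zt" using e z Ord_in_Ord[OF ox] by blast+
  then have "E (vsucc eh) <= E zt" using z(2) Ord_sub[of zt eh] by simp
  then have "vsucc eh IN zt | vsucc eh = zt" using Ord_subset_iff[OF Ord_vsucc[OF \<open>Ord eh\<close>] \<open>Ord zt\<close>] by blast
  then show "vsucc eh IN xi" using Ord_le_trans[OF ox _ z(1)] by blast
 qed
 have "omega IN xi" using u o(3) Ord_trans[OF ox] unfolding cc_def by blast
 moreover have "a IN xi" if a: "a IN (hull al x (gen xi j k))" "a IN al" for a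
 proof -
  obtain eh where e: "eh IN xi" "a IN (hull al x (gen eh j k))" using hull_finitary[OF ox o(3) l a(1)] by blast
  obtain zt where z: "zt IN xi" "eh IN zt" "cc al x j k zt" using u e(1) by blast
  have "a IN (hull al x (gen zt j k))" using gen_mono[OF Ord_sub[OF Ord_in_Ord[OF ox z(1)] z(2)]] e(2) by blast
  then have "a IN zt" using z(3) a(2) unfolding cc_def by blast
  then show ?thesis using Ord_trans[OF ox z(1)] by blast
 qed
 ultimately show ?thesis unfolding cc_def using o(2) by blast
qed

text \<open>The closure points of \<open>\<eta> \<mapsto> sup (hull(\<eta> \<union> {j, k}) \<inter> \<omega>\<^sub>1)\<close> satisfy \<open>cc\<close>.\<close>

lemma cc_club: "EX g. bfun g & (ALL xi. cpt g xi --> cc omega1 x j k xi)"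
proof -
 define s where "s eh = vleast (%dt. dt : O1 & (ALL a:O1. a IN (hull omega1 x (gen eh j k)) --> a IN dt))" for eh
 have ds: "dfun (%e. s (e 0))" unfolding s_def by (intro dint)
 have s: "s eh : O1 & (ALL a:O1. a IN (hull omega1 x (gen eh j k)) --> a IN (s eh))" if e: "eh : O1" for eh
 proof -
  let ?A = "vsep (hull omega1 x (gen eh j k)) (%a. a : O1)"
  have dA: "dpred (%e. e 0 : O1)" by (intro dint)
  have eA: "E ?A = {a : E (hull omega1 x (gen eh j k)). a : O1}" by (rule elts_vsep[OF dA])
  have "card_le (gen eh j k) omega" unfolding gen_def using countable_vun[OF _ countable_upair] e by (simp add: mem_omega1)
  then have "card_le (hull omega1 x (gen eh j k)) omega" by (rule hull_countable)
  moreover have "card_le ?A (hull omega1 x (gen eh j k))" by (rule card_le_subset) (simp add: eA)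
  ultimately have c: "vcountable ?A" unfolding vcountable_def using card_le_trans by blast
  have di: "dfun (%e. e 0)" by (intro dint)
  obtain dt where dt: "dt : O1" "ALL a:E ?A. a IN dt" using omega1_sup[OF di c] eA by blast
  let ?P = "%dt. dt : O1 & (ALL a:O1. a IN (hull omega1 x (gen eh j k)) --> a IN dt)"
  have d: "dpred (%e. ?P (e 0))" by (intro dint)
  have "?P dt" using dt eA by blast
  from vleast(2)[of ?P, OF d Ord_o1[OF dt(1)] this] show ?thesis unfolding s_def .
 qed
 have g: "bfun (vlam omega1 s)" by (rule is_fun_vlam[OF ds]) (use s in blast)
 have "cc omega1 x j k xi" if c: "cpt (vlam omega1 s) xi" for xi
 proof -
  have x: "xi : O1" "omega IN xi" "ALL eh:E xi. vsucc eh IN xi" using c unfolding cpt_def by blast+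
  have ox: "Ord xi" by (rule Ord_o1[OF x(1)])
  have "a IN xi" if a: "a IN (hull omega1 x (gen xi j k))" "a : O1" for a
  proof -
   obtain eh where e: "eh IN xi" "a IN (hull omega1 x (gen eh j k))"
    using hull_finitary[OF ox Ord_trans[OF ox x(2) zero_in_omega] x(3) a(1)] by blast
   have eo: "eh : O1" by (rule Ord_trans[OF Ord_omega1 x(1) e(1)])
   have "ap (vlam omega1 s) eh IN xi" using c e(1) unfolding cpt_def by blast
   then have "s eh IN xi" using ap_vlam[OF ds eo] by simp
   moreover have "a IN (s eh)" using s[OF eo] e(2) a(2) by blast
   ultimately show ?thesis by (rule Ord_trans[OF ox])
  qed
  then show ?thesis unfolding cc_def using x by blast
 qed
 then show ?thesis using g by blast
qed

end

section \<open>Trees of functions on countable ordinals\<close>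

lemma is_fun_dom: assumes "is_fun f A B" "is_fun f A' B'" shows "A = A'"
proof -
 have "E A <= E A'" if "is_fun f A B" "is_fun f A' B'" for A A' B B'
 proof
  fix x assume "x IN A"
  then have "vpair x (ap f x) IN f" by (rule vpair_ap[OF that(1)])
  then show "x IN A'" using that(2) unfolding is_fun_def by auto
 qed
 from this[OF assms] this[OF assms(2,1)] show ?thesis by (intro ext) blast
qed

lemma Ord_iso_id:
 assumes d: "dfun (%e. g (e 0))" and o: "Ord al" "Ord bt" and g: "!!x. x IN al ==> g x IN bt" "!!y. y IN bt ==> EX x:E al. g x = y"
  and m: "!!x y. x IN al ==> y IN al ==> g x IN (g y) <-> x IN y"
 shows "al = (bt::'v::zfc)"
proof -
 have id: "g x = x" if x: "x IN al" for x
 proof -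
  have dp: "dpred (%e. e 0 IN al --> g (e 0) = e 0)" by (intro dint d)
  have "x IN al --> g x = x"
  proof (rule Ord_induct[where P = "%x. x IN al --> g x = x", OF dp Ord_in_Ord[OF o(1) x]], intro impI)
   fix x assume IH: "!!y. y IN x ==> y IN al --> g y = y" and x: "x IN al"
   show "g x = x"
   proof (rule extensionality, rule equalityI; rule subsetI)
    fix z assume z: "z IN (g x)"
    then have "z IN bt" using Ord_trans[OF o(2) g(1)[OF x]] by blast
    then obtain y where y: "y IN al" "g y = z" using g(2) by blast
    then have "y IN x" using m[OF y(1) x] z by blast
    then show "z IN x" using IH y by metis
   next
    fix y assume y: "y IN x"
    have ya: "y IN al" by (rule Ord_trans[OF o(1) x y])
    then have "g y IN (g x)" using m[OF ya x] y by blast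
    then show "y IN (g x)" using IH[OF y] ya by simp
   qed
  qed
  then show ?thesis using x by blast
 qed
 show ?thesis
 proof (rule extensionality, rule equalityI; rule subsetI)
  fix x assume "x IN al" then show "x IN bt" using g(1)[of x] id[of x] by simp
 next
  fix y assume "y IN bt" then obtain x where "x IN al" "g x = y" using g(2) by blast
  then show "y IN al" using id[of x] by simp
 qed
qed

lemma (in KT) omega1_uncountable: "~card_le omega1 (omega::'v)"
 using mem_omega1[of "omega1::'v"] Ord_omega1 mem_not_refl[of "omega1::'v"] by blast

text \<open>A presentation of a tree on \<open>omega1\<close>: \<open>en\<close> lists the nodes
  without repetition as functions of countable length \<open>len\<close>. The axioms state closure
  under initial segments, extendability, splitting and countable levels; what the nodes are is
  irrelevant here.\<close>

locale FT = KT ty p for ty :: "'v::zfc itself" and p :: 'v +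
 fixes en len :: "'v => 'v"
 assumes den: "dfun (%e. en (e 0))" and dlen: "dfun (%e. len (e 0))"
  and en: "!!ta. ta : O1 ==> is_fun (en ta) (len ta) omega1" and len: "!!ta. ta : O1 ==> len ta : O1"
  and inj: "!!si ta. si : O1 ==> ta : O1 ==> en si = en ta ==> si = ta"
  and res: "!!ta eh. ta : O1 ==> eh IN (len ta) ==> EX si:O1. en si = rs (en ta) eh"
  and exte: "!!ta dt. ta : O1 ==> dt : O1 ==> len ta IN dt ==> EX si:O1. len si = dt & rs (en si) (len ta) = en ta"
  and two: "!!ta. ta : O1 ==> EX si:O1. EX si':O1. si ~= si' & len si = vsucc (len ta) & len si' = vsucc (len ta)
    & rs (en si) (len ta) = en ta & rs (en si') (len ta) = en ta"
  and cnt: "!!dt. dt : O1 ==> EX ga:O1. ALL ta:O1. len ta = dt --> ta IN ga"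
begin

lemma [dint]: "dfun f ==> dfun (%e. en (f e))" by (rule dfun_comp1[where K = en, OF den])
lemma [dint]: "dfun f ==> dfun (%e. len (f e))" by (rule dfun_comp1[where K = len, OF dlen])

lemma Ord_len: "ta : O1 ==> Ord (len ta)" by (rule Ord_o1[OF len])

lemma len_eq: "si : O1 ==> is_fun (en si) eh B ==> len si = eh" using is_fun_dom[OF en] by blast

lemma len_rs: assumes "si : O1" "ta : O1" "en si = rs (en ta) eh" "eh IN (len ta)" shows "len si = eh"
 by (rule len_eq[OF assms(1)]) (unfold assms(3), rule is_fun_rs[OF en[OF assms(2)] Ord_sub[OF Ord_len[OF assms(2)] assms(4)]])

definition RR :: "'v => 'v => bool" where "RR si ta <-> len si IN (len ta) & rs (en ta) (len si) = en si"

definition TT :: 'v where "TT = vsep (vtimes omega1 omega1) (%z. EX si ta. z = vpair si ta & RR si ta)"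

lemma [dint]: "dfun f ==> dfun g ==> dpred (%e. RR (f e) (g e))"
 unfolding RR_def by (intro dint)

lemma below_TT: "below TT si ta <-> si : O1 & ta : O1 & RR si ta"
proof -
 have d: "dpred (%e. EX si ta. e 0 = vpair si ta & RR si ta)" by (intro dint)
 show ?thesis unfolding below_def TT_def elts_vsep[OF d] by auto
qed

lemma RR_trans: assumes "ta : O1" "RR rh si" "RR si ta" "si : O1" shows "RR rh ta"
proof -
 have l: "len rh IN (len si)" "len si IN (len ta)" using assms unfolding RR_def by blast+
 have "rs (en ta) (len rh) = rs (rs (en ta) (len si)) (len rh)" by (rule rs_rs[OF Ord_sub[OF Ord_len[OF assms(4)] l(1)], symmetric])
 also have "... = en rh" using assms unfolding RR_def by simp
 finally show ?thesis unfolding RR_def using Ord_trans[OF Ord_len[OF assms(1)] l(2,1)] by blast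
qed

lemma RR_len: assumes "rh : O1" "si : O1" "ta : O1" "RR rh ta" "RR si ta" shows "RR rh si <-> len rh IN (len si)"
proof
 assume l: "len rh IN (len si)"
 have "rs (rs (en ta) (len si)) (len rh) = rs (en ta) (len rh)" by (rule rs_rs[OF Ord_sub[OF Ord_len[OF assms(2)] l]])
 then show "RR rh si" using assms(4,5) l unfolding RR_def by simp
qed (simp add: RR_def)

lemma strict_order_TT: "strict_order TT"
 unfolding strict_order_def
proof (intro conjI ballI impI)
 have d: "dpred (%e. EX si ta. e 0 = vpair si ta & RR si ta)" by (intro dint)
 show "E TT <= E (vtimes omega1 omega1)" unfolding TT_def elts_vsep[OF d] by blast
 show "~below TT x x" for x unfolding below_TT RR_def using mem_not_refl by blast
 fix x y z assume "below TT x y & below TT y z"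
 then show "below TT x z" unfolding below_TT using RR_trans by blast
qed

lemma elts_preds: "E (preds TT ta) = {si : O1. ta : O1 & RR si ta}"
proof -
 have d: "dpred (%e. below TT (e 0) ta)" unfolding below_def by (intro dint)
 show ?thesis unfolding preds_def set_of_vsep[OF d] elts_vsep[OF d] unfolding below_TT by blast
qed

lemma pred_ex: assumes "ta : O1" "eh IN (len ta)" shows "EX si:E (preds TT ta). len si = eh"
proof -
 obtain si where s: "si : O1" "en si = rs (en ta) eh" using res[OF assms] by blast
 have "len si = eh" by (rule len_rs[OF s(1) assms(1) s(2) assms(2)])
 then show ?thesis using s assms unfolding elts_preds RR_def by auto
qed

lemma pred_inj: "si IN (preds TT ta) ==> si' IN (preds TT ta) ==> len si = len si' ==> si = si'"
 unfolding elts_preds RR_def using inj[of si si'] by auto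

text \<open>The lengths of the predecessors of \<open>ta\<close> run exactly once through
  \<open>len ta\<close>, so \<open>len\<close> is the required isomorphism; the converse is the
  rigidity of ordinals.\<close>

lemma has_height_TT: assumes t: "ta : O1" shows "has_height TT ta al <-> al = len ta"
proof
 have d: "dfun (%e. len (e 0))" by (intro dint)
 assume a: "al = len ta"
 have ap: "ap (vlam (preds TT ta) len) y = len y" if "y IN (preds TT ta)" for y by (rule ap_vlam[OF d that])
 have "is_bijection (vlam (preds TT ta) len) (preds TT ta) (len ta)" unfolding is_bijection_iff
 proof (intro conjI ballI impI)
  show "is_fun (vlam (preds TT ta) len) (preds TT ta) (len ta)" by (rule is_fun_vlam[OF d]) (simp add: elts_preds RR_def)
  show "x = y" if "x IN (preds TT ta)" "y IN (preds TT ta)" "ap (vlam (preds TT ta) len) x = ap (vlam (preds TT ta) len) y" for x y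
   using that ap pred_inj by metis
  show "EX x:E (preds TT ta). ap (vlam (preds TT ta) len) x = z" if "z IN (len ta)" for z
   using pred_ex[OF t that] ap by metis
 qed
 moreover have "below TT y z <-> ap (vlam (preds TT ta) len) y IN (ap (vlam (preds TT ta) len) z)"
  if y: "y IN (preds TT ta)" and z: "z IN (preds TT ta)" for y z
  unfolding ap[OF y] ap[OF z] below_TT using y z RR_len[of y z ta] unfolding elts_preds by blast
 moreover have "app (vlam (preds TT ta) len) y = ap (vlam (preds TT ta) len) y" if "y IN (preds TT ta)" for y
  using app_ap[OF is_fun_vlam_img[OF d] that] .
 ultimately show "has_height TT ta al" unfolding has_height_def a using Ord_len[OF t] by auto
next
 assume "has_height TT ta al"
 then obtain h where h: "Ord al" "is_bijection h (preds TT ta) al"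
  "ALL y:E (preds TT ta). ALL z:E (preds TT ta). below TT y z <-> app h y IN (app h z)" unfolding has_height_def by blast
 have hf: "is_fun h (preds TT ta) al" using h(2) unfolding is_bijection_iff by blast
 define g where "g eh = ap h (vthe (%si. si IN (preds TT ta) & len si = eh))" for eh
 have dg: "dfun (%e. g (e 0))" unfolding g_def by (intro dint)
 have g: "g (len si) = ap h si" if s: "si IN (preds TT ta)" for si
 proof -
  have "vthe (%si'. si' IN (preds TT ta) & len si' = len si) = si" by (rule vthe_eq) (use s pred_inj in blast)+
  then show ?thesis unfolding g_def by simp
 qed
 have "len ta = al"
 proof (rule Ord_iso_id[OF dg Ord_len[OF t] h(1)])
  show "g x IN al" if x: "x IN (len ta)" for x
  proof -
   obtain si where "si IN (preds TT ta)" "len si = x" using pred_ex[OF t x] by blast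
   then show ?thesis using g[of si] ap_type[OF hf, of si] by simp
  qed
  show "EX x:E (len ta). g x = y" if y: "y IN al" for y
  proof -
   obtain si where s: "si IN (preds TT ta)" "ap h si = y" using h(2)[unfolded is_bijection_iff, THEN conjunct2, THEN conjunct2] y by blast
   then have "len si IN (len ta)" unfolding elts_preds RR_def by blast
   then show ?thesis using g[OF s(1)] s(2) by blast
  qed
  show "g x IN (g y) <-> x IN y" if xy: "x IN (len ta)" "y IN (len ta)" for x y
  proof -
   obtain si where s: "si IN (preds TT ta)" "len si = x" using pred_ex[OF t xy(1)] by blast
   obtain rh where r: "rh IN (preds TT ta)" "len rh = y" using pred_ex[OF t xy(2)] by blast
   have "below TT si rh <-> ap h si IN (ap h rh)" using h(3) s(1) r(1) app_ap[OF hf] by metis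
   moreover have "below TT si rh <-> len si IN (len rh)" using RR_len[of si rh ta] s(1) r(1) unfolding below_TT elts_preds by blast
   ultimately show ?thesis using g[OF s(1)] g[OF r(1)] s(2) r(2) by simp
  qed
 qed
 then show "al = len ta" by simp
qed

lemma elts_level: "E (level TT al) = {ta : O1. len ta = al}"
proof -
 have d: "dpred (%e. len (e 0) = al)" by (intro dint)
 have "{x : O1. has_height TT x al} = {x : O1. len x = al}" using has_height_TT by auto
 then show ?thesis unfolding level_def using set_of_vsep[OF d, of omega1] elts_vsep[OF d, of omega1] by simp
qed

lemma level_ex: assumes "al : O1" shows "EX ta:O1. len ta = al"
proof -
 have z: "vempty : O1" by simp
 consider "al IN (len vempty)" | "al = len vempty" | "len vempty IN al" using Ord_linear[OF Ord_o1[OF assms] Ord_len[OF z]] by blast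
 then show ?thesis
 proof cases
  case 1 then show ?thesis using pred_ex[OF z 1] unfolding elts_preds by blast
 next
  case 2 then show ?thesis using z by blast
 next
  case 3 then show ?thesis using exte[OF z assms 3] by blast
 qed
qed

theorem aleph1_tree_TT: "aleph1_tree TT"
 unfolding aleph1_tree_def
proof (intro conjI ballI allI impI)
 show "strict_order TT" by (rule strict_order_TT)
 show "well_ordered_by TT (preds TT ta)" for ta unfolding well_ordered_by_def
 proof (intro allI impI)
  fix M assume "E M <= E (preds TT ta) & M ~= vempty"
  then obtain m0 where M: "E M <= E (preds TT ta)" "m0 IN M" unfolding vempty_iff by blast
  have d: "dpred (%e. EX m:E M. len m = e 0)" by (intro dint)
  have in1: "m : O1 & ta : O1 & RR m ta" if "m IN M" for m using M(1) that unfolding elts_preds by blast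
  have l: "len m IN (len ta)" if "m IN M" for m using in1[OF that] unfolding RR_def by blast
  have "EX m:E M. len m = len m0" using M(2) by blast
  from set_minimal[where P = "%eh. EX m:E M. len m = eh", OF d l[OF M(2)] this] obtain m where
   m: "m IN M" "ALL z:E (len ta). z IN (len m) --> ~(EX m:E M. len m = z)" by blast
  have "below TT m x" if x: "x IN M" "x ~= m" for x
  proof -
   have "len x ~= len m" using pred_inj[of x ta m] x M(1) m(1) by blast
   moreover have "len x ~: E (len m)" using m(2) l[OF x(1)] x(1) by blast
   ultimately have "len m IN (len x)" using Ord_linear[OF Ord_len Ord_len, of x m] in1[OF x(1)] in1[OF m(1)] by blast
   then show ?thesis unfolding below_TT using RR_len[of m x ta] in1[OF x(1)] in1[OF m(1)] by blast
  qed
  then show "EX m:E M. ALL x:E M. x ~= m --> below TT m x" using m(1) by blast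
 qed
 fix al assume a: "al IN (omega1::'v)"
 obtain ga where g: "ga : O1" "ALL ta:O1. len ta = al --> ta IN ga" using cnt[OF a] by blast
 have "card_le (level TT al) ga" by (rule card_le_subset) (use g(2) elts_level in auto)
 then show "vcountable (level TT al)" unfolding vcountable_def using card_le_trans g(1) mem_omega1 by blast
 show "level TT al ~= vempty" using level_ex[OF a] unfolding vempty_iff elts_level by blast
next
 fix al assume "Ord al & al ~: E (omega1::'v)"
 then show "level TT al = vempty" unfolding vempty_iff elts_level using len by blast
qed

theorem regular_tree_TT: "regular_tree TT"
 unfolding regular_tree_def
proof (intro conjI ballI)
 obtain r where r: "r : O1" "len r = vempty" using level_ex[OF zero_in_omega1] by blast
 have z: "en x = en r" if "x : O1" "len x = vempty" for x
  by (rule fun_ext[of _ vempty omega1 _ omega1]) (use en[OF that(1)] en[OF r(1)] that(2) r(2) in simp_all)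
 have "below TT r x" if x: "x : O1" "x ~= r" for x
 proof -
  have "len x ~= vempty" using z[OF x(1)] inj[OF x(1) r(1)] x(2) by blast
  then have l: "vempty IN (len x)" using zero_le[OF Ord_len[OF x(1)]] by blast
  have "rs (en x) vempty = en r"
   by (rule fun_ext[of _ vempty omega1 _ omega1]) (use is_fun_rs[OF en[OF x(1)], of vempty] en[OF r(1)] r(2) in simp_all)
  then show ?thesis unfolding below_TT RR_def using r x l by simp
 qed
 then show "rooted TT" unfolding rooted_def using r(1) by blast
next
 fix ta assume t: "ta IN (omega1::'v)"
 obtain si si' where s: "si : O1" "si' : O1" "si ~= si'" "len si = vsucc (len ta)" "len si' = vsucc (len ta)"
  "rs (en si) (len ta) = en ta" "rs (en si') (len ta) = en ta" using two[OF t] by blast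
 have "immediate_succ TT ta rh" if r: "rh : O1" "len rh = vsucc (len ta)" "rs (en rh) (len ta) = en ta" for rh
 proof -
  have "~(below TT ta z & below TT z rh)" for z
   unfolding below_TT RR_def using r(2) mem_not_refl[of "len ta"] mem_not_sym[of "len ta" "len z"] by auto
  moreover have "below TT ta rh" unfolding below_TT RR_def using r t by simp
  ultimately show ?thesis unfolding immediate_succ_def using r(1) by blast
 qed
 then show "EX y z. y ~= z & immediate_succ TT ta y & immediate_succ TT ta z" using s by blast
next
 show "pruned TT" unfolding pruned_def
 proof (intro ballI impI)
  fix al bt x assume a: "al IN (omega1::'v)" "bt IN (omega1::'v)" "al IN bt" "x IN (level TT al)"
  then have x: "x : O1" "len x IN bt" unfolding elts_level by auto
  obtain y where "y : O1" "len y = bt" "rs (en y) (len x) = en x" using exte[OF x(1) a(2) x(2)] by blast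
  then show "EX y:E (level TT bt). below TT x y" using x unfolding elts_level below_TT RR_def by auto
 qed
qed

text \<open>Paths through the tree. They correspond to the uncountable branches by
  \<open>br\<close>, so branches can be counted as functions.\<close>

definition UU :: 'v where "UU = vsep baire (%U. ALL dt:O1. EX ta:O1. en ta = rs U dt)"

definition br :: "'v => 'v" where "br U = vsep omega1 (%ta. en ta = rs U (len ta))"

lemma elts_UU: "U IN UU <-> bfun U & (ALL dt:O1. EX ta:O1. en ta = rs U dt)"
proof -
 have "dpred (%e. ALL dt:O1. EX ta:O1. en ta = rs (e 0) dt)" by (intro dint)
 from elts_vsep[OF this] show ?thesis unfolding UU_def baire_def by simp
qed

lemma elts_br: "E (br U) = {ta : O1. en ta = rs U (len ta)}"
 unfolding br_def by (rule elts_vsep) (intro dint)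

lemma dfun_br: "dfun (%e. br (e 0))"
 unfolding br_def by (intro dint)

lemma UU_len: assumes "bfun U" "dt : O1" "ta : O1" "en ta = rs U dt" shows "len ta = dt" "ta IN (br U)"
proof -
 show l: "len ta = dt" by (rule len_eq[OF assms(3)]) (unfold assms(4), rule is_fun_rs[OF assms(1) Ord_sub[OF Ord_omega1 assms(2)]])
 show "ta IN (br U)" unfolding elts_br using assms l by simp
qed

lemma is_chain_br: "is_chain TT (br U)"
 unfolding is_chain_def
proof (intro conjI ballI)
 show "E (br U) <= O1" unfolding elts_br by blast
 fix x y assume xy: "x IN (br U)" "y IN (br U)"
 then have o: "x : O1" "y : O1" "en x = rs U (len x)" "en y = rs U (len y)" unfolding elts_br by blast+
 have *: "below TT a b" if ab: "a : O1" "b : O1" "en a = rs U (len a)" "en b = rs U (len b)" "len a IN (len b)" for a b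
  unfolding below_TT RR_def using ab rs_rs[OF Ord_sub[OF Ord_len[OF ab(2)] ab(5)], of U] by simp
 consider "len x IN (len y)" | "len x = len y" | "len y IN (len x)" using Ord_linear[OF Ord_len[OF o(1)] Ord_len[OF o(2)]] by blast
 then show "x = y | below TT x y | below TT y x"
 proof cases
  case 2 then show ?thesis using inj[OF o(1,2)] o(3,4) by simp
 qed (use * o in blast)+
qed

lemma br_branch: assumes U: "U IN UU" shows "is_branch TT (br U) & ~vcountable (br U)"
proof
 have u: "bfun U" "ALL dt:O1. EX ta:O1. en ta = rs U dt" using U elts_UU by blast+
 have "c = br U" if c: "is_chain TT c" "E (br U) <= E c" for c
 proof (rule extensionality, rule equalityI[OF _ c(2)], rule subsetI)
  fix z assume z: "z IN c"
  then have zo: "z : O1" using c(1) unfolding is_chain_def by blast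
  obtain ta where t: "ta : O1" "en ta = rs U (len z)" using u(2) len[OF zo] by blast
  note l = UU_len[OF u(1) len[OF zo] t]
  have "z = ta | below TT z ta | below TT ta z" using c z l(2) unfolding is_chain_def by blast
  then have "z = ta" unfolding below_TT RR_def l(1) using mem_not_refl by blast
  then show "z IN (br U)" using l(2) by simp
 qed
 then show "is_branch TT (br U)" unfolding is_branch_def using is_chain_br by blast
 show "~vcountable (br U)"
 proof
  assume c: "vcountable (br U)"
  have d: "dfun (%e. len (e 0))" by (intro dint)
  have "EX x:E (br U). y = len x" if "y : O1" for y using u(2) that UU_len[OF u(1) that] by metis
  from card_le_surj[OF d c[unfolded vcountable_def] this] show False using omega1_uncountable by blast
 qed
qed

lemma branch_br: assumes b: "is_branch TT b" "~vcountable b" shows "EX U:E UU. b = br U"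
proof -
 have bo: "x : O1" if "x IN b" for x using b that unfolding is_branch_def is_chain_def by blast
 have ch: "x = y | RR x y | RR y x" if "x IN b" "y IN b" for x y
  using b that unfolding is_branch_def is_chain_def below_TT by blast
 have coh: "ap (en x) th = ap (en y) th" if xy: "x IN b" "y IN b" "th IN (len x)" "th IN (len y)" for x y th
 proof -
  have "rs (en y) (len x) = en x | rs (en x) (len y) = en y | x = y" using ch[OF xy(1,2)] unfolding RR_def by blast
  then show ?thesis using ap_rs[OF xy(3), of "en y"] ap_rs[OF xy(4), of "en x"] by auto
 qed
 \<comment> \<open>Distinct members of a chain have distinct lengths, so bounded lengths would
   inject the branch into a countable ordinal.\<close>
 have unb: "EX x:E b. dt IN (len x)" if dl: "dt : O1" for dt
 proof (rule ccontr)
  assume n: "~?thesis"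
  have d: "dfun (%e. len (e 0))" by (intro dint)
  have "card_le b (vsucc dt)"
  proof (rule card_leI[OF d])
   fix x assume x: "x IN b"
   then show "len x IN (vsucc dt)" using Ord_linear[OF Ord_len[OF bo[OF x]] Ord_o1[OF dl]] n by auto
   fix y assume y: "y IN b" "len x = len y"
   then show "x = y" using ch[OF x y(1)] mem_not_refl unfolding RR_def by metis
  qed
  moreover have "card_le (vsucc dt) omega" using succ_in_omega1[OF dl] mem_omega1 by blast
  ultimately show False using b(2) card_le_trans unfolding vcountable_def by blast
 qed
 define u where "u th = vthe (%y. EX x:E b. th IN (len x) & y = ap (en x) th)" for th
 have du: "dfun (%e. u (e 0))" unfolding u_def by (intro dint)
 have u: "u th = ap (en x) th" if x: "x IN b" "th IN (len x)" for x th
  unfolding u_def by (rule vthe_eq) (use x coh in blast)+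
 let ?U = "vlam omega1 u"
 have U: "is_fun ?U omega1 omega1"
 proof (rule is_fun_vlam[OF du])
  fix th assume "th IN (omega1::'v)"
  then obtain x where x: "x IN b" "th IN (len x)" using unb by blast
  then show "u th : O1" using u[OF x] ap_type[OF en[OF bo[OF x(1)]] x(2)] by simp
 qed
 have enx: "en x = rs ?U (len x)" if x: "x IN b" for x
 proof (rule fun_ext[OF en[OF bo[OF x]] is_fun_rs[OF U Ord_sub[OF Ord_omega1 len[OF bo[OF x]]]]])
  fix th assume t: "th IN (len x)"
  have "th : O1" by (rule Ord_trans[OF Ord_omega1 len[OF bo[OF x]] t])
  then show "ap (en x) th = ap (rs ?U (len x)) th" using ap_rs[OF t] u[OF x t] ap_vlam[OF du] by simp
 qed
 have "EX ta:O1. en ta = rs ?U dt" if dl: "dt : O1" for dt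
 proof -
  obtain x where x: "x IN b" "dt IN (len x)" using unb[OF dl] by blast
  obtain ta where "ta : O1" "en ta = rs (en x) dt" using res[OF bo[OF x(1)] x(2)] by blast
  then show ?thesis using enx[OF x(1)] rs_rs[OF Ord_sub[OF Ord_len[OF bo[OF x(1)]] x(2)], of ?U] by metis
 qed
 then have "?U IN UU" unfolding elts_UU using U by blast
 moreover have "E b <= E (br ?U)" unfolding elts_br using bo enx by blast
 then have "br ?U = b" using b(1) is_chain_br unfolding is_branch_def by blast
 ultimately show ?thesis by blast
qed

lemma branches_TT: "uncountable_branches TT = vimg br UU"
 unfolding uncountable_branches_def
proof (rule set_of_eq)
 show "E (vimg br UU) = {b. is_branch TT b & ~vcountable b}"
  unfolding elts_vimg[OF dfun_br] using br_branch branch_br by blast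
qed

theorem card_branches_TT: "card_le UU ka ==> card_le (uncountable_branches TT) ka" "card_le UU (uncountable_branches TT)"
proof -
 show "card_le UU ka ==> card_le (uncountable_branches TT) ka" unfolding branches_TT by (rule card_le_vimg[OF dfun_br])
 show "card_le UU (uncountable_branches TT)" unfolding branches_TT
 proof (rule card_leI[OF dfun_br])
  show "br U IN (vimg br UU)" if "U IN UU" for U unfolding elts_vimg[OF dfun_br] using that by blast
  fix U U' assume u: "U IN UU" "U' IN UU" "br U = br U'"
  have f: "bfun U" "bfun U'" using u elts_UU by blast+
  show "U = U'"
  proof (rule fun_ext[OF f])
   fix th assume t: "th IN (omega1::'v)"
   have s: "vsucc th : O1" by (rule succ_in_omega1[OF t])
   obtain ta where tau: "ta : O1" "en ta = rs U (vsucc th)" using u(1) s elts_UU by blast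
   note l = UU_len[OF f(1) s tau]
   have "ta IN (br U')" using l(2) u(3) by simp
   then have "en ta = rs U' (vsucc th)" using l(1) unfolding elts_br by simp
   then have "rs U (vsucc th) = rs U' (vsucc th)" using tau(2) by simp
   from rs_eqD[OF this, of th] show "ap U th = ap U' th" by simp
  qed
 qed
qed

end

section \<open>The tree attached to a point\<close>

lemma col_cong:
 assumes t: "transitive_set a" and e: "E N Int E a = E N' Int E a" and x: "x IN a" "Ord x"
 shows "col N x = col N' (x::'v::zfc)"
proof -
 have d: "dpred (%e. e 0 IN a --> col N (e 0) = col N' (e 0))" by (intro dint)
 have "x IN a --> col N x = col N' x"
 proof (rule Ord_induct[where P = "%x. x IN a --> col N x = col N' x", OF d x(2)], intro impI)
  fix x assume IH: "!!y. y IN x ==> y IN a --> col N y = col N' y" and x: "x IN a"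
  have s: "E x <= E a" using t x unfolding transitive_set_def by blast
  then have "E x Int E N = E x Int E N'" using e by blast
  moreover have "col N ` (E x Int E N) = col N' ` (E x Int E N)" by (rule image_cong) (use IH s in auto)
  ultimately show "col N x = col N' x" by (intro extensionality) (simp add: elts_col)
 qed
 then show ?thesis using x by blast
qed

text \<open>This holds at every successor \<open>xi\<close>, and at a limit iff the nonzero values
  are bounded. Such \<open>xi\<close> put no constraint on a node, so each node can be continued by
  zeros to any length.\<close>

definition EZ :: "'v::zfc => 'v => bool" where
 "EZ b xi <-> (EX eh:E xi. ALL zt:E xi. eh IN zt --> ap b zt = vempty)"

lemma [dint]: "dfun f ==> dfun g ==> dpred (%e. EZ (f e) (g e))"
 by (rule dpred_comp2[where P = EZ]) (unfold EZ_def, intro dint)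

lemma EZ_cong: "(!!zt. zt IN xi ==> ap b zt = ap c zt) ==> EZ b xi <-> EZ c xi"
 unfolding EZ_def by auto

definition xt :: "'v::zfc => 'v => 'v => 'v => 'v" where
 "xt b dt m dt' = vlam dt' (%zt. if zt IN dt then ap b zt else if zt = dt then m else vempty)"

lemma [dint]: "dfun f ==> dfun g ==> dfun h ==> dfun k ==> dfun (%e. xt (f e) (g e) (h e) (k e))"
 by (rule dfun_comp4[where K = xt]) (unfold xt_def, intro dint)

lemma ap_xt: "zt IN dt' ==> ap (xt b dt m dt') zt = (if zt IN dt then ap b zt else if zt = dt then m else vempty)"
 unfolding xt_def by (rule ap_vlam) (intro dint)

lemma is_fun_xt: "(!!zt. zt IN dt' ==> (if zt IN dt then ap b zt else if zt = dt then m else vempty) IN B) ==> is_fun (xt b dt m dt') dt' B"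
 unfolding xt_def by (rule is_fun_vlam) (intro dint)

context KR
begin

text \<open>The condition bites only at limits of nonzero values: there the whole segment below
  \<open>xi\<close> must come from one collapsed pair. The length of the node is among the
  \<open>xi\<close> considered.\<close>

definition nodA :: "'v => 'v => 'v => bool" where
 "nodA X b xi <-> xi = vempty | EZ b xi | (EX j k. PP xi (rs X xi) j k & rs b xi = vlam xi (bb xi (rs X xi) j k))"

definition nodB :: "'v => 'v => 'v => bool" where
 "nodB X y xi <-> y IN omega | (EX j k. PP xi (rs X xi) j k & y = vsucc (pr j k))"

definition nod :: "'v => 'v => 'v => bool" where
 "nod X b dt <-> dt : O1 & is_fun b dt omega1 & (ALL xi:E (vsucc dt). nodA X b xi) & (ALL xi:E dt. nodB X (ap b xi) xi)"

lemma [dint]: "dfun f ==> dfun g ==> dfun h ==> dpred (%e. nodA (f e) (g e) (h e))"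
 by (rule dpred_comp3[where P = nodA]) (unfold nodA_def, intro dint)

lemma [dint]: "dfun f ==> dfun g ==> dfun h ==> dpred (%e. nodB (f e) (g e) (h e))"
 by (rule dpred_comp3[where P = nodB]) (unfold nodB_def, intro dint)

lemma [dint]: "dfun f ==> dfun g ==> dfun h ==> dpred (%e. nod (f e) (g e) (h e))"
 by (rule dpred_comp3[where P = nod]) (unfold nod_def, intro dint)

lemma nodA_cong: assumes "!!zt. zt IN xi ==> ap b zt = ap c zt" shows "nodA X b xi <-> nodA X c xi"
 using EZ_cong[of xi b c] rs_cong[of xi b c] assms unfolding nodA_def by simp

lemma PP_lt: assumes "PP xi x j k" shows "ff xi : O1" "j IN (ff xi)" "k IN (ff xi)" "j : O1" "k : O1"
proof -
 show f: "ff xi : O1" using assms ff(1) unfolding PP_def by blast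
 show k: "k IN (ff xi)" using assms unfolding PP_def by blast
 show j: "j IN (ff xi)" using assms Ord_trans[OF Ord_o1[OF f] k] unfolding PP_def Q_def by blast
 show "j : O1" "k : O1" using j k Ord_trans[OF Ord_omega1 f] by blast+
qed

lemma nodB_omega1: "nodB X y xi ==> y : O1"
 unfolding nodB_def using omega_sub_omega1 succ_in_omega1[OF pr_type] PP_lt(4,5) by blast

lemma nod_restrict: assumes n: "nod X b dt" and e: "eh IN dt" shows "nod X (rs b eh) eh"
proof -
 have d: "dt : O1" "is_fun b dt omega1" "ALL xi:E (vsucc dt). nodA X b xi" "ALL xi:E dt. nodB X (ap b xi) xi" using n unfolding nod_def by blast+
 have o: "Ord dt" "Ord eh" using Ord_o1[OF d(1)] Ord_in_Ord[OF _ e] by blast+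
 have s: "E eh <= E dt" by (rule Ord_sub[OF o(1) e])
 have "nodA X (rs b eh) xi" if x: "xi IN (vsucc eh)" for xi
 proof -
  have "xi IN (vsucc dt)" using x s e by auto
  moreover have "E xi <= E eh" using x Ord_sub[OF o(2)] by auto
  ultimately show ?thesis using d(3) nodA_cong[of xi "rs b eh" b] ap_rs[of _ eh b] by blast
 qed
 moreover have "nodB X (ap (rs b eh) xi) xi" if x: "xi IN eh" for xi using d(4) s x ap_rs[OF x] by auto
 ultimately show ?thesis unfolding nod_def using Ord_trans[OF Ord_omega1 d(1) e] is_fun_rs[OF d(2) s] by blast
qed

lemma nod_extend: assumes n: "nod X b dt" and e: "dt IN dt'" "dt' : O1" and m: "m IN omega"
 shows "nod X (xt b dt m dt') dt'" "rs (xt b dt m dt') dt = b"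
proof -
 have d: "dt : O1" "is_fun b dt omega1" "ALL xi:E (vsucc dt). nodA X b xi" "ALL xi:E dt. nodB X (ap b xi) xi" using n unfolding nod_def by blast+
 have o: "Ord dt" "Ord dt'" using Ord_o1[OF d(1)] Ord_o1[OF e(2)] by blast+
 have s: "E dt <= E dt'" by (rule Ord_sub[OF o(2) e(1)])
 have B: "nodB X (if zt IN dt then ap b zt else if zt = dt then m else vempty) zt" for zt
  using d(4) m zero_in_omega unfolding nodB_def by simp
 have A: "nodA X (xt b dt m dt') xi" if x: "xi IN (vsucc dt')" for xi
 proof (cases "xi IN (vsucc dt)")
  case True
  then have "E xi <= E dt" using Ord_sub[OF o(1)] by auto
  then have "zt IN dt & zt IN dt'" if "zt IN xi" for zt using that s by blast
  then have "ap (xt b dt m dt') zt = ap b zt" if "zt IN xi" for zt using that ap_xt[of zt dt' b dt m] by simp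
  then show ?thesis using nodA_cong[of xi "xt b dt m dt'" b] d(3) True by blast
 next
  case False
  have ox: "Ord xi" using x o(2) Ord_in_Ord by auto
  have dx: "dt IN xi" using False Ord_linear[OF ox o(1)] by auto
  have sx: "E xi <= E dt'" using x Ord_sub[OF o(2)] by auto
  have "ap (xt b dt m dt') zt = vempty" if z: "zt IN xi" "dt IN zt" for zt
  proof -
   have "zt ~: E dt" "zt ~= dt" using z(2) mem_not_sym mem_not_refl by blast+
   then show ?thesis using ap_xt[of zt dt' b dt m] z(1) sx by auto
  qed
  then have "EZ (xt b dt m dt') xi" unfolding EZ_def using dx by blast
  then show ?thesis unfolding nodA_def by blast
 qed
 have "is_fun (xt b dt m dt') dt' omega1" by (rule is_fun_xt) (rule nodB_omega1[OF B])
 moreover have "nodB X (ap (xt b dt m dt') xi) xi" if "xi IN dt'" for xi unfolding ap_xt[OF that] by (rule B)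
 ultimately show "nod X (xt b dt m dt') dt'" unfolding nod_def using A e(2) by blast
 have "rs (xt b dt m dt') dt = rs b dt" by (rule rs_cong) (use s ap_xt[of _ dt' b dt m] in auto)
 then show "rs (xt b dt m dt') dt = b" using rs_id[OF d(2)] by simp
qed

lemma nod_empty: "nod X vempty vempty"
proof -
 have "is_fun vempty vempty (omega1::'v)" unfolding is_fun_def by simp
 then show ?thesis unfolding nod_def nodA_def by simp
qed

text \<open>Every occurrence of \<open>X\<close> is restricted to an ordinal at most the length of
  the node. This is the source of the continuity of the reduction.\<close>

lemma nod_local: assumes "rs X ga = rs X' ga" "E dt <= E ga" "Ord dt" shows "nod X b dt <-> nod X' b dt"
proof -
 have "rs X xi = rs X' xi" if x: "xi IN (vsucc dt)" for xi
 proof -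
  have "E xi <= E ga" using x assms(2) Ord_sub[OF assms(3)] by auto
  then show ?thesis using rs_rs[of xi ga X] rs_rs[of xi ga X'] assms(1) by simp
 qed
 then have "nodA X b xi = nodA X' b xi" "nodB X y xi = nodB X' y xi" if "xi IN (vsucc dt)" for xi y
  using that unfolding nodA_def nodB_def by simp_all
 then show ?thesis unfolding nod_def by auto
qed

section \<open>Countability of the levels\<close>

definition NS :: "'v => 'v => 'v" where "NS X dt = vsep (funs dt omega1) (%b. nod X b dt)"

lemma [dint]: "dfun f ==> dfun g ==> dfun (%e. NS (f e) (g e))"
 by (rule dfun_comp2[where K = NS]) (unfold NS_def, intro dint)

lemma elts_NS: "E (NS X dt) = {b. nod X b dt}"
proof -
 have d: "dpred (%e. nod X (e 0) dt)" by (intro dint)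
 have "E (NS X dt) = {b : E (funs dt omega1). nod X b dt}" unfolding NS_def by (rule elts_vsep[where P = "%b. nod X b dt", OF d])
 then show ?thesis by (auto simp: nod_def)
qed

text \<open>The step of the induction that counts levels: a node is determined either by a pair
  below \<open>ff dt\<close>, or by a shorter node and one more value followed by zeros.\<close>

lemma NS_step:
 assumes n: "nod X b dt" and ne: "dt ~= vempty"
 shows "(EX j k. PP dt (rs X dt) j k & b = vlam dt (bb dt (rs X dt) j k)) | (EX eh:E dt. nod X (rs b eh) eh & nodB X (ap b eh) eh & b = xt (rs b eh) eh (ap b eh) dt)"
proof -
 have d: "dt : O1" "is_fun b dt omega1" "nodA X b dt" "ALL xi:E dt. nodB X (ap b xi) xi" using n unfolding nod_def by auto
 have od: "Ord dt" by (rule Ord_o1[OF d(1)])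
 show ?thesis
 proof (cases "EZ b dt")
  case True
  then obtain eh where e: "eh IN dt" "ALL zt:E dt. eh IN zt --> ap b zt = vempty" unfolding EZ_def by blast
  have v: "(if zt IN eh then ap (rs b eh) zt else if zt = eh then ap b eh else vempty) = ap b zt" if z: "zt IN dt" for zt
   using Ord_linear[OF Ord_in_Ord[OF od z] Ord_in_Ord[OF od e(1)]] e(2) z ap_rs[of zt eh b] mem_not_refl mem_not_sym by auto
  have "b = xt (rs b eh) eh (ap b eh) dt"
  proof (rule fun_ext[OF d(2)])
   show "is_fun (xt (rs b eh) eh (ap b eh) dt) dt omega1" by (rule is_fun_xt) (use v ap_type[OF d(2)] in simp)
   show "ap b zt = ap (xt (rs b eh) eh (ap b eh) dt) zt" if "zt IN dt" for zt unfolding ap_xt[OF that] using v[OF that] by simp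
  qed
  then show ?thesis using e(1) nod_restrict[OF n e(1)] d(4) by blast
 next
  case False
  then show ?thesis using d(3) ne rs_id[OF d(2)] unfolding nodA_def by auto
 qed
qed

lemma NS_countable: "dt : O1 ==> vcountable (NS X dt)"
proof -
 \<comment> \<open>All possible values of a node at \<open>eh\<close>: natural numbers, and
   successors of codes of pairs below \<open>ff eh\<close>. As \<open>ff eh\<close> is countable, so
   is this set.\<close>
 define W where "W eh = vun omega (if omega IN eh then vUN (ff eh) (%j. vimg (%k. vsucc (pr j k)) (ff eh)) else vempty)" for eh
 have dW: "dfun f ==> dfun (%e. W (f e))" for f by (rule dfun_comp1[where K = W]) (unfold W_def, intro dint)
 have ctr: "vcountable (vUN A (%j. vimg (g j) A))" if A: "vcountable A" and dg: "dfun (%e. g (e 0) (e (Suc 0)))" for A :: 'v and g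
 proof -
  have dg': "dfun f ==> dfun f' ==> dfun (%e. g (f e) (f' e))" for f f' by (rule dfun_comp2[where K = g, OF dg])
  have d1: "dfun (%e. vimg (g (e 0)) A)" by (intro dint dg')
  have d2: "dfun (%e. g j (e 0))" for j by (intro dint dg')
  show ?thesis by (rule countable_UN[OF d1 A]) (use card_le_vimg[OF d2] A in \<open>simp add: vcountable_def\<close>)
 qed
 have ffc: "vcountable (ff eh)" if "eh : O1" "omega IN eh" for eh
  using ff(1)[OF that] unfolding vcountable_def mem_omega1 by blast
 have Wc: "card_le (W eh) omega" if e: "eh : O1" for eh
 proof -
  have dg: "dfun (%e. vsucc (pr (e 0) (e (Suc 0))))" by (intro dint)
  show ?thesis
  proof (cases "omega IN eh")
   case True
   then have "W eh = vun omega (vUN (ff eh) (%j. vimg (%k. vsucc (pr j k)) (ff eh)))" by (simp only: W_def if_True)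
   then show ?thesis using countable_vun[OF card_le_subset[OF subset_refl] ctr[OF ffc[OF e True] dg, unfolded vcountable_def]] by simp
  next
   case False
   then have "W eh = vun omega vempty" by (simp only: W_def if_False)
   then show ?thesis using card_le_subset[of "vun omega vempty" omega] by simp
  qed
 qed
 have Wm: "y IN (W eh)" if y: "nodB X y eh" for y eh
 proof (cases "y IN omega")
  case True then show ?thesis unfolding W_def by simp
 next
  case False
  then obtain j k where jk: "PP eh (rs X eh) j k" "y = vsucc (pr j k)" using y unfolding nodB_def by blast
  have d1: "dfun (%e. vimg (%k. vsucc (pr (e 0) k)) (ff eh))" by (intro dint)
  have d2: "dfun (%e. vsucc (pr j (e 0)))" by (intro dint)
  have "omega IN eh" using jk unfolding PP_def by blast
  then have "W eh = vun omega (vUN (ff eh) (%j. vimg (%k. vsucc (pr j k)) (ff eh)))" by (simp only: W_def if_True)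
  moreover have "y IN (vUN (ff eh) (%j. vimg (%k. vsucc (pr j k)) (ff eh)))"
   unfolding elts_vUN[OF d1] by (rule UN_I[OF PP_lt(2)[OF jk(1)]]) (unfold elts_vimg[OF d2], use PP_lt(3)[OF jk(1)] jk(2) in blast)
  ultimately show ?thesis by simp
 qed
 have dp: "dpred (%e. e 0 : O1 --> vcountable (NS X (e 0)))" unfolding vcountable_def by (intro dint)
 assume dl: "dt : O1"
 have "dt : O1 --> vcountable (NS X dt)"
 proof (rule Ord_induct[where P = "%dt. dt : O1 --> vcountable (NS X dt)", OF dp Ord_o1[OF dl]], intro impI)
  fix dt assume IH: "!!eh. eh IN dt ==> eh : O1 --> vcountable (NS X eh)" and dl: "dt IN (omega1::'v)"
  have ih: "eh : O1" "vcountable (NS X eh)" if "eh IN dt" for eh using IH[OF that] Ord_trans[OF Ord_omega1 dl that] by blast+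
  have dc: "vcountable dt" using dl unfolding mem_omega1 vcountable_def by blast
  have d1: "dfun (%e. vUN (NS X (e 0)) (%b. vimg (%m. xt b (e 0) m dt) (W (e 0))))" by (intro dint dW)
  have d2: "dfun (%e. vimg (%m. xt (e 0) eh m dt) (W eh))" for eh by (intro dint dW)
  have d3: "dfun (%e. xt b eh (e 0) dt)" for b eh by (intro dint)
  let ?A = "vUN dt (%eh. vUN (NS X eh) (%b. vimg (%m. xt b eh m dt) (W eh)))"
  have A: "vcountable ?A"
  proof (rule countable_UN[OF d1 dc], rule countable_UN[OF d2 ih(2)])
   fix eh b assume "eh IN dt"
   then show "vcountable (vimg (%m. xt b eh m dt) (W eh))" unfolding vcountable_def using card_le_vimg[OF d3 Wc[OF ih(1)]] by blast
  qed
  let ?h = "%j k. vlam dt (bb dt (rs X dt) j k)"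
  have dh: "dfun (%e. ?h (e 0) (e (Suc 0)))" by (intro dint)
  let ?B = "if omega IN dt then vUN (ff dt) (%j. vimg (?h j) (ff dt)) else vempty"
  have B: "vcountable ?B"
   using ctr[OF ffc[OF dl] dh] by (auto simp: vcountable_def intro: card_le_subset)
  have "card_le (vun (vun ?A ?B) (upair vempty vempty)) omega"
   by (intro countable_vun countable_upair A[unfolded vcountable_def] B[unfolded vcountable_def])
  moreover have "E (NS X dt) <= E (vun (vun ?A ?B) (upair vempty vempty))"
  proof
   fix b assume "b IN (NS X dt)"
   then have b: "nod X b dt" unfolding elts_NS by simp
   show "b IN (vun (vun ?A ?B) (upair vempty vempty))"
   proof (cases "dt = vempty")
    case True
    then have "is_fun b vempty omega1" using b unfolding nod_def by blast
    then have "b = vempty" unfolding vempty_iff is_fun_def by auto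
    then show ?thesis by simp
   next
    case False
    from NS_step[OF b this] show ?thesis
    proof (elim disjE)
     assume "EX j k. PP dt (rs X dt) j k & b = ?h j k"
     then obtain j k where jk: "PP dt (rs X dt) j k" "b = ?h j k" by blast
     have d4: "dfun (%e. vimg (?h (e 0)) (ff dt))" by (intro dint)
     have d5: "dfun (%e. ?h j (e 0))" by (intro dint)
     have "b IN (vUN (ff dt) (%j. vimg (?h j) (ff dt)))"
      unfolding elts_vUN[OF d4] by (rule UN_I[OF PP_lt(2)[OF jk(1)]]) (unfold elts_vimg[OF d5], use PP_lt(3)[OF jk(1)] jk(2) in blast)
     moreover have "omega IN dt" using jk unfolding PP_def by blast
     ultimately show ?thesis by simp
    next
     assume "EX eh:E dt. nod X (rs b eh) eh & nodB X (ap b eh) eh & b = xt (rs b eh) eh (ap b eh) dt"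
     then obtain eh where e: "eh IN dt" "nod X (rs b eh) eh" "nodB X (ap b eh) eh" "b = xt (rs b eh) eh (ap b eh) dt" by blast
     have "b IN (vimg (%m. xt (rs b eh) eh m dt) (W eh))" unfolding elts_vimg[OF d3] using e(4) Wm[OF e(3)] by blast
     then have "b IN (vUN (NS X eh) (%b. vimg (%m. xt b eh m dt) (W eh)))"
      unfolding elts_vUN[OF d2] by (intro UN_I[of "rs b eh"]) (use e(2) in \<open>simp_all add: elts_NS\<close>)
     then have "b IN ?A" unfolding elts_vUN[OF d1] by (rule UN_I[OF e(1)])
     then show ?thesis by simp
    qed
   qed
  qed
  ultimately show "vcountable (NS X dt)" unfolding vcountable_def using card_le_trans[OF card_le_subset] by blast
 qed
 then show ?thesis using dl by blast
qed

text \<open>A countable ordinal \<open>c\<close> codes the function \<open>dec c\<close> of length \<open>q0 c\<close>; the nodes are represented by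
  their least codes, and the set of these codes is collapsed onto \<open>\<omega>\<^sub>1\<close>.\<close>

definition dec :: "'v => 'v" where "dec c = vlam (q0 c) (v (q1 c))"

definition CX :: "'v => 'v" where "CX X = vsep omega1 (%c. nod X (dec c) (q0 c) & (ALL c':E c. dec c' ~= dec c))"

definition cod :: "'v => 'v => 'v" where "cod X ta = vthe (%c. c IN (CX X) & col (CX X) c = ta)"

lemma [dint]: "dfun f ==> dfun (%e. dec (f e))"
 by (rule dfun_comp1[where K = dec]) (unfold dec_def, intro dint)

lemma [dint]: "dfun f ==> dfun (%e. CX (f e))"
 by (rule dfun_comp1[where K = CX]) (unfold CX_def, intro dint)

lemma [dint]: "dfun f ==> dfun g ==> dfun (%e. cod (f e) (g e))"
 by (rule dfun_comp2[where K = cod]) (unfold cod_def, intro dint)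

lemma elts_CX: "E (CX X) = {c : O1. nod X (dec c) (q0 c) & (ALL c':E c. dec c' ~= dec c)}"
 unfolding CX_def by (rule elts_vsep) (intro dint)

lemma dec_code: assumes "nod X b dt" shows "EX c:E (CX X). dec c = b & q0 c = dt"
proof -
 have d: "dt : O1" "is_fun b dt omega1" using assms unfolding nod_def by blast+
 obtain j where j: "j : O1" "ALL xi:E dt. v j xi = ap b xi" using v_node[OF d] by blast
 have dv: "dfun (%e. v j (e 0))" for j by (intro dint)
 have "vlam dt (v j) = vlam dt (ap b)" by (rule vlam_cong) (use j(2) in blast)
 then have db: "dec (pr dt j) = b" unfolding dec_def using d(1) j(1) vlam_eta[OF d(2)] by simp
 have dp: "dpred (%e. dec (e 0) = b)" by (intro dint)
 from set_minimal[where P = "%c. dec c = b", OF dp pr_type[OF d(1) j(1)] db] obtain c where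
  c: "c : O1" "dec c = b" "ALL z:O1. z IN c --> dec z ~= b" by blast
 have "is_fun (dec c) (q0 c) (vimg (v (q1 c)) (q0 c))" unfolding dec_def by (rule is_fun_vlam_img[OF dv])
 then have "q0 c = dt" using is_fun_dom[OF _ d(2)] c(2) by simp
 then show ?thesis unfolding elts_CX using c assms Ord_trans[OF Ord_omega1 c(1)] by blast
qed

lemma CX_Ord: "c IN (CX X) ==> Ord c" unfolding elts_CX using Ord_o1 by blast

lemma CX_inj: assumes "c IN (CX X)" "d IN (CX X)" "col (CX X) c = col (CX X) d" shows "c = d"
 by (rule col_inj[OF _ assms]) (rule CX_Ord)

text \<open>The order type is at most \<open>omega1\<close> since collapsing does not raise
  ordinals. It is uncountable because zeros alone give nodes of every countable length, so
  \<open>q0\<close> maps the codes onto \<open>omega1\<close>.\<close>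

lemma otp_CX: "otp (CX X) = omega1"
proof -
 have o: "Ord (otp (CX X))" by (rule Ord_otp[OF CX_Ord])
 have sub: "E (otp (CX X)) <= O1"
 proof
  fix y assume "y IN (otp (CX X))"
  then obtain c where c: "c IN (CX X)" "y = col (CX X) c" unfolding elts_otp by blast
  have co: "c : O1" using c(1) unfolding elts_CX by blast
  have "E (col (CX X) c) <= E c" by (rule col_le) (use CX_Ord c(1) in blast)+
  then have "E y <= E c" "Ord y" using c(2) col_Ord[OF CX_Ord[OF c(1)]] by simp_all
  then show "y : O1" using Ord_subset_iff[of y c] Ord_o1[OF co] co Ord_trans[OF Ord_omega1 co] by blast
 qed
 have "otp (CX X) ~: O1"
 proof
  assume "otp (CX X) : O1"
  then have c: "card_le (otp (CX X)) omega" unfolding mem_omega1 by blast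
  have dc: "dfun (%e. col (CX X) (e 0))" by (intro dint)
  have "card_le (CX X) (otp (CX X))"
   by (rule card_leI[OF dc]) (use CX_inj[of _ X] in \<open>auto simp: elts_otp\<close>)
  then have c': "card_le (CX X) omega" using c card_le_trans by blast
  have dq: "dfun (%e. q0 (e 0))" by (intro dint)
  have "EX c:E (CX X). dt = q0 c" if dl: "dt : O1" for dt
  proof (cases "dt = vempty")
   case True then show ?thesis using dec_code[OF nod_empty, of X] by metis
  next
   case False
   then have "vempty IN dt" using zero_le[OF Ord_o1[OF dl]] by blast
   from dec_code[OF nod_extend(1)[OF nod_empty this dl zero_in_omega], of X] show ?thesis by metis
  qed
  from card_le_surj[OF dq c' this] show False using omega1_uncountable by blast
 qed
 then show ?thesis using Ord_subset_iff[OF o Ord_omega1] sub by blast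
qed

lemma cod: assumes "ta : O1" shows "cod X ta IN (CX X)" "col (CX X) (cod X ta) = ta"
proof -
 obtain c where c: "c IN (CX X)" "ta = col (CX X) c" using assms otp_CX[of X] elts_otp[of "CX X"] by auto
 have "cod X ta = c" unfolding cod_def by (rule vthe_eq) (use c CX_inj[of _ X] in auto)
 then show "cod X ta IN (CX X)" "col (CX X) (cod X ta) = ta" using c by simp_all
qed

lemma cod_eq: assumes "c IN (CX X)" shows "col (CX X) c : O1" "cod X (col (CX X) c) = c"
proof -
 show "col (CX X) c : O1" using assms otp_CX[of X] elts_otp[of "CX X"] by auto
 show "cod X (col (CX X) c) = c" unfolding cod_def by (rule vthe_eq) (use assms CX_inj[of _ X] in auto)
qed

definition enX :: "'v => 'v => 'v" where "enX X ta = dec (cod X ta)"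
definition lenX :: "'v => 'v => 'v" where "lenX X ta = q0 (cod X ta)"

lemma [dint]: "dfun f ==> dfun g ==> dfun (%e. enX (f e) (g e))" "dfun f ==> dfun g ==> dfun (%e. lenX (f e) (g e))"
 unfolding enX_def lenX_def by (intro dint; assumption)+

lemma enX_nod: assumes "ta : O1" shows "nod X (enX X ta) (lenX X ta)"
 using cod(1)[OF assms, of X] unfolding elts_CX enX_def lenX_def by blast

lemma nod_enX: assumes "nod X b dt" shows "EX ta:O1. enX X ta = b & lenX X ta = dt"
proof -
 obtain c where c: "c IN (CX X)" "dec c = b" "q0 c = dt" using dec_code[OF assms] by blast
 show ?thesis by (rule bexI[OF _ cod_eq(1)[OF c(1)]]) (simp add: enX_def lenX_def cod_eq(2)[OF c(1)] c)
qed

lemma FT_X: "FT p (enX X) (lenX X)"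
proof unfold_locales
 show "dfun (%e. enX X (e 0))" "dfun (%e. lenX X (e 0))" by (intro dint)+
 fix ta assume t: "ta IN (omega1::'v)"
 note n = enX_nod[OF t, of X]
 show f: "is_fun (enX X ta) (lenX X ta) omega1" and l: "lenX X ta : O1" using n unfolding nod_def by blast+
 show inj: "ta = si" if s: "si : O1" "enX X ta = enX X si" for si
 proof -
  have "cod X ta = cod X si"
   using Ord_linear[OF CX_Ord[OF cod(1)[OF t]] CX_Ord[OF cod(1)[OF s(1)]], of X X] cod(1)[OF t, of X] cod(1)[OF s(1), of X] s(2)
   unfolding elts_CX enX_def by auto
  then show ?thesis using cod(2)[OF t, of X] cod(2)[OF s(1), of X] by metis
 qed
 show "EX si:O1. enX X si = rs (enX X ta) eh" if "eh IN (lenX X ta)" for eh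
  using nod_enX[OF nod_restrict[OF n that]] by blast
 show "EX si:O1. lenX X si = dt & rs (enX X si) (lenX X ta) = enX X ta" if d: "dt : O1" "lenX X ta IN dt" for dt
  using nod_enX[OF nod_extend(1)[OF n d(2,1) zero_in_omega]] nod_extend(2)[OF n d(2,1) zero_in_omega] by metis
 let ?l = "vsucc (lenX X ta)"
 have s: "lenX X ta IN ?l" "?l : O1" using succ_in_omega1[OF l] by auto
 have one: "vsucc vempty IN omega" using succ_in_omega[OF zero_in_omega] .
 let ?x = "%m. xt (enX X ta) (lenX X ta) m ?l"
 obtain si where s0: "si : O1" "enX X si = ?x vempty" "lenX X si = ?l" using nod_enX[OF nod_extend(1)[OF n s zero_in_omega]] by blast
 obtain si' where s1: "si' : O1" "enX X si' = ?x (vsucc vempty)" "lenX X si' = ?l" using nod_enX[OF nod_extend(1)[OF n s one]] by blast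
 have "ap (?x vempty) (lenX X ta) ~= ap (?x (vsucc vempty)) (lenX X ta)" unfolding ap_xt[OF s(1)] using mem_not_refl[of "lenX X ta"] vsucc_not_empty(1)[of vempty] by auto
 then have "si ~= si'" using s0(2) s1(2) by auto
 then show "EX si:O1. EX si':O1. si ~= si' & lenX X si = ?l & lenX X si' = ?l
    & rs (enX X si) (lenX X ta) = enX X ta & rs (enX X si') (lenX X ta) = enX X ta"
  using s0 s1 nod_extend(2)[OF n s zero_in_omega] nod_extend(2)[OF n s one] by (intro bexI[of _ si] bexI[of _ si']) simp_all
next
 have inj: "ta = si" if t: "ta : O1" and s: "si : O1" "enX X ta = enX X si" for ta si
 proof -
  have "cod X ta = cod X si"
   using Ord_linear[OF CX_Ord[OF cod(1)[OF t]] CX_Ord[OF cod(1)[OF s(1)]], of X X] cod(1)[OF t, of X] cod(1)[OF s(1), of X] s(2)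
   unfolding elts_CX enX_def by auto
  then show ?thesis using cod(2)[OF t, of X] cod(2)[OF s(1), of X] by metis
 qed
 fix dt assume dl: "dt IN (omega1::'v)"
 let ?A = "vsep omega1 (%ta. lenX X ta = dt)"
 have eA: "E ?A = {ta : O1. lenX X ta = dt}" by (rule elts_vsep) (intro dint)
 have de: "dfun (%e. enX X (e 0))" by (intro dint)
 have "card_le ?A (NS X dt)"
 proof (rule card_leI[OF de]; unfold eA elts_NS)
  show "enX X ta : {b. nod X b dt}" if "ta : {ta : O1. lenX X ta = dt}" for ta using that enX_nod[of ta X] by auto
  show "ta = si" if "ta : {ta : O1. lenX X ta = dt}" "si : {ta : O1. lenX X ta = dt}" "enX X ta = enX X si" for ta si
   using that inj by blast
 qed
 then have c: "vcountable ?A" using NS_countable[OF dl, of X] card_le_trans unfolding vcountable_def by blast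
 have di: "dfun (%e. e 0)" by (intro dint)
 show "EX ga:O1. ALL ta:O1. lenX X ta = dt --> ta IN ga" using omega1_sup[OF di c] unfolding eA by blast
qed

text \<open>The codes up to \<open>cod X ta\<close> describe nodes of lengths below some countable
  \<open>dt\<close>. Hence \<open>X\<close> below \<open>dt\<close> decides which of them belong to
  \<open>CX X\<close>, and with them the collapse.\<close>

lemma cod_local: assumes t: "ta : O1"
 shows "EX dt:O1. ALL X'. rs X' dt = rs X dt --> cod X' ta = cod X ta"
proof -
 let ?c = "cod X ta" let ?g = "vsucc ?c"
 have c: "?c IN (CX X)" by (rule cod(1)[OF t])
 have co: "?c : O1" using c unfolding elts_CX by blast
 have dq: "dfun (%e. q0 (e 0))" by (intro dint)
 have go: "?g : O1" by (rule succ_in_omega1[OF co])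
 have gs: "!!a. a IN ?g ==> a : O1" by (rule Ord_trans[OF Ord_omega1 go])
 have "vcountable ?g" using go unfolding mem_omega1 vcountable_def by blast
 from omega1_sup[OF dq this] obtain dt where d: "dt : O1" "ALL a:E ?g. q0 a IN dt" using pr_q(1) gs by blast
 have "cod X' ta = ?c" if x: "rs X' dt = rs X dt" for X'
 proof -
  have "nod X (dec a) (q0 a) <-> nod X' (dec a) (q0 a)" if a: "a IN ?g" for a
   by (rule nod_local[OF x[symmetric] Ord_sub[OF Ord_o1[OF d(1)]]]) (use d(2) a pr_q(1)[OF gs[OF a]] Ord_o1 in blast)+
  then have e: "E (CX X) Int E ?g = E (CX X') Int E ?g" unfolding elts_CX by blast
  have cx: "?c IN (CX X')" using e c by auto
  have "transitive_set ?g" using Ord_o1[OF go] unfolding Ord_def by blast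
  from col_cong[OF this e, of ?c] have "col (CX X') ?c = ta" using cod(2)[OF t, of X] Ord_o1[OF co] by simp
  then show ?thesis using cod_eq(2)[OF cx] by simp
 qed
 then show ?thesis using d(1) by blast
qed

end

section \<open>Counting the branches\<close>

lemma (in KT) baire_uncountable: "~card_le baire (omega1::'v)"
proof
 assume "card_le baire (omega1::'v)"
 then obtain g where g: "ALL f:E (baire::'v). ap g f : O1" "ALL f:E baire. ALL f':E baire. ap g f = ap g f' --> f = f'" by (rule card_leE)
 define D where "D xi = (if EX f:E baire. ap g f = xi then vsucc (ap (vthe (%f. f IN baire & ap g f = xi)) xi) else vempty)" for xi
 have dD: "dfun (%e. D (e 0))" unfolding D_def baire_def by (intro dint)
 have D: "D (ap g f) = vsucc (ap f (ap g f))" if f: "f IN baire" for f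
 proof -
  have "vthe (%f'. f' IN baire & ap g f' = ap g f) = f" by (rule vthe_eq) (use f g in blast)+
  then show ?thesis unfolding D_def using f by auto
 qed
 have "bfun (vlam omega1 D)"
 proof (rule is_fun_vlam[OF dD])
  fix xi assume x: "xi IN (omega1::'v)"
  show "D xi : O1"
  proof (cases "EX f:E baire. ap g f = xi")
   case True
   then obtain f where f: "f IN baire" "ap g f = xi" by blast
   have "ap f xi : O1" using f(1) ap_type[OF _ x] unfolding baire_def by auto
   then show ?thesis using D[OF f(1)] f(2) succ_in_omega1 by simp
  next
   case False then have "D xi = vempty" unfolding D_def by (rule if_not_P) then show ?thesis by simp
  qed
 qed
 then have f: "vlam omega1 D IN baire" unfolding baire_def by simp
 have "ap (vlam omega1 D) (ap g (vlam omega1 D)) = vsucc (ap (vlam omega1 D) (ap g (vlam omega1 D)))"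
  using D[OF f] ap_vlam[OF dD, of "ap g (vlam omega1 D)" omega1] g(1) f by simp
 then show False using mem_not_refl elts_vsucc by (metis insertI1)
qed

context KR
begin

definition inS :: "'v => bool" where
 "inS X <-> (ALL Y. bfun Y --> (EX Z. bfun Z &
  (ALL eh:O1. vpair (rs X eh) (vpair (rs Y eh) (rs Z eh)) IN Rs)))"

definition UB :: "'v => 'v => bool" where
 "UB X U <-> bfun U & (ALL dt:O1. nod X (rs U dt) dt)"

lemma [dint]: "dfun f ==> dfun g ==> dpred (%e. UB (f e) (g e))"
 by (rule dpred_comp2[where P = UB]) (unfold UB_def, intro dint)

lemma bb_nonzero: "bb al x j k xi ~= vempty <-> cc al x j k xi"
 unfolding bb_def using vsucc_not_empty by simp

lemma cc_props:
 assumes "cc al x j k xi" "Ord al" "Ord j" "Ord k"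
 shows "hclosed al x (hull al x (gen xi j k))" "E (hull al x (gen xi j k)) Int E al = E xi" "omega IN xi" "Ord al" "Ord xi"
  "j IN (hull al x (gen xi j k))" "k IN (hull al x (gen xi j k))"
proof -
 have c: "xi IN al" "omega IN xi" using assms unfolding cc_def by blast+
 show ox: "Ord xi" by (rule Ord_in_Ord[OF assms(2) c(1)])
 show "E (hull al x (gen xi j k)) Int E al = E xi" using assms(1) cc_int[OF assms(2) c] by blast
 show "hclosed al x (hull al x (gen xi j k))" by (rule hclosed_gen[OF c(2) ox assms(3,4)])
 show "omega IN xi" "Ord al" by fact+
 show "j IN (hull al x (gen xi j k))" "k IN (hull al x (gen xi j k))" using hull_base[of "gen xi j k"] unfolding elts_gen by blast+
qed

lemma Q_Ord: "Q al x j k ==> Ord j & Ord k" unfolding Q_def using Ord_in_Ord by blast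

lemma bb_UB: assumes q: "Q omega1 X j k" shows "UB X (vlam omega1 (bb omega1 X j k))"
proof -
 let ?B = "vlam omega1 (bb omega1 X j k)"
 have d: "dfun (%e. bb omega1 X j k (e 0))" by (intro dint)
 have o: "Ord j" "Ord k" using Q_Ord[OF q] by blast+
 have ap: "ap ?B xi = bb omega1 X j k xi" if "xi : O1" for xi by (rule ap_vlam[OF d that])
 have B: "nodB X (bb omega1 X j k xi) xi" if x: "xi : O1" for xi
 proof (cases "cc omega1 X j k xi")
  case True
  then show ?thesis using PP_down[OF q True Ord_omega1 x] unfolding nodB_def bb_def by auto
 next
  case False then show ?thesis using bb_nonzero[of omega1 X j k xi] zero_in_omega unfolding nodB_def by simp
 qed
 have f: "is_fun ?B omega1 omega1" by (rule is_fun_vlam[OF d]) (rule nodB_omega1[OF B])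
 have A: "nodA X ?B xi" if x: "xi : O1" for xi
 proof (cases "xi = vempty | EZ ?B xi")
  case True then show ?thesis unfolding nodA_def by blast
 next
  case False
  have xo: "zt : O1" if "zt IN xi" for zt by (rule Ord_trans[OF Ord_omega1 x that])
  have z: "vempty IN xi" using False zero_le[OF Ord_o1[OF x]] by blast
  have "ALL eh:E xi. EX zt:E xi. eh IN zt & cc omega1 X j k zt"
   using False ap[OF xo] bb_nonzero[of omega1 X j k] unfolding EZ_def by metis
  from cc_closed[OF Ord_omega1 x z this] have c: "cc omega1 X j k xi" .
  let ?H = "hull omega1 X (gen xi j k)"
  note h = cc_props[OF c Ord_omega1 o]
  have "rs ?B xi = vlam xi (bb xi (rs X xi) (col ?H j) (col ?H k))" unfolding rs_def[of ?B]
   by (rule vlam_cong) (use bb_collapse[OF h] ap[OF xo] in simp)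
  then show ?thesis unfolding nodA_def using PP_down[OF q c Ord_omega1 x] by blast
 qed
 have "nod X (rs ?B dt) dt" if dl: "dt : O1" for dt
 proof -
  have od: "Ord dt" by (rule Ord_o1[OF dl])
  have so: "E (vsucc dt) <= O1" using dl Ord_sub[OF Ord_omega1 dl] by auto
  have "nodA X (rs ?B dt) xi" if xd: "xi IN (vsucc dt)" for xi
  proof -
   have "E xi <= E dt" using xd Ord_sub[OF od] by auto
   then show ?thesis using nodA_cong[of xi "rs ?B dt" ?B X] ap_rs[of _ dt ?B] A so xd by blast
  qed
  moreover have "nodB X (ap (rs ?B dt) xi) xi" if xd: "xi IN dt" for xi
  proof -
   have "xi : O1" using so xd by auto
   then show ?thesis using ap_rs[OF xd, of ?B] ap B by simp
  qed
  ultimately show ?thesis unfolding nod_def using dl is_fun_rs[OF f Ord_sub[OF Ord_omega1 dl]] by blast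
 qed
 then show ?thesis unfolding UB_def using f by blast
qed

text \<open>Each point \<open>f\<close> has a least code, and a good ordinal above this code yields
  a branch. Distinct points yield distinct branches, and there are more than \<aleph>1 points by
  Cantor's diagonal argument.\<close>

lemma many_branches:
 assumes X: "inS X" and A: "!!U. U IN A <-> UB X U"
 shows "~card_le A omega1"
proof
 assume cA: "card_le A omega1"
 define nx where "nx m = vleast (%m'. ~fl omega1 X m m')" for m
 have dnx: "dfun f ==> dfun (%e. nx (f e))" for f by (rule dfun_comp1[where K = nx]) (unfold nx_def, intro dint)
 have nx: "Ord (nx m) & ~fl omega1 X m (nx m)" for m
 proof -
  have dva: "dfun (%e. va omega1 m (e 0))" for m by (intro dint)
  have Y: "is_fun (vlam omega1 (va omega1 m)) omega1 omega1" for m by (rule is_fun_vlam[OF dva]) (rule va_in[OF zero_in_omega1])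
  obtain Z where Z: "bfun Z" "ALL eh:O1. vpair (rs X eh) (vpair (rs (vlam omega1 (va omega1 m)) eh) (rs Z eh)) IN Rs"
   using X Y[of m] unfolding inS_def by blast
  obtain m' where m': "Ord m'" "ALL xi:O1. v m' xi = ap Z xi" by (rule v_fun[OF Z(1) Ord_o1 Ord_o1])
  have "~fa omega1 X m m' eh" if e: "eh : O1" for eh
  proof -
   have eo: "th : O1" if "th IN eh" for th by (rule Ord_trans[OF Ord_omega1 e that])
   have "rs (vlam omega1 (va omega1 m)) eh = vlam eh (va omega1 m)" unfolding rs_def by (rule vlam_cong) (simp add: ap_vlam[OF dva eo])
   moreover have "rs Z eh = vlam eh (va omega1 m')" unfolding rs_def by (rule vlam_cong) (simp add: va_def m'(2) eo ap_type[OF Z(1)])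
   ultimately show ?thesis unfolding fa_def using Z(2) e by auto
  qed
  then have nf: "~fl omega1 X m m'" unfolding fl_def by blast
  have d: "dpred (%e. ~fl omega1 X m (e 0))" by (intro dint)
  show ?thesis unfolding nx_def using vleast(1,2)[where P = "%m'. ~fl omega1 X m m'", OF d m'(1) nf] by blast
 qed
 \<comment> \<open>Closing \<open>i\<close> under members, successors and the least witness codes
   \<open>nx\<close> produces an ordinal above \<open>i\<close> that is good.\<close>
 define op where "op x y = vun x (upair (vsucc x) (nx x))" for x y :: 'v
 have dop: "dfun (%e. op (e 0) (e (Suc 0)))" unfolding op_def by (intro dint dnx)
 define lu where "lu i = clo op (upair i i)" for i
 have dlu: "dfun f ==> dfun (%e. lu (f e))" for f
  by (rule dfun_comp1[where K = lu]) (unfold lu_def op_def, intro dint dnx)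
 have Qi: "Q omega1 X i (lu i)" if i: "Ord i" for i
 proof -
  have oz: "Ord z" if "z IN (lu i)" for z
  proof (rule clo_Ord[OF dop _ _ that[unfolded lu_def]])
   show "Ord x" if "x IN (upair i i)" for x using that i by simp
   show "Ord z" if "Ord x" "Ord y" "z IN (op x y)" for x y z using that nx[of x] Ord_vsucc Ord_in_Ord unfolding op_def by auto
  qed
  have cl: "E x <= E (lu i)" "nx x IN (lu i)" if x: "x IN (lu i)" for x
   using clo_closed[OF dop x[unfolded lu_def] x[unfolded lu_def]] unfolding lu_def[symmetric] op_def by auto
  have "Ord (lu i)" by (rule OrdI) (use oz cl in blast)+
  moreover have "i IN (lu i)" unfolding lu_def using clo_base[OF dop, of "upair i i"] by auto
  ultimately show ?thesis unfolding Q_def using cl(2) nx by blast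
 qed
 define ix where "ix f = vleast (%i. ALL xi:O1. v i xi = ap f xi)" for f
 have dix: "dfun f ==> dfun (%e. ix (f e))" for f by (rule dfun_comp1[where K = ix]) (unfold ix_def, intro dint)
 have ix: "Ord (ix f)" "ALL xi:O1. v (ix f) xi = ap f xi" if f: "f IN baire" for f
 proof -
  have ff: "bfun f" using f unfolding baire_def by simp
  obtain i where i: "Ord i" "ALL xi:O1. v i xi = ap f xi" by (rule v_fun[OF ff Ord_o1 Ord_o1])
  have d: "dpred (%e. ALL xi:O1. v (e 0) xi = ap f xi)" by (intro dint)
  show "Ord (ix f)" "ALL xi:O1. v (ix f) xi = ap f xi" unfolding ix_def using vleast(1,2)[where P = "%i. ALL xi:O1. v i xi = ap f xi", OF d i] by blast+
 qed
 define BF where "BF f = vlam omega1 (bb omega1 X (ix f) (lu (ix f)))" for f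
 have dBF: "dfun (%e. BF (e 0))" unfolding BF_def by (intro dint dix dlu)
 have apB: "ap (BF f) xi = bb omega1 X (ix f) (lu (ix f)) xi" if "xi : O1" for f xi
  unfolding BF_def by (rule ap_vlam[OF _ that]) (intro dint)
 have "card_le baire A"
 proof (rule card_leI[OF dBF])
  show "BF f IN A" if "f IN baire" for f unfolding A BF_def by (rule bb_UB[OF Qi[OF ix(1)[OF that]]])
  fix f f' assume f: "f IN (baire::'v)" "f' IN (baire::'v)" and e: "BF f = BF f'"
  have ff: "bfun f" "bfun f'" using f unfolding baire_def by simp_all
  let ?i = "ix f" let ?i' = "ix f'" let ?l = "lu (ix f)" let ?l' = "lu (ix f')"
  obtain g where g: "bfun g" "ALL xi. cpt g xi --> cc omega1 X ?i ?l xi" using cc_club by blast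
  show "f = f'"
  proof (rule fun_ext[OF ff])
   fix eh assume eta: "eh IN (omega1::'v)"
   obtain xi where x: "cpt g xi" "eh IN xi" using cpt_ex[OF g(1) eta] by blast
   have xo: "xi : O1" using x unfolding cpt_def by blast
   have c: "cc omega1 X ?i ?l xi" using g(2) x(1) by blast
   have be: "bb omega1 X ?i ?l xi = bb omega1 X ?i' ?l' xi" using apB[OF xo, of f] apB[OF xo, of f'] e by simp
   then have c': "cc omega1 X ?i' ?l' xi" using c bb_nonzero by metis
   let ?H = "hull omega1 X (gen xi ?i ?l)" let ?H' = "hull omega1 X (gen xi ?i' ?l')"
   have P: "PP xi (rs X xi) (col ?H ?i) (col ?H ?l)" by (rule PP_down[OF Qi[OF ix(1)[OF f(1)]] c Ord_omega1 xo])
   have P': "PP xi (rs X xi) (col ?H' ?i') (col ?H' ?l')" by (rule PP_down[OF Qi[OF ix(1)[OF f(2)]] c' Ord_omega1 xo])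
   \<comment> \<open>Equal nonzero values at \<open>xi\<close> mean equal collapses of the two
     codes, and below \<open>xi\<close> the collapse of a code has the same values as the
     code.\<close>
   have "vsucc (pr (col ?H ?i) (col ?H ?l)) = vsucc (pr (col ?H' ?i') (col ?H' ?l'))" using be c c' unfolding bb_def by simp
   then have ci: "col ?H ?i = col ?H' ?i'" using vsucc_inject pr_inject[OF PP_lt(4,5)[OF P] PP_lt(4,5)[OF P']] by metis
   have o: "Ord ?i" "Ord ?l" "Ord ?i'" "Ord ?l'" using Q_Ord[OF Qi[OF ix(1)[OF f(1)]]] Q_Ord[OF Qi[OF ix(1)[OF f(2)]]] by blast+
   note h = cc_props[OF c Ord_omega1 o(1,2)] note h' = cc_props[OF c' Ord_omega1 o(3,4)]
   have "va omega1 ?i eh = va omega1 ?i' eh" using h_va[OF h(1-5) h(6) x(2)] h_va[OF h'(1-5) h'(6) x(2)] ci by simp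
   then show "ap f eh = ap f' eh" unfolding va_def using ix(2)[OF f(1)] ix(2)[OF f(2)] eta ap_type[OF ff(1) eta] ap_type[OF ff(2) eta] by simp
  qed
 qed
 then show False using baire_uncountable card_le_trans[OF _ cA] by blast
qed

section \<open>Branches in the presence of a counterexample \<open>Y\<close>\<close>

context
 fixes X Y i0 U :: 'v
 assumes Y: "bfun Y"
  and cex: "~(EX Z. bfun Z & (ALL eh:O1. vpair (rs X eh) (vpair (rs Y eh) (rs Z eh)) IN Rs))"
  and i0: "Ord i0" "ALL xi:O1. v i0 xi = ap Y xi"
  and U: "UB X U" and unb: "ALL eh:O1. EX zt:O1. eh IN zt & ap U zt ~= vempty"
begin

lemma U_club: obtains g where "bfun g" "ALL xi. cpt g xi --> (ALL eh:E xi. EX zt:E xi. eh IN zt & ap U zt ~= vempty)"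
proof -
 let ?P = "%eh zt. zt : O1 & eh IN zt & ap U zt ~= vempty"
 define s where "s eh = vleast (?P eh)" for eh
 have ds: "dfun (%e. s (e 0))" unfolding s_def by (intro dint)
 have s: "?P eh (s eh)" if e: "eh : O1" for eh
 proof -
  obtain zt where z: "?P eh zt" using unb e by blast
  have d: "dpred (%e. ?P eh (e 0))" by (intro dint)
  have "Ord zt" using z Ord_o1 by blast
  from vleast(2)[of "?P eh", OF d this z] show ?thesis unfolding s_def .
 qed
 have g: "bfun (vlam omega1 s)" by (rule is_fun_vlam[OF ds]) (use s in blast)
 have "EX zt:E xi. eh IN zt & ap U zt ~= vempty" if c: "cpt (vlam omega1 s) xi" and e: "eh IN xi" for xi eh
 proof -
  have eo: "eh : O1" using Ord_trans[OF Ord_omega1 _ e] c unfolding cpt_def by blast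
  have "ap (vlam omega1 s) eh IN xi" using c e unfolding cpt_def by blast
  then have "s eh IN xi" using ap_vlam[OF ds eo] by simp
  then show ?thesis using s[OF eo] by blast
 qed
 then show ?thesis using that g by blast
qed

lemma U_limit: assumes x: "xi : O1" "vempty IN xi" and u: "ALL eh:E xi. EX zt:E xi. eh IN zt & ap U zt ~= vempty"
 shows "EX j k. PP xi (rs X xi) j k & (ALL eh:E xi. ap U eh = bb xi (rs X xi) j k eh)"
proof -
 have "nodA X (rs U xi) xi" using U x(1) unfolding UB_def nod_def by auto
 moreover have "xi ~= vempty" using x(2) by auto
 moreover have "~EZ (rs U xi) xi"
 proof
  assume "EZ (rs U xi) xi"
  then obtain eh where e: "eh IN xi" "ALL zt:E xi. eh IN zt --> ap (rs U xi) zt = vempty" unfolding EZ_def by blast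
  obtain zt where "zt IN xi" "eh IN zt" "ap U zt ~= vempty" using u e(1) by blast
  then show False using e(2) ap_rs[of zt xi U] by metis
 qed
 ultimately obtain j k where jk: "PP xi (rs X xi) j k" "rs (rs U xi) xi = vlam xi (bb xi (rs X xi) j k)" unfolding nodA_def by blast
 have d: "dfun (%e. bb xi (rs X xi) j k (e 0))" by (intro dint)
 have "ap U eh = bb xi (rs X xi) j k eh" if e: "eh IN xi" for eh
  using ap_vlam[OF d e] ap_rs[OF e, of "rs U xi"] ap_rs[OF e, of U] jk(2) by simp
 then show ?thesis using jk(1) by blast
qed

definition jj :: "'v => 'v" where "jj xi = q0 (vthe (%a. ap U xi = vsucc a))"
definition kk :: "'v => 'v" where "kk xi = q1 (vthe (%a. ap U xi = vsucc a))"

lemma djk: "dfun f ==> dfun (%e. jj (f e))" "dfun f ==> dfun (%e. kk (f e))"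
 by (rule dfun_comp1[where K = jj], unfold jj_def, intro dint, assumption, rule dfun_comp1[where K = kk], unfold kk_def, intro dint, assumption)

lemma jk_eq: assumes "ap U xi = vsucc (pr j k)" "j : O1" "k : O1" shows "jj xi = j" "kk xi = k"
proof -
 have "vthe (%a. ap U xi = vsucc a) = pr j k" by (rule vthe_eq) (use assms(1) vsucc_inject in auto)
 then show "jj xi = j" "kk xi = k" unfolding jj_def kk_def using assms by simp_all
qed

text \<open>A nonzero value might be one of the freely inserted natural numbers. This is excluded at
  a limit \<open>al\<close> above \<open>xi\<close> where \<open>U\<close> is generated by a single
  pair, so that every nonzero value below is the successor of a pair.\<close>

lemma U_point:
 assumes x: "xi : O1" "ap U xi ~= vempty"
 shows "PP xi (rs X xi) (jj xi) (kk xi)" "ALL eh:E xi. ap U eh = bb xi (rs X xi) (jj xi) (kk xi) eh"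
proof -
 obtain g where g: "bfun g" "ALL xi. cpt g xi --> (ALL eh:E xi. EX zt:E xi. eh IN zt & ap U zt ~= vempty)" by (rule U_club)
 obtain al where a: "cpt g al" "xi IN al" using cpt_ex[OF g(1) x(1)] by blast
 have ao: "al : O1" "vempty IN al" using a Ord_trans[OF Ord_o1 _ zero_in_omega, of al] unfolding cpt_def by blast+
 obtain j k where jk: "PP al (rs X al) j k" "ALL eh:E al. ap U eh = bb al (rs X al) j k eh" using U_limit[OF ao] g(2) a(1) by blast
 have q: "Q al (rs X al) j k" using jk(1) unfolding PP_def by blast
 have o: "Ord al" "Ord j" "Ord k" using Ord_o1[OF ao(1)] Q_Ord[OF q] by blast+
 have c: "cc al (rs X al) j k xi" using jk(2) a(2) x(2) bb_nonzero by metis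
 have rr: "rs (rs X al) xi = rs X xi" by (rule rs_rs[OF Ord_sub[OF o(1) a(2)]])
 let ?H = "hull al (rs X al) (gen xi j k)"
 have P: "PP xi (rs X xi) (col ?H j) (col ?H k)" using PP_down[OF q c o(1) x(1)] rr by simp
 have "ap U xi = vsucc (pr (col ?H j) (col ?H k))" using jk(2) a(2) c unfolding bb_def by simp
 note e = jk_eq[OF this PP_lt(4,5)[OF P]]
 show "PP xi (rs X xi) (jj xi) (kk xi)" using P e by simp
 note h = cc_props[OF c o]
 have "ap U eh = bb xi (rs X xi) (col ?H j) (col ?H k) eh" if et: "eh IN xi" for eh
  using jk(2) Ord_trans[OF o(1) a(2) et] bb_collapse[OF h et] rr by simp
 then show "ALL eh:E xi. ap U eh = bb xi (rs X xi) (jj xi) (kk xi) eh" using e by simp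
qed

text \<open>A point \<open>al\<close> above \<open>xi\<close> with nonzero value exhibits
  \<open>U\<close> below \<open>al\<close> as a branch function, whose nonzero places are closed by
  \<open>cc_closed\<close>.\<close>

lemma U_closed: assumes x: "xi : O1" "vempty IN xi" and u: "ALL eh:E xi. EX zt:E xi. eh IN zt & ap U zt ~= vempty"
 shows "ap U xi ~= vempty"
proof -
 obtain al where a: "al : O1" "xi IN al" "ap U al ~= vempty" using unb x(1) by blast
 note p = U_point[OF a(1,3)]
 have oa: "Ord al" by (rule Ord_o1[OF a(1)])
 have ez: "ap U zt = bb al (rs X al) (jj al) (kk al) zt" if "zt IN xi" for zt using p(2) Ord_trans[OF oa a(2) that] by blast
 have "ALL eh:E xi. EX zt:E xi. eh IN zt & cc al (rs X al) (jj al) (kk al) zt"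
 proof
  fix eh assume "eh IN xi"
  then obtain zt where z: "zt IN xi" "eh IN zt" "ap U zt ~= vempty" using u by blast
  then have "cc al (rs X al) (jj al) (kk al) zt" using ez[OF z(1)] bb_nonzero by simp
  then show "EX zt:E xi. eh IN zt & cc al (rs X al) (jj al) (kk al) zt" using z by blast
 qed
 from cc_closed[OF oa a(2) x(2) this] show ?thesis using p(2) a(2) bb_nonzero[of al "rs X al" "jj al" "kk al" xi] by simp
qed

lemma U_below:
 assumes x: "xi : O1" "ap U xi ~= vempty" and y: "al : O1" "ap U al ~= vempty" "xi IN al"
 defines "H == hull al (rs X al) (gen xi (jj al) (kk al))"
 shows "jj xi = col H (jj al)" "kk xi = col H (kk al)" "cc al (rs X al) (jj al) (kk al) xi"
proof -
 note p = U_point[OF y(1,2)]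
 have q: "Q al (rs X al) (jj al) (kk al)" using p(1) unfolding PP_def by blast
 have e: "ap U xi = bb al (rs X al) (jj al) (kk al) xi" using p(2) y(3) by blast
 then show c: "cc al (rs X al) (jj al) (kk al) xi" using x(2) bb_nonzero by simp
 have P: "PP xi (rs (rs X al) xi) (col H (jj al)) (col H (kk al))" unfolding H_def by (rule PP_down[OF q c Ord_o1[OF y(1)] x(1)])
 have "ap U xi = vsucc (pr (col H (jj al)) (col H (kk al)))" using e c unfolding bb_def H_def by simp
 from jk_eq[OF this PP_lt(4,5)[OF P]] show "jj xi = col H (jj al)" "kk xi = col H (kk al)" .
qed

definition P1 :: "'v => bool" where "P1 xi <-> (EX i:E (kk xi). ALL eh:E xi. va xi i eh = ap Y eh)"

text \<open>If stationarily often the ordinal \<open>kk \<xi>\<close> exceeds a code of \<open>Y\<close>, then the least witnesses below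
  \<open>kk \<xi>\<close> cohere on a stationary set, so that \<open>Y\<close> is not a counterexample.\<close>

lemma case1:
 assumes A: "stat A" and A': "!!xi. xi IN A ==> xi : O1 & P1 xi & (EX g. cpt g xi) & (ALL eh:E xi. EX zt:E xi. eh IN zt & ap U zt ~= vempty)"
 shows False
proof -
 let ?Z = "%xi z. z IN (kk xi) & (ALL eh:E xi. vpair (rs X eh) (vpair (rs Y eh) (vlam eh (va xi z))) IN Rs)"
 define zz where "zz xi = vleast (?Z xi)" for xi
 have dzz: "dfun f ==> dfun (%e. zz (f e))" for f by (rule dfun_comp1[where K = zz]) (unfold zz_def, intro dint djk)
 let ?h = "%xi zt. hull xi (rs X xi) (gen zt (jj xi) (kk xi))"
 \<comment> \<open>\<open>ze xi\<close> is a point below \<open>xi\<close> from which the least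
   witness \<open>zz xi\<close> is already generated. A nonzero value of \<open>U\<close> there
   places it in the closed set, so \<open>otp_le_ff\<close> bounds the collapse of
   \<open>zz xi\<close>.\<close>
 let ?E = "%xi zt. zt IN xi & ap U zt ~= vempty & zz xi IN (?h xi zt)"
 define ze where "ze xi = vleast (?E xi)" for xi
 have dze: "dfun f ==> dfun (%e. ze (f e))" for f by (rule dfun_comp1[where K = ze]) (unfold ze_def, intro dint djk dzz)
 have Ax: "xi : O1" "Ord xi" "vempty IN xi" "ap U xi ~= vempty" "PP xi (rs X xi) (jj xi) (kk xi)" if x: "xi IN A" for xi
 proof -
  show xo: "xi : O1" using A'[OF x] by blast
  show o: "Ord xi" by (rule Ord_o1[OF xo])
  have "omega IN xi" using A'[OF x] unfolding cpt_def by blast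
  then show z: "vempty IN xi" using Ord_trans[OF o _ zero_in_omega] by blast
  show u: "ap U xi ~= vempty" by (rule U_closed[OF xo z]) (use A'[OF x] in blast)
  show "PP xi (rs X xi) (jj xi) (kk xi)" by (rule U_point(1)[OF xo u])
 qed
 have zz: "?Z xi (zz xi)" if x: "xi IN A" for xi
 proof -
  obtain i where i: "i IN (kk xi)" "ALL eh:E xi. va xi i eh = ap Y eh" using A'[OF x] unfolding P1_def by blast
  have q: "Ord (kk xi)" "ALL i:E (kk xi). EX j':E (kk xi). ~fl xi (rs X xi) i j'" using Ax(5)[OF x] unfolding PP_def Q_def by blast+
  obtain z where z: "z IN (kk xi)" "~fl xi (rs X xi) i z" using q(2) i(1) by blast
  have "vpair (rs X eh) (vpair (rs Y eh) (vlam eh (va xi z))) IN Rs" if e: "eh IN xi" for eh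
  proof -
   have s: "E eh <= E xi" by (rule Ord_sub[OF Ax(2)[OF x] e])
   have "vlam eh (va xi i) = rs Y eh" unfolding rs_def by (rule vlam_cong) (use i(2) s in blast)
   then show ?thesis using z(2) e rs_rs[OF s, of X] unfolding fl_def fa_def by auto
  qed
  then have P: "?Z xi z" using z(1) by blast
  have d: "dpred (%e. ?Z xi (e 0))" by (intro dint djk)
  from vleast(2)[of "?Z xi", OF d Ord_in_Ord[OF q(1) z(1)] P] show ?thesis unfolding zz_def .
 qed
 have ze: "?E xi (ze xi)" if x: "xi IN A" for xi
 proof -
  have l: "ALL eh:E xi. vsucc eh IN xi" using A'[OF x] unfolding cpt_def by blast
  have "zz xi IN (?h xi xi)" using zz[OF x] Ax(5)[OF x] unfolding PP_def by blast
  then obtain eh where e: "eh IN xi" "zz xi IN (?h xi eh)" using hull_finitary[OF Ax(2,3)[OF x] l] by blast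
  obtain zt where z: "zt IN xi" "eh IN zt" "ap U zt ~= vempty" using A'[OF x] e(1) by blast
  have oz: "Ord zt" by (rule Ord_in_Ord[OF Ax(2)[OF x] z(1)])
  have P: "?E xi zt" using z e(2) gen_mono[OF Ord_sub[OF oz z(2)]] by blast
  have d: "dpred (%e. ?E xi (e 0))" by (intro dint djk dzz)
  from vleast(2)[of "?E xi", OF d oz P] show ?thesis unfolding ze_def .
 qed
 have zo: "ze xi : O1" if x: "xi IN A" for xi using Ord_trans[OF Ord_omega1 Ax(1)[OF x]] ze[OF x] by blast
 have Oj: "Ord (jj xi)" "Ord (kk xi)" if x: "xi IN A" for xi using Q_Ord Ax(5)[OF x] unfolding PP_def by blast+
 let ?c = "%xi. col (?h xi (ze xi)) (zz xi)"
 define W where "W eh = (if omega IN eh then vimg (vpair eh) (ff eh) else vempty)" for eh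
 have dW: "dfun (%e. W (e 0))" unfolding W_def by (intro dint)
 have dp: "dfun (%e. vpair eh (e 0))" for eh by (intro dint)
 have Wc: "vcountable (W eh)" if e: "eh : O1" for eh
 proof (cases "omega IN eh")
  case True
  have "card_le (ff eh) omega" using ff(1)[OF e True] unfolding mem_omega1 by blast
  moreover have "W eh = vimg (vpair eh) (ff eh)" using True by (simp only: W_def if_True)
  ultimately show ?thesis unfolding vcountable_def using card_le_vimg[OF dp] by simp
 next
  case False
  then have "W eh = vempty" by (simp only: W_def if_False)
  then show ?thesis unfolding vcountable_def by (simp add: card_le_subset)
 qed
 have hW: "EX eh:E xi. vpair (ze xi) (?c xi) IN (W eh)" if x: "xi IN A" for xi
 proof (rule bexI[of _ "ze xi"])
  show zx: "ze xi IN xi" using ze[OF x] by blast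
  have c: "cc xi (rs X xi) (jj xi) (kk xi) (ze xi)" by (rule U_below(3)[OF zo[OF x] _ Ax(1,4)[OF x] zx]) (use ze[OF x] in blast)
  note h = cc_props[OF c Ax(2)[OF x] Oj[OF x]]
  have "?c xi IN (otp (?h xi (ze xi)))" using ze[OF x] unfolding elts_otp by blast
  then have "?c xi IN (ff (ze xi))" using otp_le_ff[OF h(1-5) zx zo[OF x]] by blast
  moreover have "W (ze xi) = vimg (vpair (ze xi)) (ff (ze xi))" using h(3) by (simp only: W_def if_True)
  ultimately show "vpair (ze xi) (?c xi) IN (W (ze xi))" using elts_vimg[OF dp, of "ze xi" "ff (ze xi)"] by simp
 qed
 \<comment> \<open>The pair of \<open>ze xi\<close> and the collapse of \<open>zz xi\<close> has
   countably many possible values for each \<open>ze xi\<close>, so pressing down makes it constant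
   on a stationary set.\<close>
 have dh: "dfun (%e. vpair (ze (e 0)) (?c (e 0)))" by (intro dint djk dze dzz)
 from fodor[OF A dh dW Wc hW] obtain w where w: "stat (vsep A (%xi. vpair (ze xi) (?c xi) = w))" by blast
 let ?B = "vsep A (%xi. vpair (ze xi) (?c xi) = w)"
 have eB: "E ?B = {xi : E A. vpair (ze xi) (?c xi) = w}" by (rule elts_vsep) (intro dint djk dze dzz)
 \<comment> \<open>Collapsing from \<open>al\<close> to \<open>xi\<close> sends \<open>zz al\<close>
   into the hull at the common point \<open>ze\<close>, where it has the same collapse as
   \<open>zz xi\<close>. By injectivity it is \<open>zz xi\<close>, and the collapse preserves coded
   values below \<open>xi\<close>.\<close>
 have coh: "va xi (zz xi) eh = va al (zz al) eh" if B: "xi IN ?B" "al IN ?B" and xa: "xi IN al" and e: "eh IN xi" for xi al eh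
 proof -
  have x: "xi IN A" "al IN A" "ze xi = ze al" "?c xi = ?c al" using B unfolding eB by auto
  let ?N = "?h al xi"
  note b = U_below[OF Ax(1,4)[OF x(1)] Ax(1,4)[OF x(2)] xa]
  note h = cc_props[OF b(3) Ax(2)[OF x(2)] Oj[OF x(2)]]
  have rr: "rs (rs X al) xi = rs X xi" by (rule rs_rs[OF Ord_sub[OF Ax(2)[OF x(2)] xa]])
  have zs: "E (ze al) <= E xi" using ze[OF x(1)] x(3) Ord_sub[OF Ax(2)[OF x(1)]] by metis
  have zN: "zz al IN ?N" using ze[OF x(2)] h_hull_gen(2)[OF h(1-7) zs] by blast
  have dN: "dfun (%e. col ?N (e 0))" by (intro dint)
  have hh: "?h xi (ze xi) = vimg (col ?N) (?h al (ze al))" using h_hull_gen(1)[OF h(1-7) zs] b(1,2) x(3) rr by simp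
  have "col (?h xi (ze xi)) (col ?N (zz al)) = ?c al" using h_col[OF h(1-7) zs zN] b(1,2) x(3) rr by simp
  then have ce: "col (?h xi (ze xi)) (col ?N (zz al)) = col (?h xi (ze xi)) (zz xi)" using x(4) by simp
  have m: "col ?N (zz al) IN (?h xi (ze xi))" unfolding hh elts_vimg[OF dN] using ze[OF x(2)] by blast
  have c': "cc xi (rs X xi) (jj xi) (kk xi) (ze xi)" using U_below(3)[OF zo[OF x(1)] _ Ax(1,4)[OF x(1)]] ze[OF x(1)] by blast
  note h' = cc_props[OF c' Ax(2)[OF x(1)] Oj[OF x(1)]]
  have "col ?N (zz al) = zz xi" by (rule col_inj[OF _ m _ ce]) (use h_Ord[OF h'(1-5)] ze[OF x(1)] in blast)+
  then show ?thesis using h_va[OF h(1-5) zN e] by simp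
 qed
 have coh': "va xi (zz xi) eh = va al (zz al) eh" if B: "xi IN ?B" "al IN ?B" and e: "eh IN xi" "eh IN al" for xi al eh
 proof -
  have "Ord xi" "Ord al" using B Ax(2) unfolding eB by blast+
  then consider "xi IN al" | "xi = al" | "al IN xi" using Ord_linear by blast
  then show ?thesis
  proof cases
   case 1 then show ?thesis by (rule coh[OF B _ e(1)])
  next
   case 3 then show ?thesis by (rule coh[OF B(2,1) _ e(2), symmetric])
  qed simp
 qed
 define zf where "zf eh = vthe (%y. EX xi:E ?B. eh IN xi & y = va xi (zz xi) eh)" for eh
 have dzf: "dfun (%e. zf (e 0))" unfolding zf_def by (intro dint djk dze dzz)
 have zf: "zf eh = va xi (zz xi) eh" if x: "xi IN ?B" "eh IN xi" for xi eh
  unfolding zf_def by (rule vthe_eq) (use x coh' in blast)+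
 have ex: "EX xi:E ?B. eh IN xi" if "eh : O1" for eh using stat_unbounded[OF w that] by blast
 have "bfun (vlam omega1 zf)"
 proof (rule is_fun_vlam[OF dzf])
  fix eh assume "eh IN (omega1::'v)"
  then obtain xi where x: "xi IN ?B" "eh IN xi" using ex by blast
  then have xA: "xi IN A" unfolding eB by blast
  have "va xi (zz xi) eh IN xi" by (rule va_in[OF Ax(3)[OF xA]])
  then show "zf eh : O1" using zf[OF x] Ord_trans[OF Ord_omega1 Ax(1)[OF xA]] by simp
 qed
 moreover have "vpair (rs X eh) (vpair (rs Y eh) (rs (vlam omega1 zf) eh)) IN Rs" if e: "eh : O1" for eh
 proof -
  obtain xi where x: "xi IN ?B" "eh IN xi" using ex[OF e] by blast
  then have xA: "xi IN A" unfolding eB by blast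
  have "rs (vlam omega1 zf) eh = vlam eh (va xi (zz xi))" unfolding rs_def
  proof (rule vlam_cong)
   fix th assume t: "th IN eh"
   have "th IN xi" "th : O1" using Ord_trans[OF Ax(2)[OF xA] x(2) t] Ord_trans[OF Ord_omega1 e t] by blast+
   then show "ap (vlam omega1 zf) th = va xi (zz xi) th" using ap_vlam[OF dzf] zf[OF x(1)] by simp
  qed
  then show ?thesis using zz[OF xA] x(2) by simp
 qed
 ultimately show False using cex by blast
qed

text \<open>Here \<open>jj xi\<close> and \<open>kk xi\<close> are at most the collapse of
  \<open>i0\<close>, hence collapses of ordinals at most \<open>i0\<close> in the hull. By
  \<open>hull_finitary\<close> these preimages occur in a countable hull at a smaller point, and
  pressing down twice makes both constant.\<close>

lemma case2:
 assumes A: "stat A" and A': "!!xi. xi IN A ==> xi : O1 & ~P1 xi & (EX g. cpt g xi) & ap U xi ~= vempty & cc omega1 X i0 i0 xi"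
 shows "EX l1:E (vsucc i0). EX l2:E (vsucc i0). U = vlam omega1 (bb omega1 X l1 l2)"
proof -
 let ?N = "%xi. hull omega1 X (gen xi i0 i0)"
 define lf where "lf j xi = vthe (%l. l IN (?N xi) & col (?N xi) l = j)" for j xi
 have dlf: "dfun f ==> dfun g ==> dfun (%e. lf (f e) (g e))" for f g by (rule dfun_comp2[where K = lf]) (unfold lf_def, intro dint)
 have Ax: "xi : O1" "Ord xi" "vempty IN xi" "ALL eh:E xi. vsucc eh IN xi" "ap U xi ~= vempty" "PP xi (rs X xi) (jj xi) (kk xi)" if x: "xi IN A" for xi
 proof -
  show xo: "xi : O1" using A'[OF x] by blast
  show o: "Ord xi" by (rule Ord_o1[OF xo])
  have "omega IN xi" using A'[OF x] unfolding cpt_def by blast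
  then show z: "vempty IN xi" using Ord_trans[OF o _ zero_in_omega] by blast
  show "ALL eh:E xi. vsucc eh IN xi" using A'[OF x] unfolding cpt_def by blast
  show u: "ap U xi ~= vempty" using A'[OF x] by blast
  show "PP xi (rs X xi) (jj xi) (kk xi)" by (rule U_point(1)[OF xo u])
 qed
 note h = cc_props[OF _ Ord_omega1 i0(1) i0(1), where x = X]
 have lf: "lf j xi IN (?N xi)" "lf j xi IN (vsucc i0)" "col (?N xi) (lf j xi) = j" if x: "xi IN A" and j: "j = jj xi | j = kk xi" for j xi
 proof -
  have c: "cc omega1 X i0 i0 xi" using A'[OF x] by blast
  let ?b = "col (?N xi) i0"
  have "va xi ?b eh = ap Y eh" if e: "eh IN xi" for eh
  proof -
   have eo: "eh : O1" by (rule Ord_trans[OF Ord_omega1 Ax(1)[OF x] e])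
   then show ?thesis using h_va[OF h(1-5)[OF c] h(6)[OF c] e] i0(2) ap_type[OF Y eo] unfolding va_def by simp
  qed
  \<comment> \<open>The collapse of \<open>i0\<close> codes the restriction of \<open>Y\<close> to
    \<open>xi\<close>, so the failure of \<open>P1\<close> says that it is not below
    \<open>kk xi\<close>.\<close>
  then have nb: "?b ~: E (kk xi)" using A'[OF x] unfolding P1_def by blast
  have q: "Ord (kk xi)" "jj xi IN (kk xi)" using Ax(6)[OF x] unfolding PP_def Q_def by blast+
  have ob: "Ord ?b" by (rule col_Ord[OF i0(1)])
  have kb: "kk xi IN (vsucc ?b)" using Ord_linear[OF ob q(1)] nb by auto
  have "jj xi IN (vsucc ?b)" by (rule Ord_trans[OF Ord_vsucc[OF ob] kb q(2)])
  then have jb: "j = ?b | j IN ?b" using kb j by auto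
  then obtain l where l: "l IN (?N xi)" "l IN (vsucc i0)" "col (?N xi) l = j"
  proof
   assume "j = ?b" then show ?thesis using that[of i0] h(6)[OF c] by simp
  next
   assume "j IN ?b" then show ?thesis using that unfolding elts_col by auto
  qed
  have "lf j xi = l" unfolding lf_def
   by (rule vthe_eq) (use l col_inj[of "?N xi", OF h_Ord[OF h(1-5)[OF c]]] in auto)
  then show "lf j xi IN (?N xi)" "lf j xi IN (vsucc i0)" "col (?N xi) (lf j xi) = j" using l by simp_all
 qed
 have dN: "dfun (%e. ?N (e 0))" by (intro dint)
 have Nc: "vcountable (?N eh)" if "eh : O1" for eh unfolding vcountable_def
  by (rule hull_countable) (use that countable_vun[OF _ countable_upair] mem_omega1 in \<open>auto simp: gen_def\<close>)
 have hW: "EX eh:E xi. lf j xi IN (?N eh)" if x: "xi IN A" and j: "j = jj xi | j = kk xi" for j xi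
  by (rule hull_finitary[OF Ax(2,3,4)[OF x] lf(1)[OF x j]])
 have d1: "dfun (%e. lf (jj (e 0)) (e 0))" "dfun (%e. lf (kk (e 0)) (e 0))" by (intro dlf dint djk)+
 from fodor[OF A d1(1) dN Nc hW] obtain l1 where l1: "stat (vsep A (%xi. lf (jj xi) xi = l1))" by blast
 let ?A1 = "vsep A (%xi. lf (jj xi) xi = l1)"
 have e1: "E ?A1 = {xi : E A. lf (jj xi) xi = l1}" by (rule elts_vsep) (intro dint dlf djk)
 have hW2: "EX eh:E xi. lf (kk xi) xi IN (?N eh)" if "xi IN ?A1" for xi using hW that unfolding e1 by blast
 from fodor[OF l1 d1(2) dN Nc hW2] obtain l2 where l2: "stat (vsep ?A1 (%xi. lf (kk xi) xi = l2))" by blast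
 let ?B = "vsep ?A1 (%xi. lf (kk xi) xi = l2)"
 have "E ?B = {xi : E ?A1. lf (kk xi) xi = l2}" by (rule elts_vsep) (intro dint dlf djk)
 then have e2: "E ?B = {xi : E A. lf (jj xi) xi = l1 & lf (kk xi) xi = l2}" unfolding e1 by blast
 have db: "dfun (%e. bb omega1 X l1 l2 (e 0))" by (intro dint)
 have val: "ap U eh = bb omega1 X l1 l2 eh" if e: "eh : O1" for eh
 proof -
  obtain xi where x: "xi IN ?B" "eh IN xi" using stat_unbounded[OF l2 e] by blast
  have xA: "xi IN A" and l: "lf (jj xi) xi = l1" "lf (kk xi) xi = l2" using x(1) unfolding e2 by blast+
  have c: "cc omega1 X i0 i0 xi" using A'[OF xA] by blast
  have m: "l1 IN (?N xi)" "l2 IN (?N xi)" "col (?N xi) l1 = jj xi" "col (?N xi) l2 = kk xi"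
   using lf(1,3)[OF xA, of "jj xi"] lf(1,3)[OF xA, of "kk xi"] l by auto
  have "ap U eh = bb xi (rs X xi) (jj xi) (kk xi) eh" using U_point(2)[OF Ax(1,5)[OF xA]] x(2) by blast
  then show ?thesis using bb_collapse[OF h(1-5)[OF c] m(1,2) x(2)] m(3,4) by simp
 qed
 have fU: "bfun U" using U unfolding UB_def by blast
 have "U = vlam omega1 (bb omega1 X l1 l2)"
  by (rule fun_ext[OF fU is_fun_vlam_img[OF db]]) (simp add: val ap_vlam[OF db])
 moreover obtain xi where "xi IN ?B" using stat_unbounded[OF l2 zero_in_omega1] by blast
 then have "l1 IN (vsucc i0)" "l2 IN (vsucc i0)" using lf(2)[of xi "jj xi"] lf(2)[of xi "kk xi"] unfolding e2 by auto
 ultimately show ?thesis by blast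
qed

lemma U_code: "EX l1:E (vsucc i0). EX l2:E (vsucc i0). U = vlam omega1 (bb omega1 X l1 l2)"
proof -
 obtain g where g: "bfun g" "ALL xi. cpt g xi --> (ALL eh:E xi. EX zt:E xi. eh IN zt & ap U zt ~= vempty)" by (rule U_club)
 obtain g' where g': "bfun g'" "ALL xi. cpt g' xi --> cc omega1 X i0 i0 xi" using cc_club by blast
 obtain k where k: "bfun k" "ALL xi. cpt k xi --> cpt g xi & cpt g' xi" by (rule cpt_and[OF g(1) g'(1)])
 let ?A = "vsep omega1 (cpt k)"
 have A: "stat ?A" by (rule stat_cpt[OF stat_omega1 k(1)])
 have eA: "E ?A = {xi : O1. cpt k xi}" by (rule elts_vsep) (intro dint)
 have dP: "dpred (%e. P1 (e 0))" unfolding P1_def by (intro dint djk)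
 have dnP: "dpred (%e. ~P1 (e 0))" by (intro dint dP)
 have z: "vempty IN xi" if "cpt k xi" "xi : O1" for xi using that Ord_trans[OF Ord_o1 _ zero_in_omega] unfolding cpt_def by blast
 have u: "ap U xi ~= vempty" if "cpt k xi" "xi : O1" for xi
  by (rule U_closed[OF that(2) z[OF that]]) (use that k(2) g(2) in blast)
 from stat_split[OF A dP] show ?thesis
 proof
  assume s: "stat (vsep ?A P1)"
  have False by (rule case1[OF s]) (use elts_vsep[OF dP, of ?A] eA k(2) g(2) in auto)
  then show ?thesis ..
 next
  assume s: "stat (vsep ?A (%xi. ~P1 xi))"
  show ?thesis by (rule case2[OF s]) (use elts_vsep[OF dnP, of ?A] eA k(2) g'(2) u in auto)
 qed
qed

end

text \<open>Paths with unbounded nonzero values come from pairs of ordinals at most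
  \<open>i0\<close>, which has size at most \<aleph>1. The remaining ones are eventually zero and
  determined by a node of countable length.\<close>

lemma few_branches:
 assumes X: "~inS X" and A: "!!U. U IN A <-> UB X U"
 shows "card_le A omega1"
proof -
 obtain Y where Y: "bfun Y" "~(EX Z. bfun Z & (ALL eh:O1. vpair (rs X eh) (vpair (rs Y eh) (rs Z eh)) IN Rs))"
  using X unfolding inS_def by blast
 obtain i0 where i0: "Ord i0" "card_le i0 omega1" "ALL xi:O1. v i0 xi = ap Y xi" using v_baire[OF Y(1)] by blast
 have d1: "dfun (%e. vimg (%l2. vlam omega1 (bb omega1 X (e 0) l2)) (vsucc i0))" by (intro dint)
 have d2: "dfun (%e. vlam omega1 (bb omega1 X l1 (e 0)))" for l1 by (intro dint)
 let ?B = "vUN (vsucc i0) (%l1. vimg (%l2. vlam omega1 (bb omega1 X l1 l2)) (vsucc i0))"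
 have "vsucc i0 = vun i0 (upair i0 i0)" by (rule extensionality) auto
 then have ci: "card_le (vsucc i0) omega1" using omega1_vun[OF i0(2) card_le_omega1[OF countable_upair[of i0 i0]]] by simp
 have B: "card_le ?B omega1" by (rule card_le_vUN[OF d1 ci _ omega1_square]) (rule card_le_vimg[OF d2 ci])
 have d3: "dfun (%e. vimg (%b. xt b (e 0) vempty omega1) (NS X (e 0)))" by (intro dint)
 have d4: "dfun (%e. xt (e 0) eh vempty omega1)" for eh by (intro dint)
 let ?C = "vUN omega1 (%eh. vimg (%b. xt b eh vempty omega1) (NS X eh))"
 have C: "card_le ?C omega1"
  by (rule card_le_vUN[OF d3 card_le_subset[OF subset_refl] _ omega1_square])
   (rule card_le_vimg[OF d4 card_le_omega1[OF NS_countable[unfolded vcountable_def]]])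
 have "E A <= E (vun ?B ?C)"
 proof
  fix U assume "U IN A"
  then have U: "UB X U" unfolding A .
  have fU: "bfun U" using U unfolding UB_def by blast
  show "U IN (vun ?B ?C)"
  proof (cases "ALL eh:O1. EX zt:O1. eh IN zt & ap U zt ~= vempty")
   case True
   from U_code[OF Y i0(1,3) U this] obtain l1 l2 where l: "l1 IN (vsucc i0)" "l2 IN (vsucc i0)" "U = vlam omega1 (bb omega1 X l1 l2)" by blast
   have "U IN ?B" unfolding elts_vUN[OF d1] by (rule UN_I[OF l(1)]) (unfold elts_vimg[OF d2], use l(2,3) in blast)
   then show ?thesis by simp
  next
   case False
   then obtain eh where e: "eh : O1" "ALL zt:O1. eh IN zt --> ap U zt = vempty" by blast
   let ?s = "vsucc eh"
   have s: "?s : O1" by (rule succ_in_omega1[OF e(1)])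
   have v: "(if zt IN ?s then ap (rs U ?s) zt else if zt = ?s then vempty else vempty) = ap U zt" if z: "zt : O1" for zt
   proof (cases "zt IN ?s")
    case True then show ?thesis using ap_rs[OF True, of U] by simp
   next
    case False
    then have "eh IN zt" using Ord_linear[OF Ord_o1[OF z] Ord_o1[OF e(1)]] by auto
    then show ?thesis using e(2) z False by simp
   qed
   have "U = xt (rs U ?s) ?s vempty omega1"
   proof (rule fun_ext[OF fU])
    show "is_fun (xt (rs U ?s) ?s vempty omega1) omega1 omega1" by (rule is_fun_xt) (use v ap_type[OF fU] in simp)
    show "ap U zt = ap (xt (rs U ?s) ?s vempty omega1) zt" if "zt : O1" for zt unfolding ap_xt[OF that] using v[OF that] by simp
   qed
   moreover have "rs U ?s IN (NS X ?s)" unfolding elts_NS using U s unfolding UB_def by blast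
   ultimately have "U IN (vimg (%b. xt b ?s vempty omega1) (NS X ?s))" unfolding elts_vimg[OF d4] by blast
   then have "U IN ?C" unfolding elts_vUN[OF d3] by (rule UN_I[OF s])
   then show ?thesis by simp
  qed
 qed
 then show ?thesis using card_le_trans[OF card_le_subset omega1_vun[OF B C]] by blast
qed

end

section \<open>Borel sets as projections of closed sets\<close>

lemma elts_vInter: assumes "C ~= vempty" shows "E (vInter C) = (INT a:E C. E (a::'v::zfc))"
proof -
 obtain c where c: "c IN C" using assms unfolding vempty_iff by blast
 have "dpred (%e. ALL a:E C. e 0 IN a)" by (intro dint)
 from elts_vsep[OF this, of c] have "E (vsep c (%x. ALL a:E C. x IN a)) = (INT a:E C. E a)" using c by auto
 then show ?thesis unfolding vInter_def by (rule elts_set_of)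
qed

definition cmpl :: "'v::zfc => 'v => 'v" where "cmpl S a = vsep S (%x. x ~: E a)"

lemma elts_cmpl: "E (cmpl S a) = E S - E a"
 unfolding cmpl_def by (subst elts_vsep) (intro dint, auto)

lemma [dint]: "dfun f ==> dfun g ==> dfun (%e. cmpl (f e) (g e))"
 by (rule dfun_comp2[where K = cmpl]) (unfold cmpl_def, intro dint)

lemma set_of_cmpl: "set_of (E S - E a) = cmpl S a"
 by (rule set_of_eq) (rule elts_cmpl)

lemma elts_cone: "E (cone s) = {f. bfun f & E s <= E (f::'v::zfc)}"
proof -
 have d: "dpred (%e. E s <= E (e 0))" by (intro dint)
 show ?thesis unfolding cone_def set_of_vsep[OF d] elts_vsep[OF d] baire_def by auto
qed

lemma [dint]: "dfun f ==> dfun (%e. cone (f e :: 'v::zfc))"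
proof -
 have c: "cone s = vsep (funs omega1 omega1) (%f. E s <= E f)" for s :: 'v
  unfolding cone_def baire_def by (rule set_of_vsep) (intro dint)
 show "dfun f ==> dfun (%e. cone (f e))" by (rule dfun_comp1[where K = cone]) (unfold c, intro dint)
qed

definition nodes :: "'v::zfc" where "nodes = vUN omega1 (%al. funs al omega1)"

lemma elts_nodes: "s IN nodes <-> is_node (s::'v::zfc)"
proof -
 have d: "dfun (%e. funs (e 0) (omega1::'v))" by (intro dint)
 show ?thesis unfolding nodes_def elts_vUN[OF d] is_node_def by simp
qed

lemma elts_baire_base: "E baire_base = {cone s | s. is_node (s::'v::zfc)}"
proof -
 have d: "dfun (%e. cone (e 0 :: 'v))" by (intro dint)
 have "E (vimg cone nodes) = {cone s | s. is_node (s::'v)}" unfolding elts_vimg[OF d] using elts_nodes by auto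
 then show ?thesis unfolding baire_base_def by (rule elts_set_of)
qed

lemma elts_vtimes3: "t IN (vtimes3 A B C) <-> (EX X:E A. EX Y:E B. EX Z:E C. t = vpair X (vpair Y Z))"
 unfolding vtimes3_def by auto

lemma elts_baire3_base: "E baire3_base = {vtimes3 (cone s) (cone t) (cone u) | s t u. is_node (s::'v::zfc) & is_node t & is_node u}"
proof -
 have d1: "dfun (%e. vUN nodes (%t. vimg (%u. vtimes3 (cone (e 0 :: 'v)) (cone t) (cone u)) nodes))" unfolding vtimes3_def by (intro dint)
 have d2: "dfun (%e. vimg (%u. vtimes3 (cone s) (cone (e 0)) (cone u)) nodes)" for s :: 'v unfolding vtimes3_def by (intro dint)
 have d3: "dfun (%e. vtimes3 (cone s) (cone t) (cone (e 0)))" for s t :: 'v unfolding vtimes3_def by (intro dint)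
 have "E (vUN nodes (%s. vUN nodes (%t. vimg (%u. vtimes3 (cone s) (cone t) (cone u)) nodes)))
  = {vtimes3 (cone s) (cone t) (cone u) | s t u. is_node (s::'v) & is_node t & is_node u}"
  unfolding elts_vUN[OF d1] elts_vUN[OF d2] elts_vimg[OF d3] using elts_nodes by blast
 then show ?thesis unfolding baire3_base_def by (rule elts_set_of)
qed

lemma (in KT) node_sub: assumes s: "is_fun s al omega1" and a: "al : O1" and f: "is_fun f omega1 (omega1::'v)"
 shows "E s <= E f <-> rs f al = s"
proof -
 have sub: "E al <= O1" by (rule Ord_sub[OF Ord_omega1 a])
 show ?thesis
 proof
  assume e: "E s <= E f"
  show "rs f al = s"
  proof (rule fun_ext[OF is_fun_rs[OF f sub] s])
   fix x assume x: "x IN al"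
   have "vpair x (ap s x) IN f" using vpair_ap[OF s x] e by blast
   then show "ap (rs f al) x = ap s x" using ap_rs[OF x] ap_eq[OF f] by simp
  qed
 next
  assume e: "rs f al = s"
  show "E s <= E f"
  proof
   fix z assume "z IN s"
   then obtain x where x: "x IN al" "z = vpair x (ap f x)" using mem_is_fun[OF is_fun_rs[OF f sub], of z] e by auto
   then have "x : O1" using sub by blast
   then show "z IN f" using vpair_ap[OF f] x(2) by simp
  qed
 qed
qed

context KT
begin

lemma pr_point: assumes "a : O1" "b : O1"
 shows "EX xi:E (omega1::'v). a IN xi & b IN xi & omega IN xi & (ALL x:E xi. ALL y:E xi. pr x y IN xi)"
proof -
 have d: "dfun (%e. vempty :: 'v)" by (intro dint)
 have g: "is_fun (vlam omega1 (%_. vempty)) omega1 (omega1::'v)" by (rule is_fun_vlam[OF d]) simp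
 obtain c where c: "c : O1" "E a <= E c" "E b <= E c" "a = c | a IN c" "b = c | b IN c"
  using Ord_linear[OF Ord_o1[OF assms(1)] Ord_o1[OF assms(2)]] assms Ord_sub Ord_o1 by blast
 obtain xi where x: "cpt (vlam omega1 (%_. vempty)) xi" "c IN xi" using cpt_ex[OF g c(1)] by blast
 have xo: "xi : O1" using x unfolding cpt_def by blast
 have "a IN xi" "b IN xi" using c x(2) Ord_trans[OF Ord_o1[OF xo] x(2)] by blast+
 then show ?thesis using xo x(1) unfolding cpt_def by blast
qed

text \<open>A basic open set fixes countably many coordinates of the value. Each coordinate depends
  locally on the argument, and the chosen bounds \<open>dd u\<close> have a countable
  supremum.\<close>

lemma continuousI:
 assumes d: "dfun (%e. G (e 0))" and G: "!!X. bfun X ==> is_fun (G X) omega1 (omega1::'v)"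
  and loc: "!!X u. bfun X ==> u : O1 ==> EX dt:O1. ALL X'. bfun X' --> rs X' dt = rs X dt --> ap (G X') u = ap (G X) u"
 shows "is_continuous (vlam baire G)" "!!X. bfun X ==> app (vlam baire G) X = G X"
proof -
 have d': "dfun f ==> dfun (%e. G (f e))" for f by (rule dfun_comp1[where K = G, OF d])
 have f: "is_fun (vlam baire G) baire baire" by (rule is_fun_vlam[OF d]) (use G in \<open>simp add: baire_def\<close>)
 show app: "app (vlam baire G) X = G X" if "bfun X" for X
 proof -
  have x: "X IN baire" using that unfolding baire_def by simp
  show ?thesis using app_ap[OF f x] ap_vlam[OF d x] by simp
 qed
 have "is_open baire_base (set_of {f : E baire. app (vlam baire G) f IN U})" if oU: "is_open baire_base U" for U
 proof -
  obtain C where C: "E C <= E baire_base" "U = vUnion C" using oU unfolding is_open_def by blast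
  let ?V = "vsep baire (%f. G f IN U)"
  have dV: "dpred (%e. G (e 0) IN U)" by (intro dint d')
  have eV: "E ?V = {f. bfun f & G f IN U}" unfolding elts_vsep[OF dV] baire_def by auto
  have "{f. bfun f & G f IN U} = {f : E baire. app (vlam baire G) f IN U}" using app mem_funs[of _ omega1 omega1] unfolding baire_def by auto
  then have "E ?V = {f : E baire. app (vlam baire G) f IN U}" using eV by simp
  then have sV: "set_of {f : E baire. app (vlam baire G) f IN U} = ?V" by (metis set_of_eq)
  let ?C = "vsep baire_base (%c. E c <= E ?V)"
  have eC: "E ?C = {c : E baire_base. E c <= E ?V}" by (rule elts_vsep) (intro dint)
  have "EX c:E ?C. X IN c" if X: "X IN ?V" for X
  proof -
   have Xf: "bfun X" and XU: "G X IN U" using X unfolding eV by blast+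
   obtain c where c: "c IN C" "G X IN c" using XU C(2) by auto
   then obtain s where s: "c = cone s" "is_node s" using C(1) unfolding elts_baire_base by blast
   obtain al where a: "al : O1" "is_fun s al omega1" using s(2) unfolding is_node_def by blast
   have gs: "rs (G X) al = s" using c(2) node_sub[OF a(2,1) G[OF Xf]] unfolding s(1) elts_cone by blast
   let ?P = "%u dt. dt : O1 & (ALL X'. bfun X' --> rs X' dt = rs X dt --> ap (G X') u = ap (G X) u)"
   define dd where "dd u = vleast (?P u)" for u
   have ddd: "dfun (%e. dd (e 0))" unfolding dd_def by (intro dint d')
   have dd: "?P u (dd u)" if u: "u : O1" for u
   proof -
    obtain dt where dl: "?P u dt" using loc[OF Xf u] by blast
    have dP: "dpred (%e. ?P u (e 0))" by (intro dint d')
    have "Ord dt" using dl Ord_o1 by blast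
    from vleast(2)[of "?P u", OF dP this dl] show ?thesis unfolding dd_def .
   qed
   have ac: "vcountable al" using a(1) unfolding vcountable_def mem_omega1 by blast
   have au: "u : O1" if "u IN al" for u by (rule Ord_trans[OF Ord_omega1 a(1) that])
   obtain dt where dl: "dt : O1" "ALL u:E al. dd u IN dt" using omega1_sup[OF ddd ac] dd au by blast
   have n: "is_fun (rs X dt) dt omega1" by (rule is_fun_rs[OF Xf Ord_sub[OF Ord_omega1 dl(1)]])
   have "X' IN ?V" if X': "X' IN (cone (rs X dt))" for X'
   proof -
    have x: "bfun X'" "rs X' dt = rs X dt" using X' node_sub[OF n dl(1)] unfolding elts_cone by blast+
    have "ap (G X') u = ap (G X) u" if u: "u IN al" for u
    proof -
     have "E (dd u) <= E dt" using dl Ord_sub[OF Ord_o1[OF dl(1)]] u by blast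
     then have "rs X' (dd u) = rs X (dd u)" using rs_rs[of "dd u" dt X'] rs_rs[of "dd u" dt X] x(2) by simp
     then show ?thesis using dd[OF au[OF u]] x(1) by blast
    qed
    then have "rs (G X') al = s" using gs rs_cong[of al "G X'" "G X"] by simp
    then have "G X' IN c" unfolding s(1) elts_cone using node_sub[OF a(2,1) G[OF x(1)]] G[OF x(1)] by blast
    then have "G X' IN U" using c(1) C(2) by auto
    then show ?thesis unfolding eV using x(1) by blast
   qed
   moreover have "cone (rs X dt) IN baire_base" unfolding elts_baire_base is_node_def using n dl(1) by blast
   moreover have "X IN (cone (rs X dt))" unfolding elts_cone using Xf node_sub[OF n dl(1) Xf] by blast
   ultimately show ?thesis unfolding eC by blast
  qed
  then have "vUnion ?C = ?V" by (intro extensionality) (use eC in auto)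
  then show ?thesis unfolding sV is_open_def using eC by (intro exI[of _ ?C]) auto
 qed
 then show "is_continuous (vlam baire G)" unfolding is_continuous_def using f by blast
qed

section \<open>Projections of closed sets\<close>

definition b3 :: 'v where "b3 = vtimes3 baire baire baire"

definition ag :: "'v => 'v => 'v => bool" where
 "ag eh t t' <-> (EX X Y Z X' Y' Z'. t = vpair X (vpair Y Z) & t' = vpair X' (vpair Y' Z') &
  rs X eh = rs X' eh & rs Y eh = rs Y' eh & rs Z eh = rs Z' eh)"

lemma [dint]: "dfun f ==> dfun g ==> dfun h ==> dpred (%e. ag (f e) (g e) (h e))"
 by (rule dpred_comp3[where P = ag]) (unfold ag_def, intro dint)

lemma ag_pair: "ag eh (vpair X (vpair Y Z)) (vpair X' (vpair Y' Z')) <-> rs X eh = rs X' eh & rs Y eh = rs Y' eh & rs Z eh = rs Z' eh"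
 unfolding ag_def by auto

lemma ag_trans: "ag eh t t' ==> ag eh t' t'' ==> ag eh t t''" unfolding ag_def by fastforce

lemma ag_sym: "ag eh t t' ==> ag eh t' t" unfolding ag_def by metis

lemma rs_mono: "rs f xi = rs g xi ==> E eh <= E xi ==> rs f eh = rs g eh"
 using rs_rs[of eh xi f] rs_rs[of eh xi g] by simp

lemma ag_mono: "ag xi t t' ==> E eh <= E xi ==> ag eh t t'" unfolding ag_def using rs_mono by blast

lemma b3_mem: "t IN b3 <-> (EX X Y Z. t = vpair X (vpair Y Z) & bfun X & bfun Y & bfun Z)"
 unfolding b3_def elts_vtimes3 baire_def by auto

lemma ag_refl: "t IN b3 ==> ag eh t t" unfolding b3_mem ag_def by blast

definition closed :: "'v => bool" where
 "closed D <-> (ALL t:E b3. ALL W:E baire. vpair t W ~: E D -->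
  (EX eh:O1. ALL t':E b3. ALL W':E baire. ag eh t t' --> rs W eh = rs W' eh --> vpair t' W' ~: E D))"

definition good :: "'v => bool" where
 "good b <-> (EX D. closed D & (ALL t:E b3. t IN b <-> (EX W:E baire. vpair t W IN D)))"

lemma [dint]: "dfun f ==> dpred (%e. closed (f e))"
 by (rule dpred_comp1[where P = closed]) (unfold closed_def baire_def, intro dint)

lemma [dint]: "dfun f ==> dpred (%e. good (f e))"
 by (rule dpred_comp1[where P = good]) (unfold good_def baire_def, intro dint)

definition DD :: "('v => 'v => bool) => 'v" where
 "DD P = vsep (vtimes b3 baire) (%z. EX t W. z = vpair t W & P t W)"

lemma goodI:
 assumes d: "dpred (%e. P (e 0) (e (Suc 0)))"
  and cl: "!!t W. t IN b3 ==> W IN baire ==> ~P t W ==> EX eh:O1. ALL t':E b3. ALL W':E baire. ag eh t t' --> rs W eh = rs W' eh --> ~P t' W'"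
  and b: "!!t. t IN b3 ==> t IN b <-> (EX W:E baire. P t W)"
 shows "good b"
proof -
 have d': "dfun f ==> dfun g ==> dpred (%e. P (f e) (g e))" for f g by (rule dpred_comp2[where P = P, OF d])
 have dz: "dpred (%e. EX t W. e 0 = vpair t W & P t W)" by (intro dint d')
 have m: "vpair t W IN (DD P) <-> P t W" if "t IN b3" "W IN baire" for t W
  unfolding DD_def elts_vsep[OF dz] using that by auto
 have "closed (DD P)" unfolding closed_def
 proof (intro ballI impI)
  fix t W assume tW: "t IN b3" "W IN baire" "vpair t W ~: E (DD P)"
  from cl[OF tW(1,2)] m[OF tW(1,2)] tW(3) obtain eh where "eh : O1" "ALL t':E b3. ALL W':E baire. ag eh t t' --> rs W eh = rs W' eh --> ~P t' W'" by blast
  then show "EX eh:O1. ALL t':E b3. ALL W':E baire. ag eh t t' --> rs W eh = rs W' eh --> vpair t' W' ~: E (DD P)" using m by (intro bexI[of _ eh]) auto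
 qed
 moreover have "ALL t:E b3. t IN b <-> (EX W:E baire. vpair t W IN (DD P))" using b m by auto
 ultimately show ?thesis unfolding good_def by blast
qed

lemma open_ag:
 assumes "is_open baire3_base U" shows "E U <= E b3" "t IN U ==> EX eh:O1. ALL t':E b3. ag eh t t' --> t' IN U"
proof -
 obtain C where C: "E C <= E baire3_base" "U = vUnion C" using assms unfolding is_open_def by blast
 have c3: "EX s r u. c = vtimes3 (cone s) (cone r) (cone u) & is_node s & is_node r & is_node u" if "c IN C" for c
  using C(1) that unfolding elts_baire3_base by blast
 show "E U <= E b3"
 proof
  fix t assume "t IN U"
  then obtain c where c: "c IN C" "t IN c" using C(2) by auto
  obtain s r u where s: "c = vtimes3 (cone s) (cone r) (cone u)" using c3[OF c(1)] by blast
  show "t IN b3" using c(2) unfolding s elts_vtimes3 b3_mem elts_cone by blast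
 qed
 assume "t IN U"
 then obtain c where c: "c IN C" "t IN c" using C(2) by auto
 obtain s r u where s: "c = vtimes3 (cone s) (cone r) (cone u)" "is_node s" "is_node r" "is_node u" using c3[OF c(1)] by blast
 obtain al bt ga where a: "al : O1" "is_fun s al omega1" "bt : O1" "is_fun r bt omega1" "ga : O1" "is_fun u ga omega1"
  using s(2-4) unfolding is_node_def by blast
 obtain X Y Z where t: "t = vpair X (vpair Y Z)" "X IN (cone s)" "Y IN (cone r)" "Z IN (cone u)" using c(2) unfolding s(1) elts_vtimes3 by blast
 obtain xi where x: "xi : O1" "al IN xi" "bt IN xi" using pr_point[OF a(1,3)] by blast
 obtain eh where e: "eh : O1" "xi IN eh" "ga IN eh" using pr_point[OF x(1) a(5)] by blast
 have o: "Ord xi" "Ord eh" using Ord_o1 x e by blast+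
 have se: "E al <= E eh" "E bt <= E eh" "E ga <= E eh"
  using Ord_sub[OF o(2) e(2)] Ord_sub[OF o(1) x(2)] Ord_sub[OF o(1) x(3)] Ord_sub[OF o(2) e(3)] by blast+
 have k: "f' IN (cone n)" if n: "is_fun n dt omega1" "dt : O1" "E dt <= E eh" and f: "f IN (cone n)" "bfun f'" "rs f eh = rs f' eh" for n dt f f'
 proof -
  have "rs f dt = n" using f(1) node_sub[OF n(1,2)] unfolding elts_cone by blast
  then have "rs f' dt = n" using rs_mono[OF f(3) n(3)] by simp
  then show ?thesis unfolding elts_cone using node_sub[OF n(1,2) f(2)] f(2) by blast
 qed
 have "t' IN U" if t': "t' IN b3" "ag eh t t'" for t'
 proof -
  obtain X' Y' Z' where p: "t' = vpair X' (vpair Y' Z')" "bfun X'" "bfun Y'" "bfun Z'" using t'(1) unfolding b3_mem by blast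
  have r: "rs X eh = rs X' eh" "rs Y eh = rs Y' eh" "rs Z eh = rs Z' eh" using t'(2) unfolding t(1) p(1) ag_pair by blast+
  have "t' IN c" unfolding s(1) elts_vtimes3 p(1)
   using k[OF a(2,1) se(1) t(2) p(2) r(1)] k[OF a(4,3) se(2) t(3) p(3) r(2)] k[OF a(6,5) se(3) t(4) p(4) r(3)] by blast
  then show ?thesis using c(1) C(2) by auto
 qed
 then show "EX eh:O1. ALL t':E b3. ag eh t t' --> t' IN U" using e(1) by blast
qed

text \<open>The complement is closed and ignores the additional point \<open>W\<close>. For
  \<open>U\<close> itself, the value of \<open>W\<close> at 0 names a length for which the basic
  neighbourhood of the triple lies inside \<open>U\<close>.\<close>

lemma good_open: assumes "is_open baire3_base U" shows "good U" "good (cmpl b3 U)"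
proof -
 note o = open_ag[OF assms]
 show "good (cmpl b3 U)"
 proof (rule goodI[where P = "%t W. t ~: E U"])
  show "dpred (%e. e 0 ~: E U)" by (intro dint)
  show "EX eh:O1. ALL t':E b3. ALL W':E baire. ag eh t t' --> rs W eh = rs W' eh --> ~t' ~: E U" if "~t ~: E U" for t W
   using o(2)[of t] that by blast
  have "is_fun (vlam omega1 (%_. vempty)) omega1 (omega1::'v)" by (rule is_fun_vlam) (intro dint, simp)
  then have "vlam omega1 (%_. vempty) IN (baire::'v)" unfolding baire_def by simp
  then show "t IN (cmpl b3 U) <-> (EX W:E (baire::'v). t ~: E U)" if "t IN b3" for t unfolding elts_cmpl using that by auto
 qed
 show "good U"
 proof (rule goodI[where P = "%t W. ALL t':E b3. ag (ap W vempty) t t' --> t' IN U"])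
  show "dpred (%e. ALL t':E b3. ag (ap (e (Suc 0)) vempty) (e 0) t' --> t' IN U)" by (intro dint)
  fix t assume t: "t IN b3"
  show "t IN U <-> (EX W:E baire. ALL t':E b3. ag (ap W vempty) t t' --> t' IN U)"
  proof
   assume "t IN U"
   then obtain eh where e: "eh : O1" "ALL t':E b3. ag eh t t' --> t' IN U" using o(2) by blast
   have d: "dfun (%e. eh)" by (intro dint)
   have "is_fun (vlam omega1 (%_. eh)) omega1 omega1" by (rule is_fun_vlam[OF d]) (rule e(1))
   then have "vlam omega1 (%_. eh) IN baire" unfolding baire_def by simp
   then show "EX W:E baire. ALL t':E b3. ag (ap W vempty) t t' --> t' IN U" using e(2) ap_vlam[OF d zero_in_omega1] by (intro bexI) simp_all
  next
   assume "EX W:E baire. ALL t':E b3. ag (ap W vempty) t t' --> t' IN U"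
   then show "t IN U" using ag_refl[OF t] t by blast
  qed
  fix W assume W: "W IN baire" "~(ALL t':E b3. ag (ap W vempty) t t' --> t' IN U)"
  have wo: "ap W vempty : O1" using W(1) ap_type[OF _ zero_in_omega1] unfolding baire_def by auto
  obtain s where s: "s IN b3" "ag (ap W vempty) t s" "s ~: E U" using W(2) by blast
  obtain eh where e: "eh : O1" "ap W vempty IN eh" "vempty IN eh" using pr_point[OF wo zero_in_omega1] by blast
  have sub: "E (ap W vempty) <= E eh" by (rule Ord_sub[OF Ord_o1[OF e(1)] e(2)])
  have "~(ALL t'':E b3. ag (ap W' vempty) t' t'' --> t'' IN U)" if t': "t' IN b3" "ag eh t t'" "rs W eh = rs W' eh" for t' W'
  proof -
   have "ap W' vempty = ap W vempty" using rs_eqD[OF t'(3) e(3)] by simp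
   moreover have "ag (ap W vempty) t' s" by (rule ag_trans[OF ag_sym[OF ag_mono[OF t'(2) sub]] s(2)])
   ultimately show ?thesis using s by auto
  qed
  then show "EX eh:O1. ALL t':E b3. ALL W':E baire. ag eh t t' --> rs W eh = rs W' eh --> ~(ALL t'':E b3. ag (ap W' vempty) t' t'' --> t'' IN U)"
   using e(1) by blast
 qed
qed

text \<open>The \<open>nu\<close>-th of the \<aleph>1 many points that \<open>W\<close> codes
  through the pairing.\<close>

definition sh :: "'v => 'v => 'v" where "sh nu W = vlam omega1 (%th. ap W (pr nu th))"

lemma [dint]: "dfun f ==> dfun g ==> dfun (%e. sh (f e) (g e))"
 by (rule dfun_comp2[where K = sh]) (unfold sh_def, intro dint)

lemma ap_sh: "th : O1 ==> ap (sh nu W) th = ap W (pr nu th)"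
 unfolding sh_def by (rule ap_vlam) (intro dint)

lemma sh_type: "W IN baire ==> nu : O1 ==> sh nu W IN baire"
 unfolding sh_def baire_def mem_funs by (rule is_fun_vlam) (intro dint, simp add: ap_type)

lemma sh_rs: assumes "rs W xi = rs W' xi" "xi : O1" "eh IN xi" "nu IN xi" "ALL x:E xi. ALL y:E xi. pr x y IN xi"
 shows "rs (sh nu W) eh = rs (sh nu W') eh"
proof (rule rs_cong)
 fix th assume t: "th IN eh"
 have tx: "th IN xi" by (rule Ord_trans[OF Ord_o1[OF assms(2)] assms(3) t])
 have to: "th : O1" by (rule Ord_trans[OF Ord_omega1 assms(2) tx])
 show "ap (sh nu W) th = ap (sh nu W') th" unfolding ap_sh[OF to] using rs_eqD[OF assms(1)] assms(4,5) tx by blast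
qed

lemma sh_glue:
 assumes d: "dfun (%e. w (e 0))" and w: "!!nu. nu : O1 ==> w nu IN baire"
 shows "EX W:E baire. ALL nu:O1. sh nu W = w nu"
proof -
 have d': "dfun f ==> dfun (%e. w (f e))" for f by (rule dfun_comp1[where K = w, OF d])
 let ?W = "vlam omega1 (%u. ap (w (q0 u)) (q1 u))"
 have dW: "dfun (%e. ap (w (q0 (e 0))) (q1 (e 0)))" by (intro dint d')
 have wf: "bfun (w nu)" if "nu : O1" for nu using w[OF that] unfolding baire_def by simp
 have W: "?W IN baire" unfolding baire_def mem_funs by (rule is_fun_vlam[OF dW]) (use ap_type[OF wf] pr_q in blast)
 have "sh nu ?W = w nu" if n: "nu : O1" for nu
 proof (rule fun_ext[OF _ wf[OF n]])
  show "bfun (sh nu ?W)" using sh_type[OF W n] unfolding baire_def by simp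
  fix th assume t: "th IN (omega1::'v)"
  show "ap (sh nu ?W) th = ap (w nu) th" unfolding ap_sh[OF t] ap_vlam[OF dW pr_type[OF n t]] using n t by simp
 qed
 then show ?thesis using W by blast
qed

text \<open>The ordinal \<open>mv\<close> is put below the neighbourhood length \<open>xi\<close> so
  that the value of \<open>W\<close> at \<open>mv\<close> is fixed as well; for unions this value
  selects the closed set.\<close>

lemma closed_sh:
 assumes D: "closed D" and tW: "t IN b3" "W IN baire" and n: "nu : O1" "mv : O1" and no: "vpair t (sh nu W) ~: E D"
 shows "EX xi:O1. mv IN xi & (ALL t':E b3. ALL W':E baire. ag xi t t' --> rs W xi = rs W' xi --> vpair t' (sh nu W') ~: E D)"
proof -
 obtain eh where e: "eh : O1" "ALL t':E b3. ALL W':E baire. ag eh t t' --> rs (sh nu W) eh = rs W' eh --> vpair t' W' ~: E D"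
  using D tW(1) sh_type[OF tW(2) n(1)] no unfolding closed_def by blast
 obtain zt where z: "zt : O1" "eh IN zt" "nu IN zt" using pr_point[OF e(1) n(1)] by blast
 obtain xi where x: "xi : O1" "zt IN xi" "mv IN xi" "ALL x:E xi. ALL y:E xi. pr x y IN xi" using pr_point[OF z(1) n(2)] by blast
 have ox: "Ord xi" by (rule Ord_o1[OF x(1)])
 have ex: "eh IN xi" "nu IN xi" using Ord_trans[OF ox x(2)] z by blast+
 have "vpair t' (sh nu W') ~: E D" if t': "t' IN b3" "W' IN baire" "ag xi t t'" "rs W xi = rs W' xi" for t' W'
  using e(2) t'(1) sh_type[OF t'(2) n(1)] ag_mono[OF t'(3) Ord_sub[OF ox ex(1)]] sh_rs[OF t'(4) x(1) ex x(4)] by blast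
 then show ?thesis using x(1,3) by blast
qed

text \<open>For a union, \<open>W\<close> holds an index, read at \<open>?k\<close>, together with a
  witness for the set of that index; for an intersection, it holds witnesses for all indices at
  once. The closed sets \<open>De nu\<close> are fixed beforehand by global choice.\<close>

lemma good_union:
 assumes C: "C ~= vempty" "card_le C omega1" and g: "!!c. c IN C ==> good c"
 shows "good (vUnion C)" "good (vInter C)"
proof -
 obtain c0 where c0: "c0 IN C" using C(1) unfolding vempty_iff by blast
 obtain i where i: "ALL x:E C. ap i x : O1" "ALL x:E C. ALL y:E C. ap i x = ap i y --> x = y" using C(2) by (rule card_leE)
 define ce where "ce nu = (if EX c:E C. ap i c = nu then vthe (%c. c IN C & ap i c = nu) else c0)" for nu
 have dce: "dfun f ==> dfun (%e. ce (f e))" for f by (rule dfun_comp1[where K = ce]) (unfold ce_def, intro dint)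
 have cei: "ce (ap i c) = c" if c: "c IN C" for c
 proof -
  have "vthe (%c'. c' IN C & ap i c' = ap i c) = c" by (rule vthe_eq) (use c i in blast)+
  then show ?thesis unfolding ce_def using c by auto
 qed
 have ceC: "ce nu IN C" for nu
 proof (cases "EX c:E C. ap i c = nu")
  case True then obtain c where "c IN C" "ap i c = nu" by blast
  then show ?thesis using cei[of c] by simp
 next
  case False then have "ce nu = c0" unfolding ce_def by (rule if_not_P) then show ?thesis using c0 by simp
 qed
 let ?G = "%nu D. closed D & (ALL t:E b3. t IN (ce nu) <-> (EX W:E baire. vpair t W IN D))"
 define De where "De nu = chs (?G nu)" for nu
 have dDe: "dfun f ==> dfun (%e. De (f e))" for f by (rule dfun_comp1[where K = De]) (unfold De_def baire_def, intro dint dce)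
 have De: "?G nu (De nu)" for nu
 proof -
  obtain D where D: "?G nu D" using g[OF ceC] unfolding good_def by blast
  have "dpred (%e. ?G nu (e 0))" unfolding baire_def by (intro dint dce)
  from chs[of "?G nu", OF this D] show ?thesis unfolding De_def .
 qed
 let ?k = "pr k1 vempty"
 have k: "k1 IN (omega1::'v)" using succ_in_omega1[OF zero_in_omega1] by simp
 have k': "?k : O1" using k by simp
 have Ww: "ap W u : O1" if "W IN baire" "u : O1" for W u using that ap_type unfolding baire_def by auto
 show "good (vUnion C)"
 proof (rule goodI[where P = "%t W. vpair t (sh vempty W) IN (De (ap W ?k))"])
  show "dpred (%e. vpair (e 0) (sh vempty (e (Suc 0))) IN (De (ap (e (Suc 0)) ?k)))" by (intro dint dDe)
  fix t assume t: "t IN b3"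
  show "t IN (vUnion C) <-> (EX W:E baire. vpair t (sh vempty W) IN (De (ap W ?k)))"
  proof
   assume "t IN (vUnion C)"
   then obtain c where c: "c IN C" "t IN c" by auto
   let ?n = "ap i c"
   have n: "?n : O1" using i c by blast
   obtain W0 where W0: "W0 IN baire" "vpair t W0 IN (De ?n)" using De[of ?n] cei[OF c(1)] c(2) t by auto
   have dn: "dfun (%e. ?n)" by (intro dint)
   have W1: "vlam omega1 (%_. ?n) IN baire" unfolding baire_def mem_funs by (rule is_fun_vlam[OF dn]) (rule n)
   let ?w = "%nu. if nu = vempty then W0 else vlam omega1 (%_. ?n)"
   have dw: "dfun (%e. ?w (e 0))" by (intro dint)
   obtain W where W: "W IN baire" "ALL nu:O1. sh nu W = ?w nu" using sh_glue[where w = ?w, OF dw] W0(1) W1 by (metis (no_types, lifting))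
   have "sh vempty W = W0" using W(2) zero_in_omega1 by simp
   moreover have "sh k1 W = vlam omega1 (%_. ?n)" using W(2) k vsucc_not_empty by simp
   then have "ap W ?k = ?n" using ap_sh[OF zero_in_omega1, of k1 W] ap_vlam[OF dn zero_in_omega1] by simp
   ultimately show "EX W:E baire. vpair t (sh vempty W) IN (De (ap W ?k))" using W(1) W0(2) by (intro bexI[of _ W]) simp_all
  next
   assume "EX W:E baire. vpair t (sh vempty W) IN (De (ap W ?k))"
   then obtain W where W: "W IN baire" "vpair t (sh vempty W) IN (De (ap W ?k))" by blast
   then have "t IN (ce (ap W ?k))" using De[of "ap W ?k"] t sh_type[OF W(1) zero_in_omega1] by blast
   then show "t IN (vUnion C)" using ceC by auto
  qed
  fix W assume W: "W IN baire" "vpair t (sh vempty W) ~: E (De (ap W ?k))"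
  have cl: "closed (De (ap W ?k))" using De by blast
  from closed_sh[OF cl t W(1) zero_in_omega1 k' W(2)] obtain xi where x: "xi : O1" "?k IN xi"
   "ALL t':E b3. ALL W':E baire. ag xi t t' --> rs W xi = rs W' xi --> vpair t' (sh vempty W') ~: E (De (ap W ?k))" by blast
  have "vpair t' (sh vempty W') ~: E (De (ap W' ?k))" if t': "t' IN b3" "W' IN baire" "ag xi t t'" "rs W xi = rs W' xi" for t' W'
   using x(3) t' rs_eqD[OF t'(4) x(2)] by metis
  then show "EX xi:O1. ALL t':E b3. ALL W':E baire. ag xi t t' --> rs W xi = rs W' xi --> vpair t' (sh vempty W') ~: E (De (ap W' ?k))"
   using x(1) by blast
 qed
 show "good (vInter C)"
 proof (rule goodI[where P = "%t W. ALL nu:O1. vpair t (sh nu W) IN (De nu)"])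
  show "dpred (%e. ALL nu:O1. vpair (e 0) (sh nu (e (Suc 0))) IN (De nu))" by (intro dint dDe)
  fix t assume t: "t IN b3"
  show "t IN (vInter C) <-> (EX W:E baire. ALL nu:O1. vpair t (sh nu W) IN (De nu))"
  proof
   assume "t IN (vInter C)"
   then have tc: "t IN (ce nu)" for nu unfolding elts_vInter[OF C(1)] using ceC by blast
   let ?Q = "%nu W. W IN baire & vpair t W IN (De nu)"
   define w where "w nu = chs (?Q nu)" for nu
   have dw: "dfun (%e. w (e 0))" unfolding w_def baire_def by (intro dint dDe)
   have w: "?Q nu (w nu)" for nu
   proof -
    obtain W where W: "?Q nu W" using De[of nu] tc t by blast
    have "dpred (%e. ?Q nu (e 0))" unfolding baire_def by (intro dint dDe)
    from chs[of "?Q nu", OF this W] show ?thesis unfolding w_def .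
   qed
   obtain W where W: "W IN baire" "ALL nu:O1. sh nu W = w nu" using sh_glue[OF dw] w by blast
   then show "EX W:E baire. ALL nu:O1. vpair t (sh nu W) IN (De nu)" using w by (intro bexI[of _ W]) simp_all
  next
   assume "EX W:E baire. ALL nu:O1. vpair t (sh nu W) IN (De nu)"
   then obtain W where W: "W IN baire" "ALL nu:O1. vpair t (sh nu W) IN (De nu)" by blast
   have "t IN c" if c: "c IN C" for c
   proof -
    have n: "ap i c : O1" using i c by blast
    then have "t IN (ce (ap i c))" using De[of "ap i c"] t W(2) sh_type[OF W(1) n] by blast
    then show ?thesis using cei[OF c] by simp
   qed
   then show "t IN (vInter C)" unfolding elts_vInter[OF C(1)] by blast
  qed
  fix W assume W: "W IN baire" "~(ALL nu:O1. vpair t (sh nu W) IN (De nu))"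
  then obtain nu where n: "nu : O1" "vpair t (sh nu W) ~: E (De nu)" by blast
  have cl: "closed (De nu)" using De by blast
  from closed_sh[OF cl t W(1) n(1,1,2)] n(1)
  show "EX xi:O1. ALL t':E b3. ALL W':E baire. ag xi t t' --> rs W xi = rs W' xi --> ~(ALL nu:O1. vpair t' (sh nu W') IN (De nu))"
   by blast
 qed
qed

lemma borel_good: assumes "is_borel b3 baire3_base B" shows "good B"
proof -
 let ?P = "%b. good b & good (cmpl b3 b)"
 define Fm where "Fm = vsep (vpow b3) ?P"
 have d: "dpred (%e. ?P (e 0))" by (intro dint)
 have F: "b IN Fm <-> E b <= E b3 & good b & good (cmpl b3 b)" for b unfolding Fm_def elts_vsep[OF d] by auto
 have cc: "cmpl b3 (cmpl b3 b) = b" if "E b <= E b3" for b by (rule extensionality) (use that in \<open>auto simp: elts_cmpl\<close>)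
 have "borel_closed b3 baire3_base Fm" unfolding borel_closed_def set_of_cmpl
 proof (intro conjI ballI allI impI)
  show "E a <= E b3" if "a IN Fm" for a using that F by blast
  show "U IN Fm" if "is_open baire3_base U" for U using F open_ag(1)[OF that] good_open[OF that] by blast
  show "cmpl b3 a IN Fm" if "a IN Fm" for a
  proof -
   have "E (cmpl b3 a) <= E b3" unfolding elts_cmpl by blast
   then show ?thesis using that F cc by metis
  qed
  fix C assume "E C <= E Fm & C ~= vempty & card_le C omega1"
  then have C: "E C <= E Fm" "C ~= vempty" "card_le C omega1" by blast+
  have dc: "dfun (%e. cmpl b3 (e 0))" by (intro dint)
  let ?C = "vimg (cmpl b3) C"
  have C': "?C ~= vempty" using C(2) unfolding vempty_iff elts_vimg[OF dc] by blast
  have g: "good c" if "c IN C" for c using that C(1) F by blast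
  have g': "good c" if "c IN ?C" for c using that C(1) F unfolding elts_vimg[OF dc] by blast
  have s: "E c <= E b3" if "c IN C" for c using that C(1) F by blast
  have "cmpl b3 (vUnion C) = vInter ?C"
   by (rule extensionality) (use C(2) in \<open>auto simp: elts_cmpl elts_vInter[OF C'] elts_vimg[OF dc] vempty_iff\<close>)
  moreover have "cmpl b3 (vInter C) = vUnion ?C"
   by (rule extensionality) (auto simp: elts_cmpl elts_vInter[OF C(2)] elts_vimg[OF dc])
  ultimately have gc: "good (cmpl b3 (vUnion C))" "good (cmpl b3 (vInter C))"
   using good_union[OF C' card_le_vimg[OF dc C(3)] g'] by simp_all
  show "vUnion C IN Fm" unfolding F using good_union(1)[OF C(2,3) g] gc s by auto
  have "E (vInter C) <= E b3" unfolding elts_vInter[OF C(2)] using C(2) s unfolding vempty_iff by blast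
  then show "vInter C IN Fm" unfolding F using good_union(2)[OF C(2,3) g] gc by blast
 qed
 then show ?thesis using assms F unfolding is_borel_def by blast
qed

text \<open>\<open>Z\<close> and the point witnessing membership in the Borel set are merged into
  one \<open>V\<close>. A closed set is determined by the initial segments of its points, and
  \<open>Rs\<close> collects these.\<close>

lemma Pi12_normal_form:
 assumes "Pi12 S"
 shows "EX Rs. ALL X. is_fun X omega1 (omega1::'v) --> (X IN S <-> KR.inS Rs X)"
proof -
 obtain B where B: "is_borel b3 baire3_base B" "ALL X:E baire. X IN S <-> (ALL Y:E baire. EX Z:E baire. vpair X (vpair Y Z) IN B)"
  using assms unfolding Pi12_def b3_def by blast
 obtain D where D: "closed D" "ALL t:E b3. t IN B <-> (EX W:E baire. vpair t W IN D)" using borel_good[OF B(1)] unfolding good_def by blast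
 let ?D = "%X Y V. vpair (vpair X (vpair Y (sh vempty V))) (sh k1 V) IN D"
 let ?v = "%X Y eh V. vpair (rs X eh) (vpair (rs Y eh) (rs V eh))"
 let ?s = "%X Y. vsep baire (%V. ?D X Y V)"
 define Rs where "Rs = vUN omega1 (%eh. vUN baire (%X. vUN baire (%Y. vimg (?v X Y eh) (?s X Y))))"
 have d1: "dfun (%e. vUN baire (%X. vUN baire (%Y. vimg (?v X Y (e 0)) (?s X Y))))" unfolding baire_def by (intro dint)
 have d2: "dfun (%e. vUN baire (%Y. vimg (?v (e 0) Y eh) (?s (e 0) Y)))" for eh unfolding baire_def by (intro dint)
 have d3: "dfun (%e. vimg (?v X (e 0) eh) (?s X (e 0)))" for X eh unfolding baire_def by (intro dint)
 have d4: "dfun (%e. ?v X Y eh (e 0))" for X Y eh by (intro dint)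
 have d5: "dpred (%e. ?D X Y (e 0))" for X Y by (intro dint)
 have Rs: "z IN Rs <-> (EX eh:O1. EX X:E baire. EX Y:E baire. EX V:E baire. ?D X Y V & z = ?v X Y eh V)" for z
  unfolding Rs_def elts_vUN[OF d1] elts_vUN[OF d2] elts_vUN[OF d3] elts_vimg[OF d4] elts_vsep[OF d5] by blast
 have k: "k1 IN (omega1::'v)" using succ_in_omega1[OF zero_in_omega1] by simp
 have nf: "?D X Y V <-> (ALL eh:O1. ?v X Y eh V IN Rs)" if XYV: "X IN baire" "Y IN baire" "V IN baire" for X Y V
 proof
  assume "?D X Y V" then show "ALL eh:O1. ?v X Y eh V IN Rs" unfolding Rs using XYV by blast
 next
  assume r: "ALL eh:O1. ?v X Y eh V IN Rs"
  show "?D X Y V"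
  proof (rule ccontr)
   assume n: "~?D X Y V"
   have s: "sh vempty V IN baire" "sh k1 V IN baire" using sh_type[OF XYV(3)] k by simp_all
   have t: "vpair X (vpair Y (sh vempty V)) IN b3" using XYV s unfolding b3_mem baire_def by auto
   from D(1) t s(2) n obtain eh where e: "eh : O1" "ALL t':E b3. ALL W':E baire. ag eh (vpair X (vpair Y (sh vempty V))) t' --> rs (sh k1 V) eh = rs W' eh --> vpair t' W' ~: E D"
    unfolding closed_def by blast
   obtain xi where x: "xi : O1" "eh IN xi" "k1 IN xi" "ALL x:E xi. ALL y:E xi. pr x y IN xi" using pr_point[OF e(1) k] by blast
   have ox: "Ord xi" by (rule Ord_o1[OF x(1)])
   have z: "vempty IN xi" using Ord_trans[OF ox x(3)] by simp
   obtain xi' X' Y' V' where p: "xi' : O1" "X' IN baire" "Y' IN baire" "V' IN baire" "?D X' Y' V'" "?v X Y xi V = ?v X' Y' xi' V'"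
    using r x(1) unfolding Rs by blast
   have q: "rs X xi = rs X' xi'" "rs Y xi = rs Y' xi'" "rs V xi = rs V' xi'" using p(6) by simp_all
   have f: "is_fun (rs X xi) xi omega1" "is_fun (rs X' xi') xi' omega1"
    using is_fun_rs[OF _ Ord_sub[OF Ord_omega1 x(1)]] is_fun_rs[OF _ Ord_sub[OF Ord_omega1 p(1)]] XYV(1) p(2) unfolding baire_def by auto
   \<comment> \<open>An entry of \<open>Rs\<close> does not record its length separately, but the
     domain of a restriction recovers it.\<close>
   have xx: "xi' = xi" using is_fun_dom[OF f(1)] f(2) q(1) by metis
   have s': "sh vempty V' IN baire" "sh k1 V' IN baire" using sh_type[OF p(4)] k by simp_all
   have t': "vpair X' (vpair Y' (sh vempty V')) IN b3" using p(2,3) s' unfolding b3_mem baire_def by auto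
   have sx: "E eh <= E xi" by (rule Ord_sub[OF ox x(2)])
   have "ag eh (vpair X (vpair Y (sh vempty V))) (vpair X' (vpair Y' (sh vempty V')))" unfolding ag_pair
    using rs_mono[OF _ sx] sh_rs[OF _ x(1,2) z x(4)] q xx by blast
   moreover have "rs (sh k1 V) eh = rs (sh k1 V') eh" using sh_rs[OF _ x(1,2,3,4)] q(3) xx by blast
   ultimately show False using e(2) t' s'(2) p(5) by blast
  qed
 qed
 interpret KR ty p Rs by unfold_locales
 have "X IN S <-> inS X" if "bfun X" for X
 proof -
  have X: "X IN baire" using that unfolding baire_def by simp
  have "(EX Z:E baire. vpair X (vpair Y Z) IN B) <-> (EX V:E baire. ?D X Y V)" if Y: "Y IN baire" for Y
  proof
   assume "EX Z:E baire. vpair X (vpair Y Z) IN B"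
   then obtain Z where Z: "Z IN baire" "vpair X (vpair Y Z) IN B" by blast
   have "vpair X (vpair Y Z) IN b3" using X Y Z unfolding b3_mem baire_def by auto
   then obtain W where W: "W IN baire" "vpair (vpair X (vpair Y Z)) W IN D" using D(2) Z(2) by blast
   let ?w = "%nu. if nu = vempty then Z else W"
   have dw: "dfun (%e. ?w (e 0))" by (intro dint)
   obtain V where V: "V IN baire" "ALL nu:O1. sh nu V = ?w nu" using sh_glue[where w = ?w, OF dw] Z(1) W(1) by (metis (no_types, lifting))
   have "sh vempty V = Z" "sh k1 V = W" using V(2) k zero_in_omega1 vsucc_not_empty by simp_all
   then show "EX V:E baire. ?D X Y V" using V(1) W(2) by (intro bexI[of _ V]) simp_all
  next
   assume "EX V:E baire. ?D X Y V"
   then obtain V where V: "V IN baire" "?D X Y V" by blast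
   have s: "sh vempty V IN baire" "sh k1 V IN baire" using sh_type[OF V(1)] k by simp_all
   have t: "vpair X (vpair Y (sh vempty V)) IN b3" using X Y s unfolding b3_mem baire_def by auto
   then have "vpair X (vpair Y (sh vempty V)) IN B" using D(2) V(2) s(2) by blast
   then show "EX Z:E baire. vpair X (vpair Y Z) IN B" using s(1) by blast
  qed
  then have "X IN S <-> (ALL Y:E baire. EX V:E baire. ?D X Y V)" using B(2) X by simp
  also have "... <-> (ALL Y:E baire. EX V:E baire. ALL eh:O1. ?v X Y eh V IN Rs)" using nf X by simp
  finally show ?thesis unfolding inS_def baire_def by (simp add: Bex_def Ball_def)
 qed
 then show ?thesis by blast
qed

end

section \<open>The class of Kurepa trees\<close>

lemma [dint]: "dfun f ==> dfun g ==> dfun h ==> dpred (%e. below (f e) (g e) (h e))"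
 unfolding below_def by (intro dint)

lemma preds_eq: "preds T x = vsep omega1 (%y. below T y x)"
 unfolding preds_def by (rule set_of_vsep) (intro dint)

lemma elts_preds': "E (preds T x) = {y : O1. below T y x}"
 unfolding preds_eq by (rule elts_vsep) (intro dint)

lemma [dint]: "dfun f ==> dfun g ==> dfun (%e. preds (f e) (g e))"
 by (rule dfun_comp2[where K = preds]) (unfold preds_eq, intro dint)

lemma has_height_iff: "has_height T x al <-> Ord al & (EX h. is_bijection h (preds T x) al &
  (ALL y:E (preds T x). ALL z:E (preds T x). below T y z <-> ap h y IN (ap h z)))"
proof -
 have "app h y = ap h y" if "is_bijection h (preds T x) al" "y IN (preds T x)" for h y
  using that app_ap[of h "preds T x" al y] unfolding is_bijection_def by blast
 then show ?thesis unfolding has_height_def by (metis (no_types, lifting))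
qed

lemma [dint]: "dfun f ==> dfun g ==> dfun h ==> dpred (%e. has_height (f e) (g e) (h e))"
 by (rule dpred_comp3[where P = has_height]) (unfold has_height_iff, intro dint)

lemma level_eq: "level T al = vsep omega1 (%x. has_height T x al)"
 unfolding level_def by (rule set_of_vsep) (intro dint)

lemma elts_level': "E (level T al) = {x : O1. has_height T x al}"
 unfolding level_eq by (rule elts_vsep) (intro dint)

lemma branches_eq: "uncountable_branches T = vsep (vpow omega1) (%b. is_branch T b & ~card_le b omega)"
proof -
 have d: "dpred (%e. is_branch T (e 0) & ~card_le (e 0) omega)" unfolding is_branch_def is_chain_def by (intro dint)
 have "{b. is_branch T b & ~vcountable b} = {b : E (vpow omega1). is_branch T b & ~card_le b omega}"
  unfolding vcountable_def is_branch_def is_chain_def by auto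
 then show ?thesis unfolding uncountable_branches_def using set_of_vsep[OF d, of "vpow omega1"] by (simp only:)
qed

lemma elts_branches: "E (uncountable_branches T) = {b. is_branch T b & ~vcountable b}"
proof -
 have d: "dpred (%e. is_branch T (e 0) & ~card_le (e 0) omega)" unfolding is_branch_def is_chain_def by (intro dint)
 show ?thesis unfolding branches_eq elts_vsep[where P = "%b. is_branch T b & ~card_le b omega", OF d]
  by (auto simp: vcountable_def is_branch_def is_chain_def)
qed

lemma dpred_kurepa: "dpred (%e. kurepa_tree (e 0) & regular_tree (e 0))"
 unfolding kurepa_tree_def aleph1_tree_def strict_order_def well_ordered_by_def vcountable_def level_eq regular_tree_def
  rooted_def immediate_succ_def pruned_def branches_eq is_branch_def is_chain_def by (intro dint)

lemma height_unique: assumes "has_height T x al" "has_height T x bt" shows "al = bt"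
proof -
 obtain h where h: "Ord al" "is_bijection h (preds T x) al" "ALL y:E (preds T x). ALL z:E (preds T x). below T y z <-> ap h y IN (ap h z)"
  using assms(1) unfolding has_height_iff by blast
 obtain g where g: "Ord bt" "is_bijection g (preds T x) bt" "ALL y:E (preds T x). ALL z:E (preds T x). below T y z <-> ap g y IN (ap g z)"
  using assms(2) unfolding has_height_iff by blast
 have hi: "!!y z. y IN (preds T x) ==> z IN (preds T x) ==> ap h y = ap h z ==> y = z" and hs: "!!a. a IN al ==> EX y:E (preds T x). ap h y = a"
  and ht: "!!y. y IN (preds T x) ==> ap h y IN al" using h(2) ap_type[of h "preds T x" al] unfolding is_bijection_iff by blast+
 have gs: "!!a. a IN bt ==> EX y:E (preds T x). ap g y = a"
  and gt: "!!y. y IN (preds T x) ==> ap g y IN bt" using g(2) ap_type[of g "preds T x" bt] unfolding is_bijection_iff by blast+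
 define k where "k a = ap g (vthe (%y. y IN (preds T x) & ap h y = a))" for a
 have dk: "dfun (%e. k (e 0))" unfolding k_def by (intro dint)
 have k: "k (ap h y) = ap g y" if y: "y IN (preds T x)" for y
 proof -
  have "vthe (%z. z IN (preds T x) & ap h z = ap h y) = y" by (rule vthe_eq) (use y hi in blast)+
  then show ?thesis unfolding k_def by simp
 qed
 show ?thesis
 proof (rule Ord_iso_id[OF dk h(1) g(1)])
  show "k a IN bt" if "a IN al" for a using hs[OF that] k gt by metis
  show "EX a:E al. k a = b" if "b IN bt" for b using gs[OF that] k ht by metis
  show "k a IN (k b) <-> a IN b" if ab: "a IN al" "b IN al" for a b
  proof -
   obtain y z where y: "y IN (preds T x)" "ap h y = a" "z IN (preds T x)" "ap h z = b" using hs[OF ab(1)] hs[OF ab(2)] by blast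
   then show ?thesis using k[OF y(1)] k[OF y(3)] h(3) g(3) by metis
  qed
 qed
qed

context
 fixes T :: "'v::zfc"
 assumes so: "strict_order T" and wo: "ALL x:O1. well_ordered_by T (preds T x)"
begin

lemma below_o1: assumes "below T x y" shows "x : O1 & y : O1"
proof -
 have "vpair x y IN (vtimes omega1 omega1)" using so assms unfolding strict_order_def below_def by blast
 then show ?thesis by simp
qed

lemma below_trans: "below T x y ==> below T y z ==> below T x z"
 using so below_o1[of x y] below_o1[of y z] unfolding strict_order_def by blast

lemma below_irrefl: "~below T x x" using so below_o1[of x x] unfolding strict_order_def by blast

lemma preds_linear: assumes "y IN (preds T x)" "z IN (preds T x)" shows "y = z | below T y z | below T z y"
proof -
 have xo: "x : O1" using assms below_o1 unfolding elts_preds' by blast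
 have "E (upair y z) <= E (preds T x) & upair y z ~= vempty" using assms by (auto simp: vempty_iff)
 then obtain m where "m IN (upair y z)" "ALL w:E (upair y z). w ~= m --> below T m w" using wo xo unfolding well_ordered_by_def by blast
 then show ?thesis by auto
qed

text \<open>The height is the rank for recursion along \<open>below T\<close>. A set either has the
  chosen member \<open>m0\<close> as a minimal element, or the part of it below \<open>m0\<close> is
  well-ordered and nonempty, and then its least element is minimal.\<close>

lemma height_ex: assumes x: "x : O1" shows "EX al. has_height T x al"
proof -
 let ?R = "%y x. below T y x" let ?G = "%x f. vimg (ap f) (preds T x)"
 have dR: "dpred (%e. ?R (e 0) (e (Suc 0)))" by (intro dint)
 have dG: "dfun (%e. ?G (e 0) (e (Suc 0)))" by (intro dint)
 have wf: "EX y:E a. ALL z:E a. ~?R z y" if a: "E a ~= {}" for a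
 proof -
  obtain m0 where m0: "m0 IN a" using a by blast
  let ?M = "vsep a (%z. below T z m0)"
  have eM: "E ?M = {z : E a. below T z m0}" by (rule elts_vsep) (intro dint)
  show ?thesis
  proof (cases "E ?M = {}")
   case True then show ?thesis using m0 eM by blast
  next
   case False
   then obtain z where "below T z m0" using eM by blast
   then have mo: "m0 : O1" using below_o1 by blast
   have "E ?M <= E (preds T m0) & ?M ~= vempty" using False below_o1 unfolding eM elts_preds' vempty_iff by blast
   then obtain m where m: "m IN ?M" "ALL w:E ?M. w ~= m --> below T m w" using wo mo unfolding well_ordered_by_def by blast
   have "~below T z m" if z: "z IN a" for z
   proof
    assume zm: "below T z m"
    have "below T z m0" using below_trans[OF zm] m(1) unfolding eM by blast
    then have "z IN ?M" using z eM by blast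
    moreover have "z ~= m" using zm below_irrefl by blast
    ultimately show False using m(2) below_trans[OF zm] below_irrefl by blast
   qed
   then show ?thesis using m(1) eM by blast
  qed
 qed
 define rk where "rk = rrec ?R ?G"
 have drk: "dfun (%e. rk (e 0))" unfolding rk_def by (rule dfun_rrec0[OF dR dG wf]) (assumption, intro dint)
 have drk': "dfun f ==> dfun (%e. rk (f e))" for f by (rule dfun_comp1[where K = rk, OF drk])
 have rk: "E (rk y) = rk ` E (preds T y)" if y: "y : O1" for y
 proof -
  have c: "rclosed ?R omega1" unfolding rclosed_def using below_o1 by blast
  have "rk y = vimg (ap (vlam (preds T y) rk)) (preds T y)" using rrec_eq[OF dR dG wf c y] unfolding rk_def[symmetric] preds_eq[symmetric] by blast
  also have "... = vimg rk (preds T y)" by (rule vimg_cong) (rule ap_vlam[OF drk])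
  finally show ?thesis using elts_vimg[OF drk] by simp
 qed
 have po: "y : O1" if "y IN (preds T z)" for y z using that unfolding elts_preds' by blast
 have mono: "rk y IN (rk z)" if yz: "below T y z" for y z using rk[of z] below_o1[OF yz] yz unfolding elts_preds' by blast
 have tr: "transitive_set (rk y)" if y: "y : O1" for y unfolding transitive_set_def
 proof (intro ballI subsetI)
  fix z w assume z: "z IN (rk y)" and w: "w IN z"
  obtain a where a: "a IN (preds T y)" "z = rk a" using z rk[OF y] by blast
  then obtain b where b: "b IN (preds T a)" "w = rk b" using w rk[OF po[OF a(1)]] by blast
  have "below T b y" using a(1) b(1) below_trans unfolding elts_preds' by blast
  then show "w IN (rk y)" using mono b(2) by simp
 qed
 have ork: "Ord (rk y)" if y: "y : O1" for y unfolding Ord_def using tr[OF y] tr po rk[OF y] by auto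
 have m2: "below T y z <-> rk y IN (rk z)" if yz: "y IN (preds T x)" "z IN (preds T x)" for y z
 proof
  assume e: "rk y IN (rk z)"
  have "~(y = z | below T z y)" using e mono[of z y] mem_not_refl[of "rk z"] mem_not_sym[OF e] by auto
  then show "below T y z" using preds_linear[OF yz] by blast
 qed (rule mono)
 let ?h = "vlam (preds T x) rk"
 have ap: "ap ?h y = rk y" if "y IN (preds T x)" for y by (rule ap_vlam[OF drk that])
 have "is_bijection ?h (preds T x) (rk x)" unfolding is_bijection_iff
 proof (intro conjI ballI impI)
  show "is_fun ?h (preds T x) (rk x)" by (rule is_fun_vlam[OF drk]) (use rk[OF x] in blast)
  show "y = z" if yz: "y IN (preds T x)" "z IN (preds T x)" "ap ?h y = ap ?h z" for y z
  proof -
   have "rk y = rk z" using yz(3) ap[OF yz(1)] ap[OF yz(2)] by simp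
   then show ?thesis using preds_linear[OF yz(1,2)] mono[of y z] mono[of z y] mem_not_refl[of "rk z"] by auto
  qed
  show "EX y:E (preds T x). ap ?h y = z" if "z IN (rk x)" for z using that rk[OF x] ap by auto
 qed
 then show ?thesis unfolding has_height_iff using ork[OF x] m2 ap by (intro exI[of _ "rk x"] conjI exI[of _ ?h]) auto
qed

end

section \<open>Branch counts, characteristic functions and the reduction\<close>

context KT
begin

text \<open>\<open>U\<close> is equinumerous with the order type of its set of least codes, and an
  ordinal that does not inject into \<open>omega1\<close> is at least \<open>omega2\<close>.\<close>

lemma card_dichotomy: "card_le omega2 U <-> ~card_le U (omega1::'v)"
proof
 assume "card_le omega2 U"
 then show "~card_le U omega1" using card_le_trans[of omega2 U omega1] hart_not_card_le[of "omega1::'v"] unfolding omega2_hart by blast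
next
 assume n: "~card_le U omega1"
 define ix where "ix u = vleast (%i. F i = u)" for u :: 'v
 have dix: "dfun (%e. ix (e 0))" unfolding ix_def by (intro dint)
 have ix: "Ord (ix u) & F (ix u) = u" for u
 proof -
  obtain i where i: "Ord i" "F i = u" by (rule F_surj)
  have "dpred (%e. F (e 0) = u)" by (intro dint)
  from vleast(1,2)[where P = "%i. F i = u", OF this i] show ?thesis unfolding ix_def by blast
 qed
 let ?N = "vimg ix U"
 have eN: "E ?N = ix ` E U" by (rule elts_vimg[OF dix])
 have No: "!!a. a IN ?N ==> Ord a" using ix unfolding eN by blast
 have dc: "dfun (%e. col ?N (e 0))" by (intro dint)
 have UN: "card_le U ?N" by (rule card_leI[OF dix]) (use ix in \<open>auto simp: eN\<close>, metis ix)
 have NO: "card_le ?N (otp ?N)" by (rule card_leI[OF dc]) (use col_inj[OF No] in \<open>auto simp: elts_otp\<close>)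
 have "~card_le (otp ?N) omega1" using n UN NO card_le_trans by blast
 then have "otp ?N ~: E omega2" unfolding mem_omega2 by blast
 moreover have "Ord (omega2::'v)" unfolding omega2_hart by (rule Ord_hart)
 ultimately have "card_le omega2 (otp ?N)" using Ord_not_mem[OF Ord_otp[OF No]] card_le_subset by blast
 moreover have "card_le (otp ?N) ?N" unfolding otp_def by (rule card_le_vimg[OF dc card_le_subset[OF subset_refl]])
 moreover have "card_le ?N U" by (rule card_le_vimg[OF dix card_le_subset[OF subset_refl]])
 ultimately show "card_le omega2 U" using card_le_trans by blast
qed

abbreviation one :: 'v where "one == vsucc vempty"

lemma one_o1: "one : O1" "one ~= vempty" using succ_in_omega1[OF zero_in_omega1] vsucc_not_empty by auto

lemma char_fun_eq: "char_fun p T = vlam omega1 (%u. if below T (q0 u) (q1 u) then one else vempty)"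
proof -
 have d: "dfun (%e. if below T (q0 (e 0)) (q1 (e 0)) then one else vempty)" by (intro dint)
 have a: "app p (vpair x y) = pr x y" if "x : O1" "y : O1" for x y
  unfolding pr_def using p app_ap[of p "vtimes omega1 omega1" omega1 "vpair x y"] that unfolding is_bijection_def by auto
 show ?thesis unfolding char_fun_def
 proof (rule set_of_eq, unfold elts_vlam[OF d], intro equalityI subsetI)
  fix z assume "z : {vpair x (if below T (q0 x) (q1 x) then one else vempty) |x. x : O1}"
  then obtain u where u: "u : O1" "z = vpair u (if below T (q0 u) (q1 u) then one else vempty)" by blast
  then have "z = vpair (app p (vpair (q0 u) (q1 u))) (if below T (q0 u) (q1 u) then one else vempty)" using a pr_q by simp
  then show "z : {vpair (app p (vpair x y)) (if below T x y then one else vempty) |x y. x : O1 & y : O1}" using pr_q[OF u(1)] by blast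
 next
  fix z assume "z : {vpair (app p (vpair x y)) (if below T x y then one else vempty) |x y. x : O1 & y : O1}"
  then obtain x y where x: "x : O1" "y : O1" "z = vpair (app p (vpair x y)) (if below T x y then one else vempty)" by blast
  then have "z = vpair (pr x y) (if below T (q0 (pr x y)) (q1 (pr x y)) then one else vempty)" using a by simp
  then show "z : {vpair x (if below T (q0 x) (q1 x) then one else vempty) |x. x : O1}" using pr_type[OF x(1,2)] by blast
 qed
qed

lemma ap_char: "u : O1 ==> ap (char_fun p T) u = (if below T (q0 u) (q1 u) then one else vempty)"
 unfolding char_fun_eq by (rule ap_vlam) (intro dint)

lemma char_baire: "bfun (char_fun p T)"
 unfolding char_fun_eq by (rule is_fun_vlam) (intro dint, simp add: one_o1)

lemma char_inj: assumes "char_fun p T = char_fun p T'" "E T <= E (vtimes omega1 omega1)" "E T' <= E (vtimes omega1 omega1)" shows "T = T'"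
proof -
 have b: "below T x y <-> below T' x y" if "x : O1" "y : O1" for x y
  using ap_char[of "pr x y" T] ap_char[of "pr x y" T'] assms(1) that one_o1(2) by (auto split: if_splits)
 have "z IN T <-> z IN T'" for z
 proof (cases "z IN (vtimes omega1 omega1)")
  case True then show ?thesis using b unfolding below_def by auto
 next
  case False then show ?thesis using assms(2,3) by blast
 qed
 then show ?thesis by (intro ext)
qed

lemma Kurepa_mem: "f IN (Kurepa_class p) <-> (EX T. f = char_fun p T & kurepa_tree T & regular_tree T)"
proof -
 have d': "dfun f ==> dpred (%e. kurepa_tree (f e) & regular_tree (f e :: 'v))" for f
  by (rule dpred_comp1[where P = "%T. kurepa_tree T & regular_tree T", OF dpred_kurepa])
 have d: "dpred (%e. EX T. e 0 = char_fun p T & kurepa_tree T & regular_tree T)" unfolding char_fun_eq by (intro dint d')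
 have "E (vsep baire (%f. EX T. f = char_fun p T & kurepa_tree T & regular_tree T)) = {char_fun p T | T. kurepa_tree T & regular_tree T}"
  unfolding elts_vsep[OF d] using char_baire unfolding baire_def by auto
 from elts_set_of[OF this] show ?thesis unfolding Kurepa_class_def by auto
qed

text \<open>The reduction sends \<open>X\<close> to the characteristic function of its tree, with
  the nodes numbered through \<open>cod X\<close>. Continuity is the locality of this numbering, and
  membership in \<open>S\<close> is equivalent to more than \<aleph>1 paths.\<close>

theorem Kurepa_hard:
 assumes "Pi12 S" shows "EX pi. is_continuous pi & (ALL X:E baire. X IN S <-> app pi X IN (Kurepa_class p))"
proof -
 obtain Rs where Rs: "ALL X. is_fun X omega1 (omega1::'v) --> (X IN S <-> KR.inS Rs X)" using Pi12_normal_form[OF assms] by blast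
 interpret KR ty p Rs by unfold_locales
 define G where "G X = vlam omega1 (%u. if lenX X (q0 u) IN (lenX X (q1 u)) & rs (enX X (q1 u)) (lenX X (q0 u)) = enX X (q0 u) then one else vempty)" for X
 have dG: "dfun (%e. G (e 0))" unfolding G_def by (intro dint)
 have apG: "ap (G X) u = (if lenX X (q0 u) IN (lenX X (q1 u)) & rs (enX X (q1 u)) (lenX X (q0 u)) = enX X (q0 u) then one else vempty)" if "u : O1" for X u
  unfolding G_def by (rule ap_vlam[OF _ that]) (intro dint)
 have fG: "bfun (G X)" for X unfolding G_def by (rule is_fun_vlam) (intro dint, simp add: one_o1)
 have loc: "EX dt:O1. ALL X'. bfun X' --> rs X' dt = rs X dt --> ap (G X') u = ap (G X) u" if u: "u : O1" for X u
 proof -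
  obtain a where a: "a : O1" "ALL X'. rs X' a = rs X a --> cod X' (q0 u) = cod X (q0 u)" using cod_local[OF pr_q(1)[OF u]] by blast
  obtain b where b: "b : O1" "ALL X'. rs X' b = rs X b --> cod X' (q1 u) = cod X (q1 u)" using cod_local[OF pr_q(2)[OF u]] by blast
  obtain xi where x: "xi : O1" "a IN xi" "b IN xi" using pr_point[OF a(1) b(1)] by blast
  have s: "E a <= E xi" "E b <= E xi" using Ord_sub[OF Ord_o1[OF x(1)]] x(2,3) by blast+
  have "ap (G X') u = ap (G X) u" if xx: "rs X' xi = rs X xi" for X'
  proof -
   have "cod X' (q0 u) = cod X (q0 u)" "cod X' (q1 u) = cod X (q1 u)" using a(2) b(2) rs_mono[OF xx s(1)] rs_mono[OF xx s(2)] by blast+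
   then show ?thesis unfolding apG[OF u] enX_def lenX_def by simp
  qed
  then show ?thesis using x(1) by blast
 qed
 note c = continuousI[OF dG fG loc]
 have "X IN S <-> G X IN (Kurepa_class p)" if X: "bfun X" for X
 proof -
  interpret T: FT ty p "enX X" "lenX X" by (rule FT_X)
  have GT: "G X = char_fun p T.TT"
  proof (rule fun_ext[OF fG char_baire])
   fix u assume u: "u IN (omega1::'v)"
   show "ap (G X) u = ap (char_fun p T.TT) u" unfolding apG[OF u] ap_char[OF u] T.below_TT T.RR_def using pr_q[OF u] by simp
  qed
  have UB: "U IN T.UU <-> UB X U" for U
  proof
   assume "U IN T.UU"
   then have f: "bfun U" and t: "ALL dt:O1. EX ta:O1. enX X ta = rs U dt" unfolding T.elts_UU by blast+
   have "nod X (rs U dt) dt" if dl: "dt : O1" for dt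
   proof -
    obtain ta where tau: "ta : O1" "enX X ta = rs U dt" using t dl by blast
    show ?thesis using enX_nod[OF tau(1), of X] T.UU_len(1)[OF f dl tau] tau(2) by simp
   qed
   then show "UB X U" unfolding UB_def using f by blast
  next
   assume u: "UB X U"
   then show "U IN T.UU" unfolding T.elts_UU UB_def using nod_enX by metis
  qed
  have "X IN S <-> inS X" using Rs X by blast
  also have "... <-> ~card_le T.UU omega1" using many_branches[OF _ UB] few_branches[OF _ UB] by blast
  also have "... <-> ~card_le (uncountable_branches T.TT) omega1" using T.card_branches_TT card_le_trans by blast
  also have "... <-> kurepa_tree T.TT" unfolding kurepa_tree_def card_dichotomy using T.aleph1_tree_TT by blast
  also have "... <-> G X IN (Kurepa_class p)"
  proof
   assume "kurepa_tree T.TT" then show "G X IN (Kurepa_class p)" unfolding Kurepa_mem GT using T.regular_tree_TT by blast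
  next
   assume "G X IN (Kurepa_class p)"
   then obtain T' where t: "char_fun p T.TT = char_fun p T'" "kurepa_tree T'" unfolding Kurepa_mem GT by blast
   have "T.TT = T'" by (rule char_inj[OF t(1)]) (use t(2) T.strict_order_TT in \<open>simp_all add: kurepa_tree_def aleph1_tree_def strict_order_def\<close>)
   then show "kurepa_tree T.TT" using t(2) by simp
  qed
  finally show ?thesis .
 qed
 then show ?thesis using c unfolding baire_def by (intro exI[of _ "vlam (funs omega1 omega1) G"]) simp
qed

end

section \<open>Being a Kurepa tree is \<open>\<Pi>\<^sup>1\<^sub>2\<close>\<close>

context KT
begin

section \<open>Borel relations given by formulas\<close>

definition T3 :: "('v => 'v => 'v => bool) => 'v" where
 "T3 P = vsep b3 (%t. EX X Y Z. t = vpair X (vpair Y Z) & P X Y Z)"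

text \<open>Borelness for relations instead of sets, so that it can be derived from the syntax of a
  formula; definability is included because the set \<open>T3 P\<close> must exist.\<close>

definition bor :: "('v => 'v => 'v => bool) => bool" where
 "bor P <-> dpred (%e. P (e 0) (e (Suc 0)) (e (Suc (Suc 0)))) & is_borel b3 baire3_base (T3 P)"

lemma elts_T3: assumes "dpred (%e. P (e 0) (e (Suc 0)) (e (Suc (Suc 0))))"
 shows "t IN (T3 P) <-> t IN b3 & (EX X Y Z. t = vpair X (vpair Y Z) & P X Y Z)"
proof -
 have d': "dfun f ==> dfun g ==> dfun h ==> dpred (%e. P (f e) (g e) (h e))" for f g h by (rule dpred_comp3[where P = P, OF assms])
 have d: "dpred (%e. EX X Y Z. e 0 = vpair X (vpair Y Z) & P X Y Z)" by (intro dint d')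
 show ?thesis unfolding T3_def elts_vsep[OF d] by blast
qed

lemma T3_pair: assumes "dpred (%e. P (e 0) (e (Suc 0)) (e (Suc (Suc 0))))" "vpair X (vpair Y Z) IN b3"
 shows "vpair X (vpair Y Z) IN (T3 P) <-> P X Y Z"
 unfolding elts_T3[OF assms(1)] using assms(2) by auto

lemma is_borel_cmpl: "is_borel b3 baire3_base b ==> is_borel b3 baire3_base (cmpl b3 b)"
 unfolding is_borel_def borel_closed_def set_of_cmpl by blast

lemma is_borel_Inter:
 assumes "C ~= vempty" "card_le C omega1" "!!c. c IN C ==> is_borel b3 baire3_base c" shows "is_borel b3 baire3_base (vInter C)"
 unfolding is_borel_def
proof (intro allI impI)
 fix F assume F: "borel_closed b3 baire3_base F"
 then have "E C <= E F" using assms(3) unfolding is_borel_def by blast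
 then show "vInter C IN F" using F assms(1,2) unfolding borel_closed_def by blast
qed

text \<open>Such a relation is open: around each of its triples, the cones over the initial segments
  of length \<open>eh\<close> remain inside.\<close>

lemma bor_local:
 assumes d: "dpred (%e. P (e 0) (e (Suc 0)) (e (Suc (Suc 0))))"
  and l: "!!X Y Z. P X Y Z ==> EX eh:O1. ALL X' Y' Z'. rs X' eh = rs X eh --> rs Y' eh = rs Y eh --> rs Z' eh = rs Z eh --> P X' Y' Z'"
 shows "bor P"
proof -
 let ?C = "vsep baire3_base (%c. E c <= E (T3 P))"
 have eC: "E ?C = {c : E baire3_base. E c <= E (T3 P)}" by (rule elts_vsep) (intro dint)
 have "EX c:E ?C. t IN c" if t: "t IN (T3 P)" for t
 proof -
  obtain X Y Z where p: "t = vpair X (vpair Y Z)" "P X Y Z" "bfun X" "bfun Y" "bfun Z"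
   using t unfolding elts_T3[OF d] b3_mem by auto
  obtain eh where e: "eh : O1" "ALL X' Y' Z'. rs X' eh = rs X eh --> rs Y' eh = rs Y eh --> rs Z' eh = rs Z eh --> P X' Y' Z'" using l[OF p(2)] by blast
  have n: "is_fun (rs f eh) eh omega1" if "bfun f" for f by (rule is_fun_rs[OF that Ord_sub[OF Ord_omega1 e(1)]])
  have c: "f' IN (cone (rs f eh)) <-> bfun f' & rs f' eh = rs f eh" if "bfun f" for f f'
   unfolding elts_cone using node_sub[OF n[OF that] e(1), of f'] by blast
  let ?c = "vtimes3 (cone (rs X eh)) (cone (rs Y eh)) (cone (rs Z eh))"
  have "t IN ?c" unfolding elts_vtimes3 using p c by blast
  moreover have "E ?c <= E (T3 P)"
  proof
   fix t' assume "t' IN ?c"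
   then obtain X' Y' Z' where q: "t' = vpair X' (vpair Y' Z')" "X' IN (cone (rs X eh))" "Y' IN (cone (rs Y eh))" "Z' IN (cone (rs Z eh))" unfolding elts_vtimes3 by blast
   then have "P X' Y' Z'" "t' IN b3" using e(2) c[OF p(3)] c[OF p(4)] c[OF p(5)] unfolding b3_mem by blast+
   then show "t' IN (T3 P)" unfolding elts_T3[OF d] using q(1) by blast
  qed
  moreover have "?c IN baire3_base" unfolding elts_baire3_base is_node_def using n p(3-5) e(1) by blast
  ultimately show ?thesis unfolding eC by blast
 qed
 then have "vUnion ?C = T3 P" by (intro extensionality) (use eC in auto)
 then have "is_open baire3_base (T3 P)" unfolding is_open_def using eC by (intro exI[of _ ?C]) auto
 then show ?thesis unfolding bor_def is_borel_def borel_closed_def using d by blast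
qed

lemma bor_const: "bor (%X Y Z. A)"
proof (rule bor_local)
 have "dpred (%e. e 0 = (e 0 :: 'v))" "dpred (%e. e 0 ~= (e 0 :: 'v))" by (intro dint)+
 then show "dpred (%e::nat => 'v. A)" by (cases A) simp_all
qed (use zero_in_omega1 in blast)

lemma bor_ap: assumes "c : O1"
 shows "bor (%X Y Z. ap X c = a)" "bor (%X Y Z. ap Y c = a)" "bor (%X Y Z. ap Z c = a)"
proof -
 have k: "rs X' (vsucc c) = rs X (vsucc c) ==> ap X' c = ap X c" for X' X by (rule rs_eqD[of _ "vsucc c"]) simp_all
 note b = bexI[OF _ succ_in_omega1[OF assms]]
 show "bor (%X Y Z. ap X c = a)" by (rule bor_local, intro dint, rule b) (metis k)
 show "bor (%X Y Z. ap Y c = a)" by (rule bor_local, intro dint, rule b) (metis k)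
 show "bor (%X Y Z. ap Z c = a)" by (rule bor_local, intro dint, rule b) (metis k)
qed

lemma bor_not: assumes "bor P" shows "bor (%X Y Z. ~P X Y Z)"
proof -
 have d: "dpred (%e. P (e 0) (e (Suc 0)) (e (Suc (Suc 0))))" using assms unfolding bor_def by blast
 then have d': "dpred (%e. ~P (e 0) (e (Suc 0)) (e (Suc (Suc 0))))" by (intro dint)
 have "T3 (%X Y Z. ~P X Y Z) = cmpl b3 (T3 P)"
 proof (rule ext)
  fix t
  show "t IN (T3 (%X Y Z. ~P X Y Z)) <-> t IN (cmpl b3 (T3 P))"
  proof (cases "t IN b3")
   case True
   then obtain X Y Z where t: "t = vpair X (vpair Y Z)" unfolding b3_mem by blast
   show ?thesis using T3_pair[OF d True[unfolded t]] T3_pair[where P = "%X Y Z. ~P X Y Z", OF d' True[unfolded t]] True unfolding elts_cmpl t by blast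
  qed (simp add: elts_cmpl elts_T3[where P = "%X Y Z. ~P X Y Z", OF d'])
 qed
 then show ?thesis unfolding bor_def using assms d' is_borel_cmpl unfolding bor_def by simp
qed

lemma bor_conj: assumes "bor P" "bor Q" shows "bor (%X Y Z. P X Y Z & Q X Y Z)"
proof -
 have d: "dpred (%e. P (e 0) (e (Suc 0)) (e (Suc (Suc 0))))" "dpred (%e. Q (e 0) (e (Suc 0)) (e (Suc (Suc 0))))" using assms unfolding bor_def by blast+
 then have d': "dpred (%e. P (e 0) (e (Suc 0)) (e (Suc (Suc 0))) & Q (e 0) (e (Suc 0)) (e (Suc (Suc 0))))" by (intro dint)
 let ?C = "upair (T3 P) (T3 Q)"
 have n: "?C ~= vempty" unfolding vempty_iff by simp
 have "T3 (%X Y Z. P X Y Z & Q X Y Z) = vInter ?C"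
  by (rule ext) (auto simp: elts_vInter[OF n] elts_T3[OF d(1)] elts_T3[OF d(2)] elts_T3[OF d'])
 moreover have "is_borel b3 baire3_base (vInter ?C)"
  by (rule is_borel_Inter[OF n card_le_omega1[OF countable_upair]]) (use assms in \<open>auto simp: bor_def\<close>)
 ultimately show ?thesis unfolding bor_def using d' by simp
qed

lemma bor_all:
 assumes d: "dpred (%e. P (e 0) (e (Suc 0)) (e (Suc (Suc 0))) (e (Suc (Suc (Suc 0)))))" and b: "!!nu. nu : O1 ==> bor (P nu)"
 shows "bor (%X Y Z. ALL nu:O1. P nu X Y Z)"
proof -
 have P: "dfun f ==> dfun g ==> dfun h ==> dfun k ==> dpred (%e. P (f e) (g e) (h e) (k e))" for f g h k by (rule dpred_comp4[where P = P, OF d])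
 have d1: "dpred (%e. ALL nu:O1. P nu (e 0) (e (Suc 0)) (e (Suc (Suc 0))))" by (intro dint P)
 have d2: "dpred (%e. P nu (e 0) (e (Suc 0)) (e (Suc (Suc 0))))" for nu by (intro dint P)
 have d3: "dfun (%e. T3 (P (e 0)))" unfolding T3_def by (intro dint P)
 let ?C = "vimg (%nu. T3 (P nu)) omega1"
 have n: "?C ~= vempty" unfolding vempty_iff elts_vimg[OF d3] using zero_in_omega1 by blast
 have "T3 (%X Y Z. ALL nu:O1. P nu X Y Z) = vInter ?C"
 proof (rule ext)
  fix t
  have "t IN (vInter ?C) <-> (ALL nu:O1. t IN (T3 (P nu)))" unfolding elts_vInter[OF n] elts_vimg[OF d3] by blast
  also have "... <-> t IN (T3 (%X Y Z. ALL nu:O1. P nu X Y Z))"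
  proof (cases "t IN b3")
   case True
   then obtain X Y Z where t: "t = vpair X (vpair Y Z)" unfolding b3_mem by blast
   show ?thesis using T3_pair[OF d2 True[unfolded t]] T3_pair[where P = "%X Y Z. ALL nu:O1. P nu X Y Z", OF d1 True[unfolded t]] unfolding t by blast
  next
   case False
   then have "t ~: E (T3 (P nu))" for nu unfolding elts_T3[OF d2] by blast
   moreover have "t ~: E (T3 (%X Y Z. ALL nu:O1. P nu X Y Z))" using False elts_T3[where P = "%X Y Z. ALL nu:O1. P nu X Y Z", OF d1] by blast
   ultimately show ?thesis using zero_in_omega1 by blast
  qed
  finally show "t IN (T3 (%X Y Z. ALL nu:O1. P nu X Y Z)) <-> t IN (vInter ?C)" by blast
 qed
 moreover have "is_borel b3 baire3_base (vInter ?C)"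
  by (rule is_borel_Inter[OF n card_le_vimg[OF d3 card_le_subset[OF subset_refl]]]) (use b in \<open>auto simp: elts_vimg[OF d3] bor_def\<close>)
 ultimately show ?thesis unfolding bor_def using d1 by simp
qed

lemma bor_ex:
 assumes d: "dpred (%e. P (e 0) (e (Suc 0)) (e (Suc (Suc 0))) (e (Suc (Suc (Suc 0)))))" and b: "!!nu. nu : O1 ==> bor (P nu)"
 shows "bor (%X Y Z. EX nu:O1. P nu X Y Z)"
proof -
 have "dpred (%e. ~P (e 0) (e (Suc 0)) (e (Suc (Suc 0))) (e (Suc (Suc (Suc 0)))))" by (intro dint d)
 from bor_not[OF bor_all[OF this bor_not[OF b]]] show ?thesis by simp
qed

lemma bor_imp: assumes "bor P" "bor Q" shows "bor (%X Y Z. P X Y Z --> Q X Y Z)"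
 using bor_not[OF bor_conj[OF assms(1) bor_not[OF assms(2)]]] by simp

lemma bor_disj: assumes "bor P" "bor Q" shows "bor (%X Y Z. P X Y Z | Q X Y Z)"
 using bor_imp[OF bor_not[OF assms(1)] assms(2)] by (simp add: disj_imp)

lemma bor_iff: assumes "bor P" "bor Q" shows "bor (%X Y Z. P X Y Z <-> Q X Y Z)"
 using bor_conj[OF bor_imp[OF assms] bor_imp[OF assms(2,1)]] by (simp add: iff_conv_conj_imp)

lemmas brules = bor_const bor_ap bor_all bor_ex bor_not bor_conj bor_imp bor_disj bor_iff

definition vo :: "'v => 'v => 'v" where "vo j eh = (if v j eh : O1 then v j eh else vempty)"

lemma [dint]: "dfun f ==> dfun g ==> dfun (%e. vo (f e) (g e))"
 unfolding vo_def by (intro dint)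

lemma vo_o1 [simp]: "vo j eh : O1" unfolding vo_def by simp

abbreviation rl :: "'v => 'v => 'v => bool" where "rl X x y == ap X (pr x y) = one"

text \<open>An isomorphism between \<open>al\<close> and the predecessors of \<open>x\<close> is a
  countable sequence and has a code \<open>j\<close> below \<open>omega1\<close>; the quantifier
  over isomorphisms becomes one over \<open>omega1\<close>, which Borel sets tolerate.\<close>

definition hh :: "'v => 'v => 'v => bool" where
 "hh X x al <-> (EX j:O1. (ALL eh:O1. eh IN al --> rl X (vo j eh) x) &
  (ALL y:O1. rl X y x --> (EX eh:O1. eh IN al & vo j eh = y)) &
  (ALL eh:O1. ALL zt:O1. eh IN al --> zt IN al --> (rl X (vo j eh) (vo j zt) <-> eh IN zt)))"

lemma [dint]: "dfun f ==> dfun g ==> dfun h ==> dpred (%e. hh (f e) (g e) (h e))"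
 by (rule dpred_comp3[where P = hh]) (unfold hh_def, intro dint)

lemma bor_hh: "x : O1 ==> bor (%X Y Z. hh X x al)"
 unfolding hh_def by (intro dint brules) simp_all

abbreviation im :: "'v => 'v => 'v => bool" where "im X x y == rl X x y & (ALL z:O1. ~(rl X x z & rl X z y))"

text \<open>All quantifiers range over \<open>omega1\<close>. Countability of a level is rendered as
  boundedness in \<open>omega1\<close>, and well-ordered predecessors as the existence of a
  countable height.\<close>

definition trX :: "'v => bool" where
 "trX X <-> (ALL u:O1. ap X u = one | ap X u = vempty) & (ALL x:O1. ~rl X x x) &
  (ALL x:O1. ALL y:O1. ALL z:O1. rl X x y --> rl X y z --> rl X x z) &
  (ALL x:O1. EX al:O1. hh X x al) &
  (ALL al:O1. EX dt:O1. ALL x:O1. hh X x al --> x IN dt) &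
  (ALL al:O1. EX x:O1. hh X x al) &
  (EX r:O1. ALL x:O1. x ~= r --> rl X r x) &
  (ALL x:O1. EX y:O1. EX z:O1. y ~= z & im X x y & im X x z) &
  (ALL al:O1. ALL bt:O1. al IN bt --> (ALL x:O1. hh X x al --> (EX y:O1. hh X y bt & rl X x y)))"

text \<open>\<open>Z\<close> describes an uncountable branch different from each of the \<aleph>1
  many sets listed by \<open>Y\<close>. Maximality needs no quantifier over sets: a point comparable
  with the whole chain must belong to it.\<close>

definition brX :: "'v => 'v => 'v => bool" where
 "brX X Y Z <-> (ALL x:O1. ALL y:O1. ap Z x = one --> ap Z y = one --> x = y | rl X x y | rl X y x) &
  (ALL x:O1. (ALL y:O1. ap Z y = one --> x = y | rl X x y | rl X y x) --> ap Z x = one) &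
  (ALL dt:O1. EX x:O1. ap Z x = one & x ~: E dt) &
  (ALL nu:O1. EX x:O1. ~(ap Z x = one <-> ap Y (pr nu x) = one))"

lemma bor_KK: "bor (%X Y Z. trX X & brX X Y Z)"
 unfolding trX_def brX_def by (intro dint brules bor_hh) simp_all

section \<open>Correctness of the Borel descriptions\<close>

lemma hh_iff:
 assumes so: "strict_order T" and rl: "!!x y. x : O1 ==> y : O1 ==> rl X x y <-> below T x y"
  and x: "x : O1" and a: "al : O1"
 shows "hh X x al <-> has_height T x al"
proof
 have ao: "eh : O1" if "eh IN al" for eh by (rule Ord_trans[OF Ord_omega1 a that])
 assume "hh X x al"
 then obtain j where j: "ALL eh:O1. eh IN al --> rl X (vo j eh) x" "ALL y:O1. rl X y x --> (EX eh:O1. eh IN al & vo j eh = y)"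
  "ALL eh:O1. ALL zt:O1. eh IN al --> zt IN al --> (rl X (vo j eh) (vo j zt) <-> eh IN zt)" unfolding hh_def by blast
 have j1: "vo j eh IN (preds T x)" if "eh IN al" for eh using j(1) ao[OF that] that rl[OF vo_o1 x] unfolding elts_preds' by simp
 have j2: "EX eh:E al. vo j eh = y" if "y IN (preds T x)" for y using j(2) that rl[OF _ x] unfolding elts_preds' by blast
 have j3: "below T (vo j eh) (vo j zt) <-> eh IN zt" if "eh IN al" "zt IN al" for eh zt
  using j(3) ao that rl[OF vo_o1 vo_o1] by blast
 have inj: "eh = zt" if e: "eh IN al" "zt IN al" "vo j eh = vo j zt" for eh zt
 proof -
  have "eh ~: E zt" "zt ~: E eh" using j3[OF e(1,2)] j3[OF e(2,1)] e(3) so vo_o1 unfolding strict_order_def by auto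
  then show ?thesis using Ord_linear[OF Ord_o1[OF ao[OF e(1)]] Ord_o1[OF ao[OF e(2)]]] by blast
 qed
 define k where "k y = vthe (%eh. eh IN al & vo j eh = y)" for y
 have dk: "dfun (%e. k (e 0))" unfolding k_def by (intro dint)
 have k: "k (vo j eh) = eh" if "eh IN al" for eh unfolding k_def by (rule vthe_eq) (use that inj in blast)+
 have ap: "ap (vlam (preds T x) k) y = k y" if "y IN (preds T x)" for y by (rule ap_vlam[OF dk that])
 have "is_bijection (vlam (preds T x) k) (preds T x) al" unfolding is_bijection_iff
 proof (intro conjI ballI impI)
  show "is_fun (vlam (preds T x) k) (preds T x) al" by (rule is_fun_vlam[OF dk]) (use j2 k in metis)
  show "y = z" if "y IN (preds T x)" "z IN (preds T x)" "ap (vlam (preds T x) k) y = ap (vlam (preds T x) k) z" for y z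
   using that ap j2 k by metis
  show "EX y:E (preds T x). ap (vlam (preds T x) k) y = eh" if "eh IN al" for eh using j1[OF that] ap k[OF that] by metis
 qed
 moreover have "below T y z <-> ap (vlam (preds T x) k) y IN (ap (vlam (preds T x) k) z)" if "y IN (preds T x)" "z IN (preds T x)" for y z
  using that ap j2 k j3 by metis
 ultimately show "has_height T x al" unfolding has_height_iff using Ord_o1[OF a] by blast
next
 assume "has_height T x al"
 then obtain h where h: "is_bijection h (preds T x) al" "ALL y:E (preds T x). ALL z:E (preds T x). below T y z <-> ap h y IN (ap h z)" unfolding has_height_iff by blast
 have hi: "!!y z. y IN (preds T x) ==> z IN (preds T x) ==> ap h y = ap h z ==> y = z" and hs: "!!a. a IN al ==> EX y:E (preds T x). ap h y = a"
  and ht: "!!y. y IN (preds T x) ==> ap h y IN al" using h(1) ap_type[of h "preds T x" al] unfolding is_bijection_iff by blast+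
 define g where "g eh = vthe (%y. y IN (preds T x) & ap h y = eh)" for eh
 have dg: "dfun (%e. g (e 0))" unfolding g_def by (intro dint)
 have g: "g (ap h y) = y" if "y IN (preds T x)" for y unfolding g_def by (rule vthe_eq) (use that hi in blast)+
 have gp: "g eh IN (preds T x)" "ap h (g eh) = eh" if "eh IN al" for eh using hs[OF that] g by metis+
 have gf: "is_fun (vlam al g) al omega1" by (rule is_fun_vlam[OF dg]) (use gp(1) in \<open>simp add: elts_preds'\<close>)
 obtain j where j: "j : O1" "ALL xi:E al. v j xi = ap (vlam al g) xi" using v_node[OF a gf] by blast
 have vj: "vo j eh = g eh" if "eh IN al" for eh using j(2) that ap_vlam[OF dg that] gp(1)[OF that] unfolding vo_def elts_preds' by simp
 have ao: "eh : O1" if "eh IN al" for eh by (rule Ord_trans[OF Ord_omega1 a that])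
 have "rl X (vo j eh) x" if "eh IN al" for eh using gp(1)[OF that] rl[OF _ x] unfolding vj[OF that] elts_preds' by blast
 moreover have "EX eh:O1. eh IN al & vo j eh = y" if y: "y : O1" "rl X y x" for y
 proof -
  have yp: "y IN (preds T x)" using y rl[OF y(1) x] unfolding elts_preds' by blast
  show ?thesis using ht[OF yp] ao vj g[OF yp] by (intro bexI[of _ "ap h y"]) simp_all
 qed
 moreover have "rl X (vo j eh) (vo j zt) <-> eh IN zt" if "eh IN al" "zt IN al" for eh zt
  unfolding rl[OF vo_o1 vo_o1] unfolding vj[OF that(1)] vj[OF that(2)] using h(2) gp[OF that(1)] gp[OF that(2)] by metis
 ultimately show "hh X x al" unfolding hh_def using j(1) by blast
qed

lemma well_ordered_height: assumes "has_height T x al" shows "well_ordered_by T (preds T (x::'v))"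
 unfolding well_ordered_by_def
proof (intro allI impI)
 obtain h where h: "Ord al" "is_bijection h (preds T x) al" "ALL y:E (preds T x). ALL z:E (preds T x). below T y z <-> ap h y IN (ap h z)"
  using assms unfolding has_height_iff by blast
 have hi: "!!y z. y IN (preds T x) ==> z IN (preds T x) ==> ap h y = ap h z ==> y = z"
  and ht: "!!y. y IN (preds T x) ==> ap h y IN al" using h(2) ap_type[of h "preds T x" al] unfolding is_bijection_iff by blast+
 fix M assume "E M <= E (preds T x) & M ~= vempty"
 then obtain m0 where M: "E M <= E (preds T x)" "m0 IN M" unfolding vempty_iff by blast
 have d: "dpred (%e. EX m:E M. ap h m = e 0)" by (intro dint)
 have "ap h m0 IN al" "EX m:E M. ap h m = ap h m0" using M ht by blast+
 from set_minimal[where P = "%eh. EX m:E M. ap h m = eh", OF d this] obtain m where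
  m: "m IN M" "ALL z:E al. z IN (ap h m) --> ~(EX m:E M. ap h m = z)" by blast
 have "below T m y" if y: "y IN M" "y ~= m" for y
 proof -
  have p: "y IN (preds T x)" "m IN (preds T x)" using y m M by blast+
  have "ap h y ~: E (ap h m)" "ap h y ~= ap h m" using m(2) ht[OF p(1)] y hi[OF p] by blast+
  then have "ap h m IN (ap h y)" using Ord_linear[OF Ord_in_Ord[OF h(1) ht[OF p(1)]] Ord_in_Ord[OF h(1) ht[OF p(2)]]] by blast
  then show ?thesis using h(3) p by blast
 qed
 then show "EX m:E M. ALL y:E M. y ~= m --> below T m y" using m(1) by blast
qed

lemma countable_bounded: assumes "E A <= E (omega1::'v)" shows "vcountable A <-> (EX dt:O1. ALL x:E A. x IN dt)"
proof
 have di: "dfun (%e. e 0)" by (intro dint)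
 assume "vcountable A" then show "EX dt:O1. ALL x:E A. x IN dt" using omega1_sup[OF di] assms by blast
next
 assume "EX dt:O1. ALL x:E A. x IN dt"
 then obtain dt where d: "dt : O1" "E A <= E dt" by blast
 then show "vcountable A" unfolding vcountable_def using card_le_trans[OF card_le_subset[OF d(2)]] mem_omega1 by blast
qed

lemma trX_iff:
 assumes X: "X = char_fun p T" and T: "E T <= E (vtimes omega1 omega1)"
 shows "trX X <-> aleph1_tree T & regular_tree T"
proof -
 have rl: "rl X x y <-> below T x y" if "x : O1" "y : O1" for x y
  using ap_char[of "pr x y" T] that one_o1(2) unfolding X by auto
 have v01: "ALL u:O1. ap X u = one | ap X u = vempty" unfolding X using ap_char[of _ T] by auto
 have so: "(ALL x:O1. ~rl X x x) & (ALL x:O1. ALL y:O1. ALL z:O1. rl X x y --> rl X y z --> rl X x z) <-> strict_order T"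
  unfolding strict_order_def by (intro iffI conjI ballI impI T) (use rl in blast)+
 have rt: "(EX r:O1. ALL x:O1. x ~= r --> rl X r x) <-> rooted T" unfolding rooted_def using rl by (metis (no_types, lifting))
 have im: "y : O1 & im X x y <-> immediate_succ T x y" if "x : O1" for x y
  unfolding immediate_succ_def using rl that by blast
 have ims: "(ALL x:O1. EX y:O1. EX z:O1. y ~= z & im X x y & im X x z) <->
   (ALL x:O1. EX y z. y ~= z & immediate_succ T x y & immediate_succ T x z)" 
 proof (rule ball_cong[OF refl])
  fix x assume x: "x IN (omega1::'v)"
  show "(EX y:O1. EX z:O1. y ~= z & im X x y & im X x z) <-> (EX y z. y ~= z & immediate_succ T x y & immediate_succ T x z)"
   unfolding im[OF x, symmetric] by blast
 qed
 show ?thesis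
 proof (cases "strict_order T")
  case False
  then show ?thesis unfolding trX_def aleph1_tree_def using so by blast
 next
  case s: True
  have hh: "hh X x al <-> has_height T x al" if "x : O1" "al : O1" for x al by (rule hh_iff[OF s rl that])
  have a1: "(ALL al:O1. EX dt:O1. ALL x:O1. hh X x al --> x IN dt) <-> (ALL al:O1. vcountable (level T al))"
  proof (rule ball_cong[OF refl])
   fix al assume a: "al IN (omega1::'v)"
   have "E (level T al) <= O1" unfolding elts_level' by blast
   from countable_bounded[OF this] show "(EX dt:O1. ALL x:O1. hh X x al --> x IN dt) <-> vcountable (level T al)"
    unfolding elts_level' using hh[OF _ a] by auto
  qed
  have a2: "(ALL al:O1. EX x:O1. hh X x al) <-> (ALL al:O1. level T al ~= vempty)"
   unfolding vempty_iff elts_level' using hh by auto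
  \<comment> \<open>A height transports the well-order of an ordinal to the predecessors, and
    uniqueness of heights empties the levels from \<open>omega1\<close> on; conversely a height
    exists by recursion and is countable because its level is nonempty.\<close>
  have a3: "(ALL x:O1. EX al:O1. hh X x al) <-> (ALL x:O1. well_ordered_by T (preds T x)) & (ALL al. Ord al & al ~: O1 --> level T al = vempty)"
  proof
   assume h: "ALL x:O1. EX al:O1. hh X x al"
   have ex: "EX al:O1. has_height T x al" if x: "x : O1" for x using h hh[OF x] x by blast
   have "well_ordered_by T (preds T x)" if x: "x : O1" for x using ex[OF x] well_ordered_height by blast
   moreover have "level T al = vempty" if "al ~: O1" for al unfolding vempty_iff elts_level' using ex height_unique that by blast
   ultimately show "(ALL x:O1. well_ordered_by T (preds T x)) & (ALL al. Ord al & al ~: O1 --> level T al = vempty)" by blast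
  next
   assume w: "(ALL x:O1. well_ordered_by T (preds T x)) & (ALL al. Ord al & al ~: O1 --> level T al = vempty)"
   show "ALL x:O1. EX al:O1. hh X x al"
   proof
    fix x assume x: "x IN (omega1::'v)"
    obtain al where a: "has_height T x al" using height_ex[OF s _ x] w by blast
    then have "level T al ~= vempty" unfolding vempty_iff elts_level' using x by blast
    then have "al : O1" using w a unfolding has_height_iff by blast
    then show "EX al:O1. hh X x al" using hh[OF x] a by blast
   qed
  qed
  have pr: "(ALL al:O1. ALL bt:O1. al IN bt --> (ALL x:O1. hh X x al --> (EX y:O1. hh X y bt & rl X x y))) <-> pruned T"
   unfolding pruned_def
  proof (intro ball_cong[OF refl] imp_cong[OF refl])
   fix al bt assume ab: "al IN (omega1::'v)" "bt IN (omega1::'v)"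
   show "(ALL x:O1. hh X x al --> (EX y:O1. hh X y bt & rl X x y)) <-> (ALL x:E (level T al). EX y:E (level T bt). below T x y)"
    unfolding elts_level' using hh[OF _ ab(1)] hh[OF _ ab(2)] rl by auto
  qed
  show ?thesis unfolding trX_def aleph1_tree_def regular_tree_def rt ims pr a1 a2 a3 using v01 so s by blast
 qed
qed

lemma brX_iff:
 assumes X: "!!x y. x : O1 ==> y : O1 ==> rl X x y <-> below T x y" and b: "E b = {x : O1. ap Z x = one}"
 shows "brX X Y Z <-> b IN (uncountable_branches T) & (ALL nu:O1. EX x:O1. ~(x IN b <-> ap Y (pr nu x) = one))"
proof -
 have bo: "E b <= O1" unfolding b by blast
 have c: "(ALL x:O1. ALL y:O1. ap Z x = one --> ap Z y = one --> x = y | rl X x y | rl X y x) <-> is_chain T b"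
  unfolding is_chain_def b using X by auto
 have m: "(ALL x:O1. (ALL y:O1. ap Z y = one --> x = y | rl X x y | rl X y x) --> ap Z x = one) <-> (ALL c. is_chain T c & E b <= E c --> c = b)"
  if ch: "is_chain T b"
 proof
  assume h: "ALL x:O1. (ALL y:O1. ap Z y = one --> x = y | rl X x y | rl X y x) --> ap Z x = one"
  show "ALL c. is_chain T c & E b <= E c --> c = b"
  proof (intro allI impI)
   fix c assume c: "is_chain T c & E b <= E c"
   have "z IN b" if z: "z IN c" for z
   proof -
    have zo: "z : O1" using c z unfolding is_chain_def by blast
    have "z = y | rl X z y | rl X y z" if y: "y : O1" "ap Z y = one" for y
    proof -
     have "y IN c" using c y b by blast
     then show ?thesis using c z X[OF zo y(1)] X[OF y(1) zo] unfolding is_chain_def by blast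
    qed
    then show ?thesis using h zo b by blast
   qed
   then show "c = b" using c by (intro ext) blast
  qed
 next
  assume h: "ALL c. is_chain T c & E b <= E c --> c = b"
  show "ALL x:O1. (ALL y:O1. ap Z y = one --> x = y | rl X x y | rl X y x) --> ap Z x = one"
  proof (intro ballI impI)
   fix x assume x: "x : O1" "ALL y:O1. ap Z y = one --> x = y | rl X x y | rl X y x"
   have cm: "x = y | below T x y | below T y x" if "y IN b" for y using x(2) that X[OF x(1)] X[OF _ x(1)] unfolding b by blast
   let ?c = "vun b (upair x x)"
   have "is_chain T ?c" using ch cm x(1) unfolding is_chain_def by auto
   moreover have "E b <= E ?c" by auto
   ultimately have "?c = b" using h by blast
   then have "x IN b" by (metis elts_vun elts_upair UnI2 insertI1)
   then show "ap Z x = one" unfolding b by blast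
  qed
 qed
 have u: "(ALL dt:O1. EX x:O1. ap Z x = one & x ~: E dt) <-> ~vcountable b" unfolding countable_bounded[OF bo] b by blast
 have n: "(ALL nu:O1. EX x:O1. ~(ap Z x = one <-> ap Y (pr nu x) = one)) <-> (ALL nu:O1. EX x:O1. ~(x IN b <-> ap Y (pr nu x) = one))"
  unfolding b by blast
 show ?thesis unfolding brX_def c u n elts_branches is_branch_def using m by blast
qed

theorem Kurepa_Pi12: "Pi12 (Kurepa_class p)"
proof -
 have K: "X IN (Kurepa_class p) <-> (ALL Y:E baire. EX Z:E baire. trX X & brX X Y Z)" if XB: "X IN baire" for X
 proof
  assume "X IN (Kurepa_class p)"
  then obtain T where T: "X = char_fun p T" "kurepa_tree T" "regular_tree T" unfolding Kurepa_mem by blast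
  have a: "aleph1_tree T" "E T <= E (vtimes omega1 omega1)" using T(2) unfolding kurepa_tree_def aleph1_tree_def strict_order_def by blast+
  have rl: "rl X x y <-> below T x y" if "x : O1" "y : O1" for x y
   using ap_char[of "pr x y" T] that one_o1(2) unfolding T(1) by auto
  let ?U = "uncountable_branches T"
  have nU: "~card_le ?U omega1" using T(2) unfolding kurepa_tree_def card_dichotomy by blast
  show "ALL Y:E baire. EX Z:E baire. trX X & brX X Y Z"
  proof
   fix Y assume Y: "Y IN (baire::'v)"
   let ?y = "%nu. vsep omega1 (%x. ap Y (pr nu x) = one)"
   have dy: "dfun (%e. ?y (e 0))" by (intro dint)
   have ey: "E (?y nu) = {x : O1. ap Y (pr nu x) = one}" for nu by (rule elts_vsep) (intro dint)
   \<comment> \<open>If every uncountable branch were one of the \<aleph>1 many sets listed by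
     \<open>Y\<close>, the list would map \<open>omega1\<close> onto the branches.\<close>
   have "~(ALL b:E ?U. EX nu:O1. b = ?y nu)"
    using nU card_le_surj[OF dy card_le_subset[OF subset_refl], of ?U omega1] by blast
   then obtain b where b: "b IN ?U" "ALL nu:O1. b ~= ?y nu" by blast
   have bo: "E b <= O1" using b(1) unfolding elts_branches is_branch_def is_chain_def by blast
   let ?Z = "vlam omega1 (%x. if x IN b then one else vempty)"
   have dZ: "dfun (%e. if e 0 IN b then one else vempty)" by (intro dint)
   have Z: "?Z IN baire" unfolding baire_def mem_funs by (rule is_fun_vlam[OF dZ]) (simp add: one_o1)
   have eb: "E b = {x : O1. ap ?Z x = one}" using bo ap_vlam[OF dZ] one_o1(2) by (auto split: if_splits)
   have "EX x:O1. ~(x IN b <-> ap Y (pr nu x) = one)" if "nu : O1" for nu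
   proof (rule ccontr)
    assume "~?thesis"
    then have "E b = E (?y nu)" unfolding ey using bo by blast
    then show False using b(2) that extensionality by blast
   qed
   then have "brX X Y ?Z" using brX_iff[where X = X and T = T and b = b and Z = ?Z and Y = Y, OF rl eb] b(1) by blast
   then show "EX Z:E baire. trX X & brX X Y Z" using Z trX_iff[OF T(1) a(2)] a(1) T(3) by blast
  qed
 next
  assume h: "ALL Y:E baire. EX Z:E baire. trX X & brX X Y Z"
  have t: "trX X" using h XB by blast
  let ?T = "vsep (vtimes omega1 omega1) (%z. EX x y. z = vpair x y & rl X x y)"
  have dT: "dpred (%e. EX x y. e 0 = vpair x y & rl X x y)" by (intro dint)
  have eT: "E ?T = {z : E (vtimes omega1 omega1). EX x y. z = vpair x y & rl X x y}" by (rule elts_vsep[OF dT])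
  have rl: "rl X x y <-> below ?T x y" if "x : O1" "y : O1" for x y unfolding below_def eT using that by auto
  have Xf: "bfun X" using XB unfolding baire_def by simp
  have XT: "X = char_fun p ?T"
  proof (rule fun_ext[OF Xf char_baire])
   fix u assume u: "u IN (omega1::'v)"
   have "ap X u = one | ap X u = vempty" using t[unfolded trX_def, THEN conjunct1] u by blast
   moreover have "below ?T (q0 u) (q1 u) <-> ap X u = one" using rl[OF pr_q(1,2)[OF u]] pr_q(3)[OF u] by simp
   ultimately show "ap X u = ap (char_fun p ?T) u" unfolding ap_char[OF u] by auto
  qed
  have sT: "E ?T <= E (vtimes omega1 omega1)" unfolding eT by blast
  have a: "aleph1_tree ?T & regular_tree ?T" using trX_iff[OF XT sT] t by blast
  let ?U = "uncountable_branches ?T"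
  have "~card_le ?U omega1"
  proof
   assume "card_le ?U omega1"
   then obtain i where i: "ALL x:E ?U. ap i x : O1" "ALL x:E ?U. ALL y:E ?U. ap i x = ap i y --> x = y" by (rule card_leE)
   \<comment> \<open>A hypothetical injection \<open>i\<close> of the branches into
     \<open>omega1\<close> turns into a list: section \<open>nu\<close> is the branch with index
     \<open>nu\<close>, if there is one. The branch that avoids this list then contradicts its own
     index.\<close>
   let ?g = "%u. if EX b:E ?U. ap i b = q0 u & q1 u IN b then one else vempty"
   have dg: "dfun (%e. ?g (e 0))" by (intro dint)
   have Y: "vlam omega1 ?g IN baire" unfolding baire_def mem_funs by (rule is_fun_vlam[OF dg]) (simp add: one_o1)
   obtain Z where Z: "Z IN baire" "brX X (vlam omega1 ?g) Z" using h Y by blast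
   let ?b = "vsep omega1 (%x. ap Z x = one)"
   have eb: "E ?b = {x : O1. ap Z x = one}" by (rule elts_vsep) (intro dint)
   have b: "?b IN ?U" "ALL nu:O1. EX x:O1. ~(x IN ?b <-> ap (vlam omega1 ?g) (pr nu x) = one)"
    using Z(2) brX_iff[where X = X and T = ?T and b = ?b and Z = Z and Y = "vlam omega1 ?g", OF rl eb] by blast+
   have n: "ap i ?b : O1" using i(1) b(1) by blast
   obtain x where x: "x : O1" "~(x IN ?b <-> ap (vlam omega1 ?g) (pr (ap i ?b) x) = one)" using b(2) n by blast
   have "(EX b:E ?U. ap i b = ap i ?b & x IN b) <-> x IN ?b" using i(2) b(1) by blast
   then have "ap (vlam omega1 ?g) (pr (ap i ?b) x) = one <-> x IN ?b" unfolding ap_vlam[OF dg pr_type[OF n x(1)]] q_pr[OF n x(1)] using one_o1(2) by simp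
   then show False using x(2) by blast
  qed
  then have "kurepa_tree ?T" unfolding kurepa_tree_def card_dichotomy using a by blast
  then show "X IN (Kurepa_class p)" unfolding Kurepa_mem using XT a by blast
 qed
 have d: "dpred (%e. trX (e 0) & brX (e 0) (e (Suc 0)) (e (Suc (Suc 0))))" and B: "is_borel b3 baire3_base (T3 (%X Y Z. trX X & brX X Y Z))"
  using bor_KK unfolding bor_def by blast+
 have b: "vpair X (vpair Y Z) IN (T3 (%X Y Z. trX X & brX X Y Z)) <-> trX X & brX X Y Z" if "X IN baire" "Y IN baire" "Z IN baire" for X Y Z
  by (rule T3_pair[where P = "%X Y Z. trX X & brX X Y Z", OF d]) (use that in \<open>auto simp: b3_mem baire_def\<close>)
 have "E (Kurepa_class p) <= E baire" using Kurepa_mem char_baire unfolding baire_def by auto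
 moreover have "ALL X:E baire. X IN (Kurepa_class p) <-> (ALL Y:E baire. EX Z:E baire. vpair X (vpair Y Z) IN (T3 (%X Y Z. trX X & brX X Y Z)))"
  using K b by simp
 ultimately show ?thesis unfolding Pi12_def using B unfolding b3_def by blast
qed

end

theorem theorem4p1:
  fixes p :: "'v::zfc"
  assumes V_eq_L: "\<forall>x::'v. constructible x"
    and p: "is_bijection p (vtimes omega1 omega1) omega1"
  shows "Pi12_complete (Kurepa_class p)"
proof -
 interpret KT "TYPE('v)" p by unfold_locales (use assms in blast)+
 show ?thesis unfolding Pi12_complete_def using Kurepa_Pi12 Kurepa_hard by blast
qed

end
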